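(* For $\alpha,\delta_1,\delta_2,\beta>0$ consider the diffusive Brusselator system on $\mathbb T=\mathbb R/2\pi\mathbb Z$, $$\partial_t u_1=\delta_1\partial_x^2u_1-(\beta+1)u_1+u_1^2u_2+\alpha,\qquad \partial_t u_2=\delta_2\partial_x^2u_2+\beta u_1-u_1^2u_2,$$ and, for an integer $n\neq0$, put $\beta(n)=1+\alpha^2+n^2(\delta_1+\delta_2)$, so that $\beta(\pm1)=\beta_1:=1+\alpha^2+\delta_1+\delta_2$. (1) The system can undergo an $O(2)$-Hopf bifurcation from the uniform state when $\beta$ varies around $\beta_1$, in $H^1(\mathbb T)\times H^1(\mathbb T)$, with two families of bifurcated rotating waves and a torus of bifurcated standing waves. That is, there exist $\alpha,\delta_1,\delta_2>0$ for which the $O(2)$-Hopf spectral condition at wave number $1$ holds and for which there is an $O(2)$-Hopf wave structure at wave number $1$. (2) The same can occur around any nonzero wave number: for every integer $n\ne0$ there exist $\alpha,\delta_1,\delta_2>0$ for which the $O(2)$-Hopf spectral condition at wave number $n$ holds and for which there is an $O(2)$-Hopf wave structure at wave number $n$ (with $\beta$ varying around $\beta(n)$). (3) Mean-zero perturbations of the uniform state do not support such a wave structure: for any $\alpha,\delta_1,\delta_2>0$ and any integer $n\neq 0$ for which the $O(2)$-Hopf spectral condition at wave number $n$ holds, there is no $O(2)$-Hopf wave structure at wave number $n$ all of whose members $v$ satisfy $\int_{-\pi}^{\pi}v(x,t)\,dx=0$ for all $t$.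
   Context: Perturbation variable: $v=(v_1,v_2)^T=(u_1-\alpha,\,u_2-\beta/\alpha)^T$, where $(\alpha,\beta/\alpha)$ is the uniform steady state. The system becomes $\partial_tv=\mathbf L_\beta v+\mathbf R(v)$ with $$\mathbf L_\beta=\begin{pmatrix}\delta_1\partial_x^2+\beta-1&\alpha^2\\-\beta&\delta_2\partial_x^2-\alpha^2\end{pmatrix},\qquad \mathbf R(v)=\Big(2\alpha v_1v_2+\tfrac{\beta}{\alpha}v_1^2+v_1^2v_2\Big)\begin{pmatrix}1\\-1\end{pmatrix},$$ where $\mathbf L_\beta$ acts on $L^2(\mathbb T)^2$ with domain $H^2(\mathbb T)^2$. The group $O(2)$ acts by $(R(\phi)v)(x)=v(x+\phi)$ and $(Sv)(x)=v(-x)$, and the system is equivariant under this action. $O(2)$-Hopf spectral condition at wave number $n\ne0$: $\mathbf L_{\beta(n)}$ (complexified) has, for some $\omega_n>0$, the eigenvalues $\pm i\omega_n$, each of geometric and algebraic multiplicity two, with eigenfunctions of the form $e^{\pm inx}V$, $V\in\mathbb C^2$, and has no other spectrum on the imaginary axis. Let $E_n$ denote the real four-dimensional space of real-valued functions spanned by real and imaginary parts of these eigenfunctions. Rotating wave: a time-periodic, non-stationary solution of the form $v(x,t)=w(x+ct)$ with $c\ne0$. Standing wave: a time-periodic, non-stationary solution $v$ for which there is $x_0\in\mathbb R$ with $v(2x_0-x,t)=v(x,t)$ for all $x,t$, and which satisfies $v(x+\pi/n,t)=v(x,t+T/2)$, where $T$ is its period. $O(2)$-Hopf wave structure at wave number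 $n$ (write $\beta=\beta(n)+\mu$): (a) for all sufficiently small $|\mu|>0$ with $\mu$ of one fixed sign, two rotating waves (up to translation), interchanged by $S$, giving two families parametrized by $\mu$; (b) for all sufficiently small $|\mu|>0$ with $\mu$ of one fixed sign (possibly different from that in (a)), a standing wave $U_\mu$ together with the two-torus of standing waves $U_\mu(x+s,t+\tau)$, $s,\tau\in\mathbb R$; (c) all these solutions $v$ bifurcate from $0$ along $E_n$: as $\mu\to0$, $\sup_t\|v(\cdot,t)\|_{H^1}\to0$ and $\sup_t\operatorname{dist}_{H^1}(v(\cdot,t),E_n)/\|v(\cdot,t)\|_{H^1}\to0$. *)

theory Defs
  imports "HOL-Analysis.Analysis"
begin

section \<open>Sobolev spaces on the circle\<close>

text \<open>
  Functions on the circle are \<open>2\<pi>\<close>-periodic functions on the line. Elements of \<open>L\<^sup>2\<close> are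
  represented by Borel functions and compared almost everywhere.
\<close>

definition periodic_2pi :: "(real \<Rightarrow> 'a) \<Rightarrow> bool" where
  "periodic_2pi f \<longleftrightarrow> (\<forall>x. f (x + 2 * pi) = f x)"

definition L2_circle :: "(real \<Rightarrow> 'a::euclidean_space) \<Rightarrow> bool" where
  "L2_circle f \<longleftrightarrow> periodic_2pi f \<and> f \<in> borel_measurable borel \<and>
     set_integrable lborel {-pi..pi} (\<lambda>x. (norm (f x))\<^sup>2)"

definition L2_norm :: "(real \<Rightarrow> 'a::euclidean_space) \<Rightarrow> real" where
  "L2_norm f = sqrt (LBINT x:{-pi..pi}. (norm (f x))\<^sup>2)"

definition test_function :: "(real \<Rightarrow> real) \<Rightarrow> bool" where
  "test_function \<phi> \<longleftrightarrow> periodic_2pi \<phi> \<and> (\<forall>k. (deriv ^^ k) \<phi> differentiable_on UNIV)"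

definition has_weak_deriv ::
    "(real \<Rightarrow> 'a::euclidean_space) \<Rightarrow> (real \<Rightarrow> 'a) \<Rightarrow> bool" where
  "has_weak_deriv f g \<longleftrightarrow> L2_circle f \<and> L2_circle g \<and>
     (\<forall>\<phi>. test_function \<phi> \<longrightarrow>
        (LBINT x:{-pi..pi}. deriv \<phi> x *\<^sub>R f x) = - (LBINT x:{-pi..pi}. \<phi> x *\<^sub>R g x))"

text \<open>A representative of the weak derivative, which is unique up to null sets.\<close>

definition weak_deriv :: "(real \<Rightarrow> 'a::euclidean_space) \<Rightarrow> real \<Rightarrow> 'a" where
  "weak_deriv f = (SOME g. has_weak_deriv f g)"

definition H1_circle :: "(real \<Rightarrow> 'a::euclidean_space) \<Rightarrow> bool" where
  "H1_circle f \<longleftrightarrow> (\<exists>g. has_weak_deriv f g)"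

definition H2_circle :: "(real \<Rightarrow> 'a::euclidean_space) \<Rightarrow> bool" where
  "H2_circle f \<longleftrightarrow> (\<exists>g. has_weak_deriv f g \<and> H1_circle g)"

definition H1_norm :: "(real \<Rightarrow> 'a::euclidean_space) \<Rightarrow> real" where
  "H1_norm f = sqrt ((L2_norm f)\<^sup>2 + (L2_norm (weak_deriv f))\<^sup>2)"

definition H1_dist :: "(real \<Rightarrow> 'a::euclidean_space) \<Rightarrow> (real \<Rightarrow> 'a) set \<Rightarrow> real" where
  "H1_dist f E = (INF e\<in>E. H1_norm (\<lambda>x. f x - e x))"


section \<open>The Brusselator\<close>

text \<open>The argument \<open>p\<close> stands for the value of \<open>\<partial>\<^sub>x\<^sup>2u\<close>.\<close>

definition brusselator_rhs ::
    "real \<Rightarrow> real \<Rightarrow> real \<Rightarrow> real \<Rightarrow> real^2 \<Rightarrow> real^2 \<Rightarrow> real^2" where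
  "brusselator_rhs \<alpha> \<delta>1 \<delta>2 \<beta> u p =
     vector [\<delta>1 * p$1 - (\<beta> + 1) * u$1 + (u$1)\<^sup>2 * u$2 + \<alpha>,
             \<delta>2 * p$2 + \<beta> * u$1 - (u$1)\<^sup>2 * u$2]"

text \<open>
  Global strong solutions \<open>u t x\<close> with phase space \<open>H\<^sup>1\<close>: the curve takes values in the domain
  \<open>H\<^sup>2\<close>, is continuous into \<open>H\<^sup>1\<close> and differentiable into \<open>L\<^sup>2\<close>. Each \<open>u t\<close> is the continuous
  representative, so that pointwise symmetry conditions make sense.
\<close>

definition brusselator_solution ::
    "real \<Rightarrow> real \<Rightarrow> real \<Rightarrow> real \<Rightarrow> (real \<Rightarrow> real \<Rightarrow> real^2) \<Rightarrow> bool" where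
  "brusselator_solution \<alpha> \<delta>1 \<delta>2 \<beta> u \<longleftrightarrow>
     (\<forall>t. continuous_on UNIV (u t) \<and> H2_circle (u t)) \<and>
     (\<forall>t. ((\<lambda>s. H1_norm (\<lambda>x. u s x - u t x)) \<longlongrightarrow> 0) (at t)) \<and>
     (\<forall>t. ((\<lambda>s. L2_norm (\<lambda>x. (u s x - u t x) /\<^sub>R (s - t)
                 - brusselator_rhs \<alpha> \<delta>1 \<delta>2 \<beta> (u t x) (weak_deriv (weak_deriv (u t)) x)))
            \<longlongrightarrow> 0) (at t))"

definition uniform_state :: "real \<Rightarrow> real \<Rightarrow> real^2" where
  "uniform_state \<alpha> \<beta> = vector [\<alpha>, \<beta> / \<alpha>]"

definition perturbation_solution ::
    "real \<Rightarrow> real \<Rightarrow> real \<Rightarrow> real \<Rightarrow> (real \<Rightarrow> real \<Rightarrow> real^2) \<Rightarrow> bool" where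
  "perturbation_solution \<alpha> \<delta>1 \<delta>2 \<beta> v \<longleftrightarrow>
     brusselator_solution \<alpha> \<delta>1 \<delta>2 \<beta> (\<lambda>t x. uniform_state \<alpha> \<beta> + v t x)"

definition linear_part ::
    "real \<Rightarrow> real \<Rightarrow> real \<Rightarrow> real \<Rightarrow> 'k::real_normed_field^2 \<Rightarrow> 'k^2 \<Rightarrow> 'k^2" where
  "linear_part \<alpha> \<delta>1 \<delta>2 \<beta> v p =
     vector [of_real \<delta>1 * p$1 + of_real (\<beta> - 1) * v$1 + of_real (\<alpha>\<^sup>2) * v$2,
             - of_real \<beta> * v$1 + of_real \<delta>2 * p$2 - of_real (\<alpha>\<^sup>2) * v$2]"

definition nonlinear_part :: "real \<Rightarrow> real \<Rightarrow> real^2 \<Rightarrow> real^2" where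
  "nonlinear_part \<alpha> \<beta> v =
     (2 * \<alpha> * v$1 * v$2 + \<beta> / \<alpha> * (v$1)\<^sup>2 + (v$1)\<^sup>2 * v$2) *\<^sub>R vector [1, -1]"

text \<open>The perturbation \<open>v\<close> satisfies \<open>\<partial>\<^sub>t v = L\<^sub>\<beta> v + R(v)\<close>.\<close>

lemma brusselator_rhs_perturbation:
  assumes "\<alpha> \<noteq> 0"
  shows "brusselator_rhs \<alpha> \<delta>1 \<delta>2 \<beta> (uniform_state \<alpha> \<beta> + v) p
       = linear_part \<alpha> \<delta>1 \<delta>2 \<beta> v p + nonlinear_part \<alpha> \<beta> v"
  using assms
  by (simp add: vec_eq_iff forall_2 brusselator_rhs_def uniform_state_def linear_part_def
      nonlinear_part_def field_simps power2_eq_square)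

text \<open>
  With \<open>'k = complex\<close> this is the complexification of \<open>L\<^sub>\<beta>\<close>; it is meaningful on the domain
  \<^const>\<open>H2_circle\<close> only.
\<close>

definition brusselator_L ::
    "real \<Rightarrow> real \<Rightarrow> real \<Rightarrow> real \<Rightarrow> (real \<Rightarrow> 'k::{real_normed_field, euclidean_space}^2)
      \<Rightarrow> real \<Rightarrow> 'k^2" where
  "brusselator_L \<alpha> \<delta>1 \<delta>2 \<beta> u =
     (\<lambda>x. linear_part \<alpha> \<delta>1 \<delta>2 \<beta> (u x) (weak_deriv (weak_deriv u) x))"

definition beta_crit :: "real \<Rightarrow> real \<Rightarrow> real \<Rightarrow> int \<Rightarrow> real" where
  "beta_crit \<alpha> \<delta>1 \<delta>2 n = 1 + \<alpha>\<^sup>2 + (of_int n)\<^sup>2 * (\<delta>1 + \<delta>2)"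


section \<open>Spectral condition\<close>

text \<open>
  Operators \<open>A\<close> in \<open>L\<^sup>2(\<T>,\<complex>\<^sup>2)\<close> with domain \<open>H\<^sup>2\<close>; being in the resolvent set means that
  \<open>\<lambda> - A\<close> maps the domain bijectively onto \<open>L\<^sup>2\<close> with bounded inverse.
\<close>

type_synonym operator = "(real \<Rightarrow> complex^2) \<Rightarrow> real \<Rightarrow> complex^2"

definition shifted_op :: "operator \<Rightarrow> complex \<Rightarrow> operator" where
  "shifted_op A z u = (\<lambda>x. z *s u x - A u x)"

definition resolvent_set :: "operator \<Rightarrow> complex set" where
  "resolvent_set A = {z.
     (\<forall>f. L2_circle f \<longrightarrow> (\<exists>u. H2_circle u \<and> (AE x in lborel. shifted_op A z u x = f x))) \<and>
     (\<exists>C. \<forall>u. H2_circle u \<longrightarrow> L2_norm u \<le> C * L2_norm (shifted_op A z u))}"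

definition spectrum_op :: "operator \<Rightarrow> complex set" where
  "spectrum_op A = - resolvent_set A"

text \<open>The kernel of \<open>(z - A)\<^sup>k\<close> on its natural domain.\<close>

fun power_kernel :: "operator \<Rightarrow> complex \<Rightarrow> nat \<Rightarrow> (real \<Rightarrow> complex^2) set" where
  "power_kernel A z 0 = {u. L2_circle u \<and> (AE x in lborel. u x = 0)}"
| "power_kernel A z (Suc k) = {u. H2_circle u \<and> shifted_op A z u \<in> power_kernel A z k}"

definition eigenspace :: "operator \<Rightarrow> complex \<Rightarrow> (real \<Rightarrow> complex^2) set" where
  "eigenspace A z = power_kernel A z 1"

definition generalized_eigenspace :: "operator \<Rightarrow> complex \<Rightarrow> (real \<Rightarrow> complex^2) set" where
  "generalized_eigenspace A z = (\<Union>k. power_kernel A z k)"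

text \<open>The space of functions \<open>S\<close>, modulo equality almost everywhere, has complex dimension \<open>d\<close>.\<close>

definition has_dim_ae :: "(real \<Rightarrow> complex^2) set \<Rightarrow> nat \<Rightarrow> bool" where
  "has_dim_ae S d \<longleftrightarrow> (\<exists>b :: nat \<Rightarrow> real \<Rightarrow> complex^2.
     (\<forall>i<d. b i \<in> S) \<and>
     (\<forall>c. (AE x in lborel. (\<Sum>i<d. c i *s b i x) = 0) \<longrightarrow> (\<forall>i<d. c i = 0)) \<and>
     (\<forall>f\<in>S. \<exists>c. AE x in lborel. f x = (\<Sum>i<d. c i *s b i x)))"

definition fourier_mode :: "int \<Rightarrow> complex^2 \<Rightarrow> real \<Rightarrow> complex^2" where
  "fourier_mode k V = (\<lambda>x. exp (\<i> * of_int k * of_real x) *s V)"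

definition hopf_spectral_condition ::
    "real \<Rightarrow> real \<Rightarrow> real \<Rightarrow> int \<Rightarrow> real \<Rightarrow> bool" where
  "hopf_spectral_condition \<alpha> \<delta>1 \<delta>2 n \<omega> \<longleftrightarrow> 0 < \<omega> \<and>
     (let A = brusselator_L \<alpha> \<delta>1 \<delta>2 (beta_crit \<alpha> \<delta>1 \<delta>2 n) in
       (\<forall>z\<in>{\<i> * of_real \<omega>, - \<i> * of_real \<omega>}.
          has_dim_ae (eigenspace A z) 2 \<and>
          has_dim_ae (generalized_eigenspace A z) 2 \<and>
          (\<exists>V. V \<noteq> 0 \<and> fourier_mode n V \<in> eigenspace A z
                    \<and> fourier_mode (- n) V \<in> eigenspace A z)) \<and>
       (\<forall>z\<in>spectrum_op A. Re z = 0 \<longrightarrow> z = \<i> * of_real \<omega> \<or> z = - \<i> * of_real \<omega>))"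

definition critical_parts ::
    "real \<Rightarrow> real \<Rightarrow> real \<Rightarrow> int \<Rightarrow> real \<Rightarrow> (real \<Rightarrow> real^2) set" where
  "critical_parts \<alpha> \<delta>1 \<delta>2 n \<omega> =
     (let A = brusselator_L \<alpha> \<delta>1 \<delta>2 (beta_crit \<alpha> \<delta>1 \<delta>2 n) in
       {e. \<exists>\<psi> V. (\<psi> = fourier_mode n V \<or> \<psi> = fourier_mode (- n) V) \<and>
             \<psi> \<in> eigenspace A (\<i> * of_real \<omega>) \<union> eigenspace A (- \<i> * of_real \<omega>) \<and>
             (e = (\<lambda>x. \<chi> j. Re (\<psi> x $ j)) \<or> e = (\<lambda>x. \<chi> j. Im (\<psi> x $ j)))})"

text \<open>The space \<open>E\<^sub>n\<close>, as the set of finite real linear combinations.\<close>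

definition critical_space ::
    "real \<Rightarrow> real \<Rightarrow> real \<Rightarrow> int \<Rightarrow> real \<Rightarrow> (real \<Rightarrow> real^2) set" where
  "critical_space \<alpha> \<delta>1 \<delta>2 n \<omega> =
     {(\<lambda>x. \<Sum>e\<in>G. c e *\<^sub>R e x) | G c. finite G \<and> G \<subseteq> critical_parts \<alpha> \<delta>1 \<delta>2 n \<omega>}"


section \<open>Waves and the wave structure\<close>

text \<open>Space-time functions are written \<open>v t x\<close>, time first.\<close>

type_synonym wave = "real \<Rightarrow> real \<Rightarrow> real^2"

definition shift :: "real \<Rightarrow> real \<Rightarrow> wave \<Rightarrow> wave" where
  "shift s \<tau> v = (\<lambda>t x. v (t + \<tau>) (x + s))"

definition reflect :: "wave \<Rightarrow> wave" where
  "reflect v = (\<lambda>t x. v t (- x))"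

definition time_period :: "wave \<Rightarrow> real \<Rightarrow> bool" where
  "time_period v T \<longleftrightarrow> 0 < T \<and> (\<forall>t x. v (t + T) x = v t x)"

definition minimal_period :: "wave \<Rightarrow> real \<Rightarrow> bool" where
  "minimal_period v T \<longleftrightarrow> time_period v T \<and> (\<forall>T'. time_period v T' \<longrightarrow> T \<le> T')"

definition stationary :: "wave \<Rightarrow> bool" where
  "stationary v \<longleftrightarrow> (\<forall>t x. v t x = v 0 x)"

definition rotating_wave :: "real \<Rightarrow> real \<Rightarrow> real \<Rightarrow> real \<Rightarrow> wave \<Rightarrow> bool" where
  "rotating_wave \<alpha> \<delta>1 \<delta>2 \<beta> v \<longleftrightarrow>
     perturbation_solution \<alpha> \<delta>1 \<delta>2 \<beta> v \<and> (\<exists>T. time_period v T) \<and> \<not> stationary v \<and>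
     (\<exists>w c. c \<noteq> 0 \<and> (\<forall>t x. v t x = w (x + c * t)))"

definition standing_wave :: "real \<Rightarrow> real \<Rightarrow> real \<Rightarrow> real \<Rightarrow> int \<Rightarrow> wave \<Rightarrow> bool" where
  "standing_wave \<alpha> \<delta>1 \<delta>2 \<beta> n v \<longleftrightarrow>
     perturbation_solution \<alpha> \<delta>1 \<delta>2 \<beta> v \<and> \<not> stationary v \<and>
     (\<exists>x0. \<forall>t x. v t (2 * x0 - x) = v t x) \<and>
     (\<exists>T. minimal_period v T \<and> (\<forall>t x. v t (x + pi / of_int n) = v (t + T / 2) x))"

text \<open>The two rotating waves, with all their translates, and the torus of standing waves.\<close>

definition rotating_members :: "wave \<Rightarrow> wave set" where
  "rotating_members v = {shift s 0 v | s. True} \<union> {shift s 0 (reflect v) | s. True}"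

definition standing_members :: "wave \<Rightarrow> wave set" where
  "standing_members v = {shift s \<tau> v | s \<tau>. True}"

definition one_sided :: "real set \<Rightarrow> bool" where
  "one_sided M \<longleftrightarrow> (\<exists>\<epsilon>>0. M = {0<..<\<epsilon>} \<or> M = {-\<epsilon><..<0})"

text \<open>
  \<open>P \<mu>\<close> is a set of waves; the suprema are taken in the extended reals, where they always exist.
\<close>

definition bifurcates_along ::
    "(real \<Rightarrow> real^2) set \<Rightarrow> real set \<Rightarrow> (real \<Rightarrow> wave set) \<Rightarrow> bool" where
  "bifurcates_along E M P \<longleftrightarrow>
     ((\<lambda>\<mu>. SUP v\<in>P \<mu>. SUP t. ereal (H1_norm (v t))) \<longlongrightarrow> 0) (at 0 within M) \<and>
     ((\<lambda>\<mu>. SUP v\<in>P \<mu>. SUP t. ereal (H1_dist (v t) E / H1_norm (v t))) \<longlongrightarrow> 0) (at 0 within M)"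

text \<open>
  \<open>W\<close> and \<open>U\<close> are the families of rotating and standing waves, defined for the parameters \<open>\<mu>\<close>
  in the one-sided intervals \<open>M\<close> and \<open>N\<close>. The second rotating wave is the reflection of \<open>W \<mu>\<close>.
\<close>

definition hopf_wave_structure ::
    "real \<Rightarrow> real \<Rightarrow> real \<Rightarrow> int \<Rightarrow> real \<Rightarrow> real set \<Rightarrow> (real \<Rightarrow> wave)
      \<Rightarrow> real set \<Rightarrow> (real \<Rightarrow> wave) \<Rightarrow> bool" where
  "hopf_wave_structure \<alpha> \<delta>1 \<delta>2 n \<omega> M W N U \<longleftrightarrow>
     one_sided M \<and> one_sided N \<and> (\<forall>\<mu>\<in>M \<union> N. 0 < beta_crit \<alpha> \<delta>1 \<delta>2 n + \<mu>) \<and>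
     (\<forall>\<mu>\<in>M. (\<forall>v\<in>rotating_members (W \<mu>). rotating_wave \<alpha> \<delta>1 \<delta>2 (beta_crit \<alpha> \<delta>1 \<delta>2 n + \<mu>) v) \<and>
             \<not> (\<exists>s \<tau>. reflect (W \<mu>) = shift s \<tau> (W \<mu>))) \<and>
     (\<forall>\<mu>\<in>N. \<forall>v\<in>standing_members (U \<mu>).
             standing_wave \<alpha> \<delta>1 \<delta>2 (beta_crit \<alpha> \<delta>1 \<delta>2 n + \<mu>) n v) \<and>
     bifurcates_along (critical_space \<alpha> \<delta>1 \<delta>2 n \<omega>) M (\<lambda>\<mu>. rotating_members (W \<mu>)) \<and>
     bifurcates_along (critical_space \<alpha> \<delta>1 \<delta>2 n \<omega>) N (\<lambda>\<mu>. standing_members (U \<mu>))"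

definition mean_zero :: "wave \<Rightarrow> bool" where
  "mean_zero v \<longleftrightarrow> (\<forall>t. (LBINT x:{-pi..pi}. v t x) = 0)"

end

theory Submission
  imports Defs "HOL-Library.Poly_Mapping" "HOL-Computational_Algebra.Formal_Power_Series"
begin

text \<open>
  Everything is expressed through Fourier coefficients. For \<open>\<alpha> = 1\<close>, \<open>\<delta>\<^sub>1 = 2 / n\<^sup>2\<close>, \<open>\<delta>\<^sub>2 = 1 / n\<^sup>2\<close> one has
  \<open>\<beta>(n) = 5\<close> and \<open>\<omega> = 1\<close>. Write \<open>v(t, x) = a V((1 + \<sigma>) t, n x)\<close> and \<open>\<beta> = 5 + \<mu>\<close>. Among profiles
  \<open>V(\<tau>, \<xi>)\<close> that depend on \<open>\<tau> + \<xi>\<close> only (rotating waves), or that are even in \<open>\<xi>\<close> and invariant under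
  \<open>(\<tau>, \<xi>) \<mapsto> (\<tau> + \<pi>, \<xi> + \<pi>)\<close> (standing waves), the kernel of the linearization is one complex
  dimension, so the equation can be solved order by order in the amplitude \<open>a\<close>: the coefficients of
  \<open>V\<close> are trigonometric polynomials, obtained by inverting the linear operator away from the critical
  modes, and the two real numbers \<open>\<sigma>\<^sub>j\<close>, \<open>\<mu>\<^sub>j\<close> are fixed by the solvability condition at the critical mode.
  The inverse stays bounded after composition with \<open>\<partial>\<^sub>\<tau>\<close>, so a majorant in an exponentially weighted
  \<open>\<ell>\<^sup>1\<close> norm shows that the series converge. In both cases \<open>\<mu>\<^sub>1 = 0 < \<mu>\<^sub>2\<close>, hence \<open>\<mu>\<close> parametrizes the
  waves.

  If a solution has mean zero, integrating the first equation over the circle gives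
  \<open>\<integral> (2 \<alpha> v\<^sub>1 v\<^sub>2 + (\<beta> / \<alpha>) v\<^sub>1\<^sup>2 + v\<^sub>1\<^sup>2 v\<^sub>2) dx = 0\<close>. For a small even wave close to the critical space this says
  that its critical Fourier coefficient \<open>b\<close> nearly satisfies \<open>b\<^sub>1 (2 \<alpha>\<^sup>2 b\<^sub>2 + \<beta> b\<^sub>1) = 0\<close> at all times. In the
  coordinates \<open>Y = b\<^sub>1\<close>, \<open>Z = c b\<^sub>1 + \<alpha>\<^sup>2 b\<^sub>2\<close> the motion is nearly \<open>Y' = Z\<close>, \<open>Z' = - \<omega>\<^sup>2 Y\<close>. At an extremum
  of \<open>Z \<plusminus> Y\<close> over a period, \<open>Z\<close> is close to \<open>\<plusminus> \<omega>\<^sup>2 Y\<close>, and for one choice of the sign the constraint is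
  violated there unless \<open>Y\<close> and \<open>Z\<close> vanish.
\<close>

section \<open>Fourier analysis on the circle\<close>

text \<open>Factoring out the amplitude leaves one factor \<open>a\<close> in front of the
  nonlinearity, so its coefficient at each order involves earlier orders only. The remaining
  obstacle is the term \<open>\<sigma> \<partial>\<^sub>\<tau> V\<close>, which costs a time
  derivative at every order. This is why the inverse is estimated with an extra factor 1 plus the
  temporal frequency, and why the majorant also sums the time derivatives. The symmetry classes are
  chosen so that each order has one complex solvability condition, matched by the two real unknowns.

  For the nonexistence part, standing waves are the right object. With c = \<alpha>^2 + \<delta>2
  n^2, the quadratic mean is to leading order constant along a rotating wave, proportional to
  \<beta>(n) - 2 c, and may vanish. Along a standing wave it varies with the phase of the
  oscillation, so it cannot vanish throughout. Evenness also removes the sine coefficient, which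
  leaves a vector in the plane as critical amplitude.\<close>

abbreviation circ :: "real measure" where
  "circ \<equiv> restrict_space lborel {-pi..pi}"

lemma LBINT_circ: "(LBINT x:{-pi..pi}. f x) = integral\<^sup>L circ (f :: real \<Rightarrow> 'a::{banach, second_countable_topology})"
  by (simp add: set_lebesgue_integral_def integral_restrict_space)

lemma set_integrable_circ:
  "set_integrable lborel {-pi..pi} f \<longleftrightarrow> integrable circ (f :: real \<Rightarrow> 'a::{banach, second_countable_topology})"
  by (simp add: set_integrable_def integrable_restrict_space)

lemma finite_measure_circ: "finite_measure circ"
  by (rule finite_measureI) (simp add: emeasure_restrict_space space_restrict_space)

interpretation circ: finite_measure circ
  by (rule finite_measure_circ)

lemma measurable_circ: "f \<in> borel_measurable borel \<Longrightarrow> f \<in> borel_measurable circ"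
  by (simp add: measurable_restrict_space1)

lemma integrable_circ_continuous:
  fixes f :: "real \<Rightarrow> 'a::{banach, second_countable_topology}"
  assumes "continuous_on UNIV f"
  shows "integrable circ f"
  using borel_integrable_atLeastAtMost'[of "-pi" pi f] assms
  by (simp add: set_integrable_circ continuous_on_subset)

section \<open>Square-integrable functions on the circle\<close>

lemma L2_circle_altdef:
  "L2_circle f \<longleftrightarrow> periodic_2pi f \<and> f \<in> borel_measurable borel \<and> integrable circ (\<lambda>x. (norm (f x))\<^sup>2)"
  by (simp add: L2_circle_def set_integrable_circ)

lemma L2_circleD:
  assumes "L2_circle f"
  shows "periodic_2pi f" "f \<in> borel_measurable borel" "f \<in> borel_measurable circ"
    "integrable circ (\<lambda>x. (norm (f x))\<^sup>2)"
  using assms by (auto simp: L2_circle_altdef measurable_circ)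

lemma integrable_mult_L2:
  fixes f g :: "real \<Rightarrow> real"
  assumes "f \<in> borel_measurable circ" "g \<in> borel_measurable circ"
    "integrable circ (\<lambda>x. (f x)\<^sup>2)" "integrable circ (\<lambda>x. (g x)\<^sup>2)"
  shows "integrable circ (\<lambda>x. f x * g x)"
proof (rule Bochner_Integration.integrable_bound)
  show "integrable circ (\<lambda>x. (f x)\<^sup>2 + (g x)\<^sup>2)" using assms by simp
  show "(\<lambda>x. f x * g x) \<in> borel_measurable circ" using assms by simp
  have "norm (a * b) \<le> norm (a\<^sup>2 + b\<^sup>2)" for a b :: real
  proof -
    have "0 \<le> (\<bar>a\<bar> - \<bar>b\<bar>)\<^sup>2" by simp
    then have "2 * \<bar>a * b\<bar> \<le> a\<^sup>2 + b\<^sup>2" by (simp add: power2_diff abs_mult)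
    then show ?thesis by simp
  qed
  then show "AE x in circ. norm (f x * g x) \<le> norm ((f x)\<^sup>2 + (g x)\<^sup>2)" by simp
qed

lemma Cauchy_Schwarz_circ:
  fixes f g :: "real \<Rightarrow> real"
  assumes "f \<in> borel_measurable circ" "g \<in> borel_measurable circ"
    "integrable circ (\<lambda>x. (f x)\<^sup>2)" "integrable circ (\<lambda>x. (g x)\<^sup>2)"
  shows "\<bar>integral\<^sup>L circ (\<lambda>x. f x * g x)\<bar>
    \<le> sqrt (integral\<^sup>L circ (\<lambda>x. (f x)\<^sup>2)) * sqrt (integral\<^sup>L circ (\<lambda>x. (g x)\<^sup>2))"
proof -
  define A B I where "A = integral\<^sup>L circ (\<lambda>x. (f x)\<^sup>2)" and "B = integral\<^sup>L circ (\<lambda>x. (g x)\<^sup>2)"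
    and "I = integral\<^sup>L circ (\<lambda>x. f x * g x)"
  have AB: "0 \<le> A" "0 \<le> B" by (auto simp: A_def B_def)
  note int = integrable_mult_L2[OF assms] assms(3,4)
  have *: "0 \<le> A * s\<^sup>2 + 2 * s * I + B" for s
  proof -
    have "0 \<le> integral\<^sup>L circ (\<lambda>x. (s * f x + g x)\<^sup>2)" by simp
    also have "(\<lambda>x. (s * f x + g x)\<^sup>2) = (\<lambda>x. (f x)\<^sup>2 * s\<^sup>2 + (2 * s) * (f x * g x) + (g x)\<^sup>2)"
      by (auto simp: power2_eq_square algebra_simps)
    also have "integral\<^sup>L circ \<dots> = A * s\<^sup>2 + 2 * s * I + B"
      using int by (simp add: A_def B_def I_def)
    finally show ?thesis .
  qed
  have "I\<^sup>2 \<le> A * B"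
  proof (cases "A = 0")
    case True
    have "I = 0"
    proof (rule ccontr)
      assume "I \<noteq> 0"
      \<comment> \<open>For A = 0 the quadratic is affine in s, and at this s it takes the value
        -1.\<close>
      with *[of "-(B + 1) / (2 * I)"] True AB show False by (simp add: field_simps)
    qed
    with True show ?thesis by simp
  next
    case False
    then have "0 \<le> A * (A * (I / A)\<^sup>2 - 2 * (I / A) * I + B)"
      using *[of "- I / A"] AB by simp
    also have "\<dots> = A * B - I\<^sup>2" using False by (simp add: power2_eq_square field_simps)
    finally show ?thesis by simp
  qed
  then have "sqrt (I\<^sup>2) \<le> sqrt (A * B)" by (rule real_sqrt_le_mono)
  then show ?thesis by (simp add: real_sqrt_mult A_def B_def I_def)
qed

lemma L2_norm_circ: "L2_norm f = sqrt (integral\<^sup>L circ (\<lambda>x. (norm (f x))\<^sup>2))"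
  by (simp add: L2_norm_def LBINT_circ)

lemma L2_norm_nonneg [simp]: "0 \<le> L2_norm f"
  by (simp add: L2_norm_circ)

lemma L2_norm_power2: "(L2_norm f)\<^sup>2 = integral\<^sup>L circ (\<lambda>x. (norm (f x))\<^sup>2)"
  by (simp add: L2_norm_circ)

lemma L2_norm_AE_cong:
  assumes "L2_circle f" "L2_circle g" "AE x in circ. f x = g x"
  shows "L2_norm f = L2_norm g"
proof -
  have "integral\<^sup>L circ (\<lambda>x. (norm (f x))\<^sup>2) = integral\<^sup>L circ (\<lambda>x. (norm (g x))\<^sup>2)"
    using assms(1,2)[THEN L2_circleD(3)] assms(3) by (intro integral_cong_AE) auto
  then show ?thesis by (simp add: L2_norm_circ)
qed

lemma norm_add_square_le: "(norm (a + b :: 'a::real_normed_vector))\<^sup>2 \<le> 2 * (norm a)\<^sup>2 + 2 * (norm b)\<^sup>2"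
proof -
  have "(norm (a + b))\<^sup>2 \<le> (norm a + norm b)\<^sup>2" by (simp add: norm_triangle_ineq power_mono)
  also have "\<dots> \<le> 2 * (norm a)\<^sup>2 + 2 * (norm b)\<^sup>2"
    using zero_le_power2[of "norm a - norm b"] by (simp add: power2_eq_square algebra_simps)
  finally show ?thesis .
qed

lemma L2_circle_linear:
  fixes T :: "'a::euclidean_space \<Rightarrow> 'b::euclidean_space"
  assumes "L2_circle f" "bounded_linear T"
  shows "L2_circle (\<lambda>x. T (f x))"
proof -
  interpret bounded_linear T by fact
  obtain K where K: "\<And>x. norm (T x) \<le> norm x * K" using bounded by blast
  have [measurable]: "T \<in> borel_measurable borel"
    by (rule borel_measurable_continuous_onI) (rule linear_continuous_on[OF assms(2)])
  have m: "(\<lambda>x. T (f x)) \<in> borel_measurable borel" using L2_circleD(2)[OF assms(1)] by measurable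
  have "integrable circ (\<lambda>x. (norm (T (f x)))\<^sup>2)"
  proof (rule Bochner_Integration.integrable_bound)
    show "integrable circ (\<lambda>x. (norm (f x))\<^sup>2 * K\<^sup>2)" using L2_circleD(4)[OF assms(1)] by simp
    show "(\<lambda>x. (norm (T (f x)))\<^sup>2) \<in> borel_measurable circ" using measurable_circ[OF m] by simp
    have "(norm (T x))\<^sup>2 \<le> (norm x)\<^sup>2 * K\<^sup>2" for x
      using power_mono[OF K norm_ge_zero, of x 2] by (simp add: power_mult_distrib)
    then show "AE x in circ. norm ((norm (T (f x)))\<^sup>2) \<le> norm ((norm (f x))\<^sup>2 * K\<^sup>2)" by simp
  qed
  then show ?thesis using L2_circleD(1)[OF assms(1)] m by (auto simp: L2_circle_altdef periodic_2pi_def)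
qed

lemma L2_circle_add:
  assumes "L2_circle f" "L2_circle g"
  shows "L2_circle (\<lambda>x. f x + g x)"
proof -
  have m: "(\<lambda>x. f x + g x) \<in> borel_measurable borel"
    using assms[THEN L2_circleD(2)] by (rule borel_measurable_add)
  have "integrable circ (\<lambda>x. (norm (f x + g x))\<^sup>2)"
  proof (rule Bochner_Integration.integrable_bound)
    show "integrable circ (\<lambda>x. 2 * (norm (f x))\<^sup>2 + 2 * (norm (g x))\<^sup>2)"
      using assms[THEN L2_circleD(4)] by simp
    show "(\<lambda>x. (norm (f x + g x))\<^sup>2) \<in> borel_measurable circ" using measurable_circ[OF m] by simp
    show "AE x in circ. norm ((norm (f x + g x))\<^sup>2) \<le> norm (2 * (norm (f x))\<^sup>2 + 2 * (norm (g x))\<^sup>2)"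
      using norm_add_square_le[of "f _" "g _"] by (simp add: abs_of_nonneg)
  qed
  with assms[THEN L2_circleD(1)] m show ?thesis by (auto simp: L2_circle_altdef periodic_2pi_def)
qed

lemma L2_circle_scaleR: "L2_circle f \<Longrightarrow> L2_circle (\<lambda>x. c *\<^sub>R f x)"
  by (erule L2_circle_linear) (rule bounded_linear_scaleR_right)

lemma L2_circle_diff: "L2_circle f \<Longrightarrow> L2_circle g \<Longrightarrow> L2_circle (\<lambda>x. f x - g x)"
  using L2_circle_add[OF _ L2_circle_scaleR[of g "-1"], of f] by simp

lemma L2_circle_zero: "L2_circle (\<lambda>x. 0)"
  by (simp add: L2_circle_altdef periodic_2pi_def)

lemma L2_circle_sum: "(\<And>i. i \<in> I \<Longrightarrow> L2_circle (f i)) \<Longrightarrow> L2_circle (\<lambda>x. \<Sum>i\<in>I. f i x)"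
  by (induction I rule: infinite_finite_induct) (auto intro: L2_circle_zero L2_circle_add)

lemma L2_circle_continuous:
  "continuous_on UNIV f \<Longrightarrow> periodic_2pi f \<Longrightarrow> L2_circle f"
  by (auto simp: L2_circle_altdef intro!: borel_measurable_continuous_onI integrable_circ_continuous continuous_intros)

lemma L2_integrable_norm_mult:
  fixes f :: "real \<Rightarrow> 'a::euclidean_space" and h :: "real \<Rightarrow> 'b::euclidean_space"
  assumes "L2_circle h" "L2_circle f"
  shows "integrable circ (\<lambda>x. norm (h x) * norm (f x))"
  using assms[THEN L2_circleD(3)] assms[THEN L2_circleD(4)] by (intro integrable_mult_L2) auto

lemma L2_integrable_mult:
  fixes f :: "real \<Rightarrow> 'a::euclidean_space"
  assumes "L2_circle h" "L2_circle f"
  shows "integrable circ (\<lambda>x. h x *\<^sub>R f x)"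
  by (rule Bochner_Integration.integrable_bound[OF L2_integrable_norm_mult[OF assms]])
    (use assms[THEN L2_circleD(3)] in \<open>auto simp: abs_mult\<close>)

lemma L2_integrable: "L2_circle f \<Longrightarrow> integrable circ f"
  using L2_integrable_mult[of "\<lambda>x. 1" f]
  by (simp add: L2_circle_continuous periodic_2pi_def)

lemma L2_integrable_inner:
  fixes f :: "real \<Rightarrow> 'a::euclidean_space"
  assumes "L2_circle h" "L2_circle f"
  shows "integrable circ (\<lambda>x. h x \<bullet> f x)"
  by (rule Bochner_Integration.integrable_bound[OF L2_integrable_norm_mult[OF assms]])
    (use assms[THEN L2_circleD(3)] in \<open>auto simp: Cauchy_Schwarz_ineq2\<close>)

lemma L2_norm_mult_le:
  fixes f :: "real \<Rightarrow> 'a::euclidean_space" and h :: "real \<Rightarrow> 'b::euclidean_space"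
  assumes "L2_circle h" "L2_circle f"
  shows "integral\<^sup>L circ (\<lambda>x. norm (h x) * norm (f x)) \<le> L2_norm h * L2_norm f"
  using Cauchy_Schwarz_circ[of "\<lambda>x. norm (h x)" "\<lambda>x. norm (f x)"] assms[THEN L2_circleD(3)] assms[THEN L2_circleD(4)]
  by (auto simp: L2_norm_circ)

lemma L2_norm_scaleR_le:
  fixes f :: "real \<Rightarrow> 'a::euclidean_space"
  assumes "L2_circle h" "L2_circle f"
  shows "norm (integral\<^sup>L circ (\<lambda>x. h x *\<^sub>R f x)) \<le> L2_norm h * L2_norm f"
proof -
  have "norm (integral\<^sup>L circ (\<lambda>x. h x *\<^sub>R f x)) \<le> integral\<^sup>L circ (\<lambda>x. norm (h x *\<^sub>R f x))"
    by (rule integral_norm_bound)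
  also have "\<dots> \<le> L2_norm h * L2_norm f" using L2_norm_mult_le[OF assms] by simp
  finally show ?thesis .
qed

lemma L2_norm_add_square_le:
  assumes "L2_circle f" "L2_circle g"
  shows "(L2_norm (\<lambda>x. f x + g x))\<^sup>2 \<le> 2 * (L2_norm f)\<^sup>2 + 2 * (L2_norm g)\<^sup>2"
proof -
  have "integral\<^sup>L circ (\<lambda>x. (norm (f x + g x))\<^sup>2) \<le> integral\<^sup>L circ (\<lambda>x. 2 * (norm (f x))\<^sup>2 + 2 * (norm (g x))\<^sup>2)"
    using assms[THEN L2_circleD(4)] L2_circleD(4)[OF L2_circle_add[OF assms]]
    by (intro integral_mono) (simp_all add: norm_add_square_le)
  also have "\<dots> = 2 * integral\<^sup>L circ (\<lambda>x. (norm (f x))\<^sup>2) + 2 * integral\<^sup>L circ (\<lambda>x. (norm (g x))\<^sup>2)"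
    using assms[THEN L2_circleD(4)] by (subst Bochner_Integration.integral_add) simp_all
  finally show ?thesis by (simp add: L2_norm_power2)
qed

lemma measure_circ: "measure circ {-pi..pi} = 2 * pi"
  by (simp add: measure_restrict_space)

lemma L2_norm_le_sup:
  assumes "L2_circle f" "\<And>x. norm (f x) \<le> C"
  shows "L2_norm f \<le> sqrt (2 * pi) * C"
proof -
  have C: "0 \<le> C" using assms(2)[of 0] norm_ge_zero order_trans by blast
  have "integral\<^sup>L circ (\<lambda>x. (norm (f x))\<^sup>2) \<le> integral\<^sup>L circ (\<lambda>x. C\<^sup>2)"
    using L2_circleD(4)[OF assms(1)] assms(2) by (intro integral_mono) (simp_all add: power_mono)
  also have "\<dots> = 2 * pi * C\<^sup>2" by (simp add: measure_circ space_restrict_space)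
  finally have "L2_norm f \<le> sqrt (2 * pi * C\<^sup>2)" by (simp add: L2_norm_circ)
  then show ?thesis using C by (simp add: real_sqrt_mult)
qed

lemma L2_norm_scaleR: "L2_norm (\<lambda>x. c *\<^sub>R f x) = \<bar>c\<bar> * L2_norm f"
  by (simp add: L2_norm_circ power_mult_distrib real_sqrt_mult)

section \<open>Completeness of the trigonometric system\<close>

inductive trig :: "(real \<Rightarrow> real) \<Rightarrow> bool" where
  trig_cos: "trig (\<lambda>x. cos (real k * x))"
| trig_sin: "trig (\<lambda>x. sin (real k * x))"
| trig_add: "trig f \<Longrightarrow> trig g \<Longrightarrow> trig (\<lambda>x. f x + g x)"
| trig_scale: "trig f \<Longrightarrow> trig (\<lambda>x. c * f x)"

lemma trig_cos_int: "trig (\<lambda>x. cos (of_int k * x))"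
proof (cases "0 \<le> k")
  case True
  then show ?thesis using trig_cos[of "nat k"] by simp
next
  case False
  then show ?thesis using trig_cos[of "nat (-k)"] by simp
qed

lemma trig_sin_int: "trig (\<lambda>x. sin (of_int k * x))"
proof (cases "0 \<le> k")
  case True
  then show ?thesis using trig_sin[of "nat k"] by simp
next
  case False
  then show ?thesis using trig_scale[OF trig_sin[of "nat (-k)"], of "-1"] by simp
qed

lemma trig_cong: "trig f \<Longrightarrow> (\<And>x. f x = g x) \<Longrightarrow> trig g"
  by (metis ext)

lemma trig_mult_gen:
  fixes k l :: nat
  shows "trig (\<lambda>x. cos (real k * x) * cos (real l * x))" "trig (\<lambda>x. sin (real k * x) * cos (real l * x))"
    "trig (\<lambda>x. cos (real k * x) * sin (real l * x))" "trig (\<lambda>x. sin (real k * x) * sin (real l * x))"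
proof -
  note c = trig_scale[OF trig_cos_int, of "_" "int k - int l"] trig_scale[OF trig_cos_int, of "_" "int k + int l"]
  note s = trig_scale[OF trig_sin_int, of "_" "int k - int l"] trig_scale[OF trig_sin_int, of "_" "int k + int l"]
  show "trig (\<lambda>x. cos (real k * x) * cos (real l * x))"
    by (rule trig_cong[OF trig_add[OF c(1)[of "1/2"] c(2)[of "1/2"]]])
      (simp add: cos_add cos_diff algebra_simps)
  show "trig (\<lambda>x. sin (real k * x) * cos (real l * x))"
    by (rule trig_cong[OF trig_add[OF s(1)[of "1/2"] s(2)[of "1/2"]]])
      (simp add: sin_add sin_diff algebra_simps)
  show "trig (\<lambda>x. cos (real k * x) * sin (real l * x))"
    by (rule trig_cong[OF trig_add[OF s(1)[of "-1/2"] s(2)[of "1/2"]]])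
      (simp add: sin_add sin_diff algebra_simps)
  show "trig (\<lambda>x. sin (real k * x) * sin (real l * x))"
    by (rule trig_cong[OF trig_add[OF c(1)[of "1/2"] c(2)[of "-1/2"]]])
      (simp add: cos_add cos_diff algebra_simps)
qed

text \<open>Products are not a constructor of \<open>trig\<close>, so that integrals against its
  members reduce to single modes. Closure under products is proved instead, by a double induction
  down to the product-to-sum formulas.\<close>

lemma trig_mult: "trig f \<Longrightarrow> trig g \<Longrightarrow> trig (\<lambda>x. f x * g x)"
proof (induction f rule: trig.induct)
  case (trig_cos k)
  then show ?case
  proof (induction g rule: trig.induct)
    case (trig_add f g)
    show ?case by (rule trig_cong[OF trig.trig_add[OF trig_add.IH]]) (simp add: algebra_simps)
  next
    case (trig_scale f c)
    show ?case by (rule trig_cong[OF trig.trig_scale[OF trig_scale.IH, of c]]) (simp add: algebra_simps)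
  qed (auto intro: trig_mult_gen)
next
  case (trig_sin k)
  then show ?case
  proof (induction g rule: trig.induct)
    case (trig_add f g)
    show ?case by (rule trig_cong[OF trig.trig_add[OF trig_add.IH]]) (simp add: algebra_simps)
  next
    case (trig_scale f c)
    show ?case by (rule trig_cong[OF trig.trig_scale[OF trig_scale.IH, of c]]) (simp add: algebra_simps)
  qed (auto intro: trig_mult_gen)
next
  case (trig_add f1 f2)
  show ?case by (rule trig_cong[OF trig.trig_add[OF trig_add.IH[OF trig_add.prems]]]) (simp add: algebra_simps)
next
  case (trig_scale f c)
  show ?case by (rule trig_cong[OF trig.trig_scale[OF trig_scale.IH[OF trig_scale.prems], of c]]) (simp add: algebra_simps)
qed

text \<open>A real-linear functional on the complex numbers is, on the unit circle, a combination of
  cos and sin; products stay in \<open>trig\<close>. This is the bridge from the Stone-Weierstrass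
  theorem to Fourier modes.\<close>

lemma trig_polynomial_cis:
  "real_polynomial_function p \<Longrightarrow> trig (\<lambda>x. p (cis x))"
proof (induction p rule: real_polynomial_function.induct)
  case (linear f)
  interpret bounded_linear f by fact
  have "f (cis x) = f 1 * cos (real 1 * x) + f \<i> * sin (real 1 * x)" for x
  proof -
    have "cis x = cos x *\<^sub>R 1 + sin x *\<^sub>R \<i>" by (simp add: complex_eq_iff)
    then have "f (cis x) = f (cos x *\<^sub>R 1 + sin x *\<^sub>R \<i>)" by (rule arg_cong)
    then show ?thesis by (simp add: add scaleR)
  qed
  then show ?case
    using trig_add[OF trig_scale[OF trig_cos[of 1], of "f 1"] trig_scale[OF trig_sin[of 1], of "f \<i>"]]
    by simp
next
  case (const c)
  then show ?case using trig_scale[OF trig_cos[of 0], of c] by simp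
qed (auto intro: trig_add trig_mult)

text \<open>Unnormalized real coefficients with values in any Euclidean space, so that solutions in
  \<open>real^2\<close> and eigenfunctions in \<open>complex^2\<close> share one theory. The
  normalization is restored by \<open>fourier_weight\<close> in the series.\<close>

definition fcos :: "nat \<Rightarrow> (real \<Rightarrow> 'a::euclidean_space) \<Rightarrow> 'a" where
  "fcos k f = integral\<^sup>L circ (\<lambda>x. cos (real k * x) *\<^sub>R f x)"

definition fsin :: "nat \<Rightarrow> (real \<Rightarrow> 'a::euclidean_space) \<Rightarrow> 'a" where
  "fsin k f = integral\<^sup>L circ (\<lambda>x. sin (real k * x) *\<^sub>R f x)"

lemma periodic_cos_sin:
  "periodic_2pi (\<lambda>x. cos (real k * x))" "periodic_2pi (\<lambda>x. sin (real k * x))"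
proof -
  have "real k * (x + 2 * pi) = real k * x + 2 * real k * pi" for x by (simp add: algebra_simps)
  then show "periodic_2pi (\<lambda>x. cos (real k * x))" "periodic_2pi (\<lambda>x. sin (real k * x))"
    unfolding periodic_2pi_def by (simp_all only: cos_add sin_add cos_2npi sin_2npi) simp_all
qed

lemma L2_cos_sin: "L2_circle (\<lambda>x. cos (real k * x))" "L2_circle (\<lambda>x. sin (real k * x))"
  by (auto intro!: L2_circle_continuous periodic_cos_sin continuous_intros)

lemma integral_trig_zero:
  fixes f :: "real \<Rightarrow> 'a::euclidean_space"
  assumes f: "L2_circle f" and z: "\<And>k. fcos k f = 0" "\<And>k. fsin k f = 0" and "trig h"
  shows "integrable circ (\<lambda>x. h x *\<^sub>R f x) \<and> integral\<^sup>L circ (\<lambda>x. h x *\<^sub>R f x) = 0"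
  using \<open>trig h\<close>
proof (induction h rule: trig.induct)
  case (trig_add g h)
  then show ?case by (simp add: scaleR_add_left)
next
  case (trig_scale g c)
  then have "integrable circ (\<lambda>x. c *\<^sub>R g x *\<^sub>R f x) \<and> integral\<^sup>L circ (\<lambda>x. c *\<^sub>R g x *\<^sub>R f x) = 0"
    by (simp del: scaleR_scaleR)
  then show ?case by simp
qed (use z in \<open>simp_all add: fcos_def fsin_def L2_integrable_mult[OF L2_cos_sin(1) f] L2_integrable_mult[OF L2_cos_sin(2) f]\<close>)

text \<open>Writing a periodic function as \<open>H\<close> composed with \<open>cis\<close> lets
  Stone-Weierstrass act on the compact unit circle. The uniform error passes to the integral because
  \<open>f\<close> is integrable.\<close>

lemma integral_continuous_cis_zero:
  fixes f :: "real \<Rightarrow> 'a::euclidean_space" and H :: "complex \<Rightarrow> real"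
  assumes f: "L2_circle f" and z: "\<And>k. fcos k f = 0" "\<And>k. fsin k f = 0"
    and H: "continuous_on UNIV H"
  shows "integral\<^sup>L circ (\<lambda>x. H (cis x) *\<^sub>R f x) = 0"
proof -
  have cH: "continuous_on UNIV (\<lambda>x. H (cis x))"
    by (intro continuous_on_compose2[OF H] continuous_intros) auto
  have H2: "L2_circle (\<lambda>x. H (cis x))"
    by (rule L2_circle_continuous[OF cH]) (simp add: periodic_2pi_def cis.ctr)
  have *: "norm (integral\<^sup>L circ (\<lambda>x. H (cis x) *\<^sub>R f x)) \<le> e * integral\<^sup>L circ (\<lambda>x. norm (f x))" if "e > 0" for e
  proof -
    obtain p where p: "real_polynomial_function p" "\<And>z. z \<in> sphere 0 1 \<Longrightarrow> \<bar>H z - p z\<bar> < e"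
      using Stone_Weierstrass_real_polynomial_function[of "sphere 0 1" H e, OF compact_sphere continuous_on_subset[OF H subset_UNIV] \<open>e > 0\<close>]
      by blast
    note tz = integral_trig_zero[OF f z trig_polynomial_cis[OF p(1)]]
    have i1: "integrable circ (\<lambda>x. H (cis x) *\<^sub>R f x)" by (rule L2_integrable_mult[OF H2 f])
    have "integral\<^sup>L circ (\<lambda>x. H (cis x) *\<^sub>R f x) = integral\<^sup>L circ (\<lambda>x. H (cis x) *\<^sub>R f x - p (cis x) *\<^sub>R f x)"
      using tz i1 by simp
    then have "norm (integral\<^sup>L circ (\<lambda>x. H (cis x) *\<^sub>R f x)) \<le> integral\<^sup>L circ (\<lambda>x. norm (H (cis x) *\<^sub>R f x - p (cis x) *\<^sub>R f x))"
      using integral_norm_bound[of circ "\<lambda>x. H (cis x) *\<^sub>R f x - p (cis x) *\<^sub>R f x"] by simp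
    also have "\<dots> \<le> integral\<^sup>L circ (\<lambda>x. e * norm (f x))"
    proof (rule integral_mono)
      show "integrable circ (\<lambda>x. e * norm (f x))" using L2_integrable[OF f] by simp
      show "integrable circ (\<lambda>x. norm (H (cis x) *\<^sub>R f x - p (cis x) *\<^sub>R f x))" using i1 tz by simp
      show "norm (H (cis x) *\<^sub>R f x - p (cis x) *\<^sub>R f x) \<le> e * norm (f x)" for x
        using p(2)[of "cis x"] by (simp add: scaleR_diff_left[symmetric] mult_right_mono less_imp_le)
    qed
    finally show ?thesis by simp
  qed
  have "norm (integral\<^sup>L circ (\<lambda>x. H (cis x) *\<^sub>R f x)) \<le> 0 + e" if "e > 0" for e
  proof -
    define C where "C = integral\<^sup>L circ (\<lambda>x. norm (f x))"
    have C: "0 \<le> C" by (simp add: C_def)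
    have "norm (integral\<^sup>L circ (\<lambda>x. H (cis x) *\<^sub>R f x)) \<le> e / (C + 1) * C"
      unfolding C_def by (rule *) (use C that in \<open>simp add: C_def[symmetric]\<close>)
    also have "\<dots> \<le> e" using C that by (simp add: field_simps)
    finally show ?thesis by simp
  qed
  then have "norm (integral\<^sup>L circ (\<lambda>x. H (cis x) *\<^sub>R f x)) \<le> 0" by (rule field_le_epsilon)
  then show ?thesis by simp
qed

text \<open>An arc of half-width r is a superlevel set of the cosine of the distance to its centre.
  The bound \<open>2 * pi - r\<close> is where the cosine climbs back to
  \<open>cos r\<close>.\<close>

lemma cos_gt_iff:
  assumes "0 \<le> r" "r \<le> pi" "\<bar>y\<bar> \<le> 2 * pi - r"
  shows "cos r < cos y \<longleftrightarrow> \<bar>y\<bar> < r"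
proof -
  have e: "cos y = cos \<bar>y\<bar>" by simp
  show ?thesis
  proof (cases "\<bar>y\<bar> \<le> pi")
    case True
    show ?thesis unfolding e using cos_mono_less_eq[of r "\<bar>y\<bar>"] assms True by (simp del: cos_abs_real)
  next
    case False
    have "cos \<bar>y\<bar> = cos (2 * pi - \<bar>y\<bar>)" by (simp add: cos_diff)
    moreover have "cos (2 * pi - \<bar>y\<bar>) \<le> cos r"
      using cos_mono_le_eq[of "2 * pi - \<bar>y\<bar>" r] assms False by auto
    ultimately have "\<not> cos r < cos \<bar>y\<bar>" "\<not> \<bar>y\<bar> < r" using False assms by linarith+
    then show ?thesis unfolding e by blast
  qed
qed

lemma integral_arc_zero:
  fixes f :: "real \<Rightarrow> 'a::euclidean_space"
  assumes f: "L2_circle f" and z: "\<And>k. fcos k f = 0" "\<And>k. fsin k f = 0"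
    and ab: "-pi \<le> a" "a \<le> b" "b \<le> pi"
  shows "integral\<^sup>L circ (\<lambda>x. indicator {a<..<b} x *\<^sub>R f x) = 0"
proof -
  define c r where "c = (a + b) / 2" and "r = (b - a) / 2"
  \<comment> \<open>Continuous plateau functions on the circle: zero off the arc with centre
    \<open>c\<close> and half-width \<open>r\<close>, and at each point of the arc equal to 1 from
    some n on. They converge boundedly to the indicator of the interval.\<close>
  define H where "H = (\<lambda>n z. min 1 (real n * max 0 (Re (cis (-c) * z) - cos r)))"
  have Hc: "H n (cis x) = min 1 (real n * max 0 (cos (x - c) - cos r))" for n x
    by (simp add: H_def cis_mult flip: cis_mult) (simp add: cos_diff algebra_simps)
  have lim: "(\<lambda>n. integral\<^sup>L circ (\<lambda>x. H n (cis x) *\<^sub>R f x)) \<longlonglongrightarrow> integral\<^sup>L circ (\<lambda>x. indicator {a<..<b} x *\<^sub>R f x)"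
  proof (rule integral_dominated_convergence)
    show "integrable circ (\<lambda>x. norm (f x))" using L2_integrable[OF f] by simp
    have [measurable]: "f \<in> borel_measurable circ" using f by (rule L2_circleD)
    show "(\<lambda>x. indicator {a<..<b} x *\<^sub>R f x) \<in> borel_measurable circ" 
      by (rule measurable_circ) (use L2_circleD(2)[OF f] in measurable)
    show "(\<lambda>x. H n (cis x) *\<^sub>R f x) \<in> borel_measurable circ" for n
    proof (rule borel_measurable_scaleR)
      show "(\<lambda>x. H n (cis x)) \<in> borel_measurable circ" unfolding Hc
        by (intro measurable_circ borel_measurable_continuous_onI continuous_intros)
    qed measurable
    show "AE x in circ. norm (H n (cis x) *\<^sub>R f x) \<le> norm (f x)" for n
      by (rule AE_I2) (auto simp: Hc intro!: mult_left_le_one_le)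
    show "AE x in circ. (\<lambda>n. H n (cis x) *\<^sub>R f x) \<longlonglongrightarrow> indicator {a<..<b} x *\<^sub>R f x"
    proof (rule AE_I2)
      fix x assume "x \<in> space circ"
      then have x: "-pi \<le> x" "x \<le> pi" by (auto simp: space_restrict_space)
      have r: "0 \<le> r" "r \<le> pi" "\<bar>x - c\<bar> \<le> 2 * pi - r" using x ab by (auto simp: r_def c_def abs_if field_simps)
      have *: "cos r < cos (x - c) \<longleftrightarrow> x \<in> {a<..<b}"
        using cos_gt_iff[OF r] by (auto simp: r_def c_def abs_if field_simps)
      have "(\<lambda>n. H n (cis x)) \<longlonglongrightarrow> indicator {a<..<b} x"
      proof (cases "x \<in> {a<..<b}")
        case True
        then have p: "0 < cos (x - c) - cos r" using * by simp
        obtain N where N: "1 \<le> real N * (cos (x - c) - cos r)"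
          using reals_Archimedean3[OF p] by (meson less_imp_le)
        have "\<forall>\<^sub>F n in sequentially. H n (cis x) = 1"
        proof (rule eventually_sequentiallyI[of N])
          fix n assume "N \<le> n"
          then have "real N * (cos (x - c) - cos r) \<le> real n * (cos (x - c) - cos r)" using p by (intro mult_right_mono) auto
          then have "1 \<le> real n * (cos (x - c) - cos r)" using N by linarith
          then show "H n (cis x) = 1" using p by (simp add: Hc min_absorb1)
        qed
        then show ?thesis using True by (simp add: tendsto_eventually)
      next
        case False
        then have "max 0 (cos (x - c) - cos r) = 0" using * by auto
        then show ?thesis using False by (simp add: Hc)
      qed
      then show "(\<lambda>n. H n (cis x) *\<^sub>R f x) \<longlonglongrightarrow> indicator {a<..<b} x *\<^sub>R f x" by (intro tendsto_intros)
    qed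
  qed
  have "integral\<^sup>L circ (\<lambda>x. H n (cis x) *\<^sub>R f x) = 0" for n
    by (rule integral_continuous_cis_zero[OF f z]) (auto simp: H_def intro!: continuous_intros)
  with lim show ?thesis by (simp add: LIMSEQ_const_iff)
qed

lemma sets_borel_intervals: "sets borel = sigma_sets UNIV (range (\<lambda>(a::real, b). {a<..<b}))"
proof -
  have "sets borel = sets (sigma UNIV (range (\<lambda>(a::real, b). box a b)))"
    by (simp only: borel_eq_box)
  then show ?thesis by (simp add: box_real)
qed

text \<open>Open intervals are a generator stable under intersection, so Dynkin's argument carries
  vanishing integrals from intervals to all Borel sets. An integrable function with vanishing
  integral over every measurable set is zero almost everywhere.\<close>

lemma AE_circ_zero_coeffs:
  fixes f :: "real \<Rightarrow> 'a::euclidean_space"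
  assumes f: "L2_circle f" and z: "\<And>k. fcos k f = 0" "\<And>k. fsin k f = 0"
  shows "AE x in circ. f x = 0"
proof (rule circ.density_zero)
  show fi: "integrable circ f" by (rule L2_integrable[OF f])
  have f0: "integral\<^sup>L circ f = 0" using z(1)[of 0] by (simp add: fcos_def)
  have gen: "integral\<^sup>L circ (\<lambda>x. indicator {a<..<b} x *\<^sub>R f x) = 0" for a b
  proof (cases "max a (-pi) \<le> min b pi")
    case True
    have "integral\<^sup>L circ (\<lambda>x. indicator {a<..<b} x *\<^sub>R f x) = integral\<^sup>L circ (\<lambda>x. indicator {max a (-pi)<..<min b pi} x *\<^sub>R f x)"
    proof (rule integral_cong_AE)
      show "(\<lambda>x. indicator {a<..<b} x *\<^sub>R f x) \<in> borel_measurable circ"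
        "(\<lambda>x. indicator {max a (-pi)<..<min b pi} x *\<^sub>R f x) \<in> borel_measurable circ"
        by (rule measurable_circ; use L2_circleD(2)[OF f] in measurable)+
      \<comment> \<open>Truncating the interval at the ends of the period changes the indicator at
        most at the points pi and -pi.\<close>
      have "AE x in lborel. x \<noteq> pi \<and> x \<noteq> -pi"
        by (intro AE_conjI AE_lborel_singleton)
      then have "AE x in circ. x \<noteq> pi \<and> x \<noteq> -pi" by (subst AE_restrict_space_iff) auto
      then show "AE x in circ. indicator {a<..<b} x *\<^sub>R f x = indicator {max a (-pi)<..<min b pi} x *\<^sub>R f x"
        by (rule AE_mp) (rule AE_I2, auto simp: space_restrict_space indicator_def)
    qed
    also have "\<dots> = 0" using True by (intro integral_arc_zero[OF f z]) auto
    finally show ?thesis .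
  next
    case False
    then have "(\<lambda>x. indicator {a<..<b} x *\<^sub>R f x) = (\<lambda>x. 0) \<or> b < -pi \<or> pi < a" by (auto simp: indicator_def fun_eq_iff)
    then have "integral\<^sup>L circ (\<lambda>x. indicator {a<..<b} x *\<^sub>R f x) = integral\<^sup>L circ (\<lambda>x. 0)"
      using False by (intro Bochner_Integration.integral_cong) (auto simp: space_restrict_space indicator_def)
    then show ?thesis by simp
  qed
  fix A assume "A \<in> sets circ"
  then obtain B where B: "B \<in> sets borel" "A = {-pi..pi} \<inter> B" by (auto simp: sets_restrict_space)
  have B': "B \<in> sigma_sets UNIV (range (\<lambda>(a::real, b). {a<..<b}))"
    using B(1) by (simp add: sets_borel_intervals)
  have subset_Pow: "range (\<lambda>(a::real, b). {a<..<b}) \<subseteq> Pow UNIV" by simp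
  have Int: "Int_stable (range (\<lambda>(a::real, b). {a<..<b}))"
    unfolding Int_stable_def by (auto simp: image_iff) 
  have "integral\<^sup>L circ (\<lambda>x. indicator B x *\<^sub>R f x) = 0"
    using Int subset_Pow B'
  proof (induction B rule: sigma_sets_induct_disjoint)
    case (basic A)
    then show ?case using gen by auto
  next
    case empty
    then show ?case by simp
  next
    case (compl A)
    then have "A \<in> sets borel" by (simp add: sets_borel_intervals)
    then have "(\<lambda>x. indicator A x *\<^sub>R f x) \<in> borel_measurable borel"
      using L2_circleD(2)[OF f] by measurable
    then have "integrable circ (\<lambda>x. indicator A x *\<^sub>R f x)"
      by (intro Bochner_Integration.integrable_bound[OF fi] measurable_circ) (auto simp: indicator_def)
    moreover have "(\<lambda>x. indicator (UNIV - A) x *\<^sub>R f x) = (\<lambda>x. f x - indicator A x *\<^sub>R f x)"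
      by (auto simp: indicator_def)
    ultimately show ?case using fi f0 compl by simp
  next
    case (union A)
    then have A: "A i \<in> sets borel" for i by (auto simp: sets_borel_intervals)
    have "(LINT x:(\<Union>i. {-pi..pi} \<inter> A i)|circ. f x) = (suminf (\<lambda>i. (LINT x:({-pi..pi} \<inter> A i)|circ. f x)))"
    proof (rule lebesgue_integral_countable_add)
      show "{-pi..pi} \<inter> A i \<in> sets circ" for i using A by (auto simp: sets_restrict_space)
      then have "(\<Union>i. {-pi..pi} \<inter> A i) \<in> sets circ" by blast
      then show "set_integrable circ (\<Union>i. {-pi..pi} \<inter> A i) f"
        unfolding set_integrable_def by (rule integrable_mult_indicator[OF _ fi])
      show "({-pi..pi} \<inter> A i) \<inter> ({-pi..pi} \<inter> A j) = {}" if "i \<noteq> j" for i j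
        using union(1) that by (auto simp: disjoint_family_on_def)
    qed
    moreover have "(LINT x:({-pi..pi} \<inter> C)|circ. f x) = integral\<^sup>L circ (\<lambda>x. indicator C x *\<^sub>R f x)" for C
      unfolding set_lebesgue_integral_def
      by (rule Bochner_Integration.integral_cong) (auto simp: space_restrict_space indicator_def)
    moreover have "(\<Union>i. {-pi..pi} \<inter> A i) = {-pi..pi} \<inter> (\<Union>i. A i)" by auto
    ultimately show ?case using union(3) by simp
  qed
  moreover have "set_lebesgue_integral circ A f = integral\<^sup>L circ (\<lambda>x. indicator B x *\<^sub>R f x)"
    unfolding set_lebesgue_integral_def B(2)
    by (rule Bochner_Integration.integral_cong) (auto simp: space_restrict_space indicator_def)
  ultimately show "set_lebesgue_integral circ A f = 0" by simp
qed

text \<open>For almost every x the implication holds at all translates x + 2 pi k simultaneously, as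
  these are countably many. One translate lies in the fundamental interval, and periodicity brings
  the property back to x.\<close>

lemma AE_circ_periodic:
  assumes P: "\<And>x. P (x + 2 * pi) = P x" "Measurable.pred borel P" and AE: "AE x in circ. P x"
  shows "AE x in lborel. P x"
proof -
  have "AE x in lborel. x \<in> {-pi..pi} \<longrightarrow> P x"
    using AE by (subst (asm) AE_restrict_space_iff) auto
  then have "AE x in lborel. (\<lambda>x. x \<in> {-pi..pi} \<longrightarrow> P x) (2 * pi * real_of_int k + 1 * x)" for k
    by (intro AE_borel_affine) (use P(2) in measurable)
  then have all: "AE x in lborel. \<forall>k::int. 2 * pi * real_of_int k + x \<in> {-pi..pi} \<longrightarrow> P (2 * pi * real_of_int k + x)"
    by (subst AE_all_countable) simp
  have P1: "P (x + 2 * pi * real n) = P x" for x n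
  proof (induction n)
    case (Suc n)
    have "x + 2 * pi * real (Suc n) = (x + 2 * pi * real n) + 2 * pi" by (simp add: algebra_simps)
    then show ?case using Suc by (simp only: P(1))
  qed simp
  have Pint: "P (2 * pi * real_of_int k + x) = P x" for k x
  proof (cases "0 \<le> k")
    case True
    then show ?thesis using P1[of x "nat k"] by (simp add: add.commute)
  next
    case False
    then show ?thesis using P1[of "2 * pi * real_of_int k + x" "nat (-k)"] by (simp add: algebra_simps)
  qed
  show ?thesis
  proof (rule AE_mp[OF all], intro AE_I2 impI)
    fix x :: real
    assume *: "\<forall>k::int. 2 * pi * real_of_int k + x \<in> {-pi..pi} \<longrightarrow> P (2 * pi * real_of_int k + x)"
    define k where "k = - \<lfloor>(x + pi) / (2 * pi)\<rfloor>"
    have "of_int (-k) \<le> (x + pi) / (2 * pi)" "(x + pi) / (2 * pi) < of_int (-k) + 1"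
      unfolding k_def by simp_all
    then have "2 * pi * real_of_int k + x \<in> {-pi..pi}"
      by (auto simp: field_simps)
    with * Pint show "P x" by blast
  qed
qed

lemma AE_lborel_circ: "AE x in lborel. P x \<Longrightarrow> AE x in circ. P x"
  by (subst AE_restrict_space_iff) auto

lemma AE_circ_eq_lborel:
  assumes "L2_circle f" "L2_circle g" "AE x in circ. f x = g x"
  shows "AE x in lborel. f x = g x"
proof (rule AE_circ_periodic[OF _ _ assms(3)])
  show "f (x + 2 * pi) = g (x + 2 * pi) \<longleftrightarrow> f x = g x" for x
    using assms(1,2)[THEN L2_circleD(1)] by (simp add: periodic_2pi_def)
  show "Measurable.pred borel (\<lambda>x. f x = g x)"
    using assms(1,2)[THEN L2_circleD(2)] by measurable
qed

lemma continuous_AE_zero: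
  fixes f :: "real \<Rightarrow> 'a::euclidean_space"
  assumes "continuous_on UNIV f" "AE x in lborel. f x = 0"
  shows "f x = 0"
proof (rule ccontr)
  assume "f x \<noteq> 0"
  have op: "open {x. f x \<noteq> 0}" by (intro open_Collect_neq assms continuous_intros)
  then obtain e where e: "e > 0" "ball x e \<subseteq> {x. f x \<noteq> 0}" using \<open>f x \<noteq> 0\<close> by (auto simp: open_contains_ball)
  have "{x. f x \<noteq> 0} \<in> null_sets lborel"
    using assms(2) op by (subst AE_iff_null_sets) (auto)
  then have "emeasure lborel (ball x e) \<le> 0"
    using emeasure_mono[OF e(2), of lborel] op by auto
  moreover have "ball x e = {x - e<..<x + e}" by (auto simp: dist_real_def)
  ultimately show False using e by simp
qed

text \<open>The form in which completeness is used: equations between L2 functions are checked mode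
  by mode.\<close>

lemma L2_coeffs_AE_eq:
  fixes f g :: "real \<Rightarrow> 'a::euclidean_space"
  assumes f: "L2_circle f" and g: "L2_circle g"
    and z: "\<And>k. fcos k f = fcos k g" "\<And>k. fsin k f = fsin k g"
  shows "AE x in lborel. f x = g x"
proof -
  have d: "L2_circle (\<lambda>x. f x - g x)" using f g by (rule L2_circle_diff)
  have "AE x in circ. f x - g x = 0"
    by (rule AE_circ_zero_coeffs[OF d])
      (use z in \<open>simp_all add: fcos_def fsin_def scaleR_diff_right
         L2_integrable_mult[OF L2_cos_sin(1)] L2_integrable_mult[OF L2_cos_sin(2)] f g\<close>)
  then show ?thesis by (intro AE_circ_eq_lborel[OF f g]) simp
qed

lemma fcos_linear:
  fixes f :: "real \<Rightarrow> 'a::euclidean_space" and T :: "'a \<Rightarrow> 'b::euclidean_space"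
  assumes "L2_circle f" "bounded_linear T"
  shows "fcos k (\<lambda>x. T (f x)) = T (fcos k f)" "fsin k (\<lambda>x. T (f x)) = T (fsin k f)"
proof -
  interpret bounded_linear T by fact
  show "fcos k (\<lambda>x. T (f x)) = T (fcos k f)" "fsin k (\<lambda>x. T (f x)) = T (fsin k f)"
    unfolding fcos_def fsin_def
    using integral_bounded_linear[OF assms(2) L2_integrable_mult[OF L2_cos_sin(1) assms(1)]]
      integral_bounded_linear[OF assms(2) L2_integrable_mult[OF L2_cos_sin(2) assms(1)]]
    by (simp_all add: scaleR)
qed

lemma fcos_add:
  fixes f g :: "real \<Rightarrow> 'a::euclidean_space"
  assumes "L2_circle f" "L2_circle g"
  shows "fcos k (\<lambda>x. f x + g x) = fcos k f + fcos k g" "fsin k (\<lambda>x. f x + g x) = fsin k f + fsin k g"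
  by (simp_all add: fcos_def fsin_def scaleR_add_right
         L2_integrable_mult[OF L2_cos_sin(1)] L2_integrable_mult[OF L2_cos_sin(2)] assms)

lemma fcos_diff:
  fixes f g :: "real \<Rightarrow> 'a::euclidean_space"
  assumes "L2_circle f" "L2_circle g"
  shows "fcos k (\<lambda>x. f x - g x) = fcos k f - fcos k g" "fsin k (\<lambda>x. f x - g x) = fsin k f - fsin k g"
  by (simp_all add: fcos_def fsin_def scaleR_diff_right
         L2_integrable_mult[OF L2_cos_sin(1)] L2_integrable_mult[OF L2_cos_sin(2)] assms)

lemma fcos_cong_AE:
  assumes "L2_circle f" "L2_circle g" "AE x in lborel. f x = g x"
  shows "fcos k f = fcos k g" "fsin k f = fsin k g"
proof -
  have "AE x in circ. f x = g x" using assms(3) by (rule AE_lborel_circ)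
  then show "fcos k f = fcos k g" "fsin k f = fsin k g" unfolding fcos_def fsin_def
    using assms(1,2)[THEN L2_circleD(3)] L2_cos_sin[THEN L2_circleD(3)]
    by (auto intro!: integral_cong_AE borel_measurable_scaleR)
qed

lemma norm_fcos_le:
  fixes f :: "real \<Rightarrow> 'a::euclidean_space"
  assumes "L2_circle f"
  shows "norm (fcos k f) \<le> sqrt (2 * pi) * L2_norm f" "norm (fsin k f) \<le> sqrt (2 * pi) * L2_norm f"
proof -
  have "L2_norm (\<lambda>x. cos (real k * x)) \<le> sqrt (2 * pi) * 1" "L2_norm (\<lambda>x. sin (real k * x)) \<le> sqrt (2 * pi) * 1"
    by (rule L2_norm_le_sup; simp add: L2_cos_sin)+
  then show "norm (fcos k f) \<le> sqrt (2 * pi) * L2_norm f" "norm (fsin k f) \<le> sqrt (2 * pi) * L2_norm f"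
    unfolding fcos_def fsin_def
    using L2_norm_scaleR_le[OF L2_cos_sin(1) assms, of k] L2_norm_scaleR_le[OF L2_cos_sin(2) assms, of k]
    by (auto elim!: order_trans intro!: mult_right_mono simp: L2_norm_nonneg)
qed

section \<open>Orthogonality, Bessel's inequality and summability of coefficients\<close>

lemma integral_circ_FTC:
  fixes F f :: "real \<Rightarrow> 'a::euclidean_space"
  assumes "\<And>x. (F has_vector_derivative f x) (at x)" "continuous_on UNIV f"
  shows "integral\<^sup>L circ f = F pi - F (-pi)"
proof -
  have "integral\<^sup>L circ f = integral\<^sup>L lborel (\<lambda>x. indicator {-pi..pi} x *\<^sub>R f x)"
    by (simp add: integral_restrict_space)
  also have "\<dots> = F pi - F (-pi)"
    by (rule integral_FTC_atLeastAtMost)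
      (use assms in \<open>auto intro: has_vector_derivative_at_within continuous_on_subset\<close>)
  finally show ?thesis .
qed

lemma integral_cos_int:
  "integral\<^sup>L circ (\<lambda>x. cos (of_int j * x)) = (if j = 0 then 2 * pi else 0)"
  "integral\<^sup>L circ (\<lambda>x. sin (of_int j * x)) = 0"
proof -
  show "integral\<^sup>L circ (\<lambda>x. cos (of_int j * x)) = (if j = 0 then 2 * pi else 0)"
  proof (cases "j = 0")
    case True
    then show ?thesis by (simp add: measure_circ space_restrict_space)
  next
    case False
    have "integral\<^sup>L circ (\<lambda>x. cos (of_int j * x)) = sin (of_int j * pi) / of_int j - sin (of_int j * - pi) / of_int j"
      by (rule integral_circ_FTC) 
        (use False in \<open>auto intro!: derivative_eq_intros continuous_intros simp: has_real_derivative_iff_has_vector_derivative[symmetric]\<close>)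
    then show ?thesis using False by (simp add: mult.commute)
  qed
  show "integral\<^sup>L circ (\<lambda>x. sin (of_int j * x)) = 0"
  proof (cases "j = 0")
    case False
    have "integral\<^sup>L circ (\<lambda>x. sin (of_int j * x)) = - cos (of_int j * pi) / of_int j - (- cos (of_int j * - pi) / of_int j)"
      by (rule integral_circ_FTC) 
        (use False in \<open>auto intro!: derivative_eq_intros continuous_intros simp: has_real_derivative_iff_has_vector_derivative[symmetric]\<close>)
    then show ?thesis by simp
  qed simp
qed

lemma integral_trig_orthogonal:
  fixes k l :: nat
  shows "integral\<^sup>L circ (\<lambda>x. cos (real k * x) * cos (real l * x)) = (if k = l then if k = 0 then 2 * pi else pi else 0)"
    "integral\<^sup>L circ (\<lambda>x. sin (real k * x) * cos (real l * x)) = 0"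
    "integral\<^sup>L circ (\<lambda>x. cos (real k * x) * sin (real l * x)) = 0"
    "integral\<^sup>L circ (\<lambda>x. sin (real k * x) * sin (real l * x)) = (if k = l \<and> k \<noteq> 0 then pi else 0)"
proof -
  let ?m = "int k - int l" and ?p = "int k + int l"
  have i: "integrable circ (\<lambda>x. cos (of_int j * x))" "integrable circ (\<lambda>x. sin (of_int j * x))" for j
    by (auto intro!: integrable_circ_continuous continuous_intros)
  have e: "(\<lambda>x. cos (real k * x) * cos (real l * x)) = (\<lambda>x. 1/2 * cos (of_int ?m * x) + 1/2 * cos (of_int ?p * x))"
    "(\<lambda>x. sin (real k * x) * cos (real l * x)) = (\<lambda>x. 1/2 * sin (of_int ?m * x) + 1/2 * sin (of_int ?p * x))"
    "(\<lambda>x. cos (real k * x) * sin (real l * x)) = (\<lambda>x. (-1/2) * sin (of_int ?m * x) + 1/2 * sin (of_int ?p * x))"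
    "(\<lambda>x. sin (real k * x) * sin (real l * x)) = (\<lambda>x. 1/2 * cos (of_int ?m * x) + (-1/2) * cos (of_int ?p * x))"
    by (simp_all add: fun_eq_iff cos_add cos_diff sin_add sin_diff algebra_simps)
  have f: "integral\<^sup>L circ (\<lambda>x. a * cos (of_int m * x) + b * cos (of_int p * x)) = 
      a * (if m = 0 then 2 * pi else 0) + b * (if p = 0 then 2 * pi else 0)"
    "integral\<^sup>L circ (\<lambda>x. a * sin (of_int m * x) + b * sin (of_int p * x)) = 0" for a b m p
    using i by (simp_all only: Bochner_Integration.integral_add integrable_mult_right integral_mult_right_zero
        integral_cos_int)
  show "integral\<^sup>L circ (\<lambda>x. cos (real k * x) * cos (real l * x)) = (if k = l then if k = 0 then 2 * pi else pi else 0)"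
    "integral\<^sup>L circ (\<lambda>x. sin (real k * x) * cos (real l * x)) = 0"
    "integral\<^sup>L circ (\<lambda>x. cos (real k * x) * sin (real l * x)) = 0"
    "integral\<^sup>L circ (\<lambda>x. sin (real k * x) * sin (real l * x)) = (if k = l \<and> k \<noteq> 0 then pi else 0)"
    unfolding e f by simp_all
qed

text \<open>Reciprocal of the squared L2 norm of the cosine mode k, and for k > 0 also of the sine
  mode.\<close>

definition fourier_weight :: "nat \<Rightarrow> real" where
  "fourier_weight k = (if k = 0 then 1 / (2 * pi) else 1 / pi)"

lemma fourier_weight: "0 < fourier_weight k" "fourier_weight k \<le> 1 / pi" "1 / (2 * pi) \<le> fourier_weight k"
  by (auto simp: fourier_weight_def field_simps)

definition fterm :: "(nat \<Rightarrow> 'a::euclidean_space) \<Rightarrow> (nat \<Rightarrow> 'a) \<Rightarrow> nat \<Rightarrow> real \<Rightarrow> 'a" where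
  "fterm a b k x = fourier_weight k *\<^sub>R (cos (real k * x) *\<^sub>R a k + sin (real k * x) *\<^sub>R b k)"

lemma norm_fterm_le: "norm (fterm a b k x) \<le> norm (a k) + norm (b k)"
proof -
  have p: "1 / pi \<le> 1" using pi_ge_two by (simp add: field_simps)
  have "norm (cos (real k * x) *\<^sub>R a k + sin (real k * x) *\<^sub>R b k) \<le> 1 * norm (a k) + 1 * norm (b k)"
    by (intro order_trans[OF norm_triangle_ineq] add_mono) (simp_all add: mult_left_le_one_le)
  moreover have "norm (fterm a b k x) \<le> norm (cos (real k * x) *\<^sub>R a k + sin (real k * x) *\<^sub>R b k)"
    using fourier_weight(1)[of k] order_trans[OF fourier_weight(2) p, of k] unfolding fterm_def
    by (simp add: mult_left_le_one_le)
  ultimately show ?thesis by simp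
qed

lemma L2_fterm: "L2_circle (fterm a b k)"
proof -
  have "L2_circle (\<lambda>x. cos (real k * x) *\<^sub>R v)" "L2_circle (\<lambda>x. sin (real k * x) *\<^sub>R v)" for v :: 'a
    by (rule L2_circle_linear[OF L2_cos_sin(1)], rule bounded_linear_scaleR_left)
      (rule L2_circle_linear[OF L2_cos_sin(2)], rule bounded_linear_scaleR_left)
  then show ?thesis unfolding fterm_def by (intro L2_circle_scaleR L2_circle_add)
qed

lemma fcos_fterm:
  fixes a b :: "nat \<Rightarrow> 'a::euclidean_space"
  assumes "b 0 = 0"
  shows "fcos j (fterm a b k) = (if j = k then a k else 0)" "fsin j (fterm a b k) = (if j = k then b k else 0)"
proof -
  have L: "L2_circle (\<lambda>x. cos (real k * x) *\<^sub>R v)" "L2_circle (\<lambda>x. sin (real k * x) *\<^sub>R v)" for v :: 'a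
    by (rule L2_circle_linear[OF L2_cos_sin(1)], rule bounded_linear_scaleR_left)
      (rule L2_circle_linear[OF L2_cos_sin(2)], rule bounded_linear_scaleR_left)
  have s: "fcos j (\<lambda>x. h x *\<^sub>R v) = integral\<^sup>L circ (\<lambda>x. cos (real j * x) * h x) *\<^sub>R v"
    "fsin j (\<lambda>x. h x *\<^sub>R v) = integral\<^sup>L circ (\<lambda>x. sin (real j * x) * h x) *\<^sub>R v"
    if "L2_circle h" for h and v :: 'a
    using L2_integrable_mult[OF L2_cos_sin(1) that] L2_integrable_mult[OF L2_cos_sin(2) that]
    by (simp_all add: fcos_def fsin_def)
  have "fcos j (fterm a b k) = fourier_weight k *\<^sub>R (fcos j (\<lambda>x. cos (real k * x) *\<^sub>R a k) + fcos j (\<lambda>x. sin (real k * x) *\<^sub>R b k))"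
    "fsin j (fterm a b k) = fourier_weight k *\<^sub>R (fsin j (\<lambda>x. cos (real k * x) *\<^sub>R a k) + fsin j (\<lambda>x. sin (real k * x) *\<^sub>R b k))"
    unfolding fterm_def
    by (simp_all add: fcos_linear[OF L2_circle_add[OF L] bounded_linear_scaleR_right] fcos_add[OF L])
  then show "fcos j (fterm a b k) = (if j = k then a k else 0)" "fsin j (fterm a b k) = (if j = k then b k else 0)"
    using assms by (auto simp: s L2_cos_sin integral_trig_orthogonal fourier_weight_def)
qed

lemma Bessel:
  fixes f :: "real \<Rightarrow> 'a::euclidean_space"
  assumes f: "L2_circle f"
  shows "(\<Sum>k\<le>N. (norm (fcos k f))\<^sup>2 + (norm (fsin k f))\<^sup>2) \<le> 2 * pi * (L2_norm f)\<^sup>2"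
proof -
  define t where "t = fterm (\<lambda>k. fcos k f) (\<lambda>k. fsin k f)"
  define P where "P = (\<lambda>x. \<Sum>k\<le>N. t k x)"
  have b0: "fsin 0 f = 0" by (simp add: fsin_def)
  have LP: "L2_circle P" unfolding P_def t_def by (intro L2_circle_sum L2_fterm)
  have i: "integral\<^sup>L circ (\<lambda>x. t k x \<bullet> g x) = fourier_weight k * (fcos k f \<bullet> fcos k g + fsin k f \<bullet> fsin k g)"
    if g: "L2_circle g" for g k
  proof -
    have ig: "integrable circ (\<lambda>x. cos (real k * x) *\<^sub>R g x)" "integrable circ (\<lambda>x. sin (real k * x) *\<^sub>R g x)"
      by (intro L2_integrable_mult L2_cos_sin g)+
    have "(\<lambda>x. t k x \<bullet> g x) = (\<lambda>x. fourier_weight k * (fcos k f \<bullet> (cos (real k * x) *\<^sub>R g x) + fsin k f \<bullet> (sin (real k * x) *\<^sub>R g x)))"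
      by (simp add: t_def fterm_def inner_add_left)
    then have "integral\<^sup>L circ (\<lambda>x. t k x \<bullet> g x) = fourier_weight k *
        (integral\<^sup>L circ (\<lambda>x. fcos k f \<bullet> (cos (real k * x) *\<^sub>R g x)) + integral\<^sup>L circ (\<lambda>x. fsin k f \<bullet> (sin (real k * x) *\<^sub>R g x)))"
      using ig[THEN integrable_inner_right] by (simp del: inner_scaleR_right)
    then show ?thesis using ig[THEN integral_inner_right] by (simp only: fcos_def fsin_def)
  qed
  have cP: "fcos k P = fcos k f" "fsin k P = fsin k f" if "k \<le> N" for k
  proof -
    have "fcos k P = (\<Sum>j\<le>N. fcos k (t j))" "fsin k P = (\<Sum>j\<le>N. fsin k (t j))"
      unfolding P_def fcos_def fsin_def scaleR_sum_right t_def
      by (rule Bochner_Integration.integral_sum, rule L2_integrable_mult, rule L2_cos_sin, rule L2_fterm)+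
    then show "fcos k P = fcos k f" "fsin k P = fsin k f"
      using that b0 by (simp_all add: t_def fcos_fterm)
  qed
  \<comment> \<open>P is the orthogonal projection of f onto the modes up to N, so its pairing with
    f and its pairing with itself both equal B. Expanding the square of f - P gives B <= ||f||^2;
    the smallest weight 1 / (2 pi) then accounts for the factor 2 pi.\<close>
  define B where "B = (\<Sum>k\<le>N. fourier_weight k * ((norm (fcos k f))\<^sup>2 + (norm (fsin k f))\<^sup>2))"
  have iP: "integral\<^sup>L circ (\<lambda>x. P x \<bullet> g x) = (\<Sum>k\<le>N. fourier_weight k * (fcos k f \<bullet> fcos k g + fsin k f \<bullet> fsin k g))"
    if g: "L2_circle g" for g
    unfolding P_def inner_sum_left
    by (subst Bochner_Integration.integral_sum[OF L2_integrable_inner[OF _ g]])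
      (simp_all only: i[OF g, unfolded t_def] t_def L2_fterm)
  have iPf: "integral\<^sup>L circ (\<lambda>x. P x \<bullet> f x) = B"
    unfolding iP[OF f] B_def by (simp add: power2_norm_eq_inner)
  have iPP: "integral\<^sup>L circ (\<lambda>x. P x \<bullet> P x) = B"
    unfolding iP[OF LP] B_def by (intro sum.cong) (simp_all add: cP power2_norm_eq_inner)
  have "0 \<le> integral\<^sup>L circ (\<lambda>x. (f x - P x) \<bullet> (f x - P x))" by simp
  also have "(\<lambda>x. (f x - P x) \<bullet> (f x - P x)) = (\<lambda>x. f x \<bullet> f x - 2 * (P x \<bullet> f x) + P x \<bullet> P x)"
    by (simp add: fun_eq_iff inner_diff_left inner_diff_right inner_commute)
  also have "integral\<^sup>L circ \<dots> = integral\<^sup>L circ (\<lambda>x. f x \<bullet> f x) - B"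
    using L2_integrable_inner[OF f f] L2_integrable_inner[OF LP f] L2_integrable_inner[OF LP LP]
    by (simp add: iPf iPP)
  finally have "B \<le> (L2_norm f)\<^sup>2" by (simp add: L2_norm_power2 power2_norm_eq_inner)
  moreover have "(\<Sum>k\<le>N. 1 / (2 * pi) * ((norm (fcos k f))\<^sup>2 + (norm (fsin k f))\<^sup>2)) \<le> B"
    unfolding B_def by (intro sum_mono mult_right_mono fourier_weight) simp
  ultimately have "1 / (2 * pi) * (\<Sum>k\<le>N. (norm (fcos k f))\<^sup>2 + (norm (fsin k f))\<^sup>2) \<le> (L2_norm f)\<^sup>2"
    by (simp only: sum_distrib_left[symmetric])
  then show ?thesis by (simp add: field_simps)
qed

text \<open>The induction carries the stronger bound 2 - 1 / N, whose increment 1 / a - 1 / (a + 1)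
  dominates 1 / (a + 1)^2.\<close>

lemma sum_inverse_squares_le: "(\<Sum>k\<in>{1..N}. 1 / (real k)\<^sup>2) \<le> 2"
proof -
  have "(\<Sum>k\<in>{1..Suc n}. 1 / (real k)\<^sup>2) \<le> 2 - 1 / real (Suc n)" for n
  proof (induction n)
    case (Suc n)
    have "1 / (a + 1)\<^sup>2 \<le> 1 / a - 1 / (a + 1)" if "a > 0" for a :: real
    proof -
      have "1 / (a + 1)\<^sup>2 \<le> 1 / (a * (a + 1))"
        using that by (intro divide_left_mono) (auto simp: power2_eq_square)
      then show ?thesis using that by (simp add: diff_frac_eq)
    qed
    from this[of "real (Suc n)"]
    have "1 / (real (Suc (Suc n)))\<^sup>2 \<le> 1 / real (Suc n) - 1 / real (Suc (Suc n))"
      by (simp add: add.commute)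
    then show ?case using Suc by simp
  qed simp
  then have "(\<Sum>k\<in>{1..Suc n}. 1 / (real k)\<^sup>2) \<le> 2" for n
    by (rule order_trans) simp
  then show ?thesis by (cases N) (simp_all del: sum.cl_ivl_Suc)
qed

text \<open>Cauchy-Schwarz for the square-summable coefficients against 1 / k. Applied to a weak
  derivative, whose coefficients carry a factor k, it gives absolute convergence of the Fourier
  series of an H1 function.\<close>

lemma Bessel_sum_div:
  fixes f :: "real \<Rightarrow> 'a::euclidean_space"
  assumes f: "L2_circle f"
  shows "(\<Sum>k\<in>{1..N}. (norm (fcos k f) + norm (fsin k f)) / real k) \<le> 4 * sqrt (2 * pi) * L2_norm f"
proof -
  have *: "(\<Sum>k\<in>{1..N}. \<bar>norm (c k)\<bar> * \<bar>1 / real k\<bar>) \<le> sqrt (2 * pi) * L2_norm f * 2"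
    if c: "\<And>k. (norm (c k :: 'a))\<^sup>2 \<le> (norm (fcos k f))\<^sup>2 + (norm (fsin k f))\<^sup>2" for c
  proof -
    have "(\<Sum>k\<in>{1..N}. (norm (c k))\<^sup>2) \<le> (\<Sum>k\<le>N. (norm (fcos k f))\<^sup>2 + (norm (fsin k f))\<^sup>2)"
      by (rule order_trans[OF sum_mono[OF c]]) (rule sum_mono2, auto)
    also have "\<dots> \<le> 2 * pi * (L2_norm f)\<^sup>2" by (rule Bessel[OF f])
    finally have 1: "L2_set (\<lambda>k. norm (c k)) {1..N} \<le> sqrt (2 * pi) * L2_norm f"
      unfolding L2_set_def by (intro real_le_lsqrt) (simp_all add: power_mult_distrib sum_nonneg)
    have "L2_set (\<lambda>k. 1 / real k) {1..N} \<le> sqrt 2"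
      unfolding L2_set_def using sum_inverse_squares_le[of N] by (simp add: power_divide)
    also have "\<dots> \<le> 2" using real_sqrt_le_iff[of 2 4] by simp
    finally have 2: "L2_set (\<lambda>k. 1 / real k) {1..N} \<le> 2" .
    show ?thesis
      by (rule order_trans[OF L2_set_mult_ineq mult_mono[OF 1 2]]) (auto intro: L2_set_nonneg)
  qed
  have "(\<Sum>k\<in>{1..N}. \<bar>norm (fcos k f)\<bar> * \<bar>1 / real k\<bar>) \<le> sqrt (2 * pi) * L2_norm f * 2"
    "(\<Sum>k\<in>{1..N}. \<bar>norm (fsin k f)\<bar> * \<bar>1 / real k\<bar>) \<le> sqrt (2 * pi) * L2_norm f * 2"
    by (rule *, simp)+
  then show ?thesis by (simp add: add_divide_distrib sum.distrib)
qed

section \<open>Weak derivatives and Sobolev functions in terms of Fourier coefficients\<close>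

lemma has_weak_deriv_circ:
  "has_weak_deriv f g \<longleftrightarrow> L2_circle f \<and> L2_circle g \<and>
     (\<forall>\<phi>. test_function \<phi> \<longrightarrow>
        integral\<^sup>L circ (\<lambda>x. deriv \<phi> x *\<^sub>R f x) = - integral\<^sup>L circ (\<lambda>x. \<phi> x *\<^sub>R g x))"
  by (simp add: has_weak_deriv_def LBINT_circ)

lemma has_weak_derivD:
  assumes "has_weak_deriv f g"
  shows "L2_circle f" "L2_circle g"
    "test_function \<phi> \<Longrightarrow> integral\<^sup>L circ (\<lambda>x. deriv \<phi> x *\<^sub>R f x) = - integral\<^sup>L circ (\<lambda>x. \<phi> x *\<^sub>R g x)"
  using assms by (auto simp: has_weak_deriv_circ)

lemma deriv_trig: "deriv (\<lambda>x. a * cos (c * x) + b * sin (c * x)) = (\<lambda>x::real. (b * c) * cos (c * x) + (- a * c) * sin (c * x))"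
  by (rule ext, rule DERIV_imp_deriv) (auto intro!: derivative_eq_intros simp: algebra_simps)

lemma deriv_iter_trig:
  "\<exists>A B. (deriv ^^ j) (\<lambda>x. a * cos (c * x) + b * sin (c * x)) = (\<lambda>x::real. A * cos (c * x) + B * sin (c * x))"
proof (induction j)
  case (Suc j)
  then obtain A B where "(deriv ^^ j) (\<lambda>x. a * cos (c * x) + b * sin (c * x)) = (\<lambda>x. A * cos (c * x) + B * sin (c * x))"
    by blast
  then have "(deriv ^^ Suc j) (\<lambda>x. a * cos (c * x) + b * sin (c * x)) = (\<lambda>x. (B * c) * cos (c * x) + (- A * c) * sin (c * x))"
    by (simp only: funpow.simps o_apply deriv_trig)
  then show ?case by blast
qed (simp, blast)

lemma test_function_trig: "test_function (\<lambda>x. a * cos (real k * x) + b * sin (real k * x))"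
  unfolding test_function_def
proof (intro conjI allI)
  show "periodic_2pi (\<lambda>x. a * cos (real k * x) + b * sin (real k * x))"
    using periodic_cos_sin[of k] by (simp add: periodic_2pi_def)
  fix j
  obtain A B where "(deriv ^^ j) (\<lambda>x. a * cos (real k * x) + b * sin (real k * x)) = (\<lambda>x. A * cos (real k * x) + B * sin (real k * x))"
    using deriv_iter_trig by blast
  moreover have "((\<lambda>x. A * cos (real k * x) + B * sin (real k * x)) has_real_derivative
      (B * real k) * cos (real k * x) + (- A * real k) * sin (real k * x)) (at x)" for x
    by (auto intro!: derivative_eq_intros simp: algebra_simps)
  ultimately show "(deriv ^^ j) (\<lambda>x. a * cos (real k * x) + b * sin (real k * x)) differentiable_on UNIV"
    unfolding differentiable_on_def real_differentiable_def by auto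
qed

text \<open>The trigonometric modes are themselves test functions, so the defining identity can be
  read off for each of them.\<close>

lemma weak_deriv_coeffs:
  fixes f g :: "real \<Rightarrow> 'a::euclidean_space"
  assumes "has_weak_deriv f g"
  shows "fcos k g = real k *\<^sub>R fsin k f" "fsin k g = - real k *\<^sub>R fcos k f"
proof -
  note * = has_weak_derivD(3)[OF assms test_function_trig, unfolded deriv_trig]
  have i: "integrable circ (\<lambda>x. cos (real k * x) *\<^sub>R f x)" "integrable circ (\<lambda>x. sin (real k * x) *\<^sub>R f x)"
    by (intro L2_integrable_mult L2_cos_sin has_weak_derivD(1)[OF assms])+
  have "- (real k *\<^sub>R fsin k f) = - fcos k g"
    using *[of 0 k 1] i by (simp add: fcos_def fsin_def flip: scaleR_scaleR)
  then show "fcos k g = real k *\<^sub>R fsin k f" by simp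
  have "real k *\<^sub>R fcos k f = - fsin k g"
    using *[of 1 k 0] i by (simp add: fcos_def fsin_def flip: scaleR_scaleR)
  then show "fsin k g = - real k *\<^sub>R fcos k f" by simp
qed

lemma test_functionD:
  assumes "test_function \<phi>"
  shows "periodic_2pi \<phi>" "(\<phi> has_vector_derivative deriv \<phi> x) (at x)" "continuous_on UNIV \<phi>"
    "test_function (deriv \<phi>)"
proof -
  show p: "periodic_2pi \<phi>" using assms by (simp add: test_function_def)
  have d: "(deriv ^^ k) \<phi> differentiable_on UNIV" for k using assms by (simp add: test_function_def)
  have D: "(\<phi> has_real_derivative deriv \<phi> x) (at x)" for x
    using d[of 0] by (auto simp: differentiable_on_def real_differentiable_def DERIV_deriv_iff_real_differentiable)
  then show "(\<phi> has_vector_derivative deriv \<phi> x) (at x)"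
    by (simp add: has_real_derivative_iff_has_vector_derivative)
  show "continuous_on UNIV \<phi>" using differentiable_imp_continuous_on[OF d[of 0]] by simp
  have "deriv \<phi> (x + 2 * pi) = deriv \<phi> x" for x
  proof -
    have "((\<lambda>x. \<phi> (x + 2 * pi)) has_real_derivative deriv \<phi> (x + 2 * pi)) (at x)"
      using D[of "x + 2 * pi"] by (simp add: DERIV_shift)
    moreover have "(\<lambda>x. \<phi> (x + 2 * pi)) = \<phi>" using p by (simp add: periodic_2pi_def)
    ultimately have "(\<phi> has_real_derivative deriv \<phi> (x + 2 * pi)) (at x)" by simp
    then show ?thesis using D[of x] by (rule DERIV_unique)
  qed
  then show "test_function (deriv \<phi>)"
    using d[of "Suc _"] by (simp add: test_function_def periodic_2pi_def funpow_Suc_right del: funpow.simps)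
qed

lemma has_weak_deriv_C1:
  fixes f :: "real \<Rightarrow> 'a::euclidean_space"
  assumes p: "periodic_2pi f" and d: "\<And>x. (f has_vector_derivative f' x) (at x)" and c: "continuous_on UNIV f'"
  shows "has_weak_deriv f f'"
proof -
  have cf: "continuous_on UNIV f"
    using d by (intro continuous_at_imp_continuous_on ballI has_vector_derivative_continuous)
  have "f' (x + 2 * pi) = f' x" for x
  proof -
    have "((\<lambda>x. x + 2 * pi) has_vector_derivative 1) (at x)" by (auto intro!: derivative_eq_intros)
    from vector_diff_chain_at[OF this d]
    have "((\<lambda>x. f (x + 2 * pi)) has_vector_derivative f' (x + 2 * pi)) (at x)" by (simp add: o_def)
    moreover have "(\<lambda>x. f (x + 2 * pi)) = f" using p by (simp add: periodic_2pi_def)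
    ultimately have "(f has_vector_derivative f' (x + 2 * pi)) (at x)" by simp
    then show ?thesis using d[of x] by (rule vector_derivative_unique_at)
  qed
  then have p': "periodic_2pi f'" by (simp add: periodic_2pi_def)
  have L: "L2_circle f" "L2_circle f'" using L2_circle_continuous p p' c cf by blast+
  have "integral\<^sup>L circ (\<lambda>x. deriv \<phi> x *\<^sub>R f x) = - integral\<^sup>L circ (\<lambda>x. \<phi> x *\<^sub>R f' x)" if t: "test_function \<phi>" for \<phi>
  proof -
    note tD = test_functionD[OF t] test_functionD(3)[OF test_functionD(4)[OF t]]
    have "integral\<^sup>L circ (\<lambda>x. \<phi> x *\<^sub>R f' x + deriv \<phi> x *\<^sub>R f x) = \<phi> pi *\<^sub>R f pi - \<phi> (-pi) *\<^sub>R f (-pi)"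
    proof (rule integral_circ_FTC)
      show "((\<lambda>x. \<phi> x *\<^sub>R f x) has_vector_derivative \<phi> x *\<^sub>R f' x + deriv \<phi> x *\<^sub>R f x) (at x)" for x
        using tD(2)[of x] d[of x]
        by (intro has_vector_derivative_scaleR) (simp_all add: has_real_derivative_iff_has_vector_derivative)
      show "continuous_on UNIV (\<lambda>x. \<phi> x *\<^sub>R f' x + deriv \<phi> x *\<^sub>R f x)"
        by (intro continuous_intros tD c cf)
    qed
    also have "\<phi> pi *\<^sub>R f pi - \<phi> (-pi) *\<^sub>R f (-pi) = 0"
    proof -
      have "\<phi> (-pi + 2 * pi) = \<phi> (-pi)" "f (-pi + 2 * pi) = f (-pi)"
        using tD(1) p unfolding periodic_2pi_def by blast+
      then show ?thesis by simp
    qed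
    finally have "integral\<^sup>L circ (\<lambda>x. \<phi> x *\<^sub>R f' x + deriv \<phi> x *\<^sub>R f x) = 0" .
    moreover have "integrable circ (\<lambda>x. \<phi> x *\<^sub>R f' x)" "integrable circ (\<lambda>x. deriv \<phi> x *\<^sub>R f x)"
      by (intro integrable_circ_continuous continuous_intros tD c cf)+
    ultimately show ?thesis by (simp add: eq_neg_iff_add_eq_0 add.commute)
  qed
  with L show ?thesis by (simp add: has_weak_deriv_circ)
qed

lemma integral_sums_dominated:
  fixes u :: "nat \<Rightarrow> real \<Rightarrow> 'a::euclidean_space" and g :: "real \<Rightarrow> real"
  assumes u: "\<And>k. integrable circ (u k)" and g: "integrable circ g" "\<And>x. 0 \<le> g x"
    and M: "summable M" "\<And>k x. norm (u k x) \<le> M k * g x" "\<And>k. 0 \<le> M k"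
  shows "(\<lambda>k. integral\<^sup>L circ (u k)) sums integral\<^sup>L circ (\<lambda>x. suminf (\<lambda>k. u k x))"
proof (rule sums_integral[OF u])
  show "AE x in circ. summable (\<lambda>k. norm (u k x))"
  proof (rule AE_I2)
    fix x
    show "summable (\<lambda>k. norm (u k x))"
      by (rule summable_comparison_test'[of "\<lambda>k. M k * g x" 0]) (use M in \<open>auto intro: summable_mult2\<close>)
  qed
  show "summable (\<lambda>k. integral\<^sup>L circ (\<lambda>x. norm (u k x)))"
  proof (rule summable_comparison_test'[of "\<lambda>k. M k * integral\<^sup>L circ g" 0])
    show "summable (\<lambda>k. M k * integral\<^sup>L circ g)" using M by (intro summable_mult2)
    have "integral\<^sup>L circ (\<lambda>x. norm (u k x)) \<le> integral\<^sup>L circ (\<lambda>x. M k * g x)" for k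
      using u g M by (intro integral_mono) auto
    then show "norm (integral\<^sup>L circ (\<lambda>x. norm (u k x))) \<le> M k * integral\<^sup>L circ g" for k by simp
  qed
qed

context
  fixes a b :: "nat \<Rightarrow> 'a::euclidean_space"
  assumes ab: "summable (\<lambda>k. norm (a k) + norm (b k))"
begin

lemma summable_fterm: "summable (\<lambda>k. fterm a b k x)"
  by (rule summable_comparison_test'[OF ab]) (rule norm_fterm_le)

lemma continuous_on_fterm_suminf: "continuous_on UNIV (\<lambda>x. suminf (\<lambda>k. fterm a b k x))"
proof (rule uniform_limit_theorem)
  show "uniform_limit UNIV (\<lambda>n x. \<Sum>k<n. fterm a b k x) (\<lambda>x. suminf (\<lambda>k. fterm a b k x)) sequentially"
    by (rule Weierstrass_m_test[OF _ ab]) (rule norm_fterm_le)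
  show "\<forall>\<^sub>F n in sequentially. continuous_on UNIV (\<lambda>x. \<Sum>k<n. fterm a b k x)"
    unfolding fterm_def by (intro always_eventually allI continuous_intros)
qed simp

lemma L2_fterm_suminf: "L2_circle (\<lambda>x. suminf (\<lambda>k. fterm a b k x))"
  by (rule L2_circle_continuous[OF continuous_on_fterm_suminf])
    (use periodic_cos_sin in \<open>simp add: periodic_2pi_def fterm_def\<close>)

lemma integral_fterm_suminf:
  fixes h :: "real \<Rightarrow> real"
  assumes h: "L2_circle h"
  shows "(\<lambda>k. integral\<^sup>L circ (\<lambda>x. h x *\<^sub>R fterm a b k x)) sums integral\<^sup>L circ (\<lambda>x. h x *\<^sub>R (suminf (\<lambda>k. fterm a b k x)))"
proof -
  have "(\<lambda>k. integral\<^sup>L circ (\<lambda>x. h x *\<^sub>R fterm a b k x)) sums integral\<^sup>L circ (\<lambda>x. suminf (\<lambda>k. h x *\<^sub>R fterm a b k x))"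
  proof (rule integral_sums_dominated[where g = "\<lambda>x. \<bar>h x\<bar>", OF _ _ _ ab])
    show "integrable circ (\<lambda>x. h x *\<^sub>R fterm a b k x)" for k by (intro L2_integrable_mult h L2_fterm)
    show "integrable circ (\<lambda>x. \<bar>h x\<bar>)" using L2_integrable[OF h] by simp
    show "norm (h x *\<^sub>R fterm a b k x) \<le> (norm (a k) + norm (b k)) * \<bar>h x\<bar>" for k x
      using mult_right_mono[OF norm_fterm_le[of a b k x], of "\<bar>h x\<bar>"] by (simp add: mult.commute)
  qed auto
  then show ?thesis by (simp add: suminf_scaleR_right summable_fterm)
qed

lemma fcos_fterm_suminf:
  assumes "b 0 = 0"
  shows "fcos j (\<lambda>x. suminf (\<lambda>k. fterm a b k x)) = a j" "fsin j (\<lambda>x. suminf (\<lambda>k. fterm a b k x)) = b j"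
proof -
  have "(\<lambda>k. fcos j (fterm a b k)) sums fcos j (\<lambda>x. suminf (\<lambda>k. fterm a b k x))"
    "(\<lambda>k. fsin j (fterm a b k)) sums fsin j (\<lambda>x. suminf (\<lambda>k. fterm a b k x))"
    unfolding fcos_def fsin_def by (intro integral_fterm_suminf L2_cos_sin)+
  moreover have "(\<lambda>k. if j = k then c k else 0) sums c j" for c :: "nat \<Rightarrow> 'a"
    using sums_If_finite_set[of "{j}" "\<lambda>k. c k"] by (simp add: eq_commute)
  ultimately show "fcos j (\<lambda>x. suminf (\<lambda>k. fterm a b k x)) = a j" "fsin j (\<lambda>x. suminf (\<lambda>k. fterm a b k x)) = b j"
    unfolding fcos_fterm[of b, OF assms] by (auto intro: sums_unique2)
qed

end

lemma fourier_series_AE: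
  fixes f :: "real \<Rightarrow> 'a::euclidean_space"
  assumes f: "L2_circle f" and s: "summable (\<lambda>k. norm (fcos k f) + norm (fsin k f))"
  shows "AE x in lborel. f x = (suminf (\<lambda>k. fterm (\<lambda>k. fcos k f) (\<lambda>k. fsin k f) k x))"
  by (rule L2_coeffs_AE_eq[OF f L2_fterm_suminf[OF s]])
    (use fcos_fterm_suminf[OF s] in \<open>simp_all add: fsin_def\<close>)

lemma fourier_series_continuous:
  fixes f :: "real \<Rightarrow> 'a::euclidean_space"
  assumes f: "L2_circle f" "continuous_on UNIV f" and s: "summable (\<lambda>k. norm (fcos k f) + norm (fsin k f))"
  shows "f x = (suminf (\<lambda>k. fterm (\<lambda>k. fcos k f) (\<lambda>k. fsin k f) k x))"
proof -
  have "f x - (suminf (\<lambda>k. fterm (\<lambda>k. fcos k f) (\<lambda>k. fsin k f) k x)) = 0"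
    by (rule continuous_AE_zero[where f = "\<lambda>x. f x - (suminf (\<lambda>k. fterm (\<lambda>k. fcos k f) (\<lambda>k. fsin k f) k x))"])
      (use fourier_series_AE[OF f(1) s] f(2) continuous_on_fterm_suminf[OF s] in \<open>auto intro!: continuous_intros\<close>)
  then show ?thesis by simp
qed

lemma weak_deriv_summable:
  fixes f g :: "real \<Rightarrow> 'a::euclidean_space"
  assumes "has_weak_deriv f g"
  shows "summable (\<lambda>k. norm (fcos k f) + norm (fsin k f))"
    "(suminf (\<lambda>k. norm (fcos k f) + norm (fsin k f))) \<le> 4 * sqrt (2 * pi) * (L2_norm f + L2_norm g)"
proof -
  note L = has_weak_derivD(1,2)[OF assms]
  have *: "(\<Sum>k<n. norm (fcos k f) + norm (fsin k f)) \<le> 4 * sqrt (2 * pi) * (L2_norm f + L2_norm g)" for n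
  proof -
    have "(\<Sum>k<n. norm (fcos k f) + norm (fsin k f)) \<le> (\<Sum>k\<in>{0..n}. norm (fcos k f) + norm (fsin k f))"
      by (rule sum_mono2) auto
    also have "\<dots> = norm (fcos 0 f) + (\<Sum>k\<in>{1..n}. norm (fcos k f) + norm (fsin k f))"
      by (simp add: sum.atLeast_Suc_atMost fsin_def)
    also have "(\<Sum>k\<in>{1..n}. norm (fcos k f) + norm (fsin k f)) = (\<Sum>k\<in>{1..n}. (norm (fcos k g) + norm (fsin k g)) / real k)"
      by (rule sum.cong) (auto simp: weak_deriv_coeffs[OF assms] add_divide_distrib)
    also have "\<dots> \<le> 4 * sqrt (2 * pi) * L2_norm g" by (rule Bessel_sum_div[OF L(2)])
    also have "norm (fcos 0 f) \<le> sqrt (2 * pi) * L2_norm f" by (rule norm_fcos_le[OF L(1)])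
    also have "\<dots> \<le> 4 * sqrt (2 * pi) * L2_norm f" by simp
    finally show ?thesis by (simp add: distrib_left)
  qed
  show s: "summable (\<lambda>k. norm (fcos k f) + norm (fsin k f))"
    by (rule summableI_nonneg_bounded[OF _ *]) simp
  show "(suminf (\<lambda>k. norm (fcos k f) + norm (fsin k f))) \<le> 4 * sqrt (2 * pi) * (L2_norm f + L2_norm g)"
    using * by (rule suminf_le_const[OF s])
qed

text \<open>Parseval's formula for a test function against an L2 function. The series of the test
  function converges absolutely because its derivative is square-integrable, which allows
  integration term by term.\<close>

lemma integral_test_L2:
  fixes g :: "real \<Rightarrow> 'a::euclidean_space"
  assumes t: "test_function \<phi>" and g: "L2_circle g"
  shows "(\<lambda>k. fourier_weight k *\<^sub>R (fcos k \<phi> *\<^sub>R fcos k g + fsin k \<phi> *\<^sub>R fsin k g)) sums integral\<^sup>L circ (\<lambda>x. \<phi> x *\<^sub>R g x)"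
proof -
  note tD = test_functionD[OF t]
  have w: "has_weak_deriv \<phi> (deriv \<phi>)"
    by (rule has_weak_deriv_C1[OF tD(1,2) test_functionD(3)[OF tD(4)]])
  note s = weak_deriv_summable(1)[OF w]
  let ?t = "\<lambda>k x. fterm (\<lambda>k. fcos k \<phi>) (\<lambda>k. fsin k \<phi>) k x"
  note L = has_weak_derivD(1)[OF w]
  have eq: "integral\<^sup>L circ (\<lambda>x. ?t k x *\<^sub>R g x) = fourier_weight k *\<^sub>R (fcos k \<phi> *\<^sub>R fcos k g + fsin k \<phi> *\<^sub>R fsin k g)" for k
  proof -
    have "(\<lambda>x. ?t k x *\<^sub>R g x) = (\<lambda>x. fourier_weight k *\<^sub>R (fcos k \<phi> *\<^sub>R (cos (real k * x) *\<^sub>R g x) + fsin k \<phi> *\<^sub>R (sin (real k * x) *\<^sub>R g x)))"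
      by (simp add: fterm_def fun_eq_iff algebra_simps)
    then show ?thesis
      using L2_integrable_mult[OF L2_cos_sin(1) g, of k] L2_integrable_mult[OF L2_cos_sin(2) g, of k]
      by (simp add: fcos_def[of k g] fsin_def[of k g] del: scaleR_scaleR)
  qed
  have "(\<lambda>k. integral\<^sup>L circ (\<lambda>x. ?t k x *\<^sub>R g x)) sums integral\<^sup>L circ (\<lambda>x. suminf (\<lambda>k. ?t k x *\<^sub>R g x))"
  proof (rule integral_sums_dominated[where g = "\<lambda>x. norm (g x)", OF _ _ _ s])
    show "integrable circ (\<lambda>x. ?t k x *\<^sub>R g x)" for k by (intro L2_integrable_mult g L2_fterm)
    show "integrable circ (\<lambda>x. norm (g x))" using L2_integrable[OF g] by simp
    show "norm (?t k x *\<^sub>R g x) \<le> (norm (fcos k \<phi>) + norm (fsin k \<phi>)) * norm (g x)" for k x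
      unfolding norm_scaleR real_norm_def[symmetric] by (intro mult_right_mono norm_fterm_le norm_ge_zero)
  qed auto
  also have "(\<lambda>x. suminf (\<lambda>k. ?t k x *\<^sub>R g x)) = (\<lambda>x. \<phi> x *\<^sub>R g x)"
    by (simp add: fun_eq_iff suminf_scaleR_left[OF summable_fterm[OF s], symmetric]
        fourier_series_continuous[OF L tD(3) s, symmetric])
  finally show ?thesis unfolding eq .
qed

text \<open>Modes suffice as test functions: for a general test function both integrals are expanded
  by Parseval, and the coefficients of its derivative are known. From here on weak derivatives are
  handled through coefficients alone.\<close>

lemma has_weak_deriv_iff_coeffs:
  fixes f g :: "real \<Rightarrow> 'a::euclidean_space"
  shows "has_weak_deriv f g \<longleftrightarrow> L2_circle f \<and> L2_circle g \<and>
    (\<forall>k. fcos k g = real k *\<^sub>R fsin k f \<and> fsin k g = - real k *\<^sub>R fcos k f)" (is "?L \<longleftrightarrow> ?R")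
proof
  assume ?L
  then show ?R using has_weak_derivD(1,2) weak_deriv_coeffs by blast
next
  assume R: ?R
  have "integral\<^sup>L circ (\<lambda>x. deriv \<phi> x *\<^sub>R f x) = - integral\<^sup>L circ (\<lambda>x. \<phi> x *\<^sub>R g x)" if t: "test_function \<phi>" for \<phi>
  proof -
    note tD = test_functionD[OF t]
    have w: "has_weak_deriv \<phi> (deriv \<phi>)"
      by (rule has_weak_deriv_C1[OF tD(1,2) test_functionD(3)[OF tD(4)]])
    have "(\<lambda>k. fourier_weight k *\<^sub>R (fcos k (deriv \<phi>) *\<^sub>R fcos k f + fsin k (deriv \<phi>) *\<^sub>R fsin k f))
        = (\<lambda>k. - (fourier_weight k *\<^sub>R (fcos k \<phi> *\<^sub>R fcos k g + fsin k \<phi> *\<^sub>R fsin k g)))"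
      using R by (simp add: weak_deriv_coeffs[OF w] fun_eq_iff algebra_simps)
    then have "(\<lambda>k. - (fourier_weight k *\<^sub>R (fcos k \<phi> *\<^sub>R fcos k g + fsin k \<phi> *\<^sub>R fsin k g))) sums
        integral\<^sup>L circ (\<lambda>x. deriv \<phi> x *\<^sub>R f x)"
      using integral_test_L2[OF tD(4), of f] R by simp
    with sums_minus[OF integral_test_L2[OF t, of g]] R show ?thesis by (auto intro: sums_unique2)
  qed
  with R show ?L by (simp add: has_weak_deriv_circ)
qed

lemma has_weak_deriv_cong_AE:
  assumes "has_weak_deriv f g" "L2_circle f'" "L2_circle g'" "AE x in lborel. f x = f' x" "AE x in lborel. g x = g' x"
  shows "has_weak_deriv f' g'"
  using assms fcos_cong_AE[OF has_weak_derivD(1)[OF assms(1)] assms(2,4)]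
    fcos_cong_AE[OF has_weak_derivD(2)[OF assms(1)] assms(3,5)]
  by (simp add: has_weak_deriv_iff_coeffs)

lemma has_weak_deriv_unique:
  assumes "has_weak_deriv f g" "has_weak_deriv f g'"
  shows "AE x in lborel. g x = g' x"
  using assms by (intro L2_coeffs_AE_eq) (simp_all add: has_weak_deriv_iff_coeffs)

lemma has_weak_deriv_weak_deriv: "H1_circle f \<Longrightarrow> has_weak_deriv f (weak_deriv f)"
  unfolding H1_circle_def weak_deriv_def by (rule someI_ex[of "has_weak_deriv f"])

lemma H2_circleD:
  assumes "H2_circle f"
  shows "has_weak_deriv f (weak_deriv f)" "has_weak_deriv (weak_deriv f) (weak_deriv (weak_deriv f))"
proof -
  obtain g h where g: "has_weak_deriv f g" "has_weak_deriv g h"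
    using assms by (auto simp: H2_circle_def H1_circle_def)
  show 1: "has_weak_deriv f (weak_deriv f)"
    by (rule has_weak_deriv_weak_deriv) (use g in \<open>auto simp: H1_circle_def\<close>)
  have "has_weak_deriv (weak_deriv f) h"
    by (rule has_weak_deriv_cong_AE[OF g(2)])
      (use has_weak_deriv_unique[OF g(1) 1] has_weak_derivD[OF 1] has_weak_derivD[OF g(2)] in auto)
  then show "has_weak_deriv (weak_deriv f) (weak_deriv (weak_deriv f))"
    by (intro has_weak_deriv_weak_deriv) (auto simp: H1_circle_def)
qed

text \<open>\<open>weak_deriv\<close> is an arbitrary representative, so an explicitly known second
  derivative agrees with it only almost everywhere. Explicit derivatives enter the defined notions
  through this lemma.\<close>

lemma H2_circle_AE:
  assumes "has_weak_deriv f g" "has_weak_deriv g h"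
  shows "H2_circle f" "AE x in lborel. weak_deriv (weak_deriv f) x = h x"
proof -
  show H: "H2_circle f" using assms by (auto simp: H2_circle_def H1_circle_def)
  have "has_weak_deriv (weak_deriv f) h"
    by (rule has_weak_deriv_cong_AE[OF assms(2)])
      (use has_weak_deriv_unique[OF assms(1) H2_circleD(1)[OF H]] has_weak_derivD[OF H2_circleD(1)[OF H]] 
        has_weak_derivD[OF assms(2)] in auto)
  then show "AE x in lborel. weak_deriv (weak_deriv f) x = h x"
    by (rule has_weak_deriv_unique[OF H2_circleD(2)[OF H]])
qed

lemma H2_coeffs:
  assumes "H2_circle f"
  shows "fcos k (weak_deriv (weak_deriv f)) = - (real k)\<^sup>2 *\<^sub>R fcos k f"
    "fsin k (weak_deriv (weak_deriv f)) = - (real k)\<^sup>2 *\<^sub>R fsin k f"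
  using weak_deriv_coeffs[OF H2_circleD(1)[OF assms]] weak_deriv_coeffs[OF H2_circleD(2)[OF assms]]
  by (simp_all add: power2_eq_square)

lemma H1_norm_eq:
  assumes "has_weak_deriv f g"
  shows "(H1_norm f)\<^sup>2 = (L2_norm f)\<^sup>2 + (L2_norm g)\<^sup>2"
proof -
  have w: "has_weak_deriv f (weak_deriv f)"
    by (rule has_weak_deriv_weak_deriv) (use assms in \<open>auto simp: H1_circle_def\<close>)
  have "L2_norm (weak_deriv f) = L2_norm g"
    by (rule L2_norm_AE_cong[OF has_weak_derivD(2)[OF w] has_weak_derivD(2)[OF assms]])
      (rule AE_lborel_circ[OF has_weak_deriv_unique[OF w assms]])
  then show ?thesis by (simp add: H1_norm_def)
qed

lemma H1_norm_nonneg [simp]: "0 \<le> H1_norm f"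
  by (simp add: H1_norm_def)

lemma L2_norm_le_H1_norm: "L2_norm f \<le> H1_norm f"
  unfolding H1_norm_def by (rule real_le_rsqrt) simp

text \<open>Embedding into bounded functions by absolute convergence of the Fourier series. The
  constant is twice that of \<open>weak_deriv_summable\<close>, because the L2 norms of f and of g
  are each at most the H1 norm.\<close>

lemma Sobolev:
  fixes f :: "real \<Rightarrow> 'a::euclidean_space"
  assumes "has_weak_deriv f g" "continuous_on UNIV f"
  shows "norm (f x) \<le> 8 * sqrt (2 * pi) * H1_norm f"
proof -
  note s = weak_deriv_summable[OF assms(1)]
  let ?t = "\<lambda>k. fterm (\<lambda>k. fcos k f) (\<lambda>k. fsin k f) k x"
  have sn: "summable (\<lambda>k. norm (?t k))"
    by (rule summable_comparison_test'[OF s(1)])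
      (use norm_fterm_le[of "\<lambda>k. fcos k f" "\<lambda>k. fsin k f"] in simp)
  have "norm (f x) = norm (suminf (\<lambda>k. ?t k))"
    using fourier_series_continuous[OF has_weak_derivD(1)[OF assms(1)] assms(2) s(1), of x] by simp
  also have "\<dots> \<le> (suminf (\<lambda>k. norm (?t k)))" by (rule summable_norm[OF sn])
  also have "\<dots> \<le> (suminf (\<lambda>k. norm (fcos k f) + norm (fsin k f)))"
    by (rule suminf_le[OF norm_fterm_le sn s(1)])
  also have "\<dots> \<le> 4 * sqrt (2 * pi) * (L2_norm f + L2_norm g)" by (rule s(2))
  also have "\<dots> \<le> 4 * sqrt (2 * pi) * (H1_norm f + H1_norm f)"
  proof -
    have "(L2_norm g)\<^sup>2 \<le> (H1_norm f)\<^sup>2" using H1_norm_eq[OF assms(1)] by simp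
    then have "L2_norm g \<le> H1_norm f" by (rule power2_le_imp_le) simp
    then show ?thesis by (intro mult_left_mono add_mono L2_norm_le_H1_norm) auto
  qed
  finally show ?thesis by simp
qed

lemma has_weak_deriv_add:
  assumes "has_weak_deriv f f'" "has_weak_deriv g g'"
  shows "has_weak_deriv (\<lambda>x. f x + g x) (\<lambda>x. f' x + g' x)"
  using assms by (simp add: has_weak_deriv_iff_coeffs fcos_add L2_circle_add scaleR_add_right)

lemma has_weak_deriv_diff:
  assumes "has_weak_deriv f f'" "has_weak_deriv g g'"
  shows "has_weak_deriv (\<lambda>x. f x - g x) (\<lambda>x. f' x - g' x)"
  using assms by (simp add: has_weak_deriv_iff_coeffs fcos_diff L2_circle_diff scaleR_diff_right)

lemma has_weak_deriv_const: "has_weak_deriv (\<lambda>x. c) (\<lambda>x. 0)"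
  by (rule has_weak_deriv_C1) (auto simp: periodic_2pi_def)

section \<open>The spectrum of the linearization\<close>

lemma bounded_linear_linear_part:
  fixes \<alpha> :: real
  shows "bounded_linear (\<lambda>v. linear_part \<alpha> \<delta>1 \<delta>2 \<beta> (v :: 'k::{real_normed_field,euclidean_space}^2) 0)"
    "bounded_linear (\<lambda>p. linear_part \<alpha> \<delta>1 \<delta>2 \<beta> (0 :: 'k^2) p)"
  unfolding linear_conv_bounded_linear[symmetric]
  by (rule linearI; simp add: linear_part_def vec_eq_iff forall_2 algebra_simps scaleR_conv_of_real[where 'a = 'k])+

lemma linear_part_split:
  "linear_part \<alpha> \<delta>1 \<delta>2 \<beta> v p = linear_part \<alpha> \<delta>1 \<delta>2 \<beta> v 0 + linear_part \<alpha> \<delta>1 \<delta>2 \<beta> 0 p"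
  by (simp add: linear_part_def vec_eq_iff forall_2)

lemma L2_brusselator_L:
  fixes u :: "real \<Rightarrow> 'k::{real_normed_field,euclidean_space}^2"
  assumes "H2_circle u"
  shows "L2_circle (brusselator_L \<alpha> \<delta>1 \<delta>2 \<beta> u)"
  unfolding brusselator_L_def linear_part_split[of _ _ _ _ "u _" "weak_deriv (weak_deriv u) _"]
  by (intro L2_circle_add L2_circle_linear[OF _ bounded_linear_linear_part(1)] L2_circle_linear[OF _ bounded_linear_linear_part(2)]
      has_weak_derivD(1)[OF H2_circleD(1)[OF assms]] has_weak_derivD(2)[OF H2_circleD(2)[OF assms]])

lemma coeffs_brusselator_L:
  fixes u :: "real \<Rightarrow> 'k::{real_normed_field,euclidean_space}^2"
  assumes "H2_circle u"
  shows "fcos k (brusselator_L \<alpha> \<delta>1 \<delta>2 \<beta> u) = linear_part \<alpha> \<delta>1 \<delta>2 \<beta> (fcos k u) (- (real k)\<^sup>2 *\<^sub>R fcos k u)"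
    "fsin k (brusselator_L \<alpha> \<delta>1 \<delta>2 \<beta> u) = linear_part \<alpha> \<delta>1 \<delta>2 \<beta> (fsin k u) (- (real k)\<^sup>2 *\<^sub>R fsin k u)"
proof -
  note L = has_weak_derivD(1)[OF H2_circleD(1)[OF assms]] has_weak_derivD(2)[OF H2_circleD(2)[OF assms]]
  note bl = bounded_linear_linear_part[of \<alpha> \<delta>1 \<delta>2 \<beta>]
  show "fcos k (brusselator_L \<alpha> \<delta>1 \<delta>2 \<beta> u) = linear_part \<alpha> \<delta>1 \<delta>2 \<beta> (fcos k u) (- (real k)\<^sup>2 *\<^sub>R fcos k u)"
    "fsin k (brusselator_L \<alpha> \<delta>1 \<delta>2 \<beta> u) = linear_part \<alpha> \<delta>1 \<delta>2 \<beta> (fsin k u) (- (real k)\<^sup>2 *\<^sub>R fsin k u)"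
    unfolding brusselator_L_def linear_part_split[of _ _ _ _ "u _" "weak_deriv (weak_deriv u) _"]
      linear_part_split[of _ _ _ _ "fcos k u" "- (real k)\<^sup>2 *\<^sub>R fcos k u"]
      linear_part_split[of _ _ _ _ "fsin k u" "- (real k)\<^sup>2 *\<^sub>R fsin k u"]
    by (simp_all add: fcos_add[OF L2_circle_linear[OF L(1) bl(1)] L2_circle_linear[OF L(2) bl(2)]]
        fcos_linear[OF L(1) bl(1)] fcos_linear[OF L(2) bl(2)] H2_coeffs[OF assms])
qed

text \<open>The matrix by which z - L acts on the coefficients of wave number k. It is the same for
  cosine and sine coefficients because L contains derivatives of even order only.\<close>

definition shifted_symbol :: "real \<Rightarrow> real \<Rightarrow> real \<Rightarrow> real \<Rightarrow> complex \<Rightarrow> nat \<Rightarrow> complex^2 \<Rightarrow> complex^2" where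
  "shifted_symbol \<alpha> \<delta>1 \<delta>2 \<beta> z k v = z *s v - linear_part \<alpha> \<delta>1 \<delta>2 \<beta> v (- (real k)\<^sup>2 *\<^sub>R v)"

lemma bounded_linear_smult: "bounded_linear (\<lambda>v :: complex^2. z *s v)"
  unfolding linear_conv_bounded_linear[symmetric]
  by (rule linearI; simp add: vec_eq_iff forall_2 algebra_simps scaleR_conv_of_real[where 'a = complex])

lemma shifted_op_L2:
  assumes "H2_circle u"
  shows "L2_circle (shifted_op (brusselator_L \<alpha> \<delta>1 \<delta>2 \<beta>) z u)"
    "fcos k (shifted_op (brusselator_L \<alpha> \<delta>1 \<delta>2 \<beta>) z u) = shifted_symbol \<alpha> \<delta>1 \<delta>2 \<beta> z k (fcos k u)"
    "fsin k (shifted_op (brusselator_L \<alpha> \<delta>1 \<delta>2 \<beta>) z u) = shifted_symbol \<alpha> \<delta>1 \<delta>2 \<beta> z k (fsin k u)"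
proof -
  note L = has_weak_derivD(1)[OF H2_circleD(1)[OF assms]]
  note Lz = L2_circle_linear[OF L bounded_linear_smult[of z]] L2_brusselator_L[OF assms, of \<alpha> \<delta>1 \<delta>2 \<beta>]
  show "L2_circle (shifted_op (brusselator_L \<alpha> \<delta>1 \<delta>2 \<beta>) z u)"
    unfolding shifted_op_def by (rule L2_circle_diff[OF Lz])
  show "fcos k (shifted_op (brusselator_L \<alpha> \<delta>1 \<delta>2 \<beta>) z u) = shifted_symbol \<alpha> \<delta>1 \<delta>2 \<beta> z k (fcos k u)"
    "fsin k (shifted_op (brusselator_L \<alpha> \<delta>1 \<delta>2 \<beta>) z u) = shifted_symbol \<alpha> \<delta>1 \<delta>2 \<beta> z k (fsin k u)"
    unfolding shifted_op_def fcos_diff[OF Lz] shifted_symbol_def coeffs_brusselator_L[OF assms]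
      fcos_linear[OF L bounded_linear_smult] by (rule refl)+
qed

lemma shifted_symbol_0 [simp]: "shifted_symbol \<alpha> \<delta>1 \<delta>2 \<beta> z k 0 = 0"
  by (simp add: shifted_symbol_def linear_part_def vec_eq_iff forall_2)

lemma summable_inverse_square_plus_one: "summable (\<lambda>k. 1 / (1 + (real k)\<^sup>2))"
proof (rule summable_comparison_test'[of "\<lambda>k. inverse ((real k)\<^sup>2)" 1])
  show "summable (\<lambda>k. inverse ((real k)\<^sup>2))" using inverse_power_summable[of 2, where 'a = real] by simp
  show "norm (1 / (1 + (real k)\<^sup>2)) \<le> inverse ((real k)\<^sup>2)" if "1 \<le> k" for k
    using that by (simp add: inverse_eq_divide abs_of_nonneg frac_le)
qed

text \<open>Inversion mode by mode. Decay of order 1 / (1 + k^2) makes the coefficients of the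
  candidate absolutely summable and leaves room for one further derivative; the resolvent bound
  follows by estimating the sup norm of the series.\<close>

lemma resolvent_setI:
  fixes R :: "nat \<Rightarrow> complex^2 \<Rightarrow> complex^2"
  assumes \<delta>: "\<delta>1 \<noteq> 0" "\<delta>2 \<noteq> 0"
    and R: "\<And>k w. shifted_symbol \<alpha> \<delta>1 \<delta>2 \<beta> z k (R k w) = w" "\<And>k v. R k (shifted_symbol \<alpha> \<delta>1 \<delta>2 \<beta> z k v) = v"
    and C: "\<And>k w. norm (R k w) \<le> C / (1 + (real k)\<^sup>2) * norm w"
  shows "z \<in> resolvent_set (brusselator_L \<alpha> \<delta>1 \<delta>2 \<beta>)"
  unfolding resolvent_set_def
proof (intro CollectI conjI allI impI)
  have C0: "0 \<le> C"
    using order_trans[OF norm_ge_zero C[of 0 "axis 1 1"]] by simp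
  define G where "G = C * (2 * sqrt (2 * pi))"
  have G0: "0 \<le> G" using C0 by (simp add: G_def)
  have Rsum: "summable (\<lambda>k. norm (R k (fcos k f)) + norm (R k (fsin k f)))"
    "(suminf (\<lambda>k. norm (R k (fcos k f)) + norm (R k (fsin k f)))) \<le> G * L2_norm f * (suminf (\<lambda>k. 1 / (1 + (real k)\<^sup>2)))"
    if f: "L2_circle f" for f
  proof -
    have *: "norm (R k (fcos k f)) + norm (R k (fsin k f)) \<le> G * L2_norm f * (1 / (1 + (real k)\<^sup>2))" for k
    proof -
      have "norm (R k (fcos k f)) + norm (R k (fsin k f)) \<le> C / (1 + (real k)\<^sup>2) * (norm (fcos k f) + norm (fsin k f))"
        using add_mono[OF C[of k "fcos k f"] C[of k "fsin k f"]] by (simp add: distrib_left)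
      also have "\<dots> \<le> C / (1 + (real k)\<^sup>2) * (2 * sqrt (2 * pi) * L2_norm f)"
        using norm_fcos_le[OF f, of k] C0 by (intro mult_left_mono) auto
      finally show ?thesis by (simp add: G_def)
    qed
    show s: "summable (\<lambda>k. norm (R k (fcos k f)) + norm (R k (fsin k f)))"
      by (rule summable_comparison_test'[OF summable_mult[OF summable_inverse_square_plus_one, of "G * L2_norm f"]]) (use * in simp)
    show "(suminf (\<lambda>k. norm (R k (fcos k f)) + norm (R k (fsin k f)))) \<le> G * L2_norm f * (suminf (\<lambda>k. 1 / (1 + (real k)\<^sup>2)))"
      using suminf_le[OF * s summable_mult[OF summable_inverse_square_plus_one]]
      by (simp only: suminf_mult[OF summable_inverse_square_plus_one])
  qed
  have R0: "R k 0 = 0" for k using C[of k 0] by simp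
  {
    fix f :: "real \<Rightarrow> complex^2" assume f: "L2_circle f"
    define a b where "a = (\<lambda>k. R k (fcos k f))" and "b = (\<lambda>k. R k (fsin k f))"
    \<comment> \<open>Coefficients of the first derivative of the candidate. They gain a factor k
      and remain summable by \<open>Bessel_sum_div\<close>.\<close>
    define a' b' where "a' = (\<lambda>k. real k *\<^sub>R b k)" and "b' = (\<lambda>k. - real k *\<^sub>R a k)"
    have b0: "b 0 = 0" "b' 0 = 0" by (simp_all add: b_def b'_def fsin_def R0)
    have s: "summable (\<lambda>k. norm (a k) + norm (b k))" using Rsum(1)[OF f] by (simp add: a_def b_def)
    have s': "summable (\<lambda>k. norm (a' k) + norm (b' k))"
    proof (rule summableI_nonneg_bounded)
      fix m
      have "(\<Sum>k<m. norm (a' k) + norm (b' k)) \<le> (\<Sum>k\<in>{0..m}. norm (a' k) + norm (b' k))"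
        by (rule sum_mono2) auto
      also have "\<dots> = (\<Sum>k\<in>{1..m}. norm (a' k) + norm (b' k))"
        by (simp add: sum.atLeast_Suc_atMost a'_def b'_def)
      also have "\<dots> \<le> (\<Sum>k\<in>{1..m}. C * ((norm (fcos k f) + norm (fsin k f)) / real k))"
      proof (rule sum_mono)
        fix k assume k: "k \<in> {1..m}"
        have "norm (a' k) + norm (b' k) = real k * (norm (R k (fcos k f)) + norm (R k (fsin k f)))"
          by (simp add: a'_def b'_def a_def b_def algebra_simps)
        also have "\<dots> \<le> real k * (C / (1 + (real k)\<^sup>2) * (norm (fcos k f) + norm (fsin k f)))"
          using add_mono[OF C[of k "fcos k f"] C[of k "fsin k f"]] by (intro mult_left_mono) (simp_all add: distrib_left)
        also have "\<dots> = C * (norm (fcos k f) + norm (fsin k f)) * (real k / (1 + (real k)\<^sup>2))" by simp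
        also have "\<dots> \<le> C * (norm (fcos k f) + norm (fsin k f)) * (1 / real k)"
        proof (rule mult_left_mono)
          show "real k / (1 + (real k)\<^sup>2) \<le> 1 / real k"
            using k frac_le[of "real k" "real k" "(real k)\<^sup>2" "1 + (real k)\<^sup>2"] by (simp add: power2_eq_square)
        qed (use C0 in simp)
        finally show "norm (a' k) + norm (b' k) \<le> C * ((norm (fcos k f) + norm (fsin k f)) / real k)" by simp
      qed
      also have "\<dots> \<le> C * (4 * sqrt (2 * pi) * L2_norm f)"
        unfolding sum_distrib_left[symmetric] using Bessel_sum_div[OF f] C0 by (intro mult_left_mono) auto
      finally show "(\<Sum>k<m. norm (a' k) + norm (b' k)) \<le> C * (4 * sqrt (2 * pi) * L2_norm f)" .
    qed simp
    define u g where "u = (\<lambda>x. suminf (\<lambda>k. fterm a b k x))" and "g = (\<lambda>x. suminf (\<lambda>k. fterm a' b' k x))"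
    define D :: "complex^2 \<Rightarrow> complex^2" where "D = (\<lambda>w. vector [w $ 1 / of_real \<delta>1, w $ 2 / of_real \<delta>2])"
    have D: "bounded_linear D" unfolding linear_conv_bounded_linear[symmetric] D_def
      by (rule linearI; simp add: vec_eq_iff forall_2 add_divide_distrib scaleR_conv_of_real[where 'a = complex])
    define T where "T = (\<lambda>v. z *s v - linear_part \<alpha> \<delta>1 \<delta>2 \<beta> v 0)"
    have T: "bounded_linear T" unfolding T_def
      by (intro bounded_linear_sub bounded_linear_smult bounded_linear_linear_part)
    \<comment> \<open>The second derivative is read off from the equation, since its own
      coefficients need not be summable: \<open>T\<close> is the zero-order part of z - L, and
      \<open>D\<close> inverts the diffusion matrix.\<close>
    define h where "h = (\<lambda>x. D (T (u x) - f x))"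
    have Lu: "L2_circle u" "L2_circle g" unfolding u_def g_def by (intro L2_fterm_suminf s s')+
    have LT: "L2_circle (\<lambda>x. T (u x))" by (rule L2_circle_linear[OF Lu(1) T])
    have Ld: "L2_circle (\<lambda>x. T (u x) - f x)" by (rule L2_circle_diff[OF LT f])
    have Lh: "L2_circle h" unfolding h_def by (rule L2_circle_linear[OF Ld D])
    have cu: "fcos k u = a k" "fsin k u = b k" "fcos k g = a' k" "fsin k g = b' k" for k
      unfolding u_def g_def using fcos_fterm_suminf[OF s b0(1)] fcos_fterm_suminf[OF s' b0(2)] by auto
    have DT: "D (T v - shifted_symbol \<alpha> \<delta>1 \<delta>2 \<beta> z k v) = - (real k)\<^sup>2 *\<^sub>R v" for k v
      using \<delta> by (simp add: D_def T_def shifted_symbol_def linear_part_def vec_eq_iff forall_2 scaleR_conv_of_real[where 'a = complex])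
    have ch: "fcos k h = - (real k)\<^sup>2 *\<^sub>R a k" "fsin k h = - (real k)\<^sup>2 *\<^sub>R b k" for k
      unfolding h_def fcos_linear[OF Ld D] fcos_diff[OF LT f] fcos_linear[OF Lu(1) T] cu
      using DT[of "a k" k] DT[of "b k" k] R(1) by (simp_all add: a_def b_def)
    have w: "has_weak_deriv u g" "has_weak_deriv g h"
      using Lu Lh cu ch by (simp_all add: has_weak_deriv_iff_coeffs a'_def b'_def power2_eq_square)
    have *: "shifted_op (brusselator_L \<alpha> \<delta>1 \<delta>2 \<beta>) z u x = f x" if "weak_deriv (weak_deriv u) x = h x" for x
    proof -
      have "shifted_op (brusselator_L \<alpha> \<delta>1 \<delta>2 \<beta>) z u x = T (u x) - linear_part \<alpha> \<delta>1 \<delta>2 \<beta> 0 (h x)"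
        unfolding shifted_op_def brusselator_L_def that T_def linear_part_split[of _ _ _ _ "u x" "h x"] by simp
      also have "linear_part \<alpha> \<delta>1 \<delta>2 \<beta> 0 (h x) = T (u x) - f x"
        using \<delta> by (simp add: h_def D_def linear_part_def vec_eq_iff forall_2)
      finally show ?thesis by simp
    qed
    have "AE x in lborel. shifted_op (brusselator_L \<alpha> \<delta>1 \<delta>2 \<beta>) z u x = f x"
      by (rule AE_mp[OF H2_circle_AE(2)[OF w] AE_I2]) (rule impI, rule *)
    with H2_circle_AE(1)[OF w]
    show "\<exists>u. H2_circle u \<and> (AE x in lborel. shifted_op (brusselator_L \<alpha> \<delta>1 \<delta>2 \<beta>) z u x = f x)" by blast
  }
  show "\<exists>C. \<forall>u. H2_circle u \<longrightarrow> L2_norm u \<le> C * L2_norm (shifted_op (brusselator_L \<alpha> \<delta>1 \<delta>2 \<beta>) z u)"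
  proof (intro exI allI impI)
    fix u :: "real \<Rightarrow> complex^2" assume u: "H2_circle u"
    define f where "f = shifted_op (brusselator_L \<alpha> \<delta>1 \<delta>2 \<beta>) z u"
    have f: "L2_circle f" unfolding f_def by (rule shifted_op_L2(1)[OF u])
    have c: "fcos k u = R k (fcos k f)" "fsin k u = R k (fsin k f)" for k
      unfolding f_def shifted_op_L2(2,3)[OF u] R(2) by (rule refl)+
    note Lu = has_weak_derivD(1)[OF H2_circleD(1)[OF u]]
    have s: "summable (\<lambda>k. norm (fcos k u) + norm (fsin k u))" unfolding c by (rule Rsum(1)[OF f])
    define S where "S = (\<lambda>x. suminf (\<lambda>k. fterm (\<lambda>k. fcos k u) (\<lambda>k. fsin k u) k x))"
    have LS: "L2_circle S" unfolding S_def by (rule L2_fterm_suminf[OF s])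
    have "L2_norm u = L2_norm S"
      by (rule L2_norm_AE_cong[OF Lu LS])
        (use AE_lborel_circ[OF fourier_series_AE[OF Lu s]] in \<open>simp add: S_def\<close>)
    also have "\<dots> \<le> sqrt (2 * pi) * (G * L2_norm f * (suminf (\<lambda>k. 1 / (1 + (real k)\<^sup>2))))"
    proof (rule L2_norm_le_sup[OF LS])
      fix x
      have sn: "summable (\<lambda>k. norm (fterm (\<lambda>k. fcos k u) (\<lambda>k. fsin k u) k x))"
        by (rule summable_comparison_test'[OF s])
          (use norm_fterm_le[of "\<lambda>k. fcos k u" "\<lambda>k. fsin k u"] in simp)
      have "norm (S x) \<le> (suminf (\<lambda>k. norm (fterm (\<lambda>k. fcos k u) (\<lambda>k. fsin k u) k x)))"
        unfolding S_def by (rule summable_norm[OF sn])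
      also have "\<dots> \<le> (suminf (\<lambda>k. norm (fcos k u) + norm (fsin k u)))"
        by (rule suminf_le[OF norm_fterm_le sn s])
      also have "\<dots> \<le> G * L2_norm f * (suminf (\<lambda>k. 1 / (1 + (real k)\<^sup>2)))"
        unfolding c by (rule Rsum(2)[OF f])
      finally show "norm (S x) \<le> G * L2_norm f * (suminf (\<lambda>k. 1 / (1 + (real k)\<^sup>2)))" .
    qed
    finally show "L2_norm u \<le> (sqrt (2 * pi) * G * (suminf (\<lambda>k. 1 / (1 + (real k)\<^sup>2)))) * L2_norm (shifted_op (brusselator_L \<alpha> \<delta>1 \<delta>2 \<beta>) z u)"
      by (simp add: f_def mult_ac)
  qed
qed

section \<open>Trigonometric eigenfunctions\<close>

lemma has_weak_deriv_trig:
  fixes P Q :: "'a::euclidean_space"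
  shows "has_weak_deriv (\<lambda>x. cos (real k * x) *\<^sub>R P + sin (real k * x) *\<^sub>R Q)
    (\<lambda>x. cos (real k * x) *\<^sub>R (real k *\<^sub>R Q) + sin (real k * x) *\<^sub>R (- real k *\<^sub>R P))"
proof (rule has_weak_deriv_C1)
  show "periodic_2pi (\<lambda>x. cos (real k * x) *\<^sub>R P + sin (real k * x) *\<^sub>R Q)"
    using periodic_cos_sin[of k] by (simp add: periodic_2pi_def)
  show "((\<lambda>x. cos (real k * x) *\<^sub>R P + sin (real k * x) *\<^sub>R Q) has_vector_derivative
      cos (real k * x) *\<^sub>R real k *\<^sub>R Q + sin (real k * x) *\<^sub>R (- real k *\<^sub>R P)) (at x)" for x
    by (auto intro!: derivative_eq_intros simp: has_vector_derivative_def fun_eq_iff algebra_simps)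
qed (intro continuous_intros)

lemma shifted_op_trig:
  fixes P Q :: "complex^2" and k :: nat
  defines "u \<equiv> \<lambda>x. cos (real k * x) *\<^sub>R P + sin (real k * x) *\<^sub>R Q"
  shows "H2_circle u"
    "AE x in lborel. shifted_op (brusselator_L \<alpha> \<delta>1 \<delta>2 \<beta>) z u x =
       cos (real k * x) *\<^sub>R shifted_symbol \<alpha> \<delta>1 \<delta>2 \<beta> z k P + sin (real k * x) *\<^sub>R shifted_symbol \<alpha> \<delta>1 \<delta>2 \<beta> z k Q"
proof -
  note H = H2_circle_AE[OF has_weak_deriv_trig[of k P Q] has_weak_deriv_trig, folded u_def]
  show "H2_circle u" by (rule H(1))
  show "AE x in lborel. shifted_op (brusselator_L \<alpha> \<delta>1 \<delta>2 \<beta>) z u x =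
       cos (real k * x) *\<^sub>R shifted_symbol \<alpha> \<delta>1 \<delta>2 \<beta> z k P + sin (real k * x) *\<^sub>R shifted_symbol \<alpha> \<delta>1 \<delta>2 \<beta> z k Q"
  proof (rule AE_mp[OF H(2)], intro AE_I2 impI)
    fix x assume w: "weak_deriv (weak_deriv u) x = cos (real k * x) *\<^sub>R (real k *\<^sub>R (- real k *\<^sub>R P)) + sin (real k * x) *\<^sub>R (- real k *\<^sub>R (real k *\<^sub>R Q))"
    show "shifted_op (brusselator_L \<alpha> \<delta>1 \<delta>2 \<beta>) z u x =
       cos (real k * x) *\<^sub>R shifted_symbol \<alpha> \<delta>1 \<delta>2 \<beta> z k P + sin (real k * x) *\<^sub>R shifted_symbol \<alpha> \<delta>1 \<delta>2 \<beta> z k Q"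
      unfolding shifted_op_def brusselator_L_def w
      by (simp add: u_def shifted_symbol_def linear_part_def vec_eq_iff forall_2
        scaleR_conv_of_real[where 'a = complex] algebra_simps power2_eq_square)
  qed
qed

text \<open>Translates complex exponentials into the real modes in which coefficients are taken; k
  and -k share the cosine vector and differ in the sign of the sine vector.\<close>

lemma fourier_mode_trig:
  "fourier_mode k V = (\<lambda>x. cos (real (nat \<bar>k\<bar>) * x) *\<^sub>R V + sin (real (nat \<bar>k\<bar>) * x) *\<^sub>R ((\<i> * of_int (sgn k)) *s V))"
proof
  fix x
  have e: "exp (\<i> * of_int k * of_real x) = cis (of_int k * x)" by (simp add: cis_conv_exp mult.assoc)
  have "cis (of_int k * x) = of_real (cos (real (nat \<bar>k\<bar>) * x)) + of_real (sin (real (nat \<bar>k\<bar>) * x)) * (\<i> * of_int (sgn k))"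
    by (cases k "0::int" rule: linorder_cases) (simp_all add: complex_eq_iff)
  then show "fourier_mode k V x = cos (real (nat \<bar>k\<bar>) * x) *\<^sub>R V + sin (real (nat \<bar>k\<bar>) * x) *\<^sub>R ((\<i> * of_int (sgn k)) *s V)"
    unfolding fourier_mode_def e by (simp add: vec_eq_iff scaleR_conv_of_real[where 'a = complex] algebra_simps)
qed

lemma eigenspace_iff:
  "u \<in> eigenspace A z \<longleftrightarrow> H2_circle u \<and> L2_circle (shifted_op A z u) \<and> (AE x in lborel. shifted_op A z u x = 0)"
  by (simp add: eigenspace_def)

lemma shifted_symbol_linear: "bounded_linear (shifted_symbol \<alpha> \<delta>1 \<delta>2 \<beta> z k)"
  unfolding linear_conv_bounded_linear[symmetric] shifted_symbol_def
  by (rule linearI; simp add: linear_part_def vec_eq_iff forall_2 algebra_simps scaleR_conv_of_real[where 'a = complex])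

lemma trig_in_eigenspace:
  assumes "shifted_symbol \<alpha> \<delta>1 \<delta>2 \<beta> z k P = 0" "shifted_symbol \<alpha> \<delta>1 \<delta>2 \<beta> z k Q = 0"
  shows "(\<lambda>x. cos (real k * x) *\<^sub>R P + sin (real k * x) *\<^sub>R Q) \<in> eigenspace (brusselator_L \<alpha> \<delta>1 \<delta>2 \<beta>) z"
  using shifted_op_trig(1)[where k = k and P = P and Q = Q]
    shifted_op_trig(2)[where k = k and P = P and Q = Q and z = z and \<alpha> = \<alpha> and \<beta> = \<beta> and ?\<delta>1.0 = \<delta>1 and ?\<delta>2.0 = \<delta>2]
    shifted_op_L2(1)[OF shifted_op_trig(1)] assms
  by (simp add: eigenspace_iff)

lemma shifted_symbol_smult:
  "shifted_symbol \<alpha> \<delta>1 \<delta>2 \<beta> z k (c *s V) = c *s shifted_symbol \<alpha> \<delta>1 \<delta>2 \<beta> z k V"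
  by (simp add: shifted_symbol_def linear_part_def vec_eq_iff forall_2 algebra_simps scaleR_conv_of_real[where 'a = complex])

lemma fourier_mode_in_eigenspace:
  assumes "shifted_symbol \<alpha> \<delta>1 \<delta>2 \<beta> z (nat \<bar>k\<bar>) V = 0"
  shows "fourier_mode k V \<in> eigenspace (brusselator_L \<alpha> \<delta>1 \<delta>2 \<beta>) z"
  unfolding fourier_mode_trig using assms by (intro trig_in_eigenspace) (simp_all add: shifted_symbol_smult)

lemma eigenspace_coeffs:
  assumes "u \<in> eigenspace (brusselator_L \<alpha> \<delta>1 \<delta>2 \<beta>) z"
  shows "shifted_symbol \<alpha> \<delta>1 \<delta>2 \<beta> z k (fcos k u) = 0" "shifted_symbol \<alpha> \<delta>1 \<delta>2 \<beta> z k (fsin k u) = 0"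
proof -
  from assms have u: "H2_circle u" "L2_circle (shifted_op (brusselator_L \<alpha> \<delta>1 \<delta>2 \<beta>) z u)"
    "AE x in lborel. shifted_op (brusselator_L \<alpha> \<delta>1 \<delta>2 \<beta>) z u x = (\<lambda>x. 0) x" by (auto simp: eigenspace_iff)
  show "shifted_symbol \<alpha> \<delta>1 \<delta>2 \<beta> z k (fcos k u) = 0" "shifted_symbol \<alpha> \<delta>1 \<delta>2 \<beta> z k (fsin k u) = 0"
    using fcos_cong_AE[OF u(2) L2_circle_zero u(3), of k] shifted_op_L2(2,3)[OF u(1)]
    by (simp_all add: fcos_def[of k "\<lambda>x. 0"] fsin_def[of k "\<lambda>x. 0"])
qed

lemma bounded_of_eventually_bounded:
  fixes f :: "nat \<Rightarrow> real"
  assumes "\<And>k. k \<ge> K \<Longrightarrow> f k \<le> C"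
  shows "\<exists>C'. \<forall>k. f k \<le> C'"
proof (intro exI allI)
  fix k
  show "f k \<le> max C (Max (f ` {..K}))"
  proof (cases "k \<ge> K")
    case True
    then show ?thesis using assms by (simp add: le_max_iff_disj)
  next
    case False
    then have "f k \<le> Max (f ` {..K})" by (intro Max_ge) auto
    then show ?thesis by simp
  qed
qed

text \<open>
  The parameters \<open>\<alpha> = 1\<close>, \<open>\<delta>\<^sub>1 = 2 / n\<^sup>2\<close>, \<open>\<delta>\<^sub>2 = 1 / n\<^sup>2\<close> give \<open>\<beta>(n) = 5\<close>, and the symbol at wave number \<open>k\<close>
  depends on \<open>k\<^sup>2 / n\<^sup>2\<close> only, which reduces every \<open>n\<close> to \<open>n = 1\<close>.
\<close>

context
  fixes n :: int and \<delta>1 \<delta>2 :: real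
  assumes n: "n \<noteq> 0" and \<delta>1: "\<delta>1 = 2 / (of_int n)\<^sup>2" and \<delta>2: "\<delta>2 = 1 / (of_int n)\<^sup>2"
begin

lemma beta_crit_5: "beta_crit 1 \<delta>1 \<delta>2 n = 5"
  using n by (simp add: beta_crit_def \<delta>1 \<delta>2 field_simps)

definition kap :: "nat \<Rightarrow> real" where "kap k = (real k)\<^sup>2 / (of_int n)\<^sup>2"

lemma kap_nonneg: "0 \<le> kap k"
  by (simp add: kap_def)

lemma kap_eq_1_iff: "kap k = 1 \<longleftrightarrow> k = nat \<bar>n\<bar>"
proof -
  have "kap k = 1 \<longleftrightarrow> (real k)\<^sup>2 = (real_of_int \<bar>n\<bar>)\<^sup>2" using n by (auto simp: kap_def)
  also have "\<dots> \<longleftrightarrow> real k = real_of_int \<bar>n\<bar>"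
    by (subst power2_eq_iff_nonneg) auto
  also have "\<dots> \<longleftrightarrow> k = nat \<bar>n\<bar>" by linarith
  finally show ?thesis .
qed

lemma symbol_eq: "shifted_symbol 1 \<delta>1 \<delta>2 5 z k v =
    vector [(z - 4 + 2 * of_real (kap k)) * v$1 - v$2, 5 * v$1 + (z + 1 + of_real (kap k)) * v$2]"
  by (simp add: shifted_symbol_def linear_part_def vec_eq_iff forall_2 \<delta>1 \<delta>2 kap_def scaleR_conv_of_real[where 'a = complex] algebra_simps)

text \<open>Determinant of the matrix in \<open>symbol_eq\<close>. For z on the imaginary axis its
  imaginary part vanishes only if z = 0 or kap = 1, and at z = 0 its real part is kap^2 + (1 -
  kap)^2 > 0. Hence the chosen diffusion constants admit no imaginary spectrum away from the
  critical wave number.\<close>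

definition sdet :: "complex \<Rightarrow> nat \<Rightarrow> complex" where
  "sdet z k = (z - 4 + 2 * of_real (kap k)) * (z + 1 + of_real (kap k)) + 5"

lemma sdet_imag:
  assumes "Re z = 0"
  shows "Re (sdet z k) = 1 - (Im z)\<^sup>2 - 2 * kap k + 2 * (kap k)\<^sup>2" "Im (sdet z k) = 3 * Im z * (kap k - 1)"
  using assms by (simp_all add: sdet_def power2_eq_square algebra_simps)

lemma sdet_nonzero:
  assumes "Re z = 0" "kap k = 1 \<Longrightarrow> z \<noteq> \<i> \<and> z \<noteq> - \<i>"
  shows "sdet z k \<noteq> 0"
proof
  assume "sdet z k = 0"
  then have 0: "1 - (Im z)\<^sup>2 - 2 * kap k + 2 * (kap k)\<^sup>2 = 0" "3 * Im z * (kap k - 1) = 0"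
    using sdet_imag[OF assms(1), of k] by simp_all
  show False
  proof (cases "kap k = 1")
    case True
    with 0 have "(Im z)\<^sup>2 = 1" by simp
    then have "Im z = 1 \<or> Im z = - 1" by (simp add: power2_eq_1_iff)
    then have "z = \<i> \<or> z = - \<i>" using assms(1) by (auto simp: complex_eq_iff)
    with assms(2)[OF True] show False by blast
  next
    case False
    then have "1 - 2 * kap k + 2 * (kap k)\<^sup>2 = 0" using 0 by auto
    moreover have "1 - 2 * kap k + 2 * (kap k)\<^sup>2 = (kap k)\<^sup>2 + (1 - kap k)\<^sup>2" by (simp add: power2_eq_square algebra_simps)
    ultimately have "(kap k)\<^sup>2 + (1 - kap k)\<^sup>2 = 0" by linarith
    then show False by (simp only: sum_power2_eq_zero_iff) auto
  qed
qed

lemma resolvent_imag: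
  assumes z: "Re z = 0" "z \<noteq> \<i>" "z \<noteq> - \<i>"
  shows "z \<in> resolvent_set (brusselator_L 1 \<delta>1 \<delta>2 5)"
proof -
  define R :: "nat \<Rightarrow> complex^2 \<Rightarrow> complex^2" where
    "R = (\<lambda>k w. vector [((z + 1 + of_real (kap k)) * w$1 + w$2) / sdet z k, ((z - 4 + 2 * of_real (kap k)) * w$2 - 5 * w$1) / sdet z k])"
  define f where "f = (\<lambda>k. (1 + (real k)\<^sup>2) * ((2 * norm z + 11 + 3 * kap k) / norm (sdet z k)))"
  have d: "sdet z k \<noteq> 0" for k using z by (intro sdet_nonzero) auto
  have "\<exists>C. \<forall>k. f k \<le> C"
  proof (rule bounded_of_eventually_bounded)
    \<comment> \<open>This threshold forces kap >= 2 + y^2. Then kap^2 - 2 kap absorbs y^2 in the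
      real part of the determinant, and kap^2 remains as a lower bound for the modulus, against a
      numerator of first order in kap.\<close>
    fix k assume k: "nat \<lceil>\<bar>of_int n\<bar> * (2 + (Im z)\<^sup>2)\<rceil> \<le> k"
    define y where "y = Im z"
    have "\<bar>of_int n\<bar> * (2 + y\<^sup>2) \<le> real k" using k unfolding y_def by linarith
    then have "(\<bar>of_int n\<bar> * (2 + y\<^sup>2))\<^sup>2 \<le> (real k)\<^sup>2" by (intro power_mono) auto
    then have "(2 + y\<^sup>2)\<^sup>2 * (of_int n)\<^sup>2 \<le> (real k)\<^sup>2" by (simp only: power_mult_distrib power2_abs mult.commute)
    then have "(2 + y\<^sup>2)\<^sup>2 \<le> kap k" using n by (simp add: kap_def pos_le_divide_eq)
    moreover have "1 * (2 + y\<^sup>2) \<le> (2 + y\<^sup>2) * (2 + y\<^sup>2)" by (rule mult_right_mono) auto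
    ultimately have kk: "2 + y\<^sup>2 \<le> kap k" by (simp add: power2_eq_square)
    then have k1: "1 \<le> kap k" by (smt (verit) zero_le_power2)
    have "1 * y\<^sup>2 \<le> kap k * (kap k - 2)" using kk k1 by (intro mult_mono) auto
    then have "(kap k)\<^sup>2 \<le> Re (sdet z k)" unfolding sdet_imag[OF z(1)] y_def[symmetric] by (simp add: power2_eq_square algebra_simps)
    also have "\<dots> \<le> norm (sdet z k)" by (rule complex_Re_le_cmod)
    finally have 1: "(kap k)\<^sup>2 \<le> norm (sdet z k)" .
    have 2: "1 + (real k)\<^sup>2 \<le> (1 + (of_int n)\<^sup>2) * kap k" using k1 n by (simp add: kap_def field_simps)
    have "2 * norm z * 1 \<le> 2 * norm z * kap k" using k1 by (intro mult_left_mono) auto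
    then have 3: "2 * norm z + 11 + 3 * kap k \<le> (2 * norm z + 14) * kap k" using k1 by (simp add: algebra_simps)
    have kp: "0 < kap k" using k1 by simp
    have "f k \<le> ((1 + (of_int n)\<^sup>2) * kap k) * (((2 * norm z + 14) * kap k) / (kap k)\<^sup>2)"
      unfolding f_def using 1 2 3 kp
      by (intro mult_mono frac_le) (auto intro!: divide_nonneg_nonneg add_nonneg_nonneg mult_nonneg_nonneg)
    also have "\<dots> = (1 + (of_int n)\<^sup>2) * (2 * norm z + 14)" using kp by (simp add: power2_eq_square)
    finally show "f k \<le> (1 + (of_int n)\<^sup>2) * (2 * norm z + 14)" .
  qed
  then obtain C where C: "\<And>k. f k \<le> C" by blast
  show ?thesis
  proof (rule resolvent_setI[where R = R and C = C])
    show "\<delta>1 \<noteq> 0" "\<delta>2 \<noteq> 0" using n by (simp_all add: \<delta>1 \<delta>2)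
    show "shifted_symbol 1 \<delta>1 \<delta>2 5 z k (R k w) = w" for k w
    proof -
      have "(z - 4 + 2 * of_real (kap k)) * ((z + 1 + of_real (kap k)) * w$1 + w$2) - ((z - 4 + 2 * of_real (kap k)) * w$2 - 5 * w$1) = sdet z k * w$1"
        "5 * ((z + 1 + of_real (kap k)) * w$1 + w$2) + (z + 1 + of_real (kap k)) * ((z - 4 + 2 * of_real (kap k)) * w$2 - 5 * w$1) = sdet z k * w$2"
        by (simp_all add: sdet_def algebra_simps)
      then show ?thesis using d[of k]
        by (simp add: symbol_eq R_def vec_eq_iff forall_2 diff_divide_distrib[symmetric] add_divide_distrib[symmetric])
    qed
    show "R k (shifted_symbol 1 \<delta>1 \<delta>2 5 z k v) = v" for k v
    proof -
      have "(z + 1 + of_real (kap k)) * ((z - 4 + 2 * of_real (kap k)) * v$1 - v$2) + (5 * v$1 + (z + 1 + of_real (kap k)) * v$2) = sdet z k * v$1"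
        "(z - 4 + 2 * of_real (kap k)) * (5 * v$1 + (z + 1 + of_real (kap k)) * v$2) - 5 * ((z - 4 + 2 * of_real (kap k)) * v$1 - v$2) = sdet z k * v$2"
        by (simp_all add: sdet_def algebra_simps)
      then show ?thesis using d[of k] by (simp add: symbol_eq R_def vec_eq_iff forall_2)
    qed
    show "norm (R k w) \<le> C / (1 + (real k)\<^sup>2) * norm w" for k w
    proof -
      have w: "norm (w$1) \<le> norm w" "norm (w$2) \<le> norm w" by (simp_all add: Finite_Cartesian_Product.norm_nth_le)
      have kk: "norm (of_real (kap k) :: complex) = kap k" using kap_nonneg[of k] by simp
      have n1: "norm ((z + 1 + of_real (kap k)) * w$1 + w$2) \<le> (norm z + 2 + kap k) * norm w"
      proof -
        have "norm ((z + 1 + of_real (kap k)) * w$1 + w$2) \<le> norm (z + 1 + of_real (kap k)) * norm (w$1) + norm (w$2)"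
          by (metis norm_mult norm_triangle_ineq)
        also have "\<dots> \<le> (norm z + 1 + kap k) * norm w + norm w"
          using w norm_triangle_ineq[of "z + 1" "of_real (kap k)"] norm_triangle_ineq[of z 1]
          by (intro add_mono mult_mono) (auto simp: kap_nonneg)
        finally show ?thesis by (simp add: algebra_simps)
      qed
      have n2: "norm ((z - 4 + 2 * of_real (kap k)) * w$2 - 5 * w$1) \<le> (norm z + 9 + 2 * kap k) * norm w"
      proof -
        have "norm ((z - 4 + 2 * of_real (kap k)) * w$2 - 5 * w$1) \<le> norm (z - 4 + 2 * of_real (kap k)) * norm (w$2) + norm (5 * w$1)"
          by (metis norm_mult norm_triangle_ineq4)
        also have "\<dots> \<le> (norm z + 4 + 2 * kap k) * norm w + 5 * norm w"
          using w norm_triangle_ineq[of "z - 4" "2 * of_real (kap k)"] norm_triangle_ineq4[of z 4] kap_nonneg[of k]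
          by (intro add_mono mult_mono) (auto simp: norm_mult)
        finally show ?thesis by (simp add: algebra_simps)
      qed
      have "norm (R k w) \<le> norm (R k w $ 1) + norm (R k w $ 2)"
        by (simp add: norm_vec_def L2_set_def sum_2 sqrt_sum_squares_le_sum)
      also have "\<dots> \<le> (norm z + 2 + kap k) * norm w / norm (sdet z k) + (norm z + 9 + 2 * kap k) * norm w / norm (sdet z k)"
        using n1 n2 by (intro add_mono) (simp_all add: R_def norm_divide divide_right_mono)
      also have "\<dots> = (f k / (1 + (real k)\<^sup>2)) * norm w"
      proof -
        have "1 + (real k)\<^sup>2 \<noteq> 0" by (smt (verit) zero_le_power2)
        then have "f k / (1 + (real k)\<^sup>2) = (2 * norm z + 11 + 3 * kap k) / norm (sdet z k)" by (simp add: f_def)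
        then show ?thesis by (simp add: add_divide_distrib[symmetric] algebra_simps)
      qed
      also have "\<dots> \<le> C / (1 + (real k)\<^sup>2) * norm w" by (intro mult_right_mono divide_right_mono C) auto
      finally show ?thesis .
    qed
  qed
qed

definition crit_vec :: "complex \<Rightarrow> complex^2" where "crit_vec z = vector [1, z - 2]"

lemma symbol_crit_vec:
  assumes "z\<^sup>2 = -1"
  shows "shifted_symbol 1 \<delta>1 \<delta>2 5 z (nat \<bar>n\<bar>) (c *s crit_vec z) = 0"
proof -
  have "5 + (2 + z) * (z - 2) = 0" using assms by (simp add: power2_eq_square algebra_simps)
  moreover have "kap (nat \<bar>n\<bar>) = 1" by (simp add: kap_eq_1_iff)
  ultimately show ?thesis unfolding shifted_symbol_smult
    by (simp add: symbol_eq crit_vec_def vec_eq_iff forall_2)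
qed

text \<open>Induction on the power of z - A. Off the critical wave number the symbol is injective,
  and at the critical one no Jordan chain starts, so the kernels of all powers have coefficients of
  the shape found in the eigenspace.\<close>

lemma power_kernel_coeffs:
  assumes z: "z\<^sup>2 = -1" and "u \<in> power_kernel (brusselator_L 1 \<delta>1 \<delta>2 5) z j"
  shows "L2_circle u \<and> (\<forall>k. k \<noteq> nat \<bar>n\<bar> \<longrightarrow> fcos k u = 0 \<and> fsin k u = 0) \<and>
    fcos (nat \<bar>n\<bar>) u $ 2 = (z - 2) * fcos (nat \<bar>n\<bar>) u $ 1 \<and> fsin (nat \<bar>n\<bar>) u $ 2 = (z - 2) * fsin (nat \<bar>n\<bar>) u $ 1"
  using assms(2)
proof (induction j arbitrary: u)
  case 0
  then have "L2_circle u" "AE x in lborel. u x = (\<lambda>x. 0) x" by auto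
  from this(1) fcos_cong_AE[OF this(1) L2_circle_zero this(2)]
  show ?case by (simp add: fcos_def[of _ "\<lambda>x. 0"] fsin_def[of _ "\<lambda>x. 0"])
next
  case (Suc j)
  let ?A = "brusselator_L 1 \<delta>1 \<delta>2 5" and ?N = "nat \<bar>n\<bar>"
  from Suc.prems have u: "H2_circle u" "shifted_op ?A z u \<in> power_kernel ?A z j" by auto
  note IH = Suc.IH[OF u(2)]
  have zz: "Re z = 0" 
  proof -
    have "z = \<i> \<or> z = - \<i>" using z by (metis i_squared power2_eq_iff power2_eq_square)
    then show ?thesis by auto
  qed
  have *: "v = 0" if "shifted_symbol 1 \<delta>1 \<delta>2 5 z k v = 0" "k \<noteq> ?N" for k v
  proof -
    have d: "sdet z k \<noteq> 0" using that(2) zz by (intro sdet_nonzero) (auto simp: kap_eq_1_iff)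
    have e: "(z - 4 + 2 * of_real (kap k)) * v$1 - v$2 = 0" "5 * v$1 + (z + 1 + of_real (kap k)) * v$2 = 0"
      using that(1) by (simp_all add: symbol_eq vec_eq_iff forall_2)
    have "sdet z k * v$1 = (z + 1 + of_real (kap k)) * ((z - 4 + 2 * of_real (kap k)) * v$1 - v$2) + (5 * v$1 + (z + 1 + of_real (kap k)) * v$2)"
      "sdet z k * v$2 = (z - 4 + 2 * of_real (kap k)) * (5 * v$1 + (z + 1 + of_real (kap k)) * v$2) - 5 * ((z - 4 + 2 * of_real (kap k)) * v$1 - v$2)"
      by (simp_all add: sdet_def algebra_simps)
    with e d show ?thesis by (simp add: vec_eq_iff forall_2)
  qed
  \<comment> \<open>Absence of a Jordan block: a vector mapped into the span of
    \<open>crit_vec z\<close> already lies there. Multiplying the resulting relation by z and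
    replacing z^2 by -1 isolates \<open>v $ 2\<close>.\<close>
  have **: "v $ 2 = (z - 2) * v $ 1"
    if "shifted_symbol 1 \<delta>1 \<delta>2 5 z ?N v $ 2 = (z - 2) * shifted_symbol 1 \<delta>1 \<delta>2 5 z ?N v $ 1" for v
  proof -
    have "kap ?N = 1" by (simp add: kap_eq_1_iff)
    then have "5 * v$1 + (z + 2) * v$2 = (z - 2) * ((z - 2) * v$1 - v$2)" using that by (simp add: symbol_eq add.commute)
    then have "(5 - (z - 2)\<^sup>2) * v$1 + 2 * z * v$2 = 0" by (simp add: power2_eq_square algebra_simps)
    moreover have "5 - (z - 2)\<^sup>2 = 2 + 4 * z" using z by (simp add: power2_eq_square algebra_simps)
    ultimately have "z * ((2 + 4 * z) * v$1 + 2 * z * v$2) = 0" by simp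
    moreover have "z * ((2 + 4 * z) * v$1 + 2 * z * v$2) = (2 * z + 4 * z\<^sup>2) * v$1 + 2 * z\<^sup>2 * v$2"
      by (simp add: power2_eq_square algebra_simps)
    ultimately have "(2 * z - 4) * v$1 - 2 * v$2 = 0" using z by simp
    then have "2 * v$2 = 2 * ((z - 2) * v$1)" by (simp add: algebra_simps)
    then show ?thesis by simp
  qed
  show ?case
    using IH has_weak_derivD(1)[OF H2_circleD(1)[OF u(1)]] by (auto simp: shifted_op_L2(2,3)[OF u(1)] intro: * **)
qed

text \<open>Formulated for any S between the eigenspace and the generalized eigenspace, so that
  geometric and algebraic multiplicity are obtained by one argument.\<close>

lemma has_dim_ae_crit:
  assumes z: "z\<^sup>2 = -1" and S: "eigenspace (brusselator_L 1 \<delta>1 \<delta>2 5) z \<subseteq> S"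
    "S \<subseteq> generalized_eigenspace (brusselator_L 1 \<delta>1 \<delta>2 5) z"
  shows "has_dim_ae S 2"
proof -
  let ?N = "nat \<bar>n\<bar>" and ?V = "crit_vec z"
  define b :: "nat \<Rightarrow> real \<Rightarrow> complex^2" where
    "b = (\<lambda>i x. if i = 0 then cos (real ?N * x) *\<^sub>R ?V else sin (real ?N * x) *\<^sub>R ?V)"
  have V0: "shifted_symbol 1 \<delta>1 \<delta>2 5 z ?N ?V = 0" using symbol_crit_vec[OF z, of 1] by simp
  have sum2: "(\<Sum>i<2. c i *s b i x) = c 0 *s (cos (real ?N * x) *\<^sub>R ?V) + c 1 *s (sin (real ?N * x) *\<^sub>R ?V)" for c x
    by (simp add: b_def numeral_2_eq_2)
  have b: "b i \<in> S" for i
    using subsetD[OF S(1) trig_in_eigenspace[OF V0 shifted_symbol_0]] subsetD[OF S(1) trig_in_eigenspace[OF shifted_symbol_0 V0]]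
    by (cases "i = 0") (simp_all add: b_def)
  have indep: "c i = 0" if ae: "AE x in lborel. (\<Sum>i<2. c i *s b i x) = 0" and i: "i < (2::nat)" for c i
  proof -
    have z0: "c 0 *s (cos (real ?N * x) *\<^sub>R ?V) + c 1 *s (sin (real ?N * x) *\<^sub>R ?V) = 0" for x
    proof (rule continuous_AE_zero[where f = "\<lambda>x. c 0 *s (cos (real ?N * x) *\<^sub>R ?V) + c 1 *s (sin (real ?N * x) *\<^sub>R ?V)"])
      have "(\<lambda>x. c 0 *s (cos (real ?N * x) *\<^sub>R ?V) + c 1 *s (sin (real ?N * x) *\<^sub>R ?V)) =
          (\<lambda>x. cos (real ?N * x) *\<^sub>R (c 0 *s ?V) + sin (real ?N * x) *\<^sub>R (c 1 *s ?V))"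
        by (simp add: fun_eq_iff vec_eq_iff forall_2 scaleR_conv_of_real[where 'a = complex])
      then show "continuous_on UNIV (\<lambda>x. c 0 *s (cos (real ?N * x) *\<^sub>R ?V) + c 1 *s (sin (real ?N * x) *\<^sub>R ?V))"
        by (simp only:) (intro continuous_intros)
      show "AE x in lborel. c 0 *s (cos (real ?N * x) *\<^sub>R ?V) + c 1 *s (sin (real ?N * x) *\<^sub>R ?V) = 0"
        using ae unfolding sum2 .
    qed
    \<comment> \<open>Evaluation at a quarter of the wavelength and at 0 separates the sine
      coefficient from the cosine coefficient.\<close>
    have "real ?N * (pi / (2 * real ?N)) = pi / 2" using n by simp
    then have "c 1 *s ?V = 0" using z0[of "pi / (2 * real ?N)"] by (simp only:) simp
    then have "c 0 = 0" "c 1 = 0" using z0[of 0]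
      by (auto simp: crit_vec_def vec_eq_iff forall_2 scaleR_conv_of_real[where 'a = complex])
    then show "c i = 0" using i by (auto simp: less_2_cases_iff)
  qed
  have span: "\<exists>c. AE x in lborel. u x = (\<Sum>i<2. c i *s b i x)" if "u \<in> S" for u
  proof -
  from that obtain j where "u \<in> power_kernel (brusselator_L 1 \<delta>1 \<delta>2 5) z j"
    using S(2) by (auto simp: generalized_eigenspace_def)
  note u = power_kernel_coeffs[OF z this]
  define c where "c = (\<lambda>i::nat. if i = 0 then fcos ?N u $ 1 / of_real pi else fsin ?N u $ 1 / of_real pi)"
  have fs0: "fsin 0 u = 0" by (simp add: fsin_def)
  have "AE x in lborel. u x = fterm (\<lambda>k. fcos k u) (\<lambda>k. fsin k u) ?N x"
    by (rule L2_coeffs_AE_eq[OF _ L2_fterm]) (use u fs0 in \<open>auto simp: fcos_fterm\<close>)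
  moreover have "fterm (\<lambda>k. fcos k u) (\<lambda>k. fsin k u) ?N x = (\<Sum>i<2. c i *s b i x)" for x
    unfolding sum2 using n
    by (simp add: conjunct1[OF conjunct2[OF conjunct2[OF u]]] conjunct2[OF conjunct2[OF conjunct2[OF u]]] fterm_def fourier_weight_def c_def crit_vec_def vec_eq_iff forall_2 scaleR_conv_of_real[where 'a = complex] field_simps)
  ultimately show "\<exists>c. AE x in lborel. u x = (\<Sum>i<2. c i *s b i x)" by auto
  qed
  show ?thesis unfolding has_dim_ae_def using b indep span by blast
qed

lemma spectral_condition: "hopf_spectral_condition 1 \<delta>1 \<delta>2 n 1"
  unfolding hopf_spectral_condition_def Let_def beta_crit_5
proof (intro conjI ballI impI)
  let ?A = "brusselator_L 1 \<delta>1 \<delta>2 5"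
  fix z assume "z \<in> {\<i> * complex_of_real 1, - \<i> * complex_of_real 1}"
  then have z: "z\<^sup>2 = -1" by auto
  have sub: "eigenspace ?A z \<subseteq> generalized_eigenspace ?A z"
    unfolding eigenspace_def generalized_eigenspace_def by blast
  show "has_dim_ae (eigenspace ?A z) 2" "has_dim_ae (generalized_eigenspace ?A z) 2"
    by (rule has_dim_ae_crit[OF z]; use sub in blast)+
  have "crit_vec z \<noteq> 0" by (simp add: crit_vec_def vec_eq_iff forall_2)
  moreover have "shifted_symbol 1 \<delta>1 \<delta>2 5 z (nat \<bar>n\<bar>) (crit_vec z) = 0" using symbol_crit_vec[OF z, of 1] by simp
  ultimately show "\<exists>V. V \<noteq> 0 \<and> fourier_mode n V \<in> eigenspace ?A z \<and> fourier_mode (- n) V \<in> eigenspace ?A z"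
    by (intro exI[of _ "crit_vec z"] conjI fourier_mode_in_eigenspace) simp_all
next
  fix z assume "z \<in> spectrum_op (brusselator_L 1 \<delta>1 \<delta>2 5)" "Re z = 0"
  then show "z = \<i> * complex_of_real 1 \<or> z = - \<i> * complex_of_real 1"
    using resolvent_imag[of z] by (auto simp: spectrum_op_def)
qed simp

lemma Re_mode_in_critical_parts:
  assumes "k = n \<or> k = - n"
  shows "(\<lambda>x. \<chi> j. Re (fourier_mode k (c *s crit_vec \<i>) x $ j)) \<in> critical_parts 1 \<delta>1 \<delta>2 n 1"
proof -
  have "fourier_mode k (c *s crit_vec \<i>) \<in> eigenspace (brusselator_L 1 \<delta>1 \<delta>2 5) \<i>"
    using assms by (intro fourier_mode_in_eigenspace) (auto intro!: symbol_crit_vec)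
  then show ?thesis using assms unfolding critical_parts_def beta_crit_5 Let_def by fastforce
qed

end

section \<open>Formal expansion of the bifurcating waves\<close>

text \<open>
  Laurent polynomials in two variables: the monomial \<open>(m, k)\<close> stands for \<open>exp (\<i> (m \<tau> + k \<xi>))\<close>,
  so that multiplication is convolution of Fourier coefficients.
\<close>

type_synonym laurent = "(int \<times> int) \<Rightarrow>\<^sub>0 complex"

abbreviation coef :: "laurent \<Rightarrow> int \<times> int \<Rightarrow> complex" where "coef \<equiv> Poly_Mapping.lookup"
abbreviation supp :: "laurent \<Rightarrow> (int \<times> int) set" where "supp \<equiv> Poly_Mapping.keys"

lemma coef_mult:
  assumes "finite A" "supp p \<subseteq> A"
  shows "coef (p * q) s = (\<Sum>l\<in>A. coef p l * coef q (s - l))"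
proof -
  have "(\<Sum>r. coef q r when s = l + r) = coef q (s - l)" for l
  proof -
    have "(s = l + r) = (r = s - l)" for r
    proof
      assume "s = l + r" then show "r = s - l" by simp
    next
      assume "r = s - l" then show "s = l + r" by simp
    qed
    then show ?thesis by simp
  qed
  then have "coef (p * q) s = (\<Sum>l. coef p l * coef q (s - l))" by (simp add: lookup_mult)
  also have "\<dots> = (\<Sum>l\<in>A. coef p l * coef q (s - l))"
    by (rule Sum_any.expand_superset) (use assms in \<open>auto simp: in_keys_iff\<close>)
  finally show ?thesis .
qed

text \<open>The exponential weight makes every derivative of a trigonometric series converge.\<close>

definition weight :: "int \<times> int \<Rightarrow> real" where
  "weight q = 2 ^ (nat \<bar>fst q\<bar> + nat \<bar>snd q\<bar>)"

lemma weight_pos: "0 < weight q" "1 \<le> weight q"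
  by (simp_all add: weight_def)

text \<open>Submultiplicativity of the weight is what makes \<open>nrm\<close> an algebra norm for
  convolution.\<close>

lemma weight_add: "weight (p + q) \<le> weight p * weight q"
proof -
  have n: "nat \<bar>a + b\<bar> \<le> nat \<bar>a\<bar> + nat \<bar>b\<bar>" for a b :: int
    by (metis abs_ge_zero abs_triangle_ineq nat_add_distrib nat_mono)
  have *: "nat \<bar>fst p + fst q\<bar> + nat \<bar>snd p + snd q\<bar> \<le> (nat \<bar>fst p\<bar> + nat \<bar>snd p\<bar>) + (nat \<bar>fst q\<bar> + nat \<bar>snd q\<bar>)"
    using add_mono[OF n[of "fst p" "fst q"] n[of "snd p" "snd q"]] by (simp only: add_ac)
  have "(2::real) ^ (nat \<bar>fst p + fst q\<bar> + nat \<bar>snd p + snd q\<bar>) \<le> 2 ^ ((nat \<bar>fst p\<bar> + nat \<bar>snd p\<bar>) + (nat \<bar>fst q\<bar> + nat \<bar>snd q\<bar>))"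
    by (rule power_increasing[OF *]) simp
  then show ?thesis by (simp only: weight_def fst_add snd_add power_add)
qed

lemma weight_ge: "\<bar>real_of_int (fst q)\<bar> \<le> weight q" "\<bar>real_of_int (snd q)\<bar> \<le> weight q"
    "\<bar>real_of_int (fst q)\<bar> * \<bar>real_of_int (snd q)\<bar> \<le> weight q"
    "(real_of_int (fst q))\<^sup>2 \<le> 2 * weight q" "(real_of_int (snd q))\<^sup>2 \<le> 2 * weight q"
proof -
  have a: "real n \<le> 2 ^ n" for n by (simp add: of_nat_less_two_power less_imp_le)
  \<comment> \<open>The factor 2 is due to n = 3, where 9 exceeds 2 ^ 3.\<close>
  have b: "(real n)\<^sup>2 \<le> 2 * 2 ^ n" for n
  proof (induction n rule: less_induct)
    case (less n)
    show ?case
    proof (cases "n \<le> 3")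
      case True
      then have "n = 0 \<or> n = 1 \<or> n = 2 \<or> n = 3" by auto
      then show ?thesis by auto
    next
      case False
      then obtain m where m: "n = Suc m" "m \<ge> 3" by (cases n) auto
      then have "(real n)\<^sup>2 = (real m)\<^sup>2 + 2 * real m + 1" by (simp add: power2_eq_square algebra_simps)
      also have "\<dots> \<le> (real m)\<^sup>2 + real m * real m"
      proof -
        have "3 * real m \<le> real m * real m" using m by (intro mult_right_mono) auto
        moreover have "2 * real m + 1 \<le> 3 * real m" using m by simp
        ultimately show ?thesis by linarith
      qed
      also have "\<dots> = 2 * (real m)\<^sup>2" by (simp add: power2_eq_square)
      also have "\<dots> \<le> 2 * (2 * 2 ^ m)" using less m by simp
      finally show ?thesis using m by simp
    qed
  qed
  define x y where "x = nat \<bar>fst q\<bar>" and "y = nat \<bar>snd q\<bar>"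
  have w: "weight q = 2 ^ x * 2 ^ y" by (simp add: weight_def x_def y_def power_add)
  have xy: "\<bar>real_of_int (fst q)\<bar> = real x" "\<bar>real_of_int (snd q)\<bar> = real y" by (simp_all add: x_def y_def)
  have o: "1 \<le> (2::real) ^ x" "1 \<le> (2::real) ^ y" by simp_all
  show "\<bar>real_of_int (fst q)\<bar> \<le> weight q" using mult_mono[OF a[of x] o(2)] by (simp add: xy w)
  show "\<bar>real_of_int (snd q)\<bar> \<le> weight q" using mult_mono[OF o(1) a[of y]] by (simp add: xy w)
  show "\<bar>real_of_int (fst q)\<bar> * \<bar>real_of_int (snd q)\<bar> \<le> weight q" using mult_mono[OF a[of x] a[of y]] by (simp add: xy w)
  have "(real_of_int (fst q))\<^sup>2 = (real x)\<^sup>2" "(real_of_int (snd q))\<^sup>2 = (real y)\<^sup>2"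
    using xy[symmetric] by simp_all
  then show "(real_of_int (fst q))\<^sup>2 \<le> 2 * weight q" "(real_of_int (snd q))\<^sup>2 \<le> 2 * weight q"
    using mult_mono[OF b[of x] o(2)] mult_mono[OF o(1) b[of y]] by (simp_all add: w)
qed

section \<open>The weighted norm, Fourier multipliers, evaluation and symmetry classes\<close>

definition nrm :: "laurent \<Rightarrow> real" where
  "nrm p = (\<Sum>q\<in>supp p. weight q * cmod (coef p q))"

lemma nrm_superset:
  assumes "finite A" "supp p \<subseteq> A"
  shows "nrm p = (\<Sum>q\<in>A. weight q * cmod (coef p q))"
  unfolding nrm_def by (rule sum.mono_neutral_left) (use assms in \<open>auto simp: in_keys_iff\<close>)

lemma sum_le_nrm: "finite A \<Longrightarrow> (\<Sum>q\<in>A. weight q * cmod (coef p q)) \<le> nrm p"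
proof -
  assume A: "finite A"
  have "(\<Sum>q\<in>A. weight q * cmod (coef p q)) \<le> (\<Sum>q\<in>A \<union> supp p. weight q * cmod (coef p q))"
    using A by (intro sum_mono2) (auto simp: weight_pos less_imp_le)
  then show ?thesis using A nrm_superset[of "A \<union> supp p" p] by simp
qed

lemma nrm_nonneg [simp]: "0 \<le> nrm p"
  by (auto simp: nrm_def weight_pos less_imp_le intro!: sum_nonneg)

lemma nrm_zero [simp]: "nrm 0 = 0"
  by (simp add: nrm_def)

lemma coef_le_nrm: "cmod (coef p q) \<le> nrm p"
proof -
  have "1 * cmod (coef p q) \<le> weight q * cmod (coef p q)" by (intro mult_right_mono weight_pos) simp
  also have "\<dots> \<le> nrm p" using sum_le_nrm[of "{q}" p] by simp
  finally show ?thesis by simp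
qed

lemma nrm_add: "nrm (p + q) \<le> nrm p + nrm q"
proof -
  let ?A = "supp p \<union> supp q"
  have "nrm (p + q) = (\<Sum>r\<in>?A. weight r * cmod (coef (p + q) r))"
    by (rule nrm_superset) (simp_all add: keys_add)
  also have "\<dots> \<le> (\<Sum>r\<in>?A. weight r * cmod (coef p r) + weight r * cmod (coef q r))"
    by (intro sum_mono) (simp add: lookup_add distrib_left[symmetric] weight_pos norm_triangle_ineq mult_left_mono less_imp_le)
  also have "\<dots> = nrm p + nrm q"
    by (simp add: sum.distrib nrm_superset[of ?A p] nrm_superset[of ?A q])
  finally show ?thesis .
qed

lemma nrm_uminus [simp]: "nrm (- p) = nrm p"
  by (simp add: nrm_def)

lemma nrm_diff: "nrm (p - q) \<le> nrm p + nrm q"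
  using nrm_add[of p "- q"] by simp

lemma nrm_sum: "nrm (sum f A) \<le> (\<Sum>i\<in>A. nrm (f i))"
proof (induction A rule: infinite_finite_induct)
  case (insert x F)
  then show ?case using nrm_add[of "f x" "sum f F"] by simp
qed auto

lemma nrm_mult: "nrm (p * q) \<le> nrm p * nrm q"
proof -
  have "nrm (p * q) \<le> (\<Sum>s\<in>supp (p * q). \<Sum>l\<in>supp p. (weight l * cmod (coef p l)) * (weight (s - l) * cmod (coef q (s - l))))"
    unfolding nrm_def
  proof (rule sum_mono)
    fix s
    have "weight s * cmod (coef (p * q) s) \<le> weight s * (\<Sum>l\<in>supp p. cmod (coef p l * coef q (s - l)))"
      unfolding coef_mult[OF finite_keys subset_refl] by (intro mult_left_mono norm_sum) (simp add: weight_pos less_imp_le)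
    also have "\<dots> \<le> (\<Sum>l\<in>supp p. (weight l * cmod (coef p l)) * (weight (s - l) * cmod (coef q (s - l))))"
      unfolding sum_distrib_left
    proof (rule sum_mono)
      fix l
      have "weight s * cmod (coef p l * coef q (s - l)) \<le> (weight l * weight (s - l)) * cmod (coef p l * coef q (s - l))"
        using weight_add[of l "s - l"] by (intro mult_right_mono) auto
      then show "weight s * cmod (coef p l * coef q (s - l)) \<le> (weight l * cmod (coef p l)) * (weight (s - l) * cmod (coef q (s - l)))"
        by (simp add: norm_mult mult_ac)
    qed
    finally show "weight s * cmod (coef (p * q) s) \<le> (\<Sum>l\<in>supp p. (weight l * cmod (coef p l)) * (weight (s - l) * cmod (coef q (s - l))))" .
  qed
  also have "\<dots> = (\<Sum>l\<in>supp p. (weight l * cmod (coef p l)) * (\<Sum>s\<in>supp (p * q). weight (s - l) * cmod (coef q (s - l))))"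
    by (subst sum.swap) (simp add: sum_distrib_left)
  also have "\<dots> \<le> (\<Sum>l\<in>supp p. (weight l * cmod (coef p l)) * nrm q)"
  proof (intro sum_mono mult_left_mono)
    fix l
    have "(\<Sum>s\<in>supp (p * q). weight (s - l) * cmod (coef q (s - l))) = (\<Sum>t\<in>(\<lambda>s. s - l) ` supp (p * q). weight t * cmod (coef q t))"
      by (subst sum.reindex) (auto simp: inj_on_def)
    also have "\<dots> \<le> nrm q" by (rule sum_le_nrm) simp
    finally show "(\<Sum>s\<in>supp (p * q). weight (s - l) * cmod (coef q (s - l))) \<le> nrm q" .
  qed (simp add: weight_pos less_imp_le)
  finally show ?thesis by (simp add: nrm_def sum_distrib_right)
qed

text \<open>Fourier multiplier with symbol \<open>c\<close>. Derivatives and the entries of the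
  inverse linearization are all of this kind.\<close>

definition mlt :: "(int \<times> int \<Rightarrow> complex) \<Rightarrow> laurent \<Rightarrow> laurent" where
  "mlt c p = Poly_Mapping.mapp (\<lambda>q x. c q * x) p"

lemma coef_mlt [simp]: "coef (mlt c p) q = c q * coef p q"
  by (simp add: mlt_def mapp.rep_eq when_def in_keys_iff)

lemma supp_mlt: "supp (mlt c p) \<subseteq> supp p"
  by (auto simp: in_keys_iff)

lemma mlt_add: "mlt c (p + q) = mlt c p + mlt c q"
  by (rule poly_mapping_eqI) (simp add: lookup_add distrib_left)

lemma mlt_0 [simp]: "mlt c 0 = 0"
  by (rule poly_mapping_eqI) simp

lemma nrm_mlt:
  assumes "\<And>q. cmod (c q) \<le> C"
  shows "nrm (mlt c p) \<le> C * nrm p"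
proof -
  have "nrm (mlt c p) = (\<Sum>q\<in>supp p. weight q * cmod (c q * coef p q))"
    by (simp add: nrm_superset[OF finite_keys supp_mlt])
  also have "\<dots> \<le> (\<Sum>q\<in>supp p. C * (weight q * cmod (coef p q)))"
  proof (rule sum_mono)
    fix q
    have "cmod (c q) * (weight q * cmod (coef p q)) \<le> C * (weight q * cmod (coef p q))"
      using assms weight_pos(1)[of q] by (intro mult_right_mono) auto
    then show "weight q * cmod (c q * coef p q) \<le> C * (weight q * cmod (coef p q))" by (simp add: norm_mult mult_ac)
  qed
  finally show ?thesis by (simp add: nrm_def sum_distrib_left)
qed

definition cst :: "real \<Rightarrow> laurent" where "cst c = Poly_Mapping.single 0 (of_real c)"

lemma coef_cst: "coef (cst c) q = (if q = 0 then of_real c else 0)"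
  by (auto simp: cst_def lookup_single when_def)

lemma supp_cst: "supp (cst c) \<subseteq> {0}"
proof
  fix q assume "q \<in> supp (cst c)"
  then have "coef (cst c) q \<noteq> 0" by (simp add: in_keys_iff)
  then show "q \<in> {0}" by (simp add: coef_cst split: if_splits)
qed

lemma coef_cst_mult [simp]: "coef (cst c * p) q = of_real c * coef p q"
proof -
  show ?thesis using supp_cst by (simp add: coef_mult[of "{0}"] coef_cst)
qed

lemma nrm_cst: "nrm (cst c) = \<bar>c\<bar>"
proof -
  show ?thesis using supp_cst by (simp add: nrm_superset[of "{0}"] coef_cst weight_def)
qed

lemma cst_0 [simp]: "cst 0 = 0"
  by (rule poly_mapping_eqI) (simp add: coef_cst)

definition ev :: "real \<Rightarrow> real \<Rightarrow> laurent \<Rightarrow> complex" where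
  "ev \<tau> \<xi> p = (\<Sum>q\<in>supp p. coef p q * cis (of_int (fst q) * \<tau> + of_int (snd q) * \<xi>))"

lemma ev_superset:
  assumes "finite A" "supp p \<subseteq> A"
  shows "ev \<tau> \<xi> p = (\<Sum>q\<in>A. coef p q * cis (of_int (fst q) * \<tau> + of_int (snd q) * \<xi>))"
  unfolding ev_def by (rule sum.mono_neutral_left) (use assms in \<open>auto simp: in_keys_iff\<close>)

lemma ev_add: "ev \<tau> \<xi> (p + q) = ev \<tau> \<xi> p + ev \<tau> \<xi> q"
proof -
  have f: "finite (supp p \<union> supp q)" by simp
  show ?thesis
    by (simp add: ev_superset[OF f] keys_add lookup_add distrib_right sum.distrib)
qed

lemma ev_0 [simp]: "ev \<tau> \<xi> 0 = 0"
  by (simp add: ev_def)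

lemma ev_sum: "ev \<tau> \<xi> (sum f A) = (\<Sum>i\<in>A. ev \<tau> \<xi> (f i))"
  by (induction A rule: infinite_finite_induct) (auto simp: ev_add)

lemma ev_cst [simp]: "ev \<tau> \<xi> (cst c) = of_real c"
proof -
  show ?thesis using supp_cst by (simp add: ev_superset[of "{0}"] coef_cst)
qed

lemma ev_mult: "ev \<tau> \<xi> (p * q) = ev \<tau> \<xi> p * ev \<tau> \<xi> q"
proof -
  let ?e = "\<lambda>q. cis (of_int (fst q) * \<tau> + of_int (snd q) * \<xi>)"
  have ee: "?e (l + r) = ?e l * ?e r" for l r by (simp add: cis_mult algebra_simps)
  define A where "A = supp (p * q) \<union> (\<lambda>(l, r). l + r) ` (supp p \<times> supp q)"
  have A: "finite A" "supp (p * q) \<subseteq> A" by (auto simp: A_def)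
  have "ev \<tau> \<xi> (p * q) = (\<Sum>s\<in>A. \<Sum>l\<in>supp p. (coef p l * ?e l) * (coef q (s - l) * ?e (s - l)))"
    unfolding ev_superset[OF A] coef_mult[OF finite_keys subset_refl] sum_distrib_right
  proof (intro sum.cong refl)
    fix s l :: "int \<times> int"
    have "?e s = ?e l * ?e (s - l)" using ee[of l "s - l"] by simp
    then show "coef p l * coef q (s - l) * ?e s = (coef p l * ?e l) * (coef q (s - l) * ?e (s - l))" by simp
  qed
  also have "\<dots> = (\<Sum>l\<in>supp p. (coef p l * ?e l) * (\<Sum>s\<in>A. coef q (s - l) * ?e (s - l)))"
    by (subst sum.swap) (simp add: sum_distrib_left)
  also have "\<dots> = (\<Sum>l\<in>supp p. (coef p l * ?e l) * ev \<tau> \<xi> q)"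
  proof (intro sum.cong refl arg_cong2[where f = "(*)"])
    fix l assume l: "l \<in> supp p"
    have "(\<Sum>s\<in>A. coef q (s - l) * ?e (s - l)) = (\<Sum>t\<in>(\<lambda>s. s - l) ` A. coef q t * ?e t)"
      by (subst sum.reindex) (auto simp: inj_on_def)
    also have "\<dots> = ev \<tau> \<xi> q"
    proof (rule ev_superset[symmetric])
      show "supp q \<subseteq> (\<lambda>s. s - l) ` A"
      proof
        fix r assume r: "r \<in> supp q"
        then have "l + r \<in> A" using l by (auto simp: A_def)
        then show "r \<in> (\<lambda>s. s - l) ` A" by (rule rev_image_eqI) simp
      qed
    qed (simp add: A)
    finally show "(\<Sum>s\<in>A. coef q (s - l) * ?e (s - l)) = ev \<tau> \<xi> q" .
  qed
  finally show ?thesis by (simp add: ev_def sum_distrib_right)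
qed

text \<open>A multiplier growing no faster than the weight is bounded from \<open>nrm\<close> to the
  sup norm. This is how the weight pays for derivatives of the sums.\<close>

lemma norm_ev_mlt:
  assumes "\<And>q. cmod (c q) \<le> C * weight q"
  shows "cmod (ev \<tau> \<xi> (mlt c p)) \<le> C * nrm p"
proof -
  have "ev \<tau> \<xi> (mlt c p) = (\<Sum>q\<in>supp p. c q * coef p q * cis (of_int (fst q) * \<tau> + of_int (snd q) * \<xi>))"
    by (simp add: ev_superset[OF finite_keys supp_mlt])
  then have "cmod (ev \<tau> \<xi> (mlt c p)) \<le> (\<Sum>q\<in>supp p. cmod (c q) * cmod (coef p q))"
    by (simp add: norm_mult sum_norm_le)
  also have "\<dots> \<le> (\<Sum>q\<in>supp p. (C * weight q) * cmod (coef p q))"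
    using assms by (intro sum_mono mult_right_mono) auto
  finally show ?thesis by (simp add: nrm_def sum_distrib_left mult.assoc)
qed

lemma mlt_one [simp]: "mlt (\<lambda>q. 1) p = p"
  by (rule poly_mapping_eqI) simp

text \<open>
  The two spatial symmetry types: \<open>True\<close> for travelling profiles (functions of \<open>\<tau> + \<xi>\<close>), \<open>False\<close> for
  standing profiles (even in \<open>\<xi>\<close> and invariant under \<open>(\<tau>, \<xi>) \<mapsto> (\<tau> + \<pi>, \<xi> + \<pi>)\<close>); both real-valued.
\<close>

definition adm :: "bool \<Rightarrow> laurent \<Rightarrow> bool" where
  "adm b p \<longleftrightarrow> (\<forall>q. coef p (- q) = cnj (coef p q)) \<and>
     (if b then \<forall>q. fst q \<noteq> snd q \<longrightarrow> coef p q = 0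
      else (\<forall>q. coef p (fst q, - snd q) = coef p q) \<and> (\<forall>q. odd (fst q + snd q) \<longrightarrow> coef p q = 0))"

text \<open>The operator with this symbol maps real functions to real functions and commutes with
  the reflection of \<xi>. The other conditions in \<open>adm\<close> restrict the support, which
  every multiplier preserves.\<close>

definition equivariant :: "(int \<times> int \<Rightarrow> complex) \<Rightarrow> bool" where
  "equivariant c \<longleftrightarrow> (\<forall>q. c (- q) = cnj (c q) \<and> c (fst q, - snd q) = c q)"

lemma adm_mlt: "equivariant c \<Longrightarrow> adm b p \<Longrightarrow> adm b (mlt c p)"
  unfolding adm_def equivariant_def coef_mlt complex_cnj_mult by (cases b) (simp_all del: split_paired_All)

lemma admD:
  assumes "adm b p"
  shows "coef p (- q) = cnj (coef p q)" "b \<Longrightarrow> fst q \<noteq> snd q \<Longrightarrow> coef p q = 0"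
    "\<not> b \<Longrightarrow> coef p (fst q, - snd q) = coef p q" "\<not> b \<Longrightarrow> odd (fst q + snd q) \<Longrightarrow> coef p q = 0"
  using assms unfolding adm_def by (simp_all only: if_True if_False) blast+

text \<open>Convolution and evaluation sums are extended to an index set stable under both sign
  changes, so that they can be reindexed by them.\<close>

lemma symmetric_box:
  obtains A where "finite A" "supp p \<subseteq> A" "uminus ` A = A" "(\<lambda>r. (fst r, - snd r)) ` A = A"
proof -
  define K where "K = (\<Sum>q\<in>supp p. \<bar>fst q\<bar> + \<bar>snd q\<bar>)"
  define A where "A = {-K..K} \<times> {-K..K}"
  have "\<bar>fst q\<bar> + \<bar>snd q\<bar> \<le> K" if "q \<in> supp p" for q
    unfolding K_def by (rule member_le_sum[OF that]) auto
  then have s: "supp p \<subseteq> A" unfolding A_def by (auto simp: mem_Times_iff) (smt (verit))+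
  have inv: "f ` A = A" if "\<And>x. f (f x) = x" "\<And>x. x \<in> A \<Longrightarrow> f x \<in> A" for f
  proof
    show "A \<subseteq> f ` A" using that by (metis imageI subsetI)
  qed (use that in blast)
  show thesis
    by (rule that[of A]; (intro inv)?) (use s in \<open>auto simp: A_def\<close>)
qed

lemma adm_add: "adm b p \<Longrightarrow> adm b q \<Longrightarrow> adm b (p + q)"
  unfolding adm_def lookup_add by (cases b) (simp_all del: split_paired_All)

lemma adm_uminus: "adm b p \<Longrightarrow> adm b (- p)"
  unfolding adm_def lookup_uminus by (cases b) (simp_all del: split_paired_All)

lemma adm_diff: "adm b p \<Longrightarrow> adm b q \<Longrightarrow> adm b (p - q)"
  using adm_add[of b p "- q"] adm_uminus by simp

lemma adm_0: "adm b 0"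
  by (simp add: adm_def)

lemma adm_sum: "(\<And>i. i \<in> A \<Longrightarrow> adm b (f i)) \<Longrightarrow> adm b (sum f A)"
  by (induction A rule: infinite_finite_induct) (auto simp: adm_add adm_0)

lemma adm_cst: "adm b (cst c)"
  by (auto simp: adm_def coef_cst prod_eq_iff)

lemma adm_mult:
  assumes p: "adm b p" and q: "adm b q"
  shows "adm b (p * q)"
proof -
  obtain A where A: "finite A" "supp p \<subseteq> A" and Au: "uminus ` A = A" and Ar: "(\<lambda>r. (fst r, - snd r)) ` A = A"
    by (rule symmetric_box)
  note cm = coef_mult[OF A, of q]
  have 1: "coef (p * q) (- s) = cnj (coef (p * q) s)" for s
  proof -
    have "coef (p * q) (- s) = (\<Sum>l\<in>uminus ` A. coef p l * coef q (- s - l))" unfolding cm Au by (rule refl)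
    also have "\<dots> = (\<Sum>l\<in>A. coef p (- l) * coef q (- s - (- l)))"
      by (subst sum.reindex) (auto simp: inj_on_def)
    also have "\<dots> = (\<Sum>l\<in>A. cnj (coef p l * coef q (s - l)))"
    proof (rule sum.cong[OF refl])
      fix l
      have e: "- s - (- l) = - (s - l)" by simp
      show "coef p (- l) * coef q (- s - (- l)) = cnj (coef p l * coef q (s - l))"
        unfolding e by (simp only: admD(1)[OF p] admD(1)[OF q] complex_cnj_mult)
    qed
    finally show ?thesis by (simp add: cm)
  qed
  show ?thesis
  proof (cases b)
    case True
    have "coef (p * q) s = 0" if "fst s \<noteq> snd s" for s
      unfolding cm
    proof (rule sum.neutral, rule ballI)
      fix l
      have "fst l \<noteq> snd l \<or> fst (s - l) \<noteq> snd (s - l)" using that by auto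
      then show "coef p l * coef q (s - l) = 0" 
        by (metis admD(2)[OF p True] admD(2)[OF q True] mult_zero_left mult_zero_right)
    qed
    then show ?thesis using True 1 unfolding adm_def by (simp only: if_True) blast
  next
    case False
    have "coef (p * q) s = 0" if "odd (fst s + snd s)" for s
      unfolding cm
    proof (rule sum.neutral, rule ballI)
      fix l
      have "fst s + snd s = (fst l + snd l) + (fst (s - l) + snd (s - l))" by simp
      with that have "odd (fst l + snd l) \<or> odd (fst (s - l) + snd (s - l))" by (metis even_add)
      then show "coef p l * coef q (s - l) = 0" 
        by (metis admD(4)[OF p False] admD(4)[OF q False] mult_zero_left mult_zero_right)
    qed
    moreover have "coef (p * q) (fst s, - snd s) = coef (p * q) s" for s
    proof -
      have "coef (p * q) (fst s, - snd s) = (\<Sum>l\<in>(\<lambda>r. (fst r, - snd r)) ` A. coef p l * coef q ((fst s, - snd s) - l))"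
        unfolding cm Ar by (rule refl)
      also have "\<dots> = (\<Sum>l\<in>A. coef p (fst l, - snd l) * coef q ((fst s, - snd s) - (fst l, - snd l)))"
        by (subst sum.reindex) (auto simp: inj_on_def prod_eq_iff)
      also have "\<dots> = (\<Sum>l\<in>A. coef p l * coef q (s - l))"
      proof (rule sum.cong[OF refl])
        fix l
        have e: "(fst s, - snd s) - (fst l, - snd l) = (fst (s - l), - snd (s - l))" by (simp add: prod_eq_iff)
        show "coef p (fst l, - snd l) * coef q ((fst s, - snd s) - (fst l, - snd l)) = coef p l * coef q (s - l)"
          unfolding e by (simp only: admD(3)[OF p False] admD(3)[OF q False])
      qed
      finally show ?thesis by (simp add: cm)
    qed
    ultimately show ?thesis using False 1 unfolding adm_def by (simp only: if_False) blast
  qed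
qed

lemma ev_adm_real:
  assumes "adm b p"
  shows "Im (ev \<tau> \<xi> p) = 0"
proof -
  obtain A where A: "finite A" "supp p \<subseteq> A" and Au: "uminus ` A = A"
    by (rule symmetric_box)
  have "ev \<tau> \<xi> p = (\<Sum>q\<in>uminus ` A. coef p q * cis (of_int (fst q) * \<tau> + of_int (snd q) * \<xi>))"
    unfolding Au by (rule ev_superset[OF A])
  also have "\<dots> = (\<Sum>q\<in>A. cnj (coef p q * cis (of_int (fst q) * \<tau> + of_int (snd q) * \<xi>)))"
    by (subst sum.reindex) (auto simp: inj_on_def admD(1)[OF assms] cis_cnj simp del: uminus_Pair intro!: sum.cong arg_cong[where f = cis])
  also have "\<dots> = cnj (ev \<tau> \<xi> p)" by (simp add: ev_superset[OF A])
  finally show ?thesis by (simp add: complex_eq_iff)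
qed

section \<open>Partial majorant sums of power series in the amplitude\<close>

definition psum :: "real \<Rightarrow> nat \<Rightarrow> laurent fps \<Rightarrow> real" where
  "psum r N F = (\<Sum>j\<le>N. nrm (fps_nth F j) * r ^ j)"

lemma psum_nonneg: "0 \<le> r \<Longrightarrow> 0 \<le> psum r N F"
  by (auto simp: psum_def intro!: sum_nonneg)

lemma psum_add: "0 \<le> r \<Longrightarrow> psum r N (F + G) \<le> psum r N F + psum r N G"
  unfolding psum_def sum.distrib[symmetric]
  by (intro sum_mono) (simp add: distrib_right[symmetric] nrm_add mult_right_mono)

lemma psum_uminus [simp]: "psum r N (- F) = psum r N F"
  by (simp add: psum_def)

lemma psum_mono: "0 \<le> r \<Longrightarrow> M \<le> N \<Longrightarrow> psum r M F \<le> psum r N F"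
  unfolding psum_def by (rule sum_mono2) auto

lemma psum_mult_aux:
  assumes "0 \<le> r"
  shows "psum r N (F * G) \<le> (\<Sum>(i, j)\<in>{(i, j). i + j \<le> N}. (nrm (fps_nth F i) * r ^ i) * (nrm (fps_nth G j) * r ^ j))"
proof -
  have "psum r N (F * G) \<le> (\<Sum>k\<le>N. \<Sum>i\<le>k. (nrm (fps_nth F i) * r ^ i) * (nrm (fps_nth G (k - i)) * r ^ (k - i)))"
    unfolding psum_def
  proof (rule sum_mono)
    fix k
    have "nrm (fps_nth (F * G) k) * r ^ k \<le> (\<Sum>i\<le>k. nrm (fps_nth F i * fps_nth G (k - i))) * r ^ k"
      unfolding fps_mult_nth atLeast0AtMost using assms by (intro mult_right_mono nrm_sum) auto
    also have "\<dots> \<le> (\<Sum>i\<le>k. nrm (fps_nth F i) * nrm (fps_nth G (k - i))) * r ^ k"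
      using assms by (intro mult_right_mono sum_mono nrm_mult) auto
    also have "\<dots> = (\<Sum>i\<le>k. (nrm (fps_nth F i) * r ^ i) * (nrm (fps_nth G (k - i)) * r ^ (k - i)))"
      unfolding sum_distrib_right
    proof (rule sum.cong[OF refl])
      fix i assume "i \<in> {..k}"
      then have "r ^ k = r ^ i * r ^ (k - i)" by (simp add: power_add[symmetric])
      then show "nrm (fps_nth F i) * nrm (fps_nth G (k - i)) * r ^ k = (nrm (fps_nth F i) * r ^ i) * (nrm (fps_nth G (k - i)) * r ^ (k - i))"
        by simp
    qed
    finally show "nrm (fps_nth (F * G) k) * r ^ k \<le> (\<Sum>i\<le>k. (nrm (fps_nth F i) * r ^ i) * (nrm (fps_nth G (k - i)) * r ^ (k - i)))" .
  qed
  also have "\<dots> = (\<Sum>(i, j)\<in>{(i, j). i + j \<le> N}. (nrm (fps_nth F i) * r ^ i) * (nrm (fps_nth G j) * r ^ j))"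
    by (rule sum.triangle_reindex_eq[symmetric])
  finally show ?thesis .
qed

lemma psum_mult:
  assumes "0 \<le> r"
  shows "psum r N (F * G) \<le> psum r N F * psum r N G"
proof -
  have "psum r N (F * G) \<le> (\<Sum>(i, j)\<in>{..N} \<times> {..N}. (nrm (fps_nth F i) * r ^ i) * (nrm (fps_nth G j) * r ^ j))"
    by (rule order_trans[OF psum_mult_aux[OF assms]], rule sum_mono2) (use assms in auto)
  then show ?thesis by (simp add: psum_def sum_product sum.cartesian_product)
qed

text \<open>Without constant terms, order N + 1 of the product contains only orders 1 to N of the
  factors. This gain of one order is what lets the convergence proof run by induction on N.\<close>

lemma psum_mult_0:
  assumes "0 \<le> r" "fps_nth F 0 = 0" "fps_nth G 0 = 0"
  shows "psum r (Suc N) (F * G) \<le> psum r N F * psum r N G"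
proof -
  let ?t = "\<lambda>(i, j). (nrm (fps_nth F i) * r ^ i) * (nrm (fps_nth G j) * r ^ j)"
  have "psum r (Suc N) (F * G) \<le> sum ?t {(i, j). i + j \<le> Suc N}"
    by (rule psum_mult_aux[OF assms(1)])
  also have "\<dots> = sum ?t ({(i, j). i + j \<le> Suc N} \<inter> {..N} \<times> {..N})"
  proof (rule sum.mono_neutral_right)
    have "{(i, j). i + j \<le> Suc N} \<subseteq> {..Suc N} \<times> {..Suc N}" by auto
    then show "finite {(i, j). i + j \<le> Suc N}" by (rule finite_subset) simp
    show "\<forall>p\<in>{(i, j). i + j \<le> Suc N} - {(i, j). i + j \<le> Suc N} \<inter> {..N} \<times> {..N}. ?t p = 0"
    proof
      fix p assume p: "p \<in> {(i, j). i + j \<le> Suc N} - {(i, j). i + j \<le> Suc N} \<inter> {..N} \<times> {..N}"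
      obtain i j where ij: "p = (i, j)" by (cases p)
      with p have "i = 0 \<or> j = 0" by auto
      then show "?t p = 0" using assms ij by auto
    qed
  qed auto
  also have "\<dots> \<le> sum ?t ({..N} \<times> {..N})" by (rule sum_mono2) (use assms in auto)
  finally show ?thesis by (simp add: psum_def sum_product sum.cartesian_product)
qed

lemma psum_X: "psum r (Suc N) (fps_X * F) = r * psum r N F"
  unfolding psum_def sum_distrib_left by (subst sum.atMost_Suc_shift) (simp add: mult_ac)

lemma psum_X_le: "0 \<le> r \<Longrightarrow> psum r N (fps_X * F) \<le> r * psum r N F"
  using psum_mono[of r N "Suc N" "fps_X * F"] by (simp add: psum_X)

lemma psum_numeral_mult: "0 \<le> r \<Longrightarrow> psum r N (numeral n * F) \<le> numeral n * psum r N F"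
proof -
  assume r: "0 \<le> r"
  have "psum r N (of_nat m * F) \<le> of_nat m * psum r N F" for m
  proof (induction m)
    case (Suc m)
    then show ?case using psum_add[OF r, of N "of_nat m * F" F] by (simp add: distrib_right add.commute)
  qed (simp add: psum_def)
  from this[of "numeral n"] show ?thesis by simp
qed

section \<open>The symbol of the linearized operator and its partial inverse\<close>

definition cD :: "int \<times> int \<Rightarrow> complex" where "cD q = \<i> * of_int (fst q)"

definition cX :: "int \<times> int \<Rightarrow> complex" where "cX q = - (of_int (snd q))\<^sup>2"

text \<open>Determinant of the symbol of the time derivative minus L in the rescaled variables,
  where \<alpha> = 1, \<beta> = 5 and the diffusion constants are 2 and 1.\<close>

definition mode_det :: "int \<times> int \<Rightarrow> complex" where
  "mode_det q = (cD q - 4 - 2 * cX q) * (cD q + 1 - cX q) + 5"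

definition crit :: "int \<times> int \<Rightarrow> bool" where
  "crit q \<longleftrightarrow> \<bar>fst q\<bar> = 1 \<and> \<bar>snd q\<bar> = 1"

text \<open>
  Entries of the inverse of \<open>\<partial>\<^sub>\<tau> - L\<close> at the mode \<open>q\<close>. At the critical modes they form the partial inverse
  whose values have vanishing first component.
\<close>

definition k11 :: "int \<times> int \<Rightarrow> complex" where
  "k11 q = (if crit q then 0 else (cD q + 1 - cX q) / mode_det q)"
definition k12 :: "int \<times> int \<Rightarrow> complex" where
  "k12 q = (if crit q then 0 else 1 / mode_det q)"
definition k21 :: "int \<times> int \<Rightarrow> complex" where
  "k21 q = (if crit q then -1 else -5 / mode_det q)"
definition k22 :: "int \<times> int \<Rightarrow> complex" where
  "k22 q = (if crit q then 0 else (cD q - 4 - 2 * cX q) / mode_det q)"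

lemma equivariant_kernels: "equivariant cD" "equivariant k11" "equivariant k12" "equivariant k21" "equivariant k22"
  by (simp_all add: equivariant_def cD_def cX_def k11_def k12_def k21_def k22_def mode_det_def crit_def del: split_paired_All)

lemma mode_det_parts:
  "Re (mode_det q) = 1 - (of_int (fst q))\<^sup>2 - 2 * (of_int (snd q))\<^sup>2 + 2 * ((of_int (snd q))\<^sup>2)\<^sup>2"
  "Im (mode_det q) = 3 * of_int (fst q) * ((of_int (snd q))\<^sup>2 - 1)"
proof -
  have "Re ((of_int k :: complex)\<^sup>2) = (of_int k)\<^sup>2" "Im ((of_int k :: complex)\<^sup>2) = 0" for k
    by (simp_all add: power2_eq_square)
  then show "Re (mode_det q) = 1 - (of_int (fst q))\<^sup>2 - 2 * (of_int (snd q))\<^sup>2 + 2 * ((of_int (snd q))\<^sup>2)\<^sup>2"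
    "Im (mode_det q) = 3 * of_int (fst q) * ((of_int (snd q))\<^sup>2 - 1)"
    by (simp_all add: mode_det_def cD_def cX_def) (simp_all add: power2_eq_square power4_eq_xxxx algebra_simps)
qed

text \<open>Here x is the modulus of the temporal frequency and \<kappa> the square of the spatial
  one. The left side is 1 + x times a bound for all entries of the adjugate matrix. For x <=
  \<kappa> the square of \<kappa> in the real part dominates; for x > \<kappa> it is the square of x
  together with the imaginary part.\<close>

lemma mode_det_aux:
  fixes x \<kappa> :: real
  assumes x: "0 \<le> x" and k: "4 \<le> \<kappa>"
  shows "(1 + x) * (5 + x + 2 * \<kappa>) \<le> 9 * (\<bar>1 - x\<^sup>2 - 2 * \<kappa> + 2 * \<kappa>\<^sup>2\<bar> + 3 * x * (\<kappa> - 1))"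
proof -
  have xk: "4 * x \<le> x * \<kappa>" using mult_left_mono[OF k x] by simp
  show ?thesis
  proof (cases "x \<le> \<kappa>")
    case True
    have "x * x \<le> x * \<kappa>" "4 * \<kappa> \<le> \<kappa> * \<kappa>" using True x k by (auto intro!: mult_left_mono mult_right_mono)
    then have "(1 + x) * (5 + x + 2 * \<kappa>) \<le> 9 * ((1 - x\<^sup>2 - 2 * \<kappa> + 2 * \<kappa>\<^sup>2) + 3 * x * (\<kappa> - 1))"
      using xk k x by (simp only: algebra_simps power2_eq_square; linarith?)
    then show ?thesis by (rule order_trans) (intro mult_left_mono add_mono order_refl abs_ge_self abs_ge_minus_self; simp)
  next
    case False
    have "\<kappa> * \<kappa> \<le> x * \<kappa>" "4 * x \<le> x * x" using False x k by (auto intro!: mult_left_mono mult_right_mono)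
    moreover have "9 * (- (1 - x\<^sup>2 - 2 * \<kappa> + 2 * \<kappa>\<^sup>2) + 3 * x * (\<kappa> - 1)) - (1 + x) * (5 + x + 2 * \<kappa>)
        = 8 * (x * x) + 16 * \<kappa> - 18 * (\<kappa> * \<kappa>) + 25 * (x * \<kappa>) - 33 * x - 14"
      by (simp add: algebra_simps power2_eq_square)
    ultimately have "(1 + x) * (5 + x + 2 * \<kappa>) \<le> 9 * (- (1 - x\<^sup>2 - 2 * \<kappa> + 2 * \<kappa>\<^sup>2) + 3 * x * (\<kappa> - 1))"
      using xk k x by linarith
    then show ?thesis by (rule order_trans) (intro mult_left_mono add_mono order_refl abs_ge_self abs_ge_minus_self; simp)
  qed
qed

text \<open>The first factor on the left buys one time derivative for the inverse. The constant
  doubles from 9 to 18 because real and imaginary part are each bounded by the modulus.\<close>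

lemma mode_det_bound:
  assumes "\<not> crit q"
  shows "(1 + \<bar>of_int (fst q)\<bar>) * (5 + \<bar>of_int (fst q)\<bar> + 2 * (of_int (snd q))\<^sup>2) \<le> 18 * cmod (mode_det q)"
proof -
  define m where "m = \<bar>fst q\<bar>"
  define x where "x = real_of_int m"
  define \<kappa> where "\<kappa> = (real_of_int (snd q))\<^sup>2"
  have x0: "0 \<le> x" by (simp add: x_def m_def)
  have xq: "x = \<bar>of_int (fst q)\<bar>" by (simp add: x_def m_def)
  have x2: "(of_int (fst q))\<^sup>2 = x\<^sup>2" by (simp add: xq)
  have re: "\<bar>1 - x\<^sup>2 - 2 * \<kappa> + 2 * \<kappa>\<^sup>2\<bar> \<le> cmod (mode_det q)"
    using abs_Re_le_cmod[of "mode_det q"] by (simp add: mode_det_parts \<kappa>_def x2)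
  have im: "3 * x * \<bar>\<kappa> - 1\<bar> \<le> cmod (mode_det q)"
    using abs_Im_le_cmod[of "mode_det q"] by (simp add: mode_det_parts \<kappa>_def xq abs_mult)
  have main: "(1 + x) * (5 + x + 2 * \<kappa>) \<le> 9 * (\<bar>1 - x\<^sup>2 - 2 * \<kappa> + 2 * \<kappa>\<^sup>2\<bar> + 3 * x * \<bar>\<kappa> - 1\<bar>)"
  proof -
    consider "snd q = 0" | "\<bar>snd q\<bar> = 1" | "2 \<le> \<bar>snd q\<bar>" by linarith
    then show ?thesis
    proof cases
      case 1
      then have k: "\<kappa> = 0" by (simp add: \<kappa>_def)
      show ?thesis
      proof (cases "m \<le> 1")
        case True
        then have "m = 0 \<or> m = 1" by (auto simp: m_def)
        then have "x = 0 \<or> x = 1" by (auto simp: x_def)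
        then show ?thesis by (auto simp: k)
      next
        case False
        then have "2 \<le> x" by (simp add: x_def)
        then have "2 * x \<le> x * x" by (intro mult_right_mono) auto
        moreover have "9 * (- (1 - x\<^sup>2) + 3 * x) - (1 + x) * (5 + x) = 8 * (x * x) + 21 * x - 14"
          by (simp add: algebra_simps power2_eq_square)
        ultimately have "(1 + x) * (5 + x) \<le> 9 * (- (1 - x\<^sup>2) + 3 * x)" using \<open>2 \<le> x\<close> by linarith
        then show ?thesis unfolding k by (auto simp: abs_if)
      qed
    next
      \<comment> \<open>Here the imaginary part vanishes and the determinant is 1 - x^2; the
        excluded critical modes, x = 1, are exactly its zeros.\<close>
      case 2
      then have k: "\<kappa> = 1" by (simp add: \<kappa>_def power2_eq_1_iff) linarith
      from 2 assms have "m \<noteq> 1" by (simp add: crit_def m_def)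
      then have "m = 0 \<or> 2 \<le> m" by (auto simp: m_def)
      then show ?thesis
      proof
        assume "m = 0"
        then show ?thesis by (simp add: x_def k)
      next
        assume "2 \<le> m"
        then have "2 \<le> x" by (simp add: x_def)
        then have "2 * x \<le> x * x" by (intro mult_right_mono) auto
        moreover have "9 * (- (1 - x\<^sup>2)) - (1 + x) * (7 + x) = 8 * (x * x) - 8 * x - 16"
          by (simp add: algebra_simps power2_eq_square)
        ultimately have "(1 + x) * (7 + x) \<le> 9 * (- (1 - x\<^sup>2))" using \<open>2 \<le> x\<close> by linarith
        then show ?thesis unfolding k by (auto simp: abs_if)
      qed
    next
      case 3
      then have "2 \<le> \<bar>real_of_int (snd q)\<bar>" by linarith
      then have "2 ^ 2 \<le> \<bar>real_of_int (snd q)\<bar> ^ 2" by (intro power_mono) auto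
      then have "4 \<le> \<kappa>" by (simp add: \<kappa>_def)
      then show ?thesis using mode_det_aux[OF x0 \<open>4 \<le> \<kappa>\<close>] by simp
    qed
  qed
  have "(1 + x) * (5 + x + 2 * \<kappa>) \<le> 18 * cmod (mode_det q)" 
  proof -
    have arith: "L \<le> 18 * c" if "L \<le> 9 * (p + r)" "p \<le> c" "r \<le> c" for L p r c :: real
      using that by (simp add: distrib_left)
    show ?thesis by (rule arith[OF main re im])
  qed
  then show ?thesis unfolding \<kappa>_def by (simp add: xq)
qed

lemma mode_det_nonzero:
  assumes "\<not> crit q"
  shows "mode_det q \<noteq> 0"
proof
  assume "mode_det q = 0"
  with mode_det_bound[OF assms]
  have "(1 + \<bar>of_int (fst q)\<bar>) * (5 + \<bar>of_int (fst q)\<bar> + 2 * (of_int (snd q))\<^sup>2) \<le> (0::real)" by simp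
  moreover have "0 < (1 + \<bar>of_int (fst q)\<bar>) * (5 + \<bar>of_int (fst q)\<bar> + 2 * (of_int (snd q))\<^sup>2 :: real)"
    by (intro mult_pos_pos add_pos_nonneg) auto
  ultimately show False by simp
qed

lemma kernel_bounds_aux:
  assumes "cmod a \<le> 5 + \<bar>of_int (fst q)\<bar> + 2 * (of_int (snd q))\<^sup>2" "\<not> crit q"
  shows "(1 + \<bar>of_int (fst q)\<bar>) * cmod (a / mode_det q) \<le> 18"
proof -
  have "(1 + \<bar>of_int (fst q)\<bar>) * cmod a \<le> (1 + \<bar>of_int (fst q)\<bar>) * (5 + \<bar>of_int (fst q)\<bar> + 2 * (of_int (snd q))\<^sup>2)"
    using assms(1) by (intro mult_left_mono) auto
  also have "\<dots> \<le> 18 * cmod (mode_det q)" by (rule mode_det_bound[OF assms(2)])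
  finally show ?thesis using mode_det_nonzero[OF assms(2)] by (simp add: norm_divide pos_divide_le_eq)
qed

lemma kernel_bounds:
  assumes "c \<in> {k11, k12, k21, k22}"
  shows "(1 + \<bar>of_int (fst q)\<bar>) * cmod (c q) \<le> 18"
proof (cases "crit q")
  case True
  then have "\<bar>real_of_int (fst q)\<bar> = 1" by (auto simp: crit_def)
  then show ?thesis using True assms by (auto simp: k11_def k12_def k21_def k22_def)
next
  case False
  define x \<kappa> where "x = \<bar>real_of_int (fst q)\<bar>" and "\<kappa> = (real_of_int (snd q))\<^sup>2"
  have nx: "cmod (cD q) = x" "cmod (cX q) = \<kappa>" by (simp_all add: cD_def cX_def x_def \<kappa>_def norm_mult norm_power)
  have k: "0 \<le> \<kappa>" "0 \<le> x" by (simp_all add: \<kappa>_def x_def)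
  have "cmod (cD q + 1 - cX q) \<le> x + 1 + \<kappa>"
    using norm_triangle_ineq4[of "cD q + 1" "cX q"] norm_triangle_ineq[of "cD q" 1] nx by simp
  moreover have "cmod (cD q - 4 - 2 * cX q) \<le> x + 4 + 2 * \<kappa>"
    using norm_triangle_ineq4[of "cD q - 4" "2 * cX q"] norm_triangle_ineq4[of "cD q" 4] nx by (simp add: norm_mult)
  ultimately show ?thesis
    using assms False k kernel_bounds_aux[of _ q] unfolding x_def[symmetric] \<kappa>_def[symmetric]
    by (auto simp: k11_def k12_def k21_def k22_def simp del: norm_divide)
qed

lemma nrm_kernel:
  assumes "c \<in> {k11, k12, k21, k22}"
  shows "nrm (mlt c p) \<le> 18 * nrm p" "nrm (mlt cD (mlt c p)) \<le> 18 * nrm p"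
proof -
  have "1 * cmod (c q) \<le> (1 + \<bar>of_int (fst q)\<bar>) * cmod (c q)" for q by (intro mult_right_mono) auto
  then have 1: "cmod (c q) \<le> 18" for q using kernel_bounds[OF assms, of q] by (simp del: of_int_abs) (metis order_trans)
  have "\<bar>of_int (fst q)\<bar> * cmod (c q) \<le> (1 + \<bar>of_int (fst q)\<bar>) * cmod (c q)" for q by (intro mult_right_mono) auto
  then have 2: "cmod (cD q * c q) \<le> 18" for q
    using kernel_bounds[OF assms, of q] by (simp add: cD_def norm_mult del: of_int_abs) (metis order_trans)
  show "nrm (mlt c p) \<le> 18 * nrm p" by (rule nrm_mlt[OF 1])
  have "mlt cD (mlt c p) = mlt (\<lambda>q. cD q * c q) p" by (rule poly_mapping_eqI) simp
  then show "nrm (mlt cD (mlt c p)) \<le> 18 * nrm p" using nrm_mlt[OF 2] by simp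
qed

text \<open>First component of the leading profile: \<open>2 * cos (\<tau> + \<xi>)\<close> for
  travelling waves, with its mirror image added for standing ones. The eigenvectors at the
  eigenvalues z = \<plusminus> \<i> are multiples of (1, z - 2), whence the multiplier
  \<open>cD q - 2\<close> in the second component.\<close>

definition crit1 :: "bool \<Rightarrow> laurent" where
  "crit1 b = Poly_Mapping.single (1, 1) 1 + Poly_Mapping.single (-1, -1) 1 +
     (if b then 0 else Poly_Mapping.single (1, -1) 1 + Poly_Mapping.single (-1, 1) 1)"

definition crit2 :: "bool \<Rightarrow> laurent" where
  "crit2 b = mlt (\<lambda>q. cD q - 2) (crit1 b)"

lemma coef_crit1: "coef (crit1 b) (m, k) =
   (if (m, k) = (1, 1) \<or> (m, k) = (-1, -1) \<or> \<not> b \<and> ((m, k) = (1, -1) \<or> (m, k) = (-1, 1)) then 1 else 0)"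
  by (auto simp: crit1_def lookup_add lookup_single when_def)

lemma coef_crit1': "coef (crit1 b) q = (if crit q \<and> (b \<longrightarrow> fst q = snd q) then 1 else 0)"
  by (cases q) (auto simp: coef_crit1 crit_def abs_if split: if_splits)

lemma crit_even: "crit q \<Longrightarrow> even (fst q + snd q)"
proof -
  assume "crit q"
  then have "fst q = 1 \<or> fst q = -1" "snd q = 1 \<or> snd q = -1" unfolding crit_def by linarith+
  then show ?thesis by auto
qed

lemma adm_crit: "adm b (crit1 b)" "adm b (crit2 b)"
proof -
  show 1: "adm b (crit1 b)"
    unfolding adm_def coef_crit1' using crit_even
    by (cases b) (simp_all add: crit_def del: split_paired_All split_paired_all, blast?)
  show "adm b (crit2 b)" unfolding crit2_def
    by (rule adm_mlt[OF _ 1]) (simp add: equivariant_def cD_def del: split_paired_All)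
qed

section \<open>The recursion for the coefficients of the expansion\<close>

definition fmlt :: "(int \<times> int \<Rightarrow> complex) \<Rightarrow> laurent fps \<Rightarrow> laurent fps" where
  "fmlt c F = Abs_fps (\<lambda>j. mlt c (fps_nth F j))"

lemma fmlt_nth [simp]: "fps_nth (fmlt c F) j = mlt c (fps_nth F j)"
  by (simp add: fmlt_def)

text \<open>With v = a V, \<beta> = 5 + M and \<open>fps_X\<close> standing for a, the scalar
  nonlinearity is a^2 times \<open>rho\<close>. Dividing the equation by a leaves one factor a in
  front of it.\<close>

definition rho :: "laurent fps \<Rightarrow> laurent fps \<Rightarrow> laurent fps \<Rightarrow> laurent fps" where
  "rho V1 V2 M = 2 * (V1 * V2) + (5 + M) * (V1 * V1) + fps_X * (V1 * V1 * V2)"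

text \<open>Iterating \<open>step\<close> from any start fixes entry j after j + 1 rounds. This form
  of course-of-values recursion allows \<open>step\<close> to be written with products of whole
  power series.\<close>

lemma guarded_fixpoint:
  fixes step :: "(nat \<Rightarrow> 'a) \<Rightarrow> nat \<Rightarrow> 'a"
  assumes "\<And>X Y j. (\<And>i. i < j \<Longrightarrow> X i = Y i) \<Longrightarrow> step X j = step Y j"
  shows "\<exists>X. \<forall>j. X j = step X j"
proof -
  define it where "it = (\<lambda>n. (step ^^ n) (\<lambda>_. undefined))"
  have it: "it (Suc n) = step (it n)" for n by (simp add: it_def)
  have agree: "it m j = it n j" if "n \<le> m" "j < n" for m n j
    using that
  proof (induction n arbitrary: m j)
    case (Suc n)
    then obtain m' where m: "m = Suc m'" "n \<le> m'" by (cases m) auto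
    show ?case unfolding m(1) it
    proof (rule assms)
      fix i assume "i < j"
      then show "it m' i = it n i" using Suc.prems m by (intro Suc.IH) auto
    qed
  qed simp
  show ?thesis
  proof (intro exI allI)
    fix j
    have "it (Suc j) j = step (it j) j" by (simp add: it)
    also have "\<dots> = step (\<lambda>j. it (Suc j) j) j"
      by (rule assms) (rule agree, auto)
    finally show "it (Suc j) j = step (\<lambda>j. it (Suc j) j) j" .
  qed
qed

lemma fps_mult_agree:
  fixes F F' G G' :: "'a::comm_ring_1 fps"
  assumes "\<And>i. i \<le> n \<Longrightarrow> fps_nth F i = fps_nth F' i" "\<And>i. i \<le> n \<Longrightarrow> fps_nth G i = fps_nth G' i" "j \<le> n"
  shows "fps_nth (F * G) j = fps_nth (F' * G') j"
  unfolding fps_mult_nth using assms by (intro sum.cong) auto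

text \<open>The top coefficient of each factor is multiplied by the vanishing constant term of the
  other, so agreement strictly below j suffices.\<close>

lemma fps_mult_agree_0:
  fixes F F' G G' :: "'a::comm_ring_1 fps"
  assumes F: "\<And>i. i < j \<Longrightarrow> fps_nth F i = fps_nth F' i" "\<And>i. i < j \<Longrightarrow> fps_nth G i = fps_nth G' i"
    and 0: "fps_nth F 0 = 0" "fps_nth F' 0 = 0" "fps_nth G 0 = 0" "fps_nth G' 0 = 0"
  shows "fps_nth (F * G) j = fps_nth (F' * G') j"
  unfolding fps_mult_nth
proof (rule sum.cong[OF refl])
  fix i assume "i \<in> {0..j}"
  then consider "i = 0" | "i = j" | "0 < i" "i < j" by force
  then show "fps_nth F i * fps_nth G (j - i) = fps_nth F' i * fps_nth G' (j - i)"
    by cases (use F 0 in auto)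
qed

lemma rho_agree:
  assumes "\<And>i. i \<le> n \<Longrightarrow> fps_nth V1 i = fps_nth V1' i" "\<And>i. i \<le> n \<Longrightarrow> fps_nth V2 i = fps_nth V2' i"
    "\<And>i. i \<le> n \<Longrightarrow> fps_nth M i = fps_nth M' i"
  shows "fps_nth (rho V1 V2 M) n = fps_nth (rho V1' V2' M') n"
proof -
  have 12: "fps_nth (V1 * V2) i = fps_nth (V1' * V2') i" "fps_nth (V1 * V1) i = fps_nth (V1' * V1') i" if "i \<le> n" for i
    by (rule fps_mult_agree[OF assms(1) assms(2) that] fps_mult_agree[OF assms(1) assms(1) that]; assumption)+
  have 112: "fps_nth (V1 * V1 * V2) i = fps_nth (V1' * V1' * V2') i" if "i \<le> n" for i
    by (rule fps_mult_agree[OF 12(2) assms(2) that])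
  have 5: "fps_nth (5 + M) i = fps_nth (5 + M') i" if "i \<le> n" for i using assms(3)[OF that] by simp
  have a: "fps_nth (2 * (V1 * V2)) n = fps_nth (2 * (V1' * V2')) n"
    by (rule fps_mult_agree[OF refl 12(1) order_refl])
  have b: "fps_nth ((5 + M) * (V1 * V1)) n = fps_nth ((5 + M') * (V1' * V1')) n"
    by (rule fps_mult_agree[OF 5 12(2) order_refl])
  have c: "fps_nth (fps_X * (V1 * V1 * V2)) n = fps_nth (fps_X * (V1' * V1' * V2')) n"
    by (rule fps_mult_agree[OF refl 112 order_refl])
  show ?thesis unfolding rho_def fps_add_nth a b c by (rule refl)
qed

type_synonym state = "laurent \<times> laurent \<times> real \<times> real"

context
  fixes b :: bool
begin

text \<open>Corrections to the critical profile. Order zero is overwritten by 0, because at that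
  order the solution consists of \<open>crit1\<close> and \<open>crit2\<close> with \<sigma> = \<mu>
  = 0.\<close>

definition sZ1 :: "(nat \<Rightarrow> state) \<Rightarrow> laurent fps" where
  "sZ1 X = Abs_fps (\<lambda>j. if j = 0 then 0 else fst (X j))"
definition sZ2 :: "(nat \<Rightarrow> state) \<Rightarrow> laurent fps" where
  "sZ2 X = Abs_fps (\<lambda>j. if j = 0 then 0 else fst (snd (X j)))"
definition sS :: "(nat \<Rightarrow> state) \<Rightarrow> laurent fps" where
  "sS X = Abs_fps (\<lambda>j. if j = 0 then 0 else cst (fst (snd (snd (X j)))))"
definition sM :: "(nat \<Rightarrow> state) \<Rightarrow> laurent fps" where
  "sM X = Abs_fps (\<lambda>j. if j = 0 then 0 else cst (snd (snd (snd (X j)))))"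

text \<open>At order j this and the next two series depend on earlier orders only. The products of
  the new \<mu> and \<sigma> with the critical profile are kept apart; they enter in
  \<open>rhs1\<close> and \<open>rhs2\<close>, where \<open>- Re h - Im h\<close> is \<mu> and
  \<open>Im h\<close> is \<sigma>.\<close>

definition sG :: "(nat \<Rightarrow> state) \<Rightarrow> laurent fps" where
  "sG X = sM X * sZ1 X + fps_X * rho (fps_const (crit1 b) + sZ1 X) (fps_const (crit2 b) + sZ2 X) (sM X)"
definition sH1 :: "(nat \<Rightarrow> state) \<Rightarrow> laurent fps" where
  "sH1 X = - (sS X * fmlt cD (sZ1 X))"
definition sH2 :: "(nat \<Rightarrow> state) \<Rightarrow> laurent fps" where
  "sH2 X = - (sS X * fmlt cD (sZ2 X))"

text \<open>
  The solvability condition at the critical mode \<open>(1, 1)\<close> reads \<open>\<mu> + h = \<sigma> (\<i> - 1)\<close>, with real \<open>\<sigma>\<close> and \<open>\<mu>\<close>.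
\<close>

definition solv :: "laurent \<Rightarrow> laurent \<Rightarrow> laurent \<Rightarrow> complex" where
  "solv g h1 h2 = coef g (1, 1) + ((2 + \<i>) * coef h1 (1, 1) + coef h2 (1, 1)) / (1 + \<i>)"

definition rhs1 :: "laurent \<Rightarrow> laurent \<Rightarrow> laurent \<Rightarrow> laurent" where
  "rhs1 g h1 h2 = (let h = solv g h1 h2 in
     cst (- Re h - Im h) * crit1 b + g - cst (Im h) * mlt cD (crit1 b) + h1)"
definition rhs2 :: "laurent \<Rightarrow> laurent \<Rightarrow> laurent \<Rightarrow> laurent" where
  "rhs2 g h1 h2 = (let h = solv g h1 h2 in
     - (cst (- Re h - Im h) * crit1 b + g) - cst (Im h) * mlt cD (crit2 b) + h2)"

definition step :: "(nat \<Rightarrow> state) \<Rightarrow> nat \<Rightarrow> state" where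
  "step X j = (let g = fps_nth (sG X) j; h1 = fps_nth (sH1 X) j; h2 = fps_nth (sH2 X) j;
       h = solv g h1 h2; r1 = rhs1 g h1 h2; r2 = rhs2 g h1 h2
     in (mlt k11 r1 + mlt k12 r2, mlt k21 r1 + mlt k22 r2, Im h, - Re h - Im h))"

lemma s_zero: "fps_nth (sZ1 X) 0 = 0" "fps_nth (sZ2 X) 0 = 0" "fps_nth (sS X) 0 = 0" "fps_nth (sM X) 0 = 0"
  by (simp_all add: sZ1_def sZ2_def sS_def sM_def)

text \<open>Every product entering \<open>step\<close> either has two factors without constant term
  or carries a factor \<open>fps_X\<close>, so order j never reads itself.\<close>

lemma step_guarded:
  assumes "\<And>i. i < j \<Longrightarrow> X i = Y i"
  shows "step X j = step Y j"
proof -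
  have a: "fps_nth (sZ1 X) i = fps_nth (sZ1 Y) i" "fps_nth (sZ2 X) i = fps_nth (sZ2 Y) i"
    "fps_nth (sS X) i = fps_nth (sS Y) i" "fps_nth (sM X) i = fps_nth (sM Y) i" if "i < j" for i
    using assms[OF that] by (simp_all add: sZ1_def sZ2_def sS_def sM_def)
  have z: "fps_nth (fmlt cD (sZ1 X)) 0 = 0" "fps_nth (fmlt cD (sZ2 X)) 0 = 0" for X by (simp_all add: s_zero)
  have d: "fps_nth (fmlt cD (sZ1 X)) i = fps_nth (fmlt cD (sZ1 Y)) i" "fps_nth (fmlt cD (sZ2 X)) i = fps_nth (fmlt cD (sZ2 Y)) i"
    if "i < j" for i using a[OF that] by simp_all
  have 1: "fps_nth (sM X * sZ1 X) j = fps_nth (sM Y * sZ1 Y) j"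
    by (rule fps_mult_agree_0[OF a(4) a(1)]) (simp_all add: s_zero)
  have 2: "fps_nth (sH1 X) j = fps_nth (sH1 Y) j" unfolding sH1_def fps_neg_nth
    by (rule arg_cong[where f = uminus], rule fps_mult_agree_0[OF a(3) d(1)]) (simp_all add: s_zero z)
  have 3: "fps_nth (sH2 X) j = fps_nth (sH2 Y) j" unfolding sH2_def fps_neg_nth
    by (rule arg_cong[where f = uminus], rule fps_mult_agree_0[OF a(3) d(2)]) (simp_all add: s_zero z)
  have 4: "fps_nth (fps_X * rho (fps_const (crit1 b) + sZ1 X) (fps_const (crit2 b) + sZ2 X) (sM X)) j =
      fps_nth (fps_X * rho (fps_const (crit1 b) + sZ1 Y) (fps_const (crit2 b) + sZ2 Y) (sM Y)) j"
  proof (cases j)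
    case (Suc n)
    have "fps_nth (rho (fps_const (crit1 b) + sZ1 X) (fps_const (crit2 b) + sZ2 X) (sM X)) n =
      fps_nth (rho (fps_const (crit1 b) + sZ1 Y) (fps_const (crit2 b) + sZ2 Y) (sM Y)) n"
      by (rule rho_agree) (use a Suc in simp_all)
    then show ?thesis using Suc by simp
  qed simp
  have "fps_nth (sG X) j = fps_nth (sG Y) j" unfolding sG_def fps_add_nth 1 4 by (rule refl)
  with 2 3 show ?thesis by (simp add: step_def)
qed

definition sol :: "nat \<Rightarrow> state" where "sol = (SOME X. \<forall>j. X j = step X j)"

lemma sol: "sol j = step sol j"
proof -
  have "\<forall>j. sol j = step sol j" unfolding sol_def
    by (rule someI_ex[OF guarded_fixpoint]) (rule step_guarded)
  then show ?thesis by blast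
qed

text \<open>Time derivatives of the new corrections are bounded as well, because they reappear in
  \<open>sH1\<close> and \<open>sH2\<close> at later orders. In the constant, 4 * 360 comes from the
  two corrections and their derivatives and 9 from \<sigma> and \<mu>; the rest is slack.\<close>

lemma nrm_step:
  defines "C0 \<equiv> 1 + nrm (crit1 b) + nrm (mlt cD (crit1 b)) + nrm (mlt cD (crit2 b))"
  shows "nrm (mlt k11 (rhs1 g h1 h2) + mlt k12 (rhs2 g h1 h2)) + nrm (mlt k21 (rhs1 g h1 h2) + mlt k22 (rhs2 g h1 h2))
    + nrm (mlt cD (mlt k11 (rhs1 g h1 h2) + mlt k12 (rhs2 g h1 h2))) + nrm (mlt cD (mlt k21 (rhs1 g h1 h2) + mlt k22 (rhs2 g h1 h2)))
    + \<bar>Im (solv g h1 h2)\<bar> + \<bar>- Re (solv g h1 h2) - Im (solv g h1 h2)\<bar> \<le> 2000 * C0 * (nrm g + nrm h1 + nrm h2)"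
proof -
  define h r1 r2 R where "h = solv g h1 h2" and "r1 = rhs1 g h1 h2" and "r2 = rhs2 g h1 h2" and "R = nrm g + nrm h1 + nrm h2"
  have R0: "0 \<le> R" by (simp add: R_def)
  have C0: "1 \<le> C0" by (simp add: C0_def)
  have h: "cmod h \<le> 3 * R"
  proof -
    have i: "cmod (2 + \<i>) \<le> 3" using norm_triangle_ineq[of 2 \<i>] by simp
    have "1 \<le> cmod (1 + \<i>)" using abs_Re_le_cmod[of "1 + \<i>"] by simp
    then have "cmod (z / (1 + \<i>)) \<le> cmod z" for z by (simp add: norm_divide divide_le_eq mult_left_le_one_le mult_le_cancel_left1)
    then have h1: "cmod h \<le> cmod (coef g (1, 1)) + cmod ((2 + \<i>) * coef h1 (1, 1) + coef h2 (1, 1))"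
      unfolding h_def solv_def by (meson add_left_mono norm_triangle_ineq order_trans)
    have h2: "cmod ((2 + \<i>) * coef h1 (1, 1) + coef h2 (1, 1)) \<le> 3 * cmod (coef h1 (1, 1)) + cmod (coef h2 (1, 1))"
      using norm_triangle_ineq[of "(2 + \<i>) * coef h1 (1, 1)" "coef h2 (1, 1)"] mult_right_mono[OF i, of "cmod (coef h1 (1, 1))"]
      by (simp add: norm_mult)
    have arith: "x \<le> 3 * (p + q + r)" if "x \<le> a + w" "w \<le> 3 * b + c" "a \<le> p" "b \<le> q" "c \<le> r" "0 \<le> p" "0 \<le> r"
      for x a w b c p q r :: real using that by (simp add: distrib_left)
    show ?thesis unfolding R_def
      by (rule arith[OF h1 h2 coef_le_nrm coef_le_nrm coef_le_nrm nrm_nonneg nrm_nonneg])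
  qed
  have hs: "\<bar>Im h\<bar> \<le> 3 * R" "\<bar>- Re h - Im h\<bar> \<le> 6 * R"
    using h abs_Re_le_cmod[of h] abs_Im_le_cmod[of h] by linarith+
  have cm: "nrm (cst c * p) \<le> \<bar>c\<bar> * nrm p" for c p using nrm_mult[of "cst c" p] by (simp add: nrm_cst)
  have "nrm r1 \<le> nrm (cst (- Re h - Im h) * crit1 b) + nrm g + nrm (cst (Im h) * mlt cD (crit1 b)) + nrm h1"
    unfolding r1_def rhs1_def Let_def h_def[symmetric]
    by (intro order_trans[OF nrm_add] order_trans[OF nrm_diff] add_mono order_refl)
  also have "\<dots> \<le> 6 * R * nrm (crit1 b) + nrm g + 3 * R * nrm (mlt cD (crit1 b)) + nrm h1"
    by (intro add_mono order_refl order_trans[OF cm] mult_right_mono hs nrm_nonneg)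
  also have "\<dots> \<le> 10 * C0 * R"
  proof -
    have "nrm g + nrm h1 \<le> R" by (simp add: R_def)
    moreover have "0 \<le> R * nrm (crit1 b)" "0 \<le> R * nrm (mlt cD (crit1 b))" "0 \<le> R * nrm (mlt cD (crit2 b))" using R0 by simp_all
    moreover have "10 * C0 * R = 10 * R + 10 * (R * nrm (crit1 b)) + 10 * (R * nrm (mlt cD (crit1 b))) + 10 * (R * nrm (mlt cD (crit2 b)))"
      by (simp add: C0_def algebra_simps)
    ultimately show ?thesis using R0 unfolding mult.assoc by linarith
  qed
  finally have r1: "nrm r1 \<le> 10 * C0 * R" .
  have "nrm r2 \<le> nrm (cst (- Re h - Im h) * crit1 b) + nrm g + nrm (cst (Im h) * mlt cD (crit2 b)) + nrm h2"
    unfolding r2_def rhs2_def Let_def h_def[symmetric]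
    by (intro order_trans[OF nrm_add] order_trans[OF nrm_diff] add_mono order_refl) (subst nrm_uminus, rule nrm_add)
  also have "\<dots> \<le> 6 * R * nrm (crit1 b) + nrm g + 3 * R * nrm (mlt cD (crit2 b)) + nrm h2"
    by (intro add_mono order_refl order_trans[OF cm] mult_right_mono hs nrm_nonneg)
  also have "\<dots> \<le> 10 * C0 * R"
  proof -
    have "nrm g + nrm h2 \<le> R" by (simp add: R_def)
    moreover have "0 \<le> R * nrm (crit1 b)" "0 \<le> R * nrm (mlt cD (crit1 b))" "0 \<le> R * nrm (mlt cD (crit2 b))" using R0 by simp_all
    moreover have "10 * C0 * R = 10 * R + 10 * (R * nrm (crit1 b)) + 10 * (R * nrm (mlt cD (crit1 b))) + 10 * (R * nrm (mlt cD (crit2 b)))"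
      by (simp add: C0_def algebra_simps)
    ultimately show ?thesis using R0 unfolding mult.assoc by linarith
  qed
  finally have r2: "nrm r2 \<le> 10 * C0 * R" .
  have "nrm (mlt c p + mlt c' p') \<le> 18 * nrm p + 18 * nrm p'" "nrm (mlt cD (mlt c p + mlt c' p')) \<le> 18 * nrm p + 18 * nrm p'"
    if "c \<in> {k11, k12, k21, k22}" "c' \<in> {k11, k12, k21, k22}" for c c' p p'
    unfolding mlt_add by (intro order_trans[OF nrm_add] add_mono nrm_kernel that)+
  from this[of k11 k12 r1 r2] this[of k21 k22 r1 r2] r1 r2
  have "nrm (mlt k11 r1 + mlt k12 r2) \<le> 360 * (C0 * R)" "nrm (mlt k21 r1 + mlt k22 r2) \<le> 360 * (C0 * R)"
    "nrm (mlt cD (mlt k11 r1 + mlt k12 r2)) \<le> 360 * (C0 * R)" "nrm (mlt cD (mlt k21 r1 + mlt k22 r2)) \<le> 360 * (C0 * R)"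
    by auto
  moreover have "R \<le> C0 * R" using mult_right_mono[OF C0 R0] by simp
  ultimately show ?thesis using hs R0 unfolding h_def[symmetric] r1_def[symmetric] r2_def[symmetric] R_def[symmetric] mult.assoc
    by linarith
qed

end

definition fZ1 where "fZ1 b = sZ1 (sol b)"
definition fZ2 where "fZ2 b = sZ2 (sol b)"
definition fS where "fS b = sS (sol b)"
definition fM where "fM b = sM (sol b)"
definition fV1 where "fV1 b = fps_const (crit1 b) + fZ1 b"
definition fV2 where "fV2 b = fps_const (crit2 b) + fZ2 b"

definition sig :: "bool \<Rightarrow> nat \<Rightarrow> real" where
  "sig b j = (if j = 0 then 0 else fst (snd (snd (sol b j))))"
definition mu :: "bool \<Rightarrow> nat \<Rightarrow> real" where
  "mu b j = (if j = 0 then 0 else snd (snd (snd (sol b j))))"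

lemma fS_nth: "fps_nth (fS b) j = cst (sig b j)"
  by (simp add: fS_def sS_def sig_def)

lemma fM_nth: "fps_nth (fM b) j = cst (mu b j)"
  by (simp add: fM_def sM_def mu_def)

lemma f_zero: "fps_nth (fZ1 b) 0 = 0" "fps_nth (fZ2 b) 0 = 0" "fps_nth (fS b) 0 = 0" "fps_nth (fM b) 0 = 0"
  by (simp_all add: fZ1_def fZ2_def fS_def fM_def s_zero)

definition fG where "fG b = fM b * fZ1 b + fps_X * rho (fV1 b) (fV2 b) (fM b)"
definition fH1 where "fH1 b = - (fS b * fmlt cD (fZ1 b))"
definition fH2 where "fH2 b = - (fS b * fmlt cD (fZ2 b))"

definition g_solv where "g_solv b j = solv (fps_nth (fG b) j) (fps_nth (fH1 b) j) (fps_nth (fH2 b) j)"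
definition g_rhs1 where "g_rhs1 b j = rhs1 b (fps_nth (fG b) j) (fps_nth (fH1 b) j) (fps_nth (fH2 b) j)"
definition g_rhs2 where "g_rhs2 b j = rhs2 b (fps_nth (fG b) j) (fps_nth (fH1 b) j) (fps_nth (fH2 b) j)"

lemma sol_nth:
  assumes "0 < j"
  shows "fps_nth (fZ1 b) j = mlt k11 (g_rhs1 b j) + mlt k12 (g_rhs2 b j)"
    "fps_nth (fZ2 b) j = mlt k21 (g_rhs1 b j) + mlt k22 (g_rhs2 b j)"
    "sig b j = Im (g_solv b j)" "mu b j = - Re (g_solv b j) - Im (g_solv b j)"
proof -
  have G: "sG b (sol b) = fG b" "sH1 (sol b) = fH1 b" "sH2 (sol b) = fH2 b"
    by (simp_all add: sG_def sH1_def sH2_def fG_def fH1_def fH2_def fZ1_def fZ2_def fS_def fM_def fV1_def fV2_def)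
  have "sol b j = (mlt k11 (g_rhs1 b j) + mlt k12 (g_rhs2 b j), mlt k21 (g_rhs1 b j) + mlt k22 (g_rhs2 b j),
      Im (g_solv b j), - Re (g_solv b j) - Im (g_solv b j))"
    by (subst sol) (simp add: step_def Let_def G g_solv_def g_rhs1_def g_rhs2_def)
  then show "fps_nth (fZ1 b) j = mlt k11 (g_rhs1 b j) + mlt k12 (g_rhs2 b j)"
    "fps_nth (fZ2 b) j = mlt k21 (g_rhs1 b j) + mlt k22 (g_rhs2 b j)"
    "sig b j = Im (g_solv b j)" "mu b j = - Re (g_solv b j) - Im (g_solv b j)"
    using assms by (simp_all add: fZ1_def fZ2_def sZ1_def sZ2_def sig_def mu_def)
qed

lemma g_rhs_eq:
  assumes "0 < j"
  shows "g_rhs1 b j = cst (mu b j) * crit1 b + fps_nth (fG b) j - cst (sig b j) * mlt cD (crit1 b) + fps_nth (fH1 b) j"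
    "g_rhs2 b j = - (cst (mu b j) * crit1 b + fps_nth (fG b) j) - cst (sig b j) * mlt cD (crit2 b) + fps_nth (fH2 b) j"
  using sol_nth(3,4)[OF assms, of b] by (simp_all add: g_rhs1_def g_rhs2_def rhs1_def rhs2_def g_solv_def Let_def)

lemma one_laurent: "(1 :: laurent) = cst 1"
  by (simp add: cst_def)

section \<open>Symmetry and solvability along the recursion\<close>

lemma adm_numeral: "adm b (numeral n)"
proof -
  have "adm b (of_nat m)" for m
  proof (induction m)
    case 0
    then show ?case by (simp add: adm_0)
  next
    case (Suc m)
    then show ?case using adm_add[OF adm_cst[of b 1]] by (simp add: one_laurent)
  qed
  from this[of "numeral n"] show ?thesis by simp
qed

lemma cst_add: "cst (a + c) = cst a + cst c"
  by (rule poly_mapping_eqI) (simp add: coef_cst lookup_add)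

lemma numeral_laurent: "(numeral n :: laurent) = cst (numeral n)"
proof -
  have "(of_nat m :: laurent) = cst (of_nat m)" for m
    by (induction m) (simp_all add: one_laurent cst_add)
  from this[of "numeral n"] show ?thesis by simp
qed

lemma coef_mult_cst [simp]: "coef (p * cst c) q = of_real c * coef p q"
  by (simp add: mult.commute[of p])

definition admf :: "bool \<Rightarrow> nat \<Rightarrow> laurent fps \<Rightarrow> bool" where
  "admf b n F \<longleftrightarrow> (\<forall>i\<le>n. adm b (fps_nth F i))"

lemma admf_mult: "admf b n F \<Longrightarrow> admf b n G \<Longrightarrow> admf b n (F * G)"
  unfolding admf_def fps_mult_nth by (auto intro!: adm_sum adm_mult)

lemma admf_add: "admf b n F \<Longrightarrow> admf b n G \<Longrightarrow> admf b n (F + G)"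
  by (simp add: admf_def adm_add)

lemma admf_numeral: "admf b n (numeral m)"
  by (simp add: admf_def fps_numeral_nth adm_numeral adm_0)

lemma admf_const: "adm b c \<Longrightarrow> admf b n (fps_const c)"
  by (simp add: admf_def adm_0)

lemma admf_X: "admf b n fps_X"
  using adm_cst[of b 1] by (simp add: admf_def fps_X_def adm_0 one_laurent)

lemma admf_rho: "admf b n V1 \<Longrightarrow> admf b n V2 \<Longrightarrow> admf b n M \<Longrightarrow> admf b n (rho V1 V2 M)"
  unfolding rho_def by (intro admf_add admf_mult admf_numeral admf_X)

lemma adm_fZ: "adm b (fps_nth (fZ1 b) j) \<and> adm b (fps_nth (fZ2 b) j)"
proof (induction j rule: less_induct)
  case (less j)
  show ?case
  proof (cases j)
    case 0
    then show ?thesis by (simp add: f_zero adm_0)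
  next
    case (Suc n)
    have aM: "admf b n (fM b)" for n by (simp add: admf_def fM_nth adm_cst)
    have aV: "admf b n (fV1 b)" "admf b n (fV2 b)" using less Suc
      unfolding fV1_def fV2_def by (intro admf_add admf_const adm_crit; simp add: admf_def)+
    have "adm b (fps_nth (rho (fV1 b) (fV2 b) (fM b)) n)"
      using admf_rho[OF aV aM] by (simp add: admf_def)
    then have X: "adm b (fps_nth (fps_X * rho (fV1 b) (fV2 b) (fM b)) j)" using Suc by simp
    \<comment> \<open>Order j of G could occur only for i = 0, and there F vanishes.\<close>
    have p: "adm b (fps_nth F i * fps_nth G (j - i))"
      if "\<And>i. adm b (fps_nth F i)" "fps_nth F 0 = 0" "\<And>i. i < j \<Longrightarrow> adm b (fps_nth G i)" for F G i
      using that Suc by (cases "i = 0") (auto intro!: adm_mult simp: adm_0)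
    have c: "adm b (fps_nth (fM b) i)" "adm b (fps_nth (fS b) i)" for i by (simp_all add: fM_nth fS_nth adm_cst)
    have eq: "equivariant cD" by (rule equivariant_kernels)
    have "adm b (fps_nth (fM b * fZ1 b) j)" unfolding fps_mult_nth
      by (intro adm_sum p c f_zero) (use less in auto)
    with X have G: "adm b (fps_nth (fG b) j)" by (simp add: fG_def adm_add)
    have "adm b (fps_nth (fS b * fmlt cD (fZ1 b)) j)" "adm b (fps_nth (fS b * fmlt cD (fZ2 b)) j)" unfolding fps_mult_nth
      by (intro adm_sum p c f_zero; use less adm_mlt[OF eq] in auto)+
    then have H: "adm b (fps_nth (fH1 b) j)" "adm b (fps_nth (fH2 b) j)" by (simp_all add: fH1_def fH2_def adm_uminus)
    have r: "adm b (g_rhs1 b j)" "adm b (g_rhs2 b j)"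
      unfolding g_rhs1_def g_rhs2_def rhs1_def rhs2_def Let_def
      by (intro adm_add adm_diff adm_uminus adm_mult adm_cst adm_mlt eq adm_crit G H)+
    show ?thesis using sol_nth(1,2)[of j b] Suc r equivariant_kernels by (simp add: adm_add adm_mlt)
  qed
qed

lemma adm_fV: "adm b (fps_nth (fV1 b) j)" "adm b (fps_nth (fV2 b) j)"
  using adm_fZ[of b j] adm_crit[of b] by (simp_all add: fV1_def fV2_def adm_add adm_0)

lemma adm_rhs: "adm b (g_rhs1 b j)" "adm b (g_rhs2 b j)"
proof -
  have c: "admf b n (fM b)" "admf b n (fS b)" for n by (simp_all add: admf_def fM_nth fS_nth adm_cst)
  have v: "admf b n (fV1 b)" "admf b n (fV2 b)" "admf b n (fZ1 b)" "admf b n (fZ2 b)" for n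
    by (simp_all add: admf_def adm_fV adm_fZ)
  have d: "admf b n (fmlt cD (fZ1 b))" "admf b n (fmlt cD (fZ2 b))" for n
    by (simp_all add: admf_def adm_fZ adm_mlt equivariant_kernels)
  have "admf b j (fG b)" unfolding fG_def by (intro admf_add admf_mult admf_X admf_rho c v)
  moreover have "admf b j (fS b * fmlt cD (fZ1 b))" "admf b j (fS b * fmlt cD (fZ2 b))" by (intro admf_mult c d)+
  ultimately have gh: "adm b (fps_nth (fG b) j)" "adm b (fps_nth (fH1 b) j)" "adm b (fps_nth (fH2 b) j)"
    by (simp_all add: admf_def fH1_def fH2_def adm_uminus)
  then show "adm b (g_rhs1 b j)" "adm b (g_rhs2 b j)"
    unfolding g_rhs1_def g_rhs2_def rhs1_def rhs2_def Let_def
    by (intro adm_add adm_diff adm_uminus adm_mult adm_cst adm_mlt equivariant_kernels adm_crit gh)+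
qed

text \<open>Here the symmetry class pays off: among the four critical modes its members have a
  single free complex coefficient, the others following by conjugation, reflection or
  vanishing.\<close>

lemma adm_crit_zero:
  assumes p: "adm b p" and 0: "coef p (1, 1) = 0" and q: "crit q"
  shows "coef p q = 0"
proof -
  have 1: "coef p (-1, -1) = 0" using admD(1)[OF p, of "(1, 1)"] 0 by simp
  have 2: "coef p (1, -1) = 0"
    using admD(2)[OF p, of "(1, -1)"] admD(3)[OF p, of "(1, 1)"] 0 by (cases b) simp_all
  have 3: "coef p (-1, 1) = 0" using admD(1)[OF p, of "(1, -1)"] 2 by simp
  have "fst q = 1 \<or> fst q = -1" "snd q = 1 \<or> snd q = -1" using q unfolding crit_def by linarith+
  then have "q \<in> {(1, 1), (-1, -1), (1, -1), (-1, 1)}" by (auto simp: prod_eq_iff)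
  with 0 1 2 3 show ?thesis by auto
qed

text \<open>The row (2 + cD, 1) annihilates the symbol matrix at a critical mode, because cD^2 = -1
  there. By symmetry the condition has to be checked at (1, 1) only, and there it is the equation by
  which \<sigma> and \<mu> were chosen.\<close>

lemma solvability:
  assumes "0 < j" "crit q"
  shows "coef (g_rhs2 b j) q + (2 + cD q) * coef (g_rhs1 b j) q = 0"
proof -
  define h where "h = g_solv b j"
  define p where "p = g_rhs2 b j + cst 2 * g_rhs1 b j + mlt cD (g_rhs1 b j)"
  have p: "adm b p" unfolding p_def by (intro adm_add adm_mult adm_mlt adm_cst adm_rhs equivariant_kernels)
  have E: "coef (crit1 b) (1, 1) = 1" "coef (crit2 b) (1, 1) = \<i> - 2" "cD (1, 1) = \<i>"
    by (simp_all add: crit2_def coef_crit1 cD_def)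
  define g h1 h2 where "g = coef (fps_nth (fG b) j) (1, 1)" and "h1 = coef (fps_nth (fH1 b) j) (1, 1)" and "h2 = coef (fps_nth (fH2 b) j) (1, 1)"
  have nz: "1 + \<i> \<noteq> 0" by (simp add: complex_eq_iff)
  have h: "(1 + \<i>) * h = (1 + \<i>) * g + ((2 + \<i>) * h1 + h2)"
    using nz by (simp add: h_def g_solv_def solv_def g_def h1_def h2_def field_simps)
  have hh: "h = of_real (Re h) + \<i> * of_real (Im h)" by (simp add: complex_eq_iff)
  have m: "mu b j = - Re h - Im h" "sig b j = Im h" using sol_nth(3,4)[OF assms(1)] by (simp_all add: h_def)
  have "coef p (1, 1) = (1 + \<i>) * (of_real (mu b j) + g) + 2 * of_real (sig b j) + ((2 + \<i>) * h1 + h2)"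
    unfolding p_def g_rhs_eq[OF assms(1)]
    by (simp add: lookup_add lookup_minus E g_def[symmetric] h1_def[symmetric] h2_def[symmetric])
      (simp add: algebra_simps)
  also have "\<dots> = (1 + \<i>) * (of_real (mu b j) + h) + 2 * of_real (sig b j)"
    using h by (simp add: algebra_simps)
  also have "\<dots> = 0" unfolding m by (subst (3) hh) (simp add: complex_eq_iff)
  finally have "coef p q = 0" by (rule adm_crit_zero[OF p _ assms(2)])
  then show ?thesis by (simp add: p_def lookup_add algebra_simps)
qed

lemma cX_crit: "crit q \<Longrightarrow> cX q = -1"
proof -
  assume "crit q"
  then have "snd q = 1 \<or> snd q = -1" unfolding crit_def by linarith
  then show ?thesis by (auto simp: cX_def)
qed

lemma cD_crit: "crit q \<Longrightarrow> cD q * cD q = -1"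
proof -
  assume "crit q"
  then have "fst q = 1 \<or> fst q = -1" unfolding crit_def by linarith
  then show ?thesis by (auto simp: cD_def)
qed

text \<open>Off the critical modes the kernels form the adjugate matrix over the determinant. At a
  critical mode the partial inverse returns (0, - r1): the first row then holds by construction and
  the second by \<open>solvability\<close>.\<close>

lemma linear_rows:
  assumes "0 < j"
  shows "mlt cD (fps_nth (fZ1 b) j) - 2 * mlt cX (fps_nth (fZ1 b) j) - 4 * fps_nth (fZ1 b) j - fps_nth (fZ2 b) j = g_rhs1 b j"
    "mlt cD (fps_nth (fZ2 b) j) - mlt cX (fps_nth (fZ2 b) j) + 5 * fps_nth (fZ1 b) j + fps_nth (fZ2 b) j = g_rhs2 b j"
proof -
  define r1 r2 where "r1 = g_rhs1 b j" and "r2 = g_rhs2 b j"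
  have rows: "(cD q - 4 - 2 * cX q) * (k11 q * coef r1 q + k12 q * coef r2 q) - (k21 q * coef r1 q + k22 q * coef r2 q) = coef r1 q"
    "5 * (k11 q * coef r1 q + k12 q * coef r2 q) + (cD q + 1 - cX q) * (k21 q * coef r1 q + k22 q * coef r2 q) = coef r2 q" for q
  proof (atomize (full), cases "crit q")
    case True
    have s: "coef r2 q = - ((2 + cD q) * coef r1 q)"
      using solvability[OF assms True, of b] by (simp add: r1_def r2_def add_eq_0_iff2)
    then show "(cD q - 4 - 2 * cX q) * (k11 q * coef r1 q + k12 q * coef r2 q) - (k21 q * coef r1 q + k22 q * coef r2 q) = coef r1 q \<and>
      5 * (k11 q * coef r1 q + k12 q * coef r2 q) + (cD q + 1 - cX q) * (k21 q * coef r1 q + k22 q * coef r2 q) = coef r2 q"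
      using True by (simp add: s k11_def k12_def k21_def k22_def cX_crit algebra_simps)
  next
    case False
    define A B D where "A = cD q - 4 - 2 * cX q" and "B = cD q + 1 - cX q" and "D = mode_det q"
    have D: "D \<noteq> 0" "D = A * B + 5" using mode_det_nonzero[OF False] by (simp_all add: A_def B_def D_def mode_det_def)
    have k: "k11 q = B / D" "k12 q = 1 / D" "k21 q = -5 / D" "k22 q = A / D"
      using False by (simp_all add: k11_def k12_def k21_def k22_def A_def B_def D_def)
    have "A * (B * x + y) - (- 5 * x + A * y) = D * x" "5 * (B * x + y) + B * (- 5 * x + A * y) = D * y" for x y
      by (simp_all add: D(2) algebra_simps)
    then have "(A * (B * x + y) - (- 5 * x + A * y)) / D = x" "(5 * (B * x + y) + B * (- 5 * x + A * y)) / D = y" for x y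
      using D(1) by simp_all
    then show "(cD q - 4 - 2 * cX q) * (k11 q * coef r1 q + k12 q * coef r2 q) - (k21 q * coef r1 q + k22 q * coef r2 q) = coef r1 q \<and>
      5 * (k11 q * coef r1 q + k12 q * coef r2 q) + (cD q + 1 - cX q) * (k21 q * coef r1 q + k22 q * coef r2 q) = coef r2 q"
      unfolding k A_def[symmetric] B_def[symmetric]
      by (metis (no_types, lifting) add_divide_distrib diff_divide_distrib mult_1 times_divide_eq_left times_divide_eq_right)
  qed
  show "mlt cD (fps_nth (fZ1 b) j) - 2 * mlt cX (fps_nth (fZ1 b) j) - 4 * fps_nth (fZ1 b) j - fps_nth (fZ2 b) j = g_rhs1 b j"
    unfolding sol_nth(1,2)[OF assms] r1_def[symmetric] r2_def[symmetric] numeral_laurent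
  proof (rule poly_mapping_eqI)
    fix q
    show "coef (mlt cD (mlt k11 r1 + mlt k12 r2) - cst 2 * mlt cX (mlt k11 r1 + mlt k12 r2) - cst 4 * (mlt k11 r1 + mlt k12 r2) - (mlt k21 r1 + mlt k22 r2)) q = coef r1 q"
      using rows(1)[of q] by (simp add: lookup_add lookup_minus) (simp add: algebra_simps)?
  qed
  show "mlt cD (fps_nth (fZ2 b) j) - mlt cX (fps_nth (fZ2 b) j) + 5 * fps_nth (fZ1 b) j + fps_nth (fZ2 b) j = g_rhs2 b j"
    unfolding sol_nth(1,2)[OF assms] r1_def[symmetric] r2_def[symmetric] numeral_laurent
  proof (rule poly_mapping_eqI)
    fix q
    show "coef (mlt cD (mlt k21 r1 + mlt k22 r2) - mlt cX (mlt k21 r1 + mlt k22 r2) + cst 5 * (mlt k11 r1 + mlt k12 r2) + (mlt k21 r1 + mlt k22 r2)) q = coef r2 q"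
      using rows(2)[of q] by (simp add: lookup_add lookup_minus) (simp add: algebra_simps)?
  qed
qed

lemma crit_rows:
  "mlt cD (crit1 b) = 2 * mlt cX (crit1 b) + 4 * crit1 b + crit2 b"
  "mlt cD (crit2 b) = mlt cX (crit2 b) - 5 * crit1 b - crit2 b"
proof -
  show "mlt cD (crit1 b) = 2 * mlt cX (crit1 b) + 4 * crit1 b + crit2 b"
    "mlt cD (crit2 b) = mlt cX (crit2 b) - 5 * crit1 b - crit2 b"
    unfolding numeral_laurent crit2_def
    by (rule poly_mapping_eqI; simp add: lookup_add lookup_minus coef_crit1' cX_crit algebra_simps cD_crit)+
qed

lemma fmlt_fV: "fmlt c (fV1 b) = fps_const (mlt c (crit1 b)) + fmlt c (fZ1 b)"
  "fmlt c (fV2 b) = fps_const (mlt c (crit2 b)) + fmlt c (fZ2 b)"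
  by (simp_all add: fps_eq_iff fV1_def fV2_def mlt_add)

text \<open>Order zero is \<open>crit_rows\<close>; each higher order is \<open>linear_rows\<close>
  with the right-hand side written out.\<close>

lemma formal_equation1:
  "(1 + fS b) * fmlt cD (fV1 b) = 2 * fmlt cX (fV1 b) + (4 + fM b) * fV1 b + fV2 b + fps_X * rho (fV1 b) (fV2 b) (fM b)"
proof -
  let ?E1 = "fps_const (crit1 b)"
  have "fps_nth (fmlt cD (fV1 b) + fS b * fps_const (mlt cD (crit1 b)) + fS b * fmlt cD (fZ1 b)) j =
    fps_nth (2 * fmlt cX (fV1 b) + 4 * fV1 b + fV2 b + fM b * ?E1 + fM b * fZ1 b + fps_X * rho (fV1 b) (fV2 b) (fM b)) j" for j
  proof (cases "j = 0")
    case True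
    then show ?thesis using crit_rows(1)[of b]
      by (simp add: fmlt_fV fV1_def fV2_def f_zero numeral_fps_const fps_const_mult_left)
  next
    case False
    then have j: "0 < j" by simp
    have n: "fps_nth (numeral m * F) j = numeral m * fps_nth F j" for m and F :: "laurent fps"
      by (simp add: numeral_fps_const)
    have "mlt cD (fps_nth (fZ1 b) j) + cst (sig b j) * mlt cD (crit1 b) - fps_nth (fH1 b) j
        = 2 * mlt cX (fps_nth (fZ1 b) j) + 4 * fps_nth (fZ1 b) j + fps_nth (fZ2 b) j + cst (mu b j) * crit1 b + fps_nth (fG b) j"
      using linear_rows(1)[OF j, of b] unfolding g_rhs_eq[OF j] by (simp add: algebra_simps)
    then show ?thesis using j
      by (simp add: fmlt_fV fV1_def fV2_def n distrib_left fps_numeral_nth fH1_def fG_def fS_nth fM_nth del: fps_X_mult_nth)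
        (simp add: algebra_simps)?
  qed
  then have "fmlt cD (fV1 b) + fS b * fps_const (mlt cD (crit1 b)) + fS b * fmlt cD (fZ1 b) =
    2 * fmlt cX (fV1 b) + 4 * fV1 b + fV2 b + fM b * ?E1 + fM b * fZ1 b + fps_X * rho (fV1 b) (fV2 b) (fM b)"
    by (rule fps_ext)
  moreover have "(1 + fS b) * fmlt cD (fV1 b) = fmlt cD (fV1 b) + fS b * fps_const (mlt cD (crit1 b)) + fS b * fmlt cD (fZ1 b)"
    by (simp add: fmlt_fV algebra_simps)
  moreover have "(4 + fM b) * fV1 b = 4 * fV1 b + fM b * ?E1 + fM b * fZ1 b"
    by (simp add: fV1_def algebra_simps)
  ultimately show ?thesis by (simp add: algebra_simps)
qed

lemma formal_equation2:
  "(1 + fS b) * fmlt cD (fV2 b) = fmlt cX (fV2 b) - (5 + fM b) * fV1 b - fV2 b - fps_X * rho (fV1 b) (fV2 b) (fM b)"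
proof -
  let ?E1 = "fps_const (crit1 b)"
  have "fps_nth (fmlt cD (fV2 b) + fS b * fps_const (mlt cD (crit2 b)) + fS b * fmlt cD (fZ2 b)) j =
    fps_nth (fmlt cX (fV2 b) - 5 * fV1 b - fV2 b - fM b * ?E1 - fM b * fZ1 b - fps_X * rho (fV1 b) (fV2 b) (fM b)) j" for j
  proof (cases "j = 0")
    case True
    then show ?thesis using crit_rows(2)[of b]
      by (simp add: fmlt_fV fV1_def fV2_def f_zero numeral_fps_const fps_const_mult_left)
  next
    case False
    then have j: "0 < j" by simp
    have n: "fps_nth (numeral m * F) j = numeral m * fps_nth F j" for m and F :: "laurent fps"
      by (simp add: numeral_fps_const)
    have "mlt cD (fps_nth (fZ2 b) j) + cst (sig b j) * mlt cD (crit2 b) - fps_nth (fH2 b) j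
        = mlt cX (fps_nth (fZ2 b) j) - 5 * fps_nth (fZ1 b) j - fps_nth (fZ2 b) j - cst (mu b j) * crit1 b - fps_nth (fG b) j"
      using linear_rows(2)[OF j, of b] unfolding g_rhs_eq[OF j] by (simp add: algebra_simps)
    then show ?thesis using j
      by (simp add: fmlt_fV fV1_def fV2_def n distrib_left fps_numeral_nth fH2_def fG_def fS_nth fM_nth del: fps_X_mult_nth)
        (simp add: algebra_simps)?
  qed
  then have "fmlt cD (fV2 b) + fS b * fps_const (mlt cD (crit2 b)) + fS b * fmlt cD (fZ2 b) =
    fmlt cX (fV2 b) - 5 * fV1 b - fV2 b - fM b * ?E1 - fM b * fZ1 b - fps_X * rho (fV1 b) (fV2 b) (fM b)"
    by (rule fps_ext)
  moreover have "(1 + fS b) * fmlt cD (fV2 b) = fmlt cD (fV2 b) + fS b * fps_const (mlt cD (crit2 b)) + fS b * fmlt cD (fZ2 b)"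
    by (simp add: fmlt_fV algebra_simps)
  moreover have "(5 + fM b) * fV1 b = 5 * fV1 b + fM b * ?E1 + fM b * fZ1 b"
    by (simp add: fV1_def algebra_simps)
  ultimately show ?thesis by (simp add: algebra_simps)
qed

section \<open>Convergence of the formal series\<close>

lemma psum_rho:
  assumes r: "0 \<le> r" "r \<le> 1" and V: "psum r N V1 \<le> B" "psum r N V2 \<le> B" "psum r N M \<le> 1" and B: "1 \<le> B"
  shows "psum r N (rho V1 V2 M) \<le> 9 * B ^ 3"
proof -
  have B0: "0 \<le> B" using B by simp
  note nn = psum_nonneg[OF r(1)]
  have p12: "psum r N (V1 * V2) \<le> B * B"
    by (rule order_trans[OF psum_mult[OF r(1)]]) (intro mult_mono V nn B0)
  have p11: "psum r N (V1 * V1) \<le> B * B"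
    by (rule order_trans[OF psum_mult[OF r(1)]]) (intro mult_mono V nn B0)
  have p112: "psum r N (V1 * V1 * V2) \<le> B * B * B"
    by (rule order_trans[OF psum_mult[OF r(1)]]) (intro mult_mono V p11 nn mult_nonneg_nonneg B0)
  have M11: "psum r N (M * (V1 * V1)) \<le> 1 * (B * B)"
    by (rule order_trans[OF psum_mult[OF r(1)]]) (intro mult_mono V p11 nn mult_nonneg_nonneg B0 zero_le_one)
  have X: "psum r N (fps_X * (V1 * V1 * V2)) \<le> 1 * (B * B * B)"
    by (rule order_trans[OF psum_X_le[OF r(1)]]) (intro mult_mono r p112 nn zero_le_one)
  have "rho V1 V2 M = 2 * (V1 * V2) + (5 * (V1 * V1) + M * (V1 * V1)) + fps_X * (V1 * V1 * V2)"
    by (simp add: rho_def distrib_right)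
  then have "psum r N (rho V1 V2 M) \<le> 2 * (B * B) + (5 * (B * B) + 1 * (B * B)) + 1 * (B * B * B)"
    using p12 p11
    by (simp only:) (intro order_trans[OF psum_add[OF r(1)]] add_mono M11 X order_trans[OF psum_numeral_mult[OF r(1)]] mult_left_mono; simp)
  moreover have "B * B * 1 \<le> B * B * B" using B B0 by (intro mult_left_mono) auto
  ultimately show ?thesis by (simp add: power3_eq_cube)
qed

definition ysum where
  "ysum b r N = psum r N (fZ1 b) + psum r N (fZ2 b) + psum r N (fmlt cD (fZ1 b)) + psum r N (fmlt cD (fZ2 b))
     + psum r N (fS b) + psum r N (fM b)"

lemma ysum_step:
  assumes r: "0 \<le> r"
  shows "ysum b r N \<le> 2000 * (1 + nrm (crit1 b) + nrm (mlt cD (crit1 b)) + nrm (mlt cD (crit2 b))) *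
     (psum r N (fG b) + psum r N (fH1 b) + psum r N (fH2 b))"
proof -
  let ?C = "2000 * (1 + nrm (crit1 b) + nrm (mlt cD (crit1 b)) + nrm (mlt cD (crit2 b)))"
  have "nrm (fps_nth (fZ1 b) j) + nrm (fps_nth (fZ2 b) j) + nrm (mlt cD (fps_nth (fZ1 b) j)) + nrm (mlt cD (fps_nth (fZ2 b) j))
      + nrm (fps_nth (fS b) j) + nrm (fps_nth (fM b) j) \<le> ?C * (nrm (fps_nth (fG b) j) + nrm (fps_nth (fH1 b) j) + nrm (fps_nth (fH2 b) j))" for j
  proof (cases "j = 0")
    case True
    then show ?thesis by (simp add: f_zero)
  next
    case False
    then show ?thesis
      using nrm_step[of b "fps_nth (fG b) j" "fps_nth (fH1 b) j" "fps_nth (fH2 b) j"] sol_nth[of j b]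
      by (simp add: fS_nth fM_nth nrm_cst g_rhs1_def[symmetric] g_rhs2_def[symmetric] g_solv_def[symmetric])
  qed
  then have "(nrm (fps_nth (fZ1 b) j) + nrm (fps_nth (fZ2 b) j) + nrm (mlt cD (fps_nth (fZ1 b) j)) + nrm (mlt cD (fps_nth (fZ2 b) j))
      + nrm (fps_nth (fS b) j) + nrm (fps_nth (fM b) j)) * r ^ j \<le> ?C * (nrm (fps_nth (fG b) j) + nrm (fps_nth (fH1 b) j) + nrm (fps_nth (fH2 b) j)) * r ^ j" for j
    using r by (intro mult_right_mono) auto
  then have "(\<Sum>j\<le>N. (nrm (fps_nth (fZ1 b) j) + nrm (fps_nth (fZ2 b) j) + nrm (mlt cD (fps_nth (fZ1 b) j)) + nrm (mlt cD (fps_nth (fZ2 b) j))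
      + nrm (fps_nth (fS b) j) + nrm (fps_nth (fM b) j)) * r ^ j) \<le> (\<Sum>j\<le>N. ?C * (nrm (fps_nth (fG b) j) + nrm (fps_nth (fH1 b) j) + nrm (fps_nth (fH2 b) j)) * r ^ j)"
    by (rule sum_mono)
  then show ?thesis
    by (simp add: ysum_def psum_def distrib_right distrib_left sum.distrib sum_distrib_left mult.assoc)
qed

lemma convergence: "\<exists>r>0. \<exists>C. r \<le> 1 \<and> (\<forall>N. psum r N (fV1 b) \<le> C \<and> psum r N (fV2 b) \<le> C \<and> psum r N (fS b) \<le> C \<and> psum r N (fM b) \<le> C)"
proof -
  define D where "D = 2000 * (1 + nrm (crit1 b) + nrm (mlt cD (crit1 b)) + nrm (mlt cD (crit2 b)))"
  define B where "B = 1 + nrm (crit1 b) + nrm (crit2 b)"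
  define K where "K = 9 * B ^ 3"
  \<comment> \<open>These values balance the two contributions to D (3 \<eta>^2 + r K): each of them
    equals half of \<eta>.\<close>
  define \<eta> where "\<eta> = 1 / (6 * D)"
  define r where "r = 1 / (12 * D * D * K)"
  have D: "1 \<le> D" by (simp add: D_def)
  have B: "1 \<le> B" by (simp add: B_def)
  then have K: "1 \<le> K" using one_le_power[of B 3] unfolding K_def by linarith
  have eta: "0 < \<eta>" "\<eta> \<le> 1" using D by (simp_all add: \<eta>_def field_simps)
  have "1 * 1 * 1 * 1 \<le> 12 * D * D * K" using D K by (intro mult_mono) auto
  then have r: "0 < r" "r \<le> 1" by (auto simp: r_def divide_simps)
  have y: "ysum b r N \<le> \<eta>" for N
  \<comment> \<open>The majorant at N + 1 is at most a quadratic expression in the one at N, and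
    this expression maps the interval from 0 to \<eta> into itself.\<close>
  proof (induction N)
    case 0
    then show ?case using eta by (simp add: ysum_def psum_def f_zero)
  next
    case (Suc N)
    have r0: "0 \<le> r" using r by simp
    note nn = psum_nonneg[OF r0]
    let ?y = "ysum b r N"
    have y0: "0 \<le> ?y" by (simp add: ysum_def nn)
    have le: "psum r N F \<le> ?y" if "F \<in> {fZ1 b, fZ2 b, fmlt cD (fZ1 b), fmlt cD (fZ2 b), fS b, fM b}" for F
      using that nn unfolding ysum_def by (auto intro!: add_nonneg_nonneg simp: add_increasing add_increasing2)
    have pr: "psum r (Suc N) (F * G) \<le> \<eta> * \<eta>"
      if "F \<in> {fS b, fM b}" "G \<in> {fZ1 b, fmlt cD (fZ1 b), fmlt cD (fZ2 b)}" for F G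
    proof -
      have "psum r (Suc N) (F * G) \<le> psum r N F * psum r N G"
        using that by (intro psum_mult_0[OF r0]) (auto simp: f_zero)
      also have "\<dots> \<le> \<eta> * \<eta>"
        using that eta by (intro mult_mono order_trans[OF le Suc] nn) auto
      finally show ?thesis .
    qed
    have V: "psum r N (fV1 b) \<le> B" "psum r N (fV2 b) \<le> B"
    proof -
      have c: "psum r N (fps_const p) = nrm p" for p
      proof -
        have "(\<Sum>j\<le>N. nrm (fps_nth (fps_const p) j) * r ^ j) = (\<Sum>j\<in>{0}. nrm (fps_nth (fps_const p) j) * r ^ j)"
          by (rule sum.mono_neutral_right) auto
        then show ?thesis by (simp add: psum_def)
      qed
      have "psum r N (fZ1 b) \<le> 1" "psum r N (fZ2 b) \<le> 1" using le[of "fZ1 b"] le[of "fZ2 b"] Suc eta by auto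
      then show "psum r N (fV1 b) \<le> B" "psum r N (fV2 b) \<le> B"
        using psum_add[OF r0, of N "fps_const (crit1 b)" "fZ1 b"] psum_add[OF r0, of N "fps_const (crit2 b)" "fZ2 b"]
          nrm_nonneg[of "crit1 b"] nrm_nonneg[of "crit2 b"]
        unfolding fV1_def fV2_def c B_def by linarith+
    qed
    have "psum r N (rho (fV1 b) (fV2 b) (fM b)) \<le> K"
      unfolding K_def by (rule psum_rho[OF r0 r(2) V _ B]) (use le[of "fM b"] Suc eta in auto)
    then have X: "psum r (Suc N) (fps_X * rho (fV1 b) (fV2 b) (fM b)) \<le> r * K"
      using r0 by (simp add: psum_X mult_left_mono)
    have G: "psum r (Suc N) (fG b) \<le> \<eta> * \<eta> + r * K" unfolding fG_def
      by (rule order_trans[OF psum_add[OF r0]]) (intro add_mono pr X; simp)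
    have H: "psum r (Suc N) (fH1 b) \<le> \<eta> * \<eta>" "psum r (Suc N) (fH2 b) \<le> \<eta> * \<eta>"
      unfolding fH1_def fH2_def psum_uminus by (intro pr; simp)+
    have "ysum b r (Suc N) \<le> D * (psum r (Suc N) (fG b) + psum r (Suc N) (fH1 b) + psum r (Suc N) (fH2 b))"
      unfolding D_def by (rule ysum_step[OF r0])
    also have "\<dots> \<le> D * ((\<eta> * \<eta> + r * K) + \<eta> * \<eta> + \<eta> * \<eta>)"
      using D G H by (intro mult_left_mono add_mono) auto
    also have "\<dots> = \<eta>" using D K by (simp add: \<eta>_def r_def field_simps)
    finally show ?case .
  qed
  have "psum r N F \<le> B" if "F \<in> {fV1 b, fV2 b, fS b, fM b}" for F N
  proof -
    have r0: "0 \<le> r" using r by simp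
    note nn = psum_nonneg[OF r0]
    have le: "psum r N F \<le> 1" if "F \<in> {fZ1 b, fZ2 b, fS b, fM b}" for F
    proof -
      have "psum r N F \<le> ysum b r N"
        using that nn unfolding ysum_def by (auto intro!: add_nonneg_nonneg simp: add_increasing add_increasing2)
      then show ?thesis using y[of N] eta by simp
    qed
    have c: "psum r N (fps_const p) = nrm p" for p
    proof -
      have "(\<Sum>j\<le>N. nrm (fps_nth (fps_const p) j) * r ^ j) = (\<Sum>j\<in>{0}. nrm (fps_nth (fps_const p) j) * r ^ j)"
        by (rule sum.mono_neutral_right) auto
      then show ?thesis by (simp add: psum_def)
    qed
    have "psum r N (fZ1 b) \<le> 1" "psum r N (fZ2 b) \<le> 1" by (rule le; simp)+
    then have "psum r N (fV1 b) \<le> B" "psum r N (fV2 b) \<le> B"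
      using psum_add[OF r0, of N "fps_const (crit1 b)" "fZ1 b"] psum_add[OF r0, of N "fps_const (crit2 b)" "fZ2 b"]
        nrm_nonneg[of "crit1 b"] nrm_nonneg[of "crit2 b"]
      unfolding fV1_def fV2_def c B_def by linarith+
    with that le[of "fS b"] le[of "fM b"] B show ?thesis by auto
  qed
  with r show ?thesis by (intro exI[of _ r] conjI exI[of _ B]) auto
qed

section \<open>The second-order coefficient of the detuning\<close>

lemma coef_crit1_mult: "coef (crit1 b * p) (m, k) = coef p (m - 1, k - 1) + coef p (m + 1, k + 1) +
    (if b then 0 else coef p (m - 1, k + 1) + coef p (m + 1, k - 1))"
proof -
  let ?A = "{(1, 1), (-1, -1), (1, -1), (-1, 1)} :: (int \<times> int) set"
  have "supp (crit1 b) \<subseteq> ?A" by (auto simp: in_keys_iff coef_crit1 split: if_splits)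
  from coef_mult[OF _ this, of p "(m, k)"] show ?thesis by (simp add: coef_crit1)
qed

lemma coef_crit2: "coef (crit2 b) (m, k) = (\<i> * of_int m - 2) * coef (crit1 b) (m, k)"
  by (simp add: crit2_def cD_def)

lemma coef_crit2_mult: "coef (crit2 b * p) (m, k) = (\<i> - 2) * coef p (m - 1, k - 1) + (- \<i> - 2) * coef p (m + 1, k + 1) +
    (if b then 0 else (\<i> - 2) * coef p (m - 1, k + 1) + (- \<i> - 2) * coef p (m + 1, k - 1))"
proof -
  let ?A = "{(1, 1), (-1, -1), (1, -1), (-1, 1)} :: (int \<times> int) set"
  have "supp (crit2 b) \<subseteq> ?A" by (auto simp: in_keys_iff coef_crit2 coef_crit1 split: if_splits)
  from coef_mult[OF _ this, of p "(m, k)"] show ?thesis by (simp add: coef_crit1 coef_crit2)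
qed

definition quad where "quad b = 2 * (crit1 b * crit2 b) + 5 * (crit1 b * crit1 b)"

lemma coef_quad: "coef (quad b) q = 2 * coef (crit1 b * crit2 b) q + 5 * coef (crit1 b * crit1 b) q"
  by (simp add: quad_def numeral_laurent lookup_add)

text \<open>Products of two critical modes have even frequencies, so the quadratic term has no
  coefficient at (1, 1), and both \<sigma> and \<mu> vanish at first order.\<close>

lemma first_order:
  "fps_nth (fG b) 1 = quad b" "fps_nth (fH1 b) 1 = 0" "fps_nth (fH2 b) 1 = 0" "sig b 1 = 0" "mu b 1 = 0"
  "fps_nth (fZ1 b) 1 = mlt (\<lambda>q. k11 q - k12 q) (quad b)" "fps_nth (fZ2 b) 1 = mlt (\<lambda>q. k21 q - k22 q) (quad b)"
proof -
  show G: "fps_nth (fG b) 1 = quad b"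
    by (simp add: fG_def quad_def rho_def fV1_def fV2_def f_zero fps_mult_nth numeral_fps_const)
  show H: "fps_nth (fH1 b) 1 = 0" "fps_nth (fH2 b) 1 = 0"
    by (simp_all add: fH1_def fH2_def fps_mult_nth f_zero)
  have "coef (quad b) (1, 1) = 0"
    by (simp add: coef_quad coef_crit1_mult coef_crit2 coef_crit1)
  then have s: "g_solv b 1 = 0" by (simp add: g_solv_def solv_def G[simplified] H[simplified])
  show m: "sig b 1 = 0" "mu b 1 = 0" using sol_nth(3,4)[of 1 b] s by simp_all
  have r: "g_rhs1 b 1 = quad b" "g_rhs2 b 1 = - quad b"
    using g_rhs_eq[of 1 b] m G H by simp_all
  show "fps_nth (fZ1 b) 1 = mlt (\<lambda>q. k11 q - k12 q) (quad b)" "fps_nth (fZ2 b) 1 = mlt (\<lambda>q. k21 q - k22 q) (quad b)"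
    by (rule poly_mapping_eqI; use sol_nth(1,2)[of 1 b] r in \<open>simp add: lookup_add algebra_simps\<close>)+
qed

text \<open>The resonant terms: the quadratic interaction of the critical profile with the first
  correction, and the cubic term of the critical profile with itself. The factor 10 is 2 * 5, from
  the square weighted by \<beta> = 5.\<close>

lemma second_order:
  "g_solv b 2 = 2 * (coef (crit1 b * fps_nth (fZ2 b) 1) (1, 1) + coef (crit2 b * fps_nth (fZ1 b) 1) (1, 1))
     + 10 * coef (crit1 b * fps_nth (fZ1 b) 1) (1, 1) + coef (crit1 b * (crit1 b * crit2 b)) (1, 1)"
proof -
  have Z: "fps_nth (fM b) 1 = 0" "fps_nth (fS b) 1 = 0" by (simp_all add: fM_nth fS_nth first_order[simplified])
  have H: "fps_nth (fH1 b) 2 = 0" "fps_nth (fH2 b) 2 = 0"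
    using Z by (simp_all add: fH1_def fH2_def fps_mult_nth f_zero numeral_2_eq_2)
  have "fps_nth (fG b) 2 = 2 * (crit1 b * fps_nth (fZ2 b) 1 + crit2 b * fps_nth (fZ1 b) 1)
      + 10 * (crit1 b * fps_nth (fZ1 b) 1) + crit1 b * (crit1 b * crit2 b)"
  proof -
    have "fps_nth (fM b * fZ1 b) 2 = 0" using Z by (simp add: fps_mult_nth f_zero numeral_2_eq_2)
    moreover have "fps_nth (rho (fV1 b) (fV2 b) (fM b)) 1 = 2 * (crit1 b * fps_nth (fZ2 b) 1 + crit2 b * fps_nth (fZ1 b) 1)
      + 10 * (crit1 b * fps_nth (fZ1 b) 1) + crit1 b * (crit1 b * crit2 b)"
    proof -
      have V: "fps_nth (fV1 b) 0 = crit1 b" "fps_nth (fV2 b) 0 = crit2 b"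
        "fps_nth (fV1 b) 1 = fps_nth (fZ1 b) 1" "fps_nth (fV2 b) 1 = fps_nth (fZ2 b) 1"
        by (simp_all add: fV1_def fV2_def f_zero)
      have m1: "fps_nth (F * G) 1 = fps_nth F 0 * fps_nth G 1 + fps_nth F 1 * fps_nth G 0" for F G :: "laurent fps"
        by (simp add: fps_mult_nth)
      have "fps_nth (5 + fM b) 0 = 5" "fps_nth (5 + fM b) 1 = 0" "fps_nth (2 :: laurent fps) 1 = 0"
        using Z by (simp_all add: f_zero fps_numeral_nth)
      then show ?thesis
        by (simp add: rho_def m1[simplified] V[simplified]) (simp add: algebra_simps)?
    qed
    ultimately show ?thesis by (simp add: fG_def)
  qed
  then show ?thesis unfolding g_solv_def solv_def H by (simp add: numeral_laurent lookup_add)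
qed

text \<open>These are the modes that a critical mode carries to (1, 1), so only their responses
  enter the second-order coefficient.\<close>

lemma mode_det_values:
  "mode_det (0, 0) = 1" "mode_det (2, 2) = 21 + 18 * \<i>" "mode_det (2, 0) = - 3 - 6 * \<i>" "mode_det (0, 2) = 25"
  by (simp_all add: mode_det_def cD_def cX_def complex_eq_iff)

lemma not_crit_values: "\<not> crit (0, 0)" "\<not> crit (2, 2)" "\<not> crit (2, 0)" "\<not> crit (0, 2)"
  by (simp_all add: crit_def)

lemma quad_values:
  "coef (quad b) (0, 0) = (if b then 2 else 4)" "coef (quad b) (2, 2) = 1 + 2 * \<i>"
  "coef (quad False) (2, 0) = 2 + 4 * \<i>" "coef (quad False) (0, 2) = 2"
  by (simp_all add: coef_quad coef_crit1_mult coef_crit2 coef_crit1 complex_eq_iff)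

lemma kernel_values:
  "k11 (0, 0) - k12 (0, 0) = 0" "k21 (0, 0) - k22 (0, 0) = -1"
  "k11 (2, 2) - k12 (2, 2) = Complex (8 / 51) (-2 / 51)" "k21 (2, 2) - k22 (2, 2) = Complex (-5 / 17) (8 / 51)"
  "k11 (2, 0) - k12 (2, 0) = Complex (-4 / 15) (-2 / 15)" "k21 (2, 0) - k22 (2, 0) = Complex (1 / 3) 0"
  "k11 (0, 2) - k12 (0, 2) = 4 / 25" "k21 (0, 2) - k22 (0, 2) = - 9 / 25"
  by (simp_all add: k11_def k12_def k21_def k22_def mode_det_values not_crit_values cD_def cX_def
      complex_eq_iff Re_divide Im_divide power2_eq_square)

text \<open>Both branches are supercritical. The exact values are 135 / 17 for travelling and 35047
  / 1275 for standing waves.\<close>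

lemma mu_2_pos: "0 < mu b 2"
proof -
  have Z: "coef (fps_nth (fZ1 c) 1) q = (k11 q - k12 q) * coef (quad c) q"
    "coef (fps_nth (fZ2 c) 1) q = (k21 q - k22 q) * coef (quad c) q" for q c
    by (simp_all only: first_order coef_mlt)
  have "Re (g_solv b 2) + Im (g_solv b 2) < 0"
  proof (cases b)
    case True
    have "g_solv True 2 = Complex (-472 / 51) (67 / 51)"
      unfolding second_order coef_crit1_mult coef_crit2_mult
      using True by (simp add: Z[unfolded One_nat_def] kernel_values quad_values coef_crit1 coef_crit2 complex_eq_iff)
    then show ?thesis using True by simp
  next
    case False
    have "Re (g_solv False 2) + Im (g_solv False 2) = -35047 / 1275"
      unfolding second_order coef_crit1_mult coef_crit2_mult
      using False by (simp add: Z[unfolded One_nat_def] kernel_values quad_values coef_crit1 coef_crit2)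
    then show ?thesis using False by simp
  qed
  then show ?thesis using sol_nth(4)[of 2 b] by simp
qed

section \<open>From formal series to classical solutions\<close>

text \<open>The estimates are uniform in x and use one constant for all times, so that every L2 or
  H1 limit in the definition of a solution reduces to a sup-norm bound.\<close>

definition classical :: "real \<Rightarrow> real \<Rightarrow> real \<Rightarrow> real \<Rightarrow> wave \<Rightarrow> bool" where
  "classical \<alpha> \<delta>1 \<delta>2 \<beta> v \<longleftrightarrow> (\<exists>vx vxx vt L.
     (\<forall>t. periodic_2pi (v t)) \<and>
     (\<forall>t x. (v t has_vector_derivative vx t x) (at x)) \<and>
     (\<forall>t x. (vx t has_vector_derivative vxx t x) (at x)) \<and>
     (\<forall>t. continuous_on UNIV (vxx t)) \<and>
     (\<forall>s t x. norm (v s x - v t x) \<le> L * \<bar>s - t\<bar> \<and> norm (vx s x - vx t x) \<le> L * \<bar>s - t\<bar> \<and>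
        norm (v s x - v t x - (s - t) *\<^sub>R vt t x) \<le> L * (s - t)\<^sup>2) \<and>
     (\<forall>t x. vt t x = linear_part \<alpha> \<delta>1 \<delta>2 \<beta> (v t x) (vxx t x) + nonlinear_part \<alpha> \<beta> (v t x)))"

lemma classicalI:
  assumes "\<And>t. periodic_2pi (v t)"
    "\<And>t x. (v t has_vector_derivative vx t x) (at x)"
    "\<And>t x. (vx t has_vector_derivative vxx t x) (at x)"
    "\<And>t. continuous_on UNIV (vxx t)"
    "\<And>s t x. norm (v s x - v t x) \<le> L * \<bar>s - t\<bar>" "\<And>s t x. norm (vx s x - vx t x) \<le> L * \<bar>s - t\<bar>"
    "\<And>s t x. norm (v s x - v t x - (s - t) *\<^sub>R vt t x) \<le> L * (s - t)\<^sup>2"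
    "\<And>t x. vt t x = linear_part \<alpha> \<delta>1 \<delta>2 \<beta> (v t x) (vxx t x) + nonlinear_part \<alpha> \<beta> (v t x)"
  shows "classical \<alpha> \<delta>1 \<delta>2 \<beta> v"
  unfolding classical_def
  by (rule exI[of _ vx], rule exI[of _ vxx], rule exI[of _ vt], rule exI[of _ L]) (intro conjI allI assms)

lemma tendsto_0_linear_bound:
  fixes f :: "real \<Rightarrow> real"
  assumes "\<And>s. s \<noteq> t \<Longrightarrow> \<bar>f s\<bar> \<le> K * \<bar>s - t\<bar>"
  shows "(f \<longlongrightarrow> 0) (at t)"
proof (rule Lim_null_comparison)
  show "\<forall>\<^sub>F s in at t. norm (f s) \<le> K * \<bar>s - t\<bar>"
    using assms by (auto simp: eventually_at_filter)
  have "((\<lambda>s. K * \<bar>s - t\<bar>) \<longlongrightarrow> K * \<bar>t - t\<bar>) (at t)" by (intro tendsto_intros)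
  then show "((\<lambda>s. K * \<bar>s - t\<bar>) \<longlongrightarrow> 0) (at t)" by simp
qed

lemma classical_perturbation_solution:
  assumes "\<alpha> \<noteq> 0" "classical \<alpha> \<delta>1 \<delta>2 \<beta> v"
  shows "perturbation_solution \<alpha> \<delta>1 \<delta>2 \<beta> v"
proof -
  obtain vx vxx vt L where per: "\<And>t. periodic_2pi (v t)"
    and dx: "\<And>t x. (v t has_vector_derivative vx t x) (at x)"
    and dxx: "\<And>t x. (vx t has_vector_derivative vxx t x) (at x)"
    and cxx: "\<And>t. continuous_on UNIV (vxx t)"
    and L: "\<And>s t x. norm (v s x - v t x) \<le> L * \<bar>s - t\<bar>" "\<And>s t x. norm (vx s x - vx t x) \<le> L * \<bar>s - t\<bar>"
        "\<And>s t x. norm (v s x - v t x - (s - t) *\<^sub>R vt t x) \<le> L * (s - t)\<^sup>2"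
    and pde: "\<And>t x. vt t x = linear_part \<alpha> \<delta>1 \<delta>2 \<beta> (v t x) (vxx t x) + nonlinear_part \<alpha> \<beta> (v t x)"
    using assms(2) unfolding classical_def by blast
  define u where "u = (\<lambda>t x. uniform_state \<alpha> \<beta> + v t x)"
  have cv: "continuous_on UNIV (v t)" for t
    using dx by (intro continuous_at_imp_continuous_on ballI has_vector_derivative_continuous)
  have cvx: "continuous_on UNIV (vx t)" for t
    using dxx by (intro continuous_at_imp_continuous_on ballI has_vector_derivative_continuous)
  have wv: "has_weak_deriv (v t) (vx t)" for t by (rule has_weak_deriv_C1[OF per dx cvx])
  have perx: "periodic_2pi (vx t)" for t
  proof -
    have "(v t has_vector_derivative vx t (x + 2 * pi)) (at x)" for x
    proof -
      have "((\<lambda>x. x + 2 * pi) has_vector_derivative 1) (at x)" by (auto intro!: derivative_eq_intros)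
      from vector_diff_chain_at[OF this dx]
      have "((\<lambda>x. v t (x + 2 * pi)) has_vector_derivative vx t (x + 2 * pi)) (at x)" by (simp add: o_def)
      moreover have "(\<lambda>x. v t (x + 2 * pi)) = v t" using per by (simp add: periodic_2pi_def)
      ultimately show ?thesis by simp
    qed
    then show ?thesis using dx vector_derivative_unique_at unfolding periodic_2pi_def by blast
  qed
  have wvx: "has_weak_deriv (vx t) (vxx t)" for t by (rule has_weak_deriv_C1[OF perx dxx cxx])
  have wu: "has_weak_deriv (u t) (vx t)" for t
    using has_weak_deriv_add[OF has_weak_deriv_const wv] by (simp add: u_def)
  note H2 = H2_circle_AE[OF wu wvx]
  have cu: "continuous_on UNIV (u t)" for t unfolding u_def by (intro continuous_intros cv)
  have H1lim: "((\<lambda>s. H1_norm (\<lambda>x. u s x - u t x)) \<longlongrightarrow> 0) (at t)" for t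
  proof (rule tendsto_0_linear_bound)
    fix s
    have w: "has_weak_deriv (\<lambda>x. u s x - u t x) (\<lambda>x. vx s x - vx t x)" by (rule has_weak_deriv_diff[OF wu wu])
    have "L2_norm (\<lambda>x. u s x - u t x) \<le> sqrt (2 * pi) * (L * \<bar>s - t\<bar>)" "L2_norm (\<lambda>x. vx s x - vx t x) \<le> sqrt (2 * pi) * (L * \<bar>s - t\<bar>)"
      using L2_norm_le_sup[OF has_weak_derivD(1)[OF w]] L2_norm_le_sup[OF has_weak_derivD(2)[OF w]] L(1,2)
      by (simp_all add: u_def)
    then have "(H1_norm (\<lambda>x. u s x - u t x))\<^sup>2 \<le> (sqrt (2 * pi) * (L * \<bar>s - t\<bar>))\<^sup>2 + (sqrt (2 * pi) * (L * \<bar>s - t\<bar>))\<^sup>2"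
      unfolding H1_norm_eq[OF w] by (intro add_mono power_mono) auto
    also have "\<dots> \<le> (2 * (sqrt (2 * pi) * (L * \<bar>s - t\<bar>)))\<^sup>2" by (simp add: power_mult_distrib)
    finally have "\<bar>H1_norm (\<lambda>x. u s x - u t x)\<bar> \<le> \<bar>2 * (sqrt (2 * pi) * (L * \<bar>s - t\<bar>))\<bar>"
      by (simp only: abs_le_square_iff)
    moreover have "0 \<le> L * \<bar>s - t\<bar>" using L(1)[of s 0 t] norm_ge_zero order_trans by blast
    ultimately show "\<bar>H1_norm (\<lambda>x. u s x - u t x)\<bar> \<le> (2 * sqrt (2 * pi) * L) * \<bar>s - t\<bar>"
      by (simp add: abs_of_nonneg mult.assoc)
  qed
  have L2lim: "((\<lambda>s. L2_norm (\<lambda>x. (u s x - u t x) /\<^sub>R (s - t)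
                 - brusselator_rhs \<alpha> \<delta>1 \<delta>2 \<beta> (u t x) (weak_deriv (weak_deriv (u t)) x))) \<longlongrightarrow> 0) (at t)" for t
  proof (rule tendsto_0_linear_bound)
    fix s assume st: "s \<noteq> t"
    let ?w = "weak_deriv (weak_deriv (u t))"
    define g where "g = (\<lambda>x. (v s x - v t x) /\<^sub>R (s - t) - vt t x)"
    have cn: "continuous_on UNIV (\<lambda>x. nonlinear_part \<alpha> \<beta> (v t x))" unfolding nonlinear_part_def
      by (intro continuous_intros continuous_on_component cv)
    have lin: "continuous_on UNIV (\<lambda>x. linear_part \<alpha> \<delta>1 \<delta>2 \<beta> (v t x) 0)"
      by (rule continuous_on_compose2[OF linear_continuous_on[OF bounded_linear_linear_part(1)] cv]) auto
    have linx: "continuous_on UNIV (\<lambda>x. linear_part \<alpha> \<delta>1 \<delta>2 \<beta> 0 (vxx t x))"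
      by (rule continuous_on_compose2[OF linear_continuous_on[OF bounded_linear_linear_part(2)] cxx]) auto
    have perxx: "periodic_2pi (vxx t)" using has_weak_derivD(2)[OF wvx] L2_circleD(1) by blast
    have Lw: "L2_circle ?w" by (rule has_weak_derivD(2)[OF H2_circleD(2)[OF H2(1)]])
    have Ln: "L2_circle (\<lambda>x. nonlinear_part \<alpha> \<beta> (v t x))" "L2_circle (\<lambda>x. linear_part \<alpha> \<delta>1 \<delta>2 \<beta> (v t x) 0)"
      "L2_circle (\<lambda>x. linear_part \<alpha> \<delta>1 \<delta>2 \<beta> 0 (vxx t x))"
      by (rule L2_circle_continuous, rule cn lin linx, use per[of t] perxx in \<open>simp add: periodic_2pi_def\<close>)+
    have Lwl: "L2_circle (\<lambda>x. linear_part \<alpha> \<delta>1 \<delta>2 \<beta> 0 (?w x))"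
      by (rule L2_circle_linear[OF Lw bounded_linear_linear_part(2)])
    have Ld: "L2_circle (\<lambda>x. (v s x - v t x) /\<^sub>R (s - t))"
      by (intro L2_circle_scaleR L2_circle_diff has_weak_derivD(1)[OF wv])
    have r: "brusselator_rhs \<alpha> \<delta>1 \<delta>2 \<beta> (u t x) p = linear_part \<alpha> \<delta>1 \<delta>2 \<beta> (v t x) 0 + linear_part \<alpha> \<delta>1 \<delta>2 \<beta> 0 p + nonlinear_part \<alpha> \<beta> (v t x)" for x p
      unfolding u_def brusselator_rhs_perturbation[OF assms(1)] linear_part_split[of _ _ _ _ "v t x" p] by simp
    have vtr: "vt t x = linear_part \<alpha> \<delta>1 \<delta>2 \<beta> (v t x) 0 + linear_part \<alpha> \<delta>1 \<delta>2 \<beta> 0 (vxx t x) + nonlinear_part \<alpha> \<beta> (v t x)" for x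
      unfolding pde linear_part_split[of _ _ _ _ "v t x" "vxx t x"] by simp
    have L1: "L2_circle (\<lambda>x. (u s x - u t x) /\<^sub>R (s - t) - brusselator_rhs \<alpha> \<delta>1 \<delta>2 \<beta> (u t x) (?w x))"
      unfolding r using Ld Ln Lwl by (simp add: u_def L2_circle_diff L2_circle_add)
    have L2: "L2_circle g" unfolding g_def vtr by (intro L2_circle_diff L2_circle_add Ld Ln)
    \<comment> \<open>The chosen weak second derivative equals the classical one almost everywhere
      only; the L2 norm does not see the difference.\<close>
    have "AE x in circ. ?w x = vxx t x" by (rule AE_lborel_circ[OF H2(2)])
    then have "AE x in circ. (u s x - u t x) /\<^sub>R (s - t) - brusselator_rhs \<alpha> \<delta>1 \<delta>2 \<beta> (u t x) (?w x) = g x"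
    proof (rule AE_mp, intro AE_I2 impI)
      fix x assume w: "?w x = vxx t x"
      show "(u s x - u t x) /\<^sub>R (s - t) - brusselator_rhs \<alpha> \<delta>1 \<delta>2 \<beta> (u t x) (?w x) = g x"
        unfolding r g_def vtr w by (simp add: u_def)
    qed
    from L2_norm_AE_cong[OF L1 L2 this]
    have "L2_norm (\<lambda>x. (u s x - u t x) /\<^sub>R (s - t) - brusselator_rhs \<alpha> \<delta>1 \<delta>2 \<beta> (u t x) (?w x)) = L2_norm g" .
    also have "\<dots> \<le> sqrt (2 * pi) * (L * \<bar>s - t\<bar>)"
    proof (rule L2_norm_le_sup[OF L2])
      fix x
      have "g x = (v s x - v t x - (s - t) *\<^sub>R vt t x) /\<^sub>R (s - t)" using st by (simp add: g_def scaleR_diff_right)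
      then have "norm (g x) = norm (v s x - v t x - (s - t) *\<^sub>R vt t x) / \<bar>s - t\<bar>"
        by (simp add: divide_inverse mult.commute)
      also have "\<dots> \<le> L * (s - t)\<^sup>2 / \<bar>s - t\<bar>" by (intro divide_right_mono L) simp
      also have "\<dots> = L * \<bar>s - t\<bar>"
      proof -
        have "L * d\<^sup>2 / d = L * d" if "d \<noteq> 0" for d :: real using that by (simp add: power2_eq_square)
        from this[of "\<bar>s - t\<bar>"] show ?thesis using st by simp
      qed
      finally show "norm (g x) \<le> L * \<bar>s - t\<bar>" .
    qed
    finally show "\<bar>L2_norm (\<lambda>x. (u s x - u t x) /\<^sub>R (s - t) - brusselator_rhs \<alpha> \<delta>1 \<delta>2 \<beta> (u t x) (?w x))\<bar> \<le> (sqrt (2 * pi) * L) * \<bar>s - t\<bar>"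
      by (simp add: mult.assoc)
  qed
  show ?thesis unfolding perturbation_solution_def brusselator_solution_def u_def[symmetric]
    using cu H2(1) H1lim L2lim by simp
qed

text \<open>Comparing a^j with r^j gains (a / r)^k on the tail from index k on. It is applied with k
  = 0 for bounds, k = 1 for the distance to the leading term, and k = 3 for the detuning.\<close>

lemma tail_bound:
  fixes g :: "nat \<Rightarrow> real"
  assumes g: "\<And>j. \<bar>g j\<bar> \<le> K * (N j * a ^ j)" and N: "\<And>j. 0 \<le> N j" "summable (\<lambda>j. N j * r ^ j)"
    and a: "0 \<le> a" "a \<le> r" "0 < r" and K: "0 \<le> K"
  shows "summable g" "\<bar>suminf g - (\<Sum>j<k. g j)\<bar> \<le> K * (a / r) ^ k * (suminf (\<lambda>j. N j * r ^ j))"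
proof -
  have le: "N j * a ^ j \<le> N j * r ^ j" for j using a N by (intro mult_left_mono power_mono) auto
  have "\<bar>g j\<bar> \<le> K * (N j * r ^ j)" for j by (rule order_trans[OF g mult_left_mono[OF le K]])
  then show s: "summable g" by (intro summable_comparison_test'[OF summable_mult[OF N(2)], of 0]) simp
  have b: "\<bar>g (j + k)\<bar> \<le> K * (a / r) ^ k * (N (j + k) * r ^ (j + k))" for j
  proof -
    have "a ^ (j + k) \<le> (a / r) ^ k * r ^ (j + k)"
    proof -
      have "a ^ (j + k) = a ^ j * a ^ k" by (simp add: power_add)
      also have "\<dots> \<le> r ^ j * a ^ k" using a by (intro mult_right_mono power_mono) auto
      also have "\<dots> = (a / r) ^ k * r ^ (j + k)" using a by (simp add: power_add power_divide)
      finally show ?thesis .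
    qed
    from mult_left_mono[OF mult_left_mono[OF this N(1)[of "j + k"]] K] g[of "j + k"]
    have "\<bar>g (j + k)\<bar> \<le> K * (N (j + k) * ((a / r) ^ k * r ^ (j + k)))" by linarith
    then show ?thesis by (simp only: mult_ac)
  qed
  have sk: "summable (\<lambda>j. N (j + k) * r ^ (j + k))" using summable_iff_shift[of "\<lambda>j. N j * r ^ j" k] N(2) by simp
  have sg: "summable (\<lambda>j. \<bar>g (j + k)\<bar>)"
    by (rule summable_comparison_test'[OF summable_mult[OF sk, of "K * (a / r) ^ k"], of 0]) (simp add: b)
  have "\<bar>suminf g - (\<Sum>j<k. g j)\<bar> = \<bar>suminf (\<lambda>j. g (j + k))\<bar>" using suminf_split_initial_segment[OF s, of k] by simp
  also have "\<dots> \<le> (suminf (\<lambda>j. \<bar>g (j + k)\<bar>))" by (rule summable_rabs[OF sg])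
  also have "\<dots> \<le> (suminf (\<lambda>j. K * (a / r) ^ k * (N (j + k) * r ^ (j + k))))"
    by (rule suminf_le[OF b sg summable_mult[OF sk]])
  also have "\<dots> = K * (a / r) ^ k * (suminf (\<lambda>j. N (j + k) * r ^ (j + k)))" by (rule suminf_mult[OF sk])
  also have "\<dots> \<le> K * (a / r) ^ k * (suminf (\<lambda>j. N j * r ^ j))"
  proof (rule mult_left_mono)
    have "0 \<le> (\<Sum>j<k. N j * r ^ j)" using N(1) a by (intro sum_nonneg) auto
    then show "(suminf (\<lambda>j. N (j + k) * r ^ (j + k))) \<le> (suminf (\<lambda>j. N j * r ^ j))"
      using suminf_split_initial_segment[OF N(2), of k] by linarith
  qed (use K a in auto)
  finally show "\<bar>suminf g - (\<Sum>j<k. g j)\<bar> \<le> K * (a / r) ^ k * (suminf (\<lambda>j. N j * r ^ j))" .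
qed

text \<open>Absolute convergence at amplitude a and at the point (\<tau>, \<xi>), together with the
  value. As a relation compatible with sums and Cauchy products, it turns an identity of formal
  series into a pointwise equation.\<close>

definition evaluates :: "real \<Rightarrow> real \<Rightarrow> real \<Rightarrow> laurent fps \<Rightarrow> complex \<Rightarrow> bool" where
  "evaluates a \<tau> \<xi> F z \<longleftrightarrow> summable (\<lambda>j. norm (ev \<tau> \<xi> (fps_nth F j) * of_real (a ^ j))) \<and>
     (\<lambda>j. ev \<tau> \<xi> (fps_nth F j) * of_real (a ^ j)) sums z"

lemma evaluates_unique: "evaluates a \<tau> \<xi> F z \<Longrightarrow> evaluates a \<tau> \<xi> F w \<Longrightarrow> z = w"
  unfolding evaluates_def using sums_unique2 by blast

lemma evaluates_add:
  assumes "evaluates a \<tau> \<xi> F z" "evaluates a \<tau> \<xi> G w"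
  shows "evaluates a \<tau> \<xi> (F + G) (z + w)"
proof -
  have e: "ev \<tau> \<xi> (fps_nth (F + G) j) * of_real (a ^ j) = ev \<tau> \<xi> (fps_nth F j) * of_real (a ^ j) + ev \<tau> \<xi> (fps_nth G j) * of_real (a ^ j)" for j
    by (simp add: ev_add distrib_right)
  have "summable (\<lambda>j. norm (ev \<tau> \<xi> (fps_nth F j) * of_real (a ^ j)) + norm (ev \<tau> \<xi> (fps_nth G j) * of_real (a ^ j)))"
    using assms by (intro summable_add) (auto simp: evaluates_def)
  then have "summable (\<lambda>j. norm (ev \<tau> \<xi> (fps_nth (F + G) j) * of_real (a ^ j)))" unfolding e
    by (rule summable_comparison_test'[of _ 0]) (simp add: norm_triangle_ineq)
  moreover have "(\<lambda>j. ev \<tau> \<xi> (fps_nth (F + G) j) * of_real (a ^ j)) sums (z + w)" unfolding e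
    using assms by (intro sums_add) (auto simp: evaluates_def)
  ultimately show ?thesis by (simp add: evaluates_def)
qed

lemma ev_uminus: "ev \<tau> \<xi> (- p) = - ev \<tau> \<xi> p"
  using ev_add[of \<tau> \<xi> p "- p"] by (simp add: eq_neg_iff_add_eq_0 add.commute)

lemma evaluates_uminus: "evaluates a \<tau> \<xi> F z \<Longrightarrow> evaluates a \<tau> \<xi> (- F) (- z)"
  unfolding evaluates_def using sums_minus[of "\<lambda>j. ev \<tau> \<xi> (fps_nth F j) * of_real (a ^ j)" z] by (simp add: ev_uminus)

lemma evaluates_diff: "evaluates a \<tau> \<xi> F z \<Longrightarrow> evaluates a \<tau> \<xi> G w \<Longrightarrow> evaluates a \<tau> \<xi> (F - G) (z - w)"
  using evaluates_add[of a \<tau> \<xi> F z "- G" "- w"] evaluates_uminus[of a \<tau> \<xi> G w] by simp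

lemma evaluates_mult:
  assumes "evaluates a \<tau> \<xi> F z" "evaluates a \<tau> \<xi> G w"
  shows "evaluates a \<tau> \<xi> (F * G) (z * w)"
proof -
  let ?f = "\<lambda>j. ev \<tau> \<xi> (fps_nth F j) * of_real (a ^ j)" and ?g = "\<lambda>j. ev \<tau> \<xi> (fps_nth G j) * of_real (a ^ j)"
  have e: "ev \<tau> \<xi> (fps_nth (F * G) k) * of_real (a ^ k) = (\<Sum>i\<le>k. ?f i * ?g (k - i))" for k
  proof -
    have "of_real (a ^ k) = (of_real (a ^ i) * of_real (a ^ (k - i)) :: complex)" if "i \<le> k" for i
      using that by (simp only: of_real_mult[symmetric] power_add[symmetric] le_add_diff_inverse)
    then show ?thesis
      unfolding fps_mult_nth ev_sum ev_mult atLeast0AtMost sum_distrib_right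
      by (intro sum.cong) (simp_all add: mult_ac del: of_real_power)
  qed
  have f: "summable (\<lambda>j. norm (?f j))" "?f sums z" and g: "summable (\<lambda>j. norm (?g j))" "?g sums w"
    using assms by (simp_all only: evaluates_def)
  have "summable (\<lambda>k. \<Sum>i\<le>k. norm (?f i) * norm (?g (k - i)))"
    by (rule summable_Cauchy_product) (use f g in simp_all)
  then have "summable (\<lambda>k. norm (\<Sum>i\<le>k. ?f i * ?g (k - i)))"
    by (rule summable_comparison_test'[of _ 0]) (unfold real_norm_def abs_norm_cancel norm_mult[symmetric], rule norm_sum)
  moreover have "(\<lambda>k. \<Sum>i\<le>k. ?f i * ?g (k - i)) sums (z * w)"
    using Cauchy_product_sums[OF f(1) g(1)] by (simp only: sums_unique[OF f(2), symmetric] sums_unique[OF g(2), symmetric])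
  ultimately show ?thesis unfolding evaluates_def e by (rule conjI)
qed

lemma evaluates_const: "evaluates a \<tau> \<xi> (fps_const p) (ev \<tau> \<xi> p)"
proof -
  have e: "ev \<tau> \<xi> (fps_nth (fps_const p) j) * of_real (a ^ j) = (if j = 0 then ev \<tau> \<xi> p else 0)" for j
    by simp
  have "summable (\<lambda>j::nat. norm (if j = 0 then ev \<tau> \<xi> p else 0))" by (rule summable_finite[of "{0}"]) auto
  then show ?thesis unfolding evaluates_def e using sums_single[of 0 "\<lambda>_. ev \<tau> \<xi> p"] by (rule conjI)
qed

lemma evaluates_numeral: "evaluates a \<tau> \<xi> (numeral m) (numeral m)"
  using evaluates_const[of a \<tau> \<xi> "numeral m"] by (simp add: numeral_laurent numeral_fps_const)

lemma evaluates_one: "evaluates a \<tau> \<xi> 1 1"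
proof -
  have "fps_const (cst 1) = 1" by (simp only: one_laurent[symmetric] fps_const_1_eq_1)
  then show ?thesis using evaluates_const[of a \<tau> \<xi> "cst 1"] by (simp only: ev_cst of_real_1)
qed

lemma evaluates_X: "evaluates a \<tau> \<xi> fps_X (of_real a)"
proof -
  have e: "ev \<tau> \<xi> (fps_nth fps_X j) * of_real (a ^ j) = (if j = 1 then of_real a else 0)" for j
    by (simp add: fps_X_def one_laurent)
  have "summable (\<lambda>j::nat. norm (if j = 1 then of_real a else 0 :: complex))" by (rule summable_finite[of "{1}"]) auto
  then show ?thesis unfolding evaluates_def e using sums_single[of 1 "\<lambda>_. of_real a"] by (rule conjI)
qed

definition tame :: "real \<Rightarrow> laurent fps \<Rightarrow> bool" where
  "tame a F \<longleftrightarrow> summable (\<lambda>j. nrm (fps_nth F j) * a ^ j)"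

text \<open>The symbol of \<open>\<partial>\<^sub>\<tau>\<^sup>k \<partial>\<^sub>\<xi>\<^sup>l\<close>.\<close>

definition tr :: "nat \<Rightarrow> nat \<Rightarrow> int \<times> int \<Rightarrow> complex" where
  "tr k l q = (\<i> * of_int (fst q)) ^ k * (\<i> * of_int (snd q)) ^ l"

text \<open>Derivative of order k in \<tau> and l in \<xi> of the summed series. The weight covers k
  + l <= 2 by \<open>tr_bound\<close>, which is all that the equation and the time regularity
  require.\<close>

definition ser :: "laurent fps \<Rightarrow> real \<Rightarrow> nat \<Rightarrow> nat \<Rightarrow> real \<Rightarrow> real \<Rightarrow> real" where
  "ser F a k l \<tau> \<xi> = (suminf (\<lambda>j. Re (ev \<tau> \<xi> (mlt (tr k l) (fps_nth F j))) * a ^ j))"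

lemma tr_eq: "tr 0 0 = (\<lambda>q. 1)" "tr 1 0 = cD" "tr 0 2 = cX"
  by (simp_all add: tr_def cD_def cX_def fun_eq_iff power_mult_distrib)

lemma tr_bound: assumes "k + l \<le> 2" shows "cmod (tr k l q) \<le> 2 * weight q"
proof -
  have c: "cmod (tr k l q) = \<bar>real_of_int (fst q)\<bar> ^ k * \<bar>real_of_int (snd q)\<bar> ^ l"
    by (simp add: tr_def norm_mult norm_power)
  have "(k = 0 \<and> l = 0) \<or> (k = 1 \<and> l = 0) \<or> (k = 0 \<and> l = 1) \<or> (k = 1 \<and> l = 1) \<or> (k = 2 \<and> l = 0) \<or> (k = 0 \<and> l = 2)"
    using assms by arith
  then show ?thesis unfolding c using weight_pos[of q] weight_ge[of q] by (elim disjE) (auto simp: power2_abs)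
qed

lemma ser_term_bound:
  assumes "k + l \<le> 2" "0 \<le> a"
  shows "\<bar>Re (ev \<tau> \<xi> (mlt (tr k l) p)) * a ^ j\<bar> \<le> 2 * (nrm p * a ^ j)"
proof -
  have "\<bar>Re (ev \<tau> \<xi> (mlt (tr k l) p))\<bar> \<le> 2 * nrm p"
    using abs_Re_le_cmod norm_ev_mlt[OF tr_bound[OF assms(1)]] order_trans by blast
  from mult_right_mono[OF this, of "a ^ j"] show ?thesis using assms(2) by (simp add: abs_mult mult.assoc)
qed

lemma ser_summable:
  assumes "k + l \<le> 2" "0 \<le> a" "tame a F"
  shows "summable (\<lambda>j. Re (ev \<tau> \<xi> (mlt (tr k l) (fps_nth F j))) * a ^ j)"
  by (rule summable_comparison_test'[OF summable_mult[OF assms(3)[unfolded tame_def], of 2], of 0])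
    (unfold real_norm_def, rule ser_term_bound[OF assms(1,2)])

lemma ser_tail:
  assumes "k + l \<le> 2" "0 \<le> a" "a \<le> r" "0 < r" "tame r F"
  shows "\<bar>ser F a k l \<tau> \<xi> - (\<Sum>j<m. Re (ev \<tau> \<xi> (mlt (tr k l) (fps_nth F j))) * a ^ j)\<bar> \<le> 2 * (a / r) ^ m * (suminf (\<lambda>j. nrm (fps_nth F j) * r ^ j))"
  unfolding ser_def
  by (rule tail_bound(2)[OF ser_term_bound[OF assms(1,2)] nrm_nonneg assms(5)[unfolded tame_def] assms(2-4)]) simp

lemma ev_mlt_deriv:
  "((\<lambda>\<tau>. Re (ev \<tau> \<xi> (mlt (tr k l) p))) has_field_derivative Re (ev \<tau> \<xi> (mlt (tr (Suc k) l) p))) (at \<tau>)"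
  "((\<lambda>\<xi>. Re (ev \<tau> \<xi> (mlt (tr k l) p))) has_field_derivative Re (ev \<tau> \<xi> (mlt (tr k (Suc l)) p))) (at \<xi>)"
proof -
  have e: "Re (ev \<tau> \<xi> (mlt c p)) = (\<Sum>q\<in>supp p. Re (c q * coef p q) * cos (of_int (fst q) * \<tau> + of_int (snd q) * \<xi>)
      - Im (c q * coef p q) * sin (of_int (fst q) * \<tau> + of_int (snd q) * \<xi>))" for c \<tau> \<xi>
    by (simp add: ev_superset[OF finite_keys supp_mlt])
  have s: "tr (Suc k) l q * coef p q = \<i> * of_int (fst q) * (tr k l q * coef p q)"
     "tr k (Suc l) q * coef p q = \<i> * of_int (snd q) * (tr k l q * coef p q)" for q
    by (simp_all add: tr_def)
  show "((\<lambda>\<tau>. Re (ev \<tau> \<xi> (mlt (tr k l) p))) has_field_derivative Re (ev \<tau> \<xi> (mlt (tr (Suc k) l) p))) (at \<tau>)"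
    unfolding e s by (auto intro!: derivative_eq_intros sum.cong simp: algebra_simps)
  show "((\<lambda>\<xi>. Re (ev \<tau> \<xi> (mlt (tr k l) p))) has_field_derivative Re (ev \<tau> \<xi> (mlt (tr k (Suc l)) p))) (at \<xi>)"
    unfolding e s by (auto intro!: derivative_eq_intros sum.cong simp: algebra_simps)
qed

lemma ser_deriv_aux:
  assumes f: "\<And>j x. ((\<lambda>x. f j x) has_field_derivative f' j x) (at x)" and b: "\<And>j x. \<bar>f' j x\<bar> \<le> 2 * M j"
    and "summable M" and s: "\<And>x. summable (\<lambda>j. f j x)"
  shows "((\<lambda>x. suminf (\<lambda>j. f j x)) has_field_derivative (suminf (\<lambda>j. f' j x :: real))) (at (x :: real))"
proof (rule has_field_derivative_series'(2)[of UNIV f f' 0])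
  show "uniformly_convergent_on UNIV (\<lambda>n x. \<Sum>i<n. f' i x)"
    by (rule Weierstrass_m_test'[OF _ summable_mult[OF assms(3)]]) (use b in auto)
qed (use f s in auto)

lemma ser_deriv:
  assumes "k + l < 2" "0 \<le> a" "tame a F"
  shows "((\<lambda>\<tau>. ser F a k l \<tau> \<xi>) has_field_derivative ser F a (Suc k) l \<tau> \<xi>) (at \<tau>)"
    "((\<lambda>\<xi>. ser F a k l \<tau> \<xi>) has_field_derivative ser F a k (Suc l) \<tau> \<xi>) (at \<xi>)"
proof -
  have kl: "k + l \<le> 2" "Suc k + l \<le> 2" "k + Suc l \<le> 2" using assms(1) by auto
  show "((\<lambda>\<tau>. ser F a k l \<tau> \<xi>) has_field_derivative ser F a (Suc k) l \<tau> \<xi>) (at \<tau>)"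
    unfolding ser_def
    by (rule ser_deriv_aux[OF DERIV_cmult_right[OF ev_mlt_deriv(1)] ser_term_bound[OF kl(2) assms(2)] assms(3)[unfolded tame_def] ser_summable[OF kl(1) assms(2,3)]])
  show "((\<lambda>\<xi>. ser F a k l \<tau> \<xi>) has_field_derivative ser F a k (Suc l) \<tau> \<xi>) (at \<xi>)"
    unfolding ser_def
    by (rule ser_deriv_aux[OF DERIV_cmult_right[OF ev_mlt_deriv(2)] ser_term_bound[OF kl(3) assms(2)] assms(3)[unfolded tame_def] ser_summable[OF kl(1) assms(2,3)]])
qed

lemma ser_continuous:
  assumes "k + l \<le> 2" "0 \<le> a" "tame a F"
  shows "continuous_on UNIV (\<lambda>\<xi>. ser F a k l \<tau> \<xi>)"
proof -
  have "uniform_limit UNIV (\<lambda>n \<xi>. \<Sum>j<n. Re (ev \<tau> \<xi> (mlt (tr k l) (fps_nth F j))) * a ^ j) (\<lambda>\<xi>. ser F a k l \<tau> \<xi>) sequentially"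
    unfolding ser_def
    by (rule Weierstrass_m_test[OF _ summable_mult[OF assms(3)[unfolded tame_def]]]) (use ser_term_bound[OF assms(1,2)] in auto)
  moreover have "continuous_on UNIV (\<lambda>\<xi>. \<Sum>j<n. Re (ev \<tau> \<xi> (mlt (tr k l) (fps_nth F j))) * a ^ j)" for n
    using ev_mlt_deriv(2)
    by (intro continuous_on_sum continuous_on_mult_right continuous_at_imp_continuous_on ballI DERIV_isCont)
  ultimately show ?thesis
    by (intro uniform_limit_theorem[where F = sequentially, OF always_eventually]) auto
qed

lemma ser_periodic:
  "ser F a k l \<tau> (\<xi> + 2 * pi * of_int m) = ser F a k l \<tau> \<xi>" "ser F a k l (\<tau> + 2 * pi * of_int m) \<xi> = ser F a k l \<tau> \<xi>"
proof -
  have c: "cis (x + 2 * pi * of_int i) = cis x" for x i by (simp add: cis_mult[symmetric])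
  have "ev \<tau> (\<xi> + 2 * pi * of_int m) p = ev \<tau> \<xi> p" "ev (\<tau> + 2 * pi * of_int m) \<xi> p = ev \<tau> \<xi> p" for p
  proof -
    have "of_int (fst q) * \<tau> + of_int (snd q) * (\<xi> + 2 * pi * of_int m) = of_int (fst q) * \<tau> + of_int (snd q) * \<xi> + 2 * pi * of_int (snd q * m)"
      "of_int (fst q) * (\<tau> + 2 * pi * of_int m) + of_int (snd q) * \<xi> = of_int (fst q) * \<tau> + of_int (snd q) * \<xi> + 2 * pi * of_int (fst q * m)" for q :: "int \<times> int"
      by (simp_all add: algebra_simps)
    then show "ev \<tau> (\<xi> + 2 * pi * of_int m) p = ev \<tau> \<xi> p" "ev (\<tau> + 2 * pi * of_int m) \<xi> p = ev \<tau> \<xi> p"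
      unfolding ev_def by (simp_all only: c)
  qed
  then show "ser F a k l \<tau> (\<xi> + 2 * pi * of_int m) = ser F a k l \<tau> \<xi>" "ser F a k l (\<tau> + 2 * pi * of_int m) \<xi> = ser F a k l \<tau> \<xi>"
    by (simp_all add: ser_def)
qed

text \<open>Members of a symmetry class take real values, so the real part in \<open>ser\<close>
  loses nothing and the real series is the complex value.\<close>

lemma ser_evaluates:
  assumes "k + l \<le> 2" "0 \<le> a" "tame a F" "equivariant (tr k l)" "\<And>j. adm b (fps_nth F j)"
  shows "evaluates a \<tau> \<xi> (fmlt (tr k l) F) (of_real (ser F a k l \<tau> \<xi>))"
proof -
  have "Im (ev \<tau> \<xi> (mlt (tr k l) (fps_nth F j))) = 0" for j
    using ev_adm_real adm_mlt[OF assms(4,5)] by blast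
  then have e: "ev \<tau> \<xi> (fps_nth (fmlt (tr k l) F) j) * of_real (a ^ j) = of_real (Re (ev \<tau> \<xi> (mlt (tr k l) (fps_nth F j))) * a ^ j)" for j
    by (simp add: complex_eq_iff)
  have "summable (\<lambda>j. \<bar>Re (ev \<tau> \<xi> (mlt (tr k l) (fps_nth F j))) * a ^ j\<bar>)"
    by (rule summable_comparison_test'[OF summable_mult[OF assms(3)[unfolded tame_def], of 2], of 0])
      (unfold real_norm_def abs_idempotent, rule ser_term_bound[OF assms(1,2)])
  moreover have "(\<lambda>j. Re (ev \<tau> \<xi> (mlt (tr k l) (fps_nth F j))) * a ^ j) sums ser F a k l \<tau> \<xi>"
    unfolding ser_def by (rule summable_sums[OF ser_summable[OF assms(1-3)]])
  ultimately show ?thesis unfolding evaluates_def e by (simp only: sums_of_real_iff norm_of_real simp_thms)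
qed

lemma evaluates_cst:
  assumes "summable (\<lambda>j. \<bar>f j\<bar> * a ^ j)" "0 \<le> a" "\<And>j. fps_nth F j = cst (f j)"
  shows "evaluates a \<tau> \<xi> F (of_real (suminf (\<lambda>j. f j * a ^ j)))"
proof -
  have e: "ev \<tau> \<xi> (fps_nth F j) * of_real (a ^ j) = of_real (f j * a ^ j)" for j by (simp add: assms(3))
  have n: "norm (of_real (f j * a ^ j) :: complex) = \<bar>f j\<bar> * a ^ j" for j
    using assms(2) by (simp only: norm_of_real abs_mult) simp
  have "summable (\<lambda>j. f j * a ^ j)"
    by (rule summable_rabs_cancel) (use assms in \<open>simp add: abs_mult\<close>)
  then show ?thesis unfolding evaluates_def e n using assms(1) by (simp only: sums_of_real_iff summable_sums simp_thms)
qed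

definition convergence_radius :: "bool \<Rightarrow> real" where
  "convergence_radius b = (SOME r. 0 < r \<and> tame r (fV1 b) \<and> tame r (fV2 b) \<and>
     summable (\<lambda>j. \<bar>sig b j\<bar> * r ^ j) \<and> summable (\<lambda>j. \<bar>mu b j\<bar> * r ^ j))"

lemma psum_tame:
  assumes "0 \<le> r" "\<And>N. psum r N F \<le> C"
  shows "tame r F"
  unfolding tame_def
proof (rule bounded_imp_summable)
  show "(\<Sum>j\<le>n. nrm (fps_nth F j) * r ^ j) \<le> C" for n using assms(2) by (simp add: psum_def)
qed (use assms in simp)

lemma convergence_radius:
  "0 < convergence_radius b" "tame (convergence_radius b) (fV1 b)" "tame (convergence_radius b) (fV2 b)"
  "summable (\<lambda>j. \<bar>sig b j\<bar> * convergence_radius b ^ j)" "summable (\<lambda>j. \<bar>mu b j\<bar> * convergence_radius b ^ j)"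
proof -
  obtain r C where r: "0 < r" and C: "\<And>N. psum r N (fV1 b) \<le> C" "\<And>N. psum r N (fV2 b) \<le> C"
      "\<And>N. psum r N (fS b) \<le> C" "\<And>N. psum r N (fM b) \<le> C"
    using convergence[of b] by blast
  have r0: "0 \<le> r" using r by simp
  have "tame r (fV1 b)" "tame r (fV2 b)" "tame r (fS b)" "tame r (fM b)"
    using psum_tame[OF r0 C(1)] psum_tame[OF r0 C(2)] psum_tame[OF r0 C(3)] psum_tame[OF r0 C(4)] by auto
  then have "0 < r \<and> tame r (fV1 b) \<and> tame r (fV2 b) \<and>
     summable (\<lambda>j. \<bar>sig b j\<bar> * r ^ j) \<and> summable (\<lambda>j. \<bar>mu b j\<bar> * r ^ j)"
    using r by (simp add: tame_def fS_nth fM_nth nrm_cst)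
  from someI[of "\<lambda>r. 0 < r \<and> tame r (fV1 b) \<and> tame r (fV2 b) \<and>
     summable (\<lambda>j. \<bar>sig b j\<bar> * r ^ j) \<and> summable (\<lambda>j. \<bar>mu b j\<bar> * r ^ j)", OF this]
  show "0 < convergence_radius b" "tame (convergence_radius b) (fV1 b)" "tame (convergence_radius b) (fV2 b)"
    "summable (\<lambda>j. \<bar>sig b j\<bar> * convergence_radius b ^ j)" "summable (\<lambda>j. \<bar>mu b j\<bar> * convergence_radius b ^ j)"
    unfolding convergence_radius_def by blast+
qed

lemma summable_power_mono:
  fixes N :: "nat \<Rightarrow> real"
  assumes "summable (\<lambda>j. N j * r ^ j)" "\<And>j. 0 \<le> N j" "0 \<le> a" "a \<le> r"
  shows "summable (\<lambda>j. N j * a ^ j)"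
  by (rule summable_comparison_test'[OF assms(1), of 0]) (use assms in \<open>auto intro!: mult_left_mono power_mono\<close>)

lemma tame_mono: "tame r F \<Longrightarrow> 0 \<le> a \<Longrightarrow> a \<le> r \<Longrightarrow> tame a F"
  unfolding tame_def by (rule summable_power_mono) auto

section \<open>Profiles at a given amplitude\<close>

definition frequency :: "bool \<Rightarrow> real \<Rightarrow> real" where
  "frequency b a = 1 + suminf (\<lambda>j. sig b j * a ^ j)"
definition detuning :: "bool \<Rightarrow> real \<Rightarrow> real" where
  "detuning b a = suminf (\<lambda>j. mu b j * a ^ j)"

definition profile :: "bool \<Rightarrow> real \<Rightarrow> nat \<Rightarrow> nat \<Rightarrow> real \<Rightarrow> real \<Rightarrow> real^2" where
  "profile b a k l \<tau> \<xi> = vector [ser (fV1 b) a k l \<tau> \<xi>, ser (fV2 b) a k l \<tau> \<xi>]"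

lemma equivariant_tr: "equivariant (tr 0 0)" "equivariant (tr 1 0)" "equivariant (tr 0 2)"
  by (auto simp: equivariant_def tr_def)

text \<open>Both sides of \<open>formal_equation1\<close> and \<open>formal_equation2\<close> are
  evaluated at amplitude a, and uniqueness of the value yields the two rows.\<close>

lemma profile_equation:
  assumes a: "0 \<le> a" "a \<le> convergence_radius b"
  shows "frequency b a *\<^sub>R profile b a 1 0 \<tau> \<xi> =
     linear_part 1 2 1 (5 + detuning b a) (profile b a 0 0 \<tau> \<xi>) (profile b a 0 2 \<tau> \<xi>)
     + vector [a * (2 * profile b a 0 0 \<tau> \<xi> $ 1 * profile b a 0 0 \<tau> \<xi> $ 2 + (5 + detuning b a) * (profile b a 0 0 \<tau> \<xi> $ 1)\<^sup>2
         + a * ((profile b a 0 0 \<tau> \<xi> $ 1)\<^sup>2 * profile b a 0 0 \<tau> \<xi> $ 2)),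
       - a * (2 * profile b a 0 0 \<tau> \<xi> $ 1 * profile b a 0 0 \<tau> \<xi> $ 2 + (5 + detuning b a) * (profile b a 0 0 \<tau> \<xi> $ 1)\<^sup>2
         + a * ((profile b a 0 0 \<tau> \<xi> $ 1)\<^sup>2 * profile b a 0 0 \<tau> \<xi> $ 2))]"
proof -
  let ?E = "evaluates a \<tau> \<xi>"
  note R = convergence_radius[of b]
  have t: "tame a (fV1 b)" "tame a (fV2 b)" using tame_mono[OF _ a] R by auto
  have f0: "fmlt (tr 0 0) F = F" for F by (simp add: fps_eq_iff tr_eq)
  have E0: "?E (fV1 b) (of_real (ser (fV1 b) a 0 0 \<tau> \<xi>))" "?E (fV2 b) (of_real (ser (fV2 b) a 0 0 \<tau> \<xi>))"
    using ser_evaluates[OF _ a(1) t(1) equivariant_tr(1) adm_fV(1)] ser_evaluates[OF _ a(1) t(2) equivariant_tr(1) adm_fV(2)]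
    by (simp_all add: f0)
  have ED: "?E (fmlt cD (fV1 b)) (of_real (ser (fV1 b) a 1 0 \<tau> \<xi>))" "?E (fmlt cD (fV2 b)) (of_real (ser (fV2 b) a 1 0 \<tau> \<xi>))"
    using ser_evaluates[OF _ a(1) t(1) equivariant_tr(2) adm_fV(1)] ser_evaluates[OF _ a(1) t(2) equivariant_tr(2) adm_fV(2)]
    unfolding tr_eq by simp_all
  have EX: "?E (fmlt cX (fV1 b)) (of_real (ser (fV1 b) a 0 2 \<tau> \<xi>))" "?E (fmlt cX (fV2 b)) (of_real (ser (fV2 b) a 0 2 \<tau> \<xi>))"
    using ser_evaluates[OF _ a(1) t(1) equivariant_tr(3) adm_fV(1)] ser_evaluates[OF _ a(1) t(2) equivariant_tr(3) adm_fV(2)]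
    unfolding tr_eq by simp_all
  have ES: "?E (fS b) (of_real (frequency b a - 1))" unfolding frequency_def
    using evaluates_cst[OF summable_power_mono[OF R(4) _ a] a(1) fS_nth] by simp
  have EM: "?E (fM b) (of_real (detuning b a))" unfolding detuning_def
    using evaluates_cst[OF summable_power_mono[OF R(5) _ a] a(1) fM_nth] by simp
  note rules = evaluates_add evaluates_diff evaluates_mult evaluates_numeral evaluates_one evaluates_X E0 ED EX ES EM
  let ?v1 = "ser (fV1 b) a 0 0 \<tau> \<xi>" and ?v2 = "ser (fV2 b) a 0 0 \<tau> \<xi>"
  let ?R = "complex_of_real a * (2 * (of_real ?v1 * of_real ?v2) + (5 + of_real (detuning b a)) * (of_real ?v1 * of_real ?v1)
      + of_real a * (of_real ?v1 * of_real ?v1 * of_real ?v2))"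
  have rho: "?E (fps_X * rho (fV1 b) (fV2 b) (fM b)) ?R" unfolding rho_def by (intro rules)
  have "?E ((1 + fS b) * fmlt cD (fV1 b)) ((1 + of_real (frequency b a - 1)) * of_real (ser (fV1 b) a 1 0 \<tau> \<xi>))"
    by (intro rules)
  moreover have "?E ((1 + fS b) * fmlt cD (fV1 b)) (2 * of_real (ser (fV1 b) a 0 2 \<tau> \<xi>) + (4 + of_real (detuning b a)) * of_real ?v1 + of_real ?v2 + ?R)"
    unfolding formal_equation1 by (intro rules rho)
  ultimately have "(1 + of_real (frequency b a - 1)) * of_real (ser (fV1 b) a 1 0 \<tau> \<xi>) =
      2 * of_real (ser (fV1 b) a 0 2 \<tau> \<xi>) + (4 + of_real (detuning b a)) * of_real ?v1 + of_real ?v2 + ?R" by (rule evaluates_unique)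
  from arg_cong[OF this, of Re] have 1: "frequency b a * ser (fV1 b) a 1 0 \<tau> \<xi> = 2 * ser (fV1 b) a 0 2 \<tau> \<xi> + (4 + detuning b a) * ?v1 + ?v2
      + a * (2 * (?v1 * ?v2) + (5 + detuning b a) * (?v1 * ?v1) + a * (?v1 * ?v1 * ?v2))" by simp
  have "?E ((1 + fS b) * fmlt cD (fV2 b)) ((1 + of_real (frequency b a - 1)) * of_real (ser (fV2 b) a 1 0 \<tau> \<xi>))"
    by (intro rules)
  moreover have "?E ((1 + fS b) * fmlt cD (fV2 b)) (of_real (ser (fV2 b) a 0 2 \<tau> \<xi>) - (5 + of_real (detuning b a)) * of_real ?v1 - of_real ?v2 - ?R)"
    unfolding formal_equation2 by (intro rules rho)
  ultimately have "(1 + of_real (frequency b a - 1)) * of_real (ser (fV2 b) a 1 0 \<tau> \<xi>) =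
      of_real (ser (fV2 b) a 0 2 \<tau> \<xi>) - (5 + of_real (detuning b a)) * of_real ?v1 - of_real ?v2 - ?R" by (rule evaluates_unique)
  from arg_cong[OF this, of Re] have 2: "frequency b a * ser (fV2 b) a 1 0 \<tau> \<xi> = ser (fV2 b) a 0 2 \<tau> \<xi> - (5 + detuning b a) * ?v1 - ?v2
      - a * (2 * (?v1 * ?v2) + (5 + detuning b a) * (?v1 * ?v1) + a * (?v1 * ?v1 * ?v2))" by simp
  show ?thesis
    by (simp add: vec_eq_iff forall_2 profile_def linear_part_def 1[simplified] 2[simplified] power2_eq_square algebra_simps)
qed

lemma profile_periodic:
  "profile b a k l \<tau> (\<xi> + 2 * pi * of_int m) = profile b a k l \<tau> \<xi>" "profile b a k l (\<tau> + 2 * pi * of_int m) \<xi> = profile b a k l \<tau> \<xi>"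
  by (simp_all add: profile_def ser_periodic)

lemma ev_adm_travelling: "adm True p \<Longrightarrow> ev \<tau> \<xi> p = ev (\<tau> + \<xi>) 0 p"
  unfolding ev_def
proof (rule sum.cong[OF refl])
  assume p: "adm True p"
  fix q assume "q \<in> supp p"
  then have q: "fst q = snd q" using admD(2)[OF p, of q] by (auto simp: in_keys_iff)
  show "coef p q * cis (of_int (fst q) * \<tau> + of_int (snd q) * \<xi>) = coef p q * cis (of_int (fst q) * (\<tau> + \<xi>) + of_int (snd q) * 0)"
    unfolding q by (simp add: distrib_left)
qed

lemma ev_adm_standing:
  assumes "adm False p"
  shows "ev \<tau> (- \<xi>) p = ev \<tau> \<xi> p" "ev (\<tau> + pi) (\<xi> + pi) p = ev \<tau> \<xi> p"
proof -
  obtain A where A: "finite A" "supp p \<subseteq> A" and Ar: "(\<lambda>r. (fst r, - snd r)) ` A = A" by (rule symmetric_box)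
  have i: "inj_on (\<lambda>r::int\<times>int. (fst r, - snd r)) A" by (auto simp: inj_on_def)
  have "ev \<tau> (- \<xi>) p = (\<Sum>q\<in>(\<lambda>r. (fst r, - snd r)) ` A. coef p q * cis (of_int (fst q) * \<tau> + of_int (snd q) * (- \<xi>)))"
    unfolding ev_superset[OF A] Ar by (rule refl)
  also have "\<dots> = ev \<tau> \<xi> p" unfolding sum.reindex[OF i] ev_superset[OF A]
    by (rule sum.cong) (simp_all add: admD(3)[OF assms])
  finally show "ev \<tau> (- \<xi>) p = ev \<tau> \<xi> p" .
  show "ev (\<tau> + pi) (\<xi> + pi) p = ev \<tau> \<xi> p" unfolding ev_def
  proof (rule sum.cong[OF refl])
    fix q assume "q \<in> supp p"
    then have "even (fst q + snd q)" using admD(4)[OF assms, of q] by (metis in_keys_iff)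
    then obtain m where "fst q + snd q = 2 * m" by (rule evenE)
    then have m: "real_of_int (fst q) + of_int (snd q) = 2 * of_int m" by linarith
    have "of_int (fst q) * (\<tau> + pi) + of_int (snd q) * (\<xi> + pi) = of_int (fst q) * \<tau> + of_int (snd q) * \<xi> + (real_of_int (fst q) + of_int (snd q)) * pi"
      by (simp add: algebra_simps)
    also have "\<dots> = of_int (fst q) * \<tau> + of_int (snd q) * \<xi> + 2 * pi * of_int m" unfolding m by simp
    finally have "cis (of_int (fst q) * (\<tau> + pi) + of_int (snd q) * (\<xi> + pi)) = cis (of_int (fst q) * \<tau> + of_int (snd q) * \<xi>)"
      by (simp add: cis_mult[symmetric])
    then show "coef p q * cis (of_int (fst q) * (\<tau> + pi) + of_int (snd q) * (\<xi> + pi)) = coef p q * cis (of_int (fst q) * \<tau> + of_int (snd q) * \<xi>)" by simp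
  qed
qed

lemma profile_travelling: "profile True a 0 0 \<tau> \<xi> = profile True a 0 0 (\<tau> + \<xi>) 0"
  by (simp add: profile_def ser_def tr_eq ev_adm_travelling[OF adm_fV(1), of \<tau> \<xi>] ev_adm_travelling[OF adm_fV(2), of \<tau> \<xi>])

text \<open>The second identity combines invariance under the joint shift by pi with the period 2 pi
  in \<tau>, which makes shifts of \<tau> by pi and by - pi equal.\<close>

lemma profile_standing:
  "profile False a 0 0 \<tau> (- \<xi>) = profile False a 0 0 \<tau> \<xi>"
  "profile False a 0 0 \<tau> (\<xi> + pi) = profile False a 0 0 (\<tau> + pi) \<xi>"
proof -
  show "profile False a 0 0 \<tau> (- \<xi>) = profile False a 0 0 \<tau> \<xi>"
    by (simp add: profile_def ser_def tr_eq ev_adm_standing adm_fV)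
  have "profile False a 0 0 (\<tau> + pi) \<xi> = profile False a 0 0 (\<tau> + pi + pi) (\<xi> + pi)"
    unfolding profile_def ser_def tr_eq mlt_one ev_adm_standing(2)[OF adm_fV(1), of "\<tau> + pi" \<xi>] ev_adm_standing(2)[OF adm_fV(2), of "\<tau> + pi" \<xi>]
    by (rule refl)
  also have "\<dots> = profile False a 0 0 \<tau> (\<xi> + pi)" using profile_periodic(2)[of False a 0 0 \<tau> 1] by (simp add: add.assoc)
  finally show "profile False a 0 0 \<tau> (\<xi> + pi) = profile False a 0 0 (\<tau> + pi) \<xi>" by simp
qed

lemma has_vector_derivative_vector2:
  assumes "(f has_vector_derivative f') (at x)" "(g has_vector_derivative g') (at x)"
  shows "((\<lambda>x. vector [f x, g x] :: real^2) has_vector_derivative vector [f', g']) (at x)"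
proof -
  have v: "vector [p, q] = p *\<^sub>R axis 1 1 + q *\<^sub>R (axis 2 1 :: real^2)" for p q :: real
    by (simp add: vec_eq_iff forall_2 axis_def)
  show ?thesis unfolding v
    using assms by (auto intro!: derivative_eq_intros simp: has_real_derivative_iff_has_vector_derivative)
qed

lemma profile_deriv:
  assumes "k + l < 2" "0 \<le> a" "a \<le> convergence_radius b"
  shows "((\<lambda>\<tau>. profile b a k l \<tau> \<xi>) has_vector_derivative profile b a (Suc k) l \<tau> \<xi>) (at \<tau>)"
    "((\<lambda>\<xi>. profile b a k l \<tau> \<xi>) has_vector_derivative profile b a k (Suc l) \<tau> \<xi>) (at \<xi>)"
proof -
  have t: "tame a (fV1 b)" "tame a (fV2 b)" using tame_mono[OF _ assms(2,3)] convergence_radius by auto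
  show "((\<lambda>\<tau>. profile b a k l \<tau> \<xi>) has_vector_derivative profile b a (Suc k) l \<tau> \<xi>) (at \<tau>)"
    "((\<lambda>\<xi>. profile b a k l \<tau> \<xi>) has_vector_derivative profile b a k (Suc l) \<tau> \<xi>) (at \<xi>)"
    unfolding profile_def
    by (intro has_vector_derivative_vector2 ser_deriv[OF assms(1,2), unfolded has_real_derivative_iff_has_vector_derivative] t)+
qed

lemma norm_vec2_le: "norm (v :: real^2) \<le> \<bar>v $ 1\<bar> + \<bar>v $ 2\<bar>"
  using norm_le_l1_cart[of v] by (simp add: sum_2)

definition profile_bound :: "bool \<Rightarrow> real" where
  "profile_bound b = 2 * suminf (\<lambda>j. nrm (fps_nth (fV1 b) j) * convergence_radius b ^ j)
     + 2 * suminf (\<lambda>j. nrm (fps_nth (fV2 b) j) * convergence_radius b ^ j)"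

lemma profile_bound_nonneg: "0 \<le> profile_bound b"
  unfolding profile_bound_def using convergence_radius[of b]
  by (intro add_nonneg_nonneg mult_nonneg_nonneg suminf_nonneg) (auto simp: tame_def)

lemma profile_tail:
  assumes "k + l \<le> 2" "0 \<le> a" "a \<le> convergence_radius b"
  shows "norm (profile b a k l \<tau> \<xi>) \<le> profile_bound b"
    "norm (profile b a k l \<tau> \<xi> - vector [Re (ev \<tau> \<xi> (mlt (tr k l) (crit1 b))), Re (ev \<tau> \<xi> (mlt (tr k l) (crit2 b)))])
       \<le> profile_bound b / convergence_radius b * a"
proof -
  note R = convergence_radius[of b]
  note s = ser_tail[OF assms R(1) R(2)] ser_tail[OF assms R(1) R(3)]
  show "norm (profile b a k l \<tau> \<xi>) \<le> profile_bound b"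
    using norm_vec2_le[of "profile b a k l \<tau> \<xi>"] s(1)[of \<tau> \<xi> 0] s(2)[of \<tau> \<xi> 0]
    by (simp add: profile_def profile_bound_def)
  have V: "fps_nth (fV1 b) 0 = crit1 b" "fps_nth (fV2 b) 0 = crit2 b" by (simp_all add: fV1_def fV2_def f_zero)
  let ?d = "profile b a k l \<tau> \<xi> - vector [Re (ev \<tau> \<xi> (mlt (tr k l) (crit1 b))), Re (ev \<tau> \<xi> (mlt (tr k l) (crit2 b)))]"
  have "norm ?d \<le> \<bar>?d $ 1\<bar> + \<bar>?d $ 2\<bar>" by (rule norm_vec2_le)
  also have "\<dots> \<le> 2 * (a / convergence_radius b) * suminf (\<lambda>j. nrm (fps_nth (fV1 b) j) * convergence_radius b ^ j)
     + 2 * (a / convergence_radius b) * suminf (\<lambda>j. nrm (fps_nth (fV2 b) j) * convergence_radius b ^ j)"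
    using s(1)[of \<tau> \<xi> 1] s(2)[of \<tau> \<xi> 1] by (simp add: profile_def V)
  also have "\<dots> = profile_bound b / convergence_radius b * a" by (simp only: profile_bound_def divide_inverse distrib_right distrib_left mult_ac)
  finally show "norm ?d \<le> profile_bound b / convergence_radius b * a" .
qed

lemma lipschitz_from_derivative:
  fixes f :: "real \<Rightarrow> 'a::real_normed_vector"
  assumes "\<And>x. x \<in> closed_segment s t \<Longrightarrow> (f has_vector_derivative f' x) (at x)"
    "\<And>x. x \<in> closed_segment s t \<Longrightarrow> norm (f' x) \<le> B"
  shows "norm (f s - f t) \<le> B * \<bar>s - t\<bar>"
proof -
  have "norm (f s - f t) \<le> B * norm (s - t)"
  proof (rule differentiable_bound[where S = "closed_segment s t"])
    fix x assume x: "x \<in> closed_segment s t"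
    show "(f has_derivative (\<lambda>h. h *\<^sub>R f' x)) (at x within closed_segment s t)"
      using assms(1)[OF x] has_vector_derivative_at_within unfolding has_vector_derivative_def by blast
    show "onorm (\<lambda>h. h *\<^sub>R f' x) \<le> B"
      by (rule onorm_le) (use assms(2)[OF x] in \<open>simp add: mult.commute[of B] mult_left_mono\<close>)
  qed auto
  then show ?thesis by simp
qed

lemma second_order_estimate:
  fixes f :: "real \<Rightarrow> 'a::real_normed_vector"
  assumes f: "\<And>t. (f has_vector_derivative f' t) (at t)" "\<And>t. (f' has_vector_derivative f'' t) (at t)"
    and B: "\<And>t. norm (f'' t) \<le> B"
  shows "norm (f s - f t - (s - t) *\<^sub>R f' t) \<le> B * (s - t)\<^sup>2"
proof -
  have f': "norm (f' s - f' t) \<le> B * \<bar>s - t\<bar>" for s t by (rule lipschitz_from_derivative) (use f B in auto)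
  have B0: "0 \<le> B" using B[of 0] norm_ge_zero order_trans by blast
  have "norm ((f s - s *\<^sub>R f' t) - (f t - t *\<^sub>R f' t)) \<le> B * \<bar>s - t\<bar> * \<bar>s - t\<bar>"
  proof (rule lipschitz_from_derivative[where f = "\<lambda>x. f x - x *\<^sub>R f' t"])
    fix x assume x: "x \<in> closed_segment s t"
    have "((\<lambda>x. x *\<^sub>R f' t) has_vector_derivative f' t) (at x)"
      unfolding has_vector_derivative_def by (auto intro!: derivative_eq_intros)
    then show "((\<lambda>x. f x - x *\<^sub>R f' t) has_vector_derivative f' x - f' t) (at x)"
      by (intro has_vector_derivative_diff f)
    have "\<bar>x - t\<bar> \<le> \<bar>s - t\<bar>" using x by (auto simp: closed_segment_eq_real_ivl split: if_splits)
    then have "B * \<bar>x - t\<bar> \<le> B * \<bar>s - t\<bar>" using B0 by (rule mult_left_mono)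
    then show "norm (f' x - f' t) \<le> B * \<bar>s - t\<bar>" using f'[of x t] by linarith
  qed
  moreover have "f s - s *\<^sub>R f' t - (f t - t *\<^sub>R f' t) = f s - f t - (s - t) *\<^sub>R f' t" by (simp add: scaleR_diff_left)
  moreover have "B * \<bar>s - t\<bar> * \<bar>s - t\<bar> = B * (s - t)\<^sup>2" by (simp add: power2_eq_square mult.assoc)
  ultimately show ?thesis by simp
qed

lemma has_vector_derivative_affine:
  fixes f :: "real \<Rightarrow> 'a::real_normed_vector"
  assumes "\<And>x. (f has_vector_derivative f' x) (at x)"
  shows "((\<lambda>x. f (m * x + c)) has_vector_derivative m *\<^sub>R f' (m * x + c)) (at x)"
proof -
  have "((\<lambda>x. m * x + c) has_vector_derivative m) (at x)"
    unfolding has_real_derivative_iff_has_vector_derivative[symmetric] by (auto intro!: derivative_eq_intros)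
  from vector_diff_chain_at[OF this assms] show ?thesis by (simp add: o_def)
qed

text \<open>Phase, signed wave number and offset are left free, so that at each time every translate
  and reflection of a wave is again a snapshot and one family of estimates covers them all.\<close>

definition snapshot :: "bool \<Rightarrow> real \<Rightarrow> real \<Rightarrow> int \<Rightarrow> real \<Rightarrow> real \<Rightarrow> real^2" where
  "snapshot b a \<theta> m c = (\<lambda>x. a *\<^sub>R profile b a 0 0 \<theta> (of_int m * x + c))"

definition wave :: "bool \<Rightarrow> int \<Rightarrow> real \<Rightarrow> wave" where
  "wave b n a t = snapshot b a (frequency b a * t) n 0"

lemma profile_affine_deriv:
  assumes "k + l < 2" "0 \<le> a" "a \<le> convergence_radius b"
  shows "((\<lambda>x. profile b a k l \<theta> (m * x + c)) has_vector_derivative m *\<^sub>R profile b a k (Suc l) \<theta> (m * x + c)) (at x)"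
    "((\<lambda>x. profile b a k l (m * x + c) \<xi>) has_vector_derivative m *\<^sub>R profile b a (Suc k) l (m * x + c) \<xi>) (at x)"
  using has_vector_derivative_affine[OF profile_deriv(2)[OF assms]] has_vector_derivative_affine[OF profile_deriv(1)[OF assms]]
  by simp_all

lemma profile_space_periodic: "profile b a k l \<theta> (of_int m * (x + 2 * pi) + c) = profile b a k l \<theta> (of_int m * x + c)"
  using profile_periodic(1)[of b a k l \<theta> "of_int m * x + c" m] by (simp add: algebra_simps)

text \<open>Two space derivatives bring out n^2, which cancels against the diffusion constants. What
  remains is the profile equation multiplied by the amplitude.\<close>

lemma classical_snapshot:
  assumes n: "n \<noteq> 0" and m: "m = n \<or> m = - n" and a: "0 \<le> a" "a \<le> convergence_radius b"
  shows "classical 1 (2 / (of_int n)\<^sup>2) (1 / (of_int n)\<^sup>2) (5 + detuning b a)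
    (\<lambda>t. snapshot b a (frequency b a * t + d) m c)"
proof -
  define \<Omega> N B where "\<Omega> = frequency b a" and "N = real_of_int m" and "B = profile_bound b"
  have N: "N \<noteq> 0" and N2: "(real_of_int n)\<^sup>2 = N\<^sup>2" using n m by (auto simp: N_def)
  have B0: "0 \<le> B" by (simp add: B_def profile_bound_nonneg)
  let ?P = "\<lambda>k l t x. profile b a k l (\<Omega> * t + d) (N * x + c)" and ?v = "\<lambda>t. snapshot b a (frequency b a * t + d) m c"
  have w: "?v t x = a *\<^sub>R ?P 0 0 t x" for t x by (simp add: snapshot_def \<Omega>_def N_def)
  have dx: "((\<lambda>x. r *\<^sub>R ?P k l t x) has_vector_derivative (r * N) *\<^sub>R ?P k (Suc l) t x) (at x)" if "k + l < 2" for r k l t x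
    using profile_affine_deriv(1)[OF that a, of "\<Omega> * t + d" N c x]
    by (auto intro!: derivative_eq_intros)
  have dt: "((\<lambda>t. r *\<^sub>R ?P k l t x) has_vector_derivative (r * \<Omega>) *\<^sub>R ?P (Suc k) l t x) (at t)" if "k + l < 2" for r k l t x
    using profile_affine_deriv(2)[OF that a, of \<Omega> d "N * x + c" t]
    by (auto intro!: derivative_eq_intros)
  have bd: "norm (r *\<^sub>R ?P k l t x) \<le> \<bar>r\<bar> * B" if "k + l \<le> 2" for r k l t x
    using profile_tail(1)[OF that a] by (simp add: B_def mult_left_mono)
  define L where "L = (\<bar>a * \<Omega>\<bar> + \<bar>a * N * \<Omega>\<bar> + \<bar>a * \<Omega> * \<Omega>\<bar>) * B"
  have L: "\<bar>a * \<Omega>\<bar> * B \<le> L" "\<bar>a * N * \<Omega>\<bar> * B \<le> L" "\<bar>a * \<Omega> * \<Omega>\<bar> * B \<le> L"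
    unfolding L_def by (intro mult_right_mono B0; simp)+
  show ?thesis
  proof (rule classicalI[where vx = "\<lambda>t x. (a * N) *\<^sub>R ?P 0 1 t x" and vxx = "\<lambda>t x. (a * N * N) *\<^sub>R ?P 0 2 t x"
      and vt = "\<lambda>t x. (a * \<Omega>) *\<^sub>R ?P 1 0 t x" and L = L])
    show "periodic_2pi (?v t)" for t
      using profile_space_periodic by (simp add: periodic_2pi_def snapshot_def)
    show "(?v t has_vector_derivative (a * N) *\<^sub>R ?P 0 1 t x) (at x)" for t x
      using dx[of 0 0 a t x] by (simp add: w[abs_def])
    show "((\<lambda>x. (a * N) *\<^sub>R ?P 0 1 t x) has_vector_derivative (a * N * N) *\<^sub>R ?P 0 2 t x) (at x)" for t x
      using dx[of 0 1 "a * N" t x] by (simp add: numeral_2_eq_2)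
    show "continuous_on UNIV (\<lambda>x. (a * N * N) *\<^sub>R ?P 0 2 t x)" for t
    proof -
      have t: "tame a (fV1 b)" "tame a (fV2 b)" using tame_mono[OF _ a] convergence_radius by auto
      have v: "vector [p, q] = p *\<^sub>R axis 1 1 + q *\<^sub>R (axis 2 1 :: real^2)" for p q :: real
        by (simp add: vec_eq_iff forall_2 axis_def)
      have "continuous_on UNIV (\<lambda>\<xi>. profile b a 0 2 (\<Omega> * t + d) \<xi>)" unfolding profile_def v
        using ser_continuous[OF _ a(1) t(1), of 0 2] ser_continuous[OF _ a(1) t(2), of 0 2] by (intro continuous_intros) auto
      moreover have "continuous_on UNIV (\<lambda>x. N * x + c)" by (intro continuous_intros)
      ultimately have "continuous_on UNIV (\<lambda>x. ?P 0 2 t x)" by (rule continuous_on_compose2) simp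
      then show ?thesis by (rule continuous_on_scaleR[OF continuous_on_const])
    qed
    fix s t x
    have "norm (a *\<^sub>R ?P 0 0 s x - a *\<^sub>R ?P 0 0 t x) \<le> \<bar>a * \<Omega>\<bar> * B * \<bar>s - t\<bar>"
      by (rule lipschitz_from_derivative[OF dt bd]) auto
    also have "\<dots> \<le> L * \<bar>s - t\<bar>" by (intro mult_right_mono L) simp
    finally show "norm (?v s x - ?v t x) \<le> L * \<bar>s - t\<bar>" by (simp add: w)
    have "norm ((a * N) *\<^sub>R ?P 0 1 s x - (a * N) *\<^sub>R ?P 0 1 t x) \<le> \<bar>a * N * \<Omega>\<bar> * B * \<bar>s - t\<bar>"
      by (rule lipschitz_from_derivative[OF dt bd]) auto
    also have "\<dots> \<le> L * \<bar>s - t\<bar>" by (intro mult_right_mono L) simp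
    finally show "norm ((a * N) *\<^sub>R ?P 0 1 s x - (a * N) *\<^sub>R ?P 0 1 t x) \<le> L * \<bar>s - t\<bar>" .
    have "norm (a *\<^sub>R ?P 0 0 s x - a *\<^sub>R ?P 0 0 t x - (s - t) *\<^sub>R ((a * \<Omega>) *\<^sub>R ?P (Suc 0) 0 t x)) \<le> \<bar>a * \<Omega> * \<Omega>\<bar> * B * (s - t)\<^sup>2"
      by (rule second_order_estimate[OF dt dt bd]) auto
    also have "\<dots> \<le> L * (s - t)\<^sup>2" by (intro mult_right_mono L) simp
    finally show "norm (?v s x - ?v t x - (s - t) *\<^sub>R ((a * \<Omega>) *\<^sub>R ?P 1 0 t x)) \<le> L * (s - t)\<^sup>2"
      by (simp add: w)
    have "(a * \<Omega>) *\<^sub>R ?P 1 0 t x = a *\<^sub>R (\<Omega> *\<^sub>R ?P 1 0 t x)" by simp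
    also have "\<dots> = linear_part 1 (2 / N\<^sup>2) (1 / N\<^sup>2) (5 + detuning b a) (a *\<^sub>R ?P 0 0 t x) ((a * N * N) *\<^sub>R ?P 0 2 t x)
        + nonlinear_part 1 (5 + detuning b a) (a *\<^sub>R ?P 0 0 t x)"
      unfolding \<Omega>_def profile_equation[OF a] using N
      by (simp add: vec_eq_iff forall_2 linear_part_def nonlinear_part_def power2_eq_square algebra_simps)
    finally show "(a * \<Omega>) *\<^sub>R ?P 1 0 t x = linear_part 1 (2 / (of_int n)\<^sup>2) (1 / (of_int n)\<^sup>2) (5 + detuning b a) (?v t x)
        ((a * N * N) *\<^sub>R ?P 0 2 t x) + nonlinear_part 1 (5 + detuning b a) (?v t x)"
      unfolding w N2 .
  qed
qed

section \<open>The leading term, the critical space and asymptotics for small amplitude\<close>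

lemma profile_0: "profile b 0 k l \<theta> \<xi> = vector [Re (ev \<theta> \<xi> (mlt (tr k l) (crit1 b))), Re (ev \<theta> \<xi> (mlt (tr k l) (crit2 b)))]"
proof -
  have "fps_nth (fV1 b) 0 = crit1 b" "fps_nth (fV2 b) 0 = crit2 b" by (simp_all add: fV1_def fV2_def f_zero)
  then show ?thesis by (simp add: profile_def ser_def powser_zero)
qed

lemma ev_crit1:
  "ev \<theta> \<xi> (mlt c (crit1 b)) = c (1, 1) * cis (\<theta> + \<xi>) + c (-1, -1) * cis (- \<theta> - \<xi>) +
     (if b then 0 else c (1, -1) * cis (\<theta> - \<xi>) + c (-1, 1) * cis (- \<theta> + \<xi>))"
proof -
  let ?A = "{(1, 1), (-1, -1), (1, -1), (-1, 1)} :: (int \<times> int) set"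
  have "supp (mlt c (crit1 b)) \<subseteq> ?A" by (auto simp: in_keys_iff coef_crit1 split: if_splits)
  from ev_superset[OF _ this, of \<theta> \<xi>] show ?thesis by (simp add: coef_crit1)
qed

lemma profile_leading:
  "profile b 0 0 0 \<theta> \<xi> = vector [2 * cos (\<theta> + \<xi>), - 4 * cos (\<theta> + \<xi>) - 2 * sin (\<theta> + \<xi>)]
     + (if b then 0 else vector [2 * cos (\<theta> - \<xi>), - 4 * cos (\<theta> - \<xi>) - 2 * sin (\<theta> - \<xi>)])"
proof -
  have e: "ev \<theta> \<xi> (crit1 b) = cis (\<theta> + \<xi>) + cis (- \<theta> - \<xi>) + (if b then 0 else cis (\<theta> - \<xi>) + cis (- \<theta> + \<xi>))"
    using ev_crit1[of \<theta> \<xi> "\<lambda>q. 1" b] by simp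
  show ?thesis
    unfolding profile_0 tr_eq mlt_one crit2_def e ev_crit1
    by (cases b) (simp_all add: vec_eq_iff forall_2 cD_def cos_add sin_add cos_diff sin_diff)
qed

lemma critical_space_single:
  assumes "e \<in> critical_parts \<alpha> \<delta>1 \<delta>2 n \<omega>" shows "e \<in> critical_space \<alpha> \<delta>1 \<delta>2 n \<omega>"
proof -
  have "e = (\<lambda>x. \<Sum>e\<in>{e}. 1 *\<^sub>R e x)" by simp
  then show ?thesis using assms unfolding critical_space_def mem_Collect_eq
    by (intro exI[of _ "{e}"] exI[of _ "\<lambda>_::real \<Rightarrow> real^2. 1::real"]) simp
qed

lemma critical_space_pair:
  assumes "e \<in> critical_parts \<alpha> \<delta>1 \<delta>2 n \<omega>" "e' \<in> critical_parts \<alpha> \<delta>1 \<delta>2 n \<omega>"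
  shows "(\<lambda>x. e x + e' x) \<in> critical_space \<alpha> \<delta>1 \<delta>2 n \<omega>"
\<comment> \<open>\<open>critical_space\<close> sums over a set of functions, in which two equal
  summands are counted once; the coefficient 2 makes up for this.\<close>
proof (cases "e = e'")
  case True
  have "(\<lambda>x. e x + e' x) = (\<lambda>x. \<Sum>e\<in>{e}. 2 *\<^sub>R e x)" by (simp add: True scaleR_2)
  then show ?thesis using assms unfolding critical_space_def mem_Collect_eq
    by (intro exI[of _ "{e}"] exI[of _ "\<lambda>_::real \<Rightarrow> real^2. 2::real"]) simp
next
  case False
  have "(\<lambda>x. e x + e' x) = (\<lambda>x. \<Sum>e\<in>{e, e'}. 1 *\<^sub>R e x)" using False by simp
  then show ?thesis using assms unfolding critical_space_def mem_Collect_eq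
    by (intro exI[of _ "{e, e'}"] exI[of _ "\<lambda>_::real \<Rightarrow> real^2. 1::real"]) simp
qed

text \<open>A travelling profile contributes one critical wave, a standing one the sum of two
  running in opposite directions.\<close>

lemma leading_in_critical_space:
  assumes n: "n \<noteq> 0" and \<delta>: "\<delta>1 = 2 / (of_int n)\<^sup>2" "\<delta>2 = 1 / (of_int n)\<^sup>2" and m: "m = n \<or> m = - n"
  shows "(\<lambda>x. a *\<^sub>R profile b 0 0 0 \<theta> (of_int m * x + c)) \<in> critical_space 1 \<delta>1 \<delta>2 n 1"
proof -
  define e where "e = (\<lambda>k \<phi> x. a *\<^sub>R (vector [2 * cos (\<phi> + of_int k * x), - 4 * cos (\<phi> + of_int k * x) - 2 * sin (\<phi> + of_int k * x)] :: real^2))"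
  have e: "e k \<phi> \<in> critical_parts 1 \<delta>1 \<delta>2 n 1" if k: "k = n \<or> k = - n" for k \<phi>
  proof -
    have f: "exp (\<i> * of_int k * of_real x) * cis \<phi> = cis (\<phi> + of_int k * x)" for x
    proof -
      have "exp (\<i> * of_int k * of_real x) = cis (of_int k * x)" by (simp add: cis_conv_exp mult.assoc)
      then show ?thesis by (simp add: cis_mult add.commute)
    qed
    have "e k \<phi> = (\<lambda>x. \<chi> j. Re (fourier_mode k ((2 * of_real a * cis \<phi>) *s crit_vec \<i>) x $ j))"
    proof (rule ext)
      fix x
      have v: "crit_vec \<i> $ 1 = 1" "crit_vec \<i> $ 2 = \<i> - 2" by (simp_all add: crit_vec_def[OF n \<delta>])
      have "exp (\<i> * of_int k * of_real x) * (2 * of_real a * cis \<phi> * z) = of_real (2 * a) * (cis (\<phi> + of_int k * x) * z)" for z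
        using f[of x, symmetric] by (simp add: mult_ac)
      then show "e k \<phi> x = (\<chi> j. Re (fourier_mode k ((2 * of_real a * cis \<phi>) *s crit_vec \<i>) x $ j))"
        by (simp only: fourier_mode_def vec_eq_iff forall_2 vec_lambda_beta vector_smult_component v e_def vector_scaleR_component vector_2)
          (simp add: algebra_simps)
    qed
    then show ?thesis using Re_mode_in_critical_parts[OF n \<delta> k] by simp
  qed
  show ?thesis
  proof (cases b)
    case True
    have "(\<lambda>x. a *\<^sub>R profile b 0 0 0 \<theta> (of_int m * x + c)) = e m (\<theta> + c)"
      by (simp add: profile_leading True e_def add_ac)
    then show ?thesis using critical_space_single[OF e[OF m]] by simp
  next
    case False
    have "(\<lambda>x. a *\<^sub>R profile b 0 0 0 \<theta> (of_int m * x + c)) = (\<lambda>x. e m (\<theta> + c) x + e (- m) (\<theta> - c) x)"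
      by (simp add: profile_leading False e_def add_ac scaleR_add_right[symmetric] diff_diff_eq)
    moreover have "- m = n \<or> - m = - n" using m by auto
    ultimately show ?thesis using critical_space_pair[OF e[OF m] e] by simp
  qed
qed

lemma integral_cos_square:
  assumes "m \<noteq> 0"
  shows "(\<integral>x. (cos (of_int m * x + c))\<^sup>2 \<partial>circ) = pi"
proof -
  let ?m = "real_of_int m"
  have s: "(cos y)\<^sup>2 = 1 / 2 + cos (2 * y) / 2" for y :: real
    using cos_double_cos[of y] by linarith
  have d: "((\<lambda>x. x / 2 + sin (2 * (?m * x + c)) / (4 * ?m)) has_vector_derivative (cos (?m * x + c))\<^sup>2) (at x)" for x
    unfolding has_real_derivative_iff_has_vector_derivative[symmetric] s
    using assms by (auto intro!: derivative_eq_intros)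
  have c: "continuous_on UNIV (\<lambda>x. (cos (?m * x + c))\<^sup>2)" by (intro continuous_intros)
  have "(\<integral>x. (cos (?m * x + c))\<^sup>2 \<partial>circ) = (pi / 2 + sin (2 * (?m * pi + c)) / (4 * ?m)) - (- pi / 2 + sin (2 * (?m * (- pi) + c)) / (4 * ?m))"
    using integral_circ_FTC[OF d c] by simp
  moreover have "sin (2 * (?m * pi + c)) = sin (2 * (?m * (- pi) + c))"
  proof -
    have "2 * (?m * pi + c) = 2 * (?m * (- pi) + c) + 2 * pi * of_int (2 * m)" by (simp add: algebra_simps)
    then show ?thesis by (simp only: sin_add[of _ "2 * pi * of_int (2 * m)"] sin_int_2pin cos_int_2pin mult_1_right mult_zero_right add_0_right)
  qed
  ultimately show ?thesis by simp
qed

lemma H1_norm_le: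
  assumes "has_weak_deriv f g" "L2_norm f \<le> p" "L2_norm g \<le> q"
  shows "H1_norm f \<le> p + q"
proof -
  have "0 \<le> p" "0 \<le> q" using assms(2,3) L2_norm_nonneg order_trans by blast+
  moreover have "(H1_norm f)\<^sup>2 \<le> p\<^sup>2 + q\<^sup>2"
    unfolding H1_norm_eq[OF assms(1)] using assms(2,3) by (intro add_mono power_mono) auto
  moreover from calculation have "0 \<le> 2 * p * q" by simp
  ultimately have "(H1_norm f)\<^sup>2 \<le> (p + q)\<^sup>2" unfolding power2_sum by linarith
  then show ?thesis by (rule power2_le_imp_le) (use \<open>0 \<le> p\<close> \<open>0 \<le> q\<close> in simp)
qed

lemma snapshot_weak_deriv:
  assumes "0 \<le> a" "a \<le> convergence_radius b"
  shows "has_weak_deriv (\<lambda>x. r *\<^sub>R profile b a 0 0 \<theta> (of_int m * x + c)) (\<lambda>x. (r * of_int m) *\<^sub>R profile b a 0 1 \<theta> (of_int m * x + c))"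
proof (rule has_weak_deriv_C1)
  have d: "((\<lambda>x. profile b a 0 l \<theta> (of_int m * x + c)) has_vector_derivative of_int m *\<^sub>R profile b a 0 (Suc l) \<theta> (of_int m * x + c)) (at x)"
    if "l < 2" for l x using profile_affine_deriv(1)[OF _ assms] that by simp
  show "periodic_2pi (\<lambda>x. r *\<^sub>R profile b a 0 0 \<theta> (of_int m * x + c))"
    using profile_space_periodic by (simp add: periodic_2pi_def)
  show "((\<lambda>x. r *\<^sub>R profile b a 0 0 \<theta> (of_int m * x + c)) has_vector_derivative (r * of_int m) *\<^sub>R profile b a 0 1 \<theta> (of_int m * x + c)) (at x)" for x
    using d[of 0 x] by (auto intro!: derivative_eq_intros)
  have "continuous_on UNIV (\<lambda>x. profile b a 0 1 \<theta> (of_int m * x + c))"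
    using d[of 1] by (intro continuous_at_imp_continuous_on ballI has_vector_derivative_continuous) auto
  then show "continuous_on UNIV (\<lambda>x. (r * of_int m) *\<^sub>R profile b a 0 1 \<theta> (of_int m * x + c))"
    by (intro continuous_intros)
qed

text \<open>The bifurcation condition divides by the norm, so a lower bound uniform in the phase is
  required: a standing wave must never pass close to 0 relative to its amplitude.\<close>

lemma leading_L2_lower:
  assumes "m \<noteq> 0"
  shows "2 * pi \<le> (L2_norm (\<lambda>x. profile b 0 0 0 \<theta> (of_int m * x + c)))\<^sup>2"
proof -
  define \<phi> where "\<phi> = (if b then \<theta> + c else c)"
  have low: "2 * (cos (of_int m * x + \<phi>))\<^sup>2 \<le> (norm (profile b 0 0 0 \<theta> (of_int m * x + c)))\<^sup>2" for x
  proof (cases b)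
    case True
    let ?y = "profile b 0 0 0 \<theta> (of_int m * x + c)"
    have e: "\<theta> + (of_int m * x + c) = of_int m * x + \<phi>" by (simp add: \<phi>_def True)
    have "?y $ 1 = 2 * cos (of_int m * x + \<phi>)" unfolding profile_leading e by (simp add: True)
    then have "4 * (cos (of_int m * x + \<phi>))\<^sup>2 \<le> (norm ?y)\<^sup>2"
      unfolding power2_norm_eq_inner inner_vec_def by (simp add: sum_2 power2_eq_square)
    then show ?thesis using zero_le_power2[of "cos (of_int m * x + \<phi>)"] by linarith
  next
    case False
    let ?y = "profile b 0 0 0 \<theta> (of_int m * x + c)" and ?c = "cos (of_int m * x + \<phi>)"
    have "of_int m * x + c = of_int m * x + \<phi>" by (simp add: \<phi>_def False)
    then have y: "?y $ 1 = 4 * cos \<theta> * ?c" "?y $ 2 = 4 * (- 2 * cos \<theta> - sin \<theta>) * ?c"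
      by (simp_all add: profile_leading False cos_add sin_add cos_diff sin_diff algebra_simps)
    have "(norm ?y)\<^sup>2 = (?y $ 1)\<^sup>2 + (?y $ 2)\<^sup>2"
      unfolding power2_norm_eq_inner inner_vec_def by (simp add: sum_2 power2_eq_square)
    also have "\<dots> = (16 * ((cos \<theta>)\<^sup>2 + (2 * cos \<theta> + sin \<theta>)\<^sup>2)) * ?c\<^sup>2"
      unfolding y by (simp add: power2_eq_square algebra_simps)
    finally have n: "(norm ?y)\<^sup>2 = (16 * ((cos \<theta>)\<^sup>2 + (2 * cos \<theta> + sin \<theta>)\<^sup>2)) * ?c\<^sup>2" .
    have "2 \<le> 16 * ((cos \<theta>)\<^sup>2 + (2 * cos \<theta> + sin \<theta>)\<^sup>2)"
    proof -
      \<comment> \<open>Completing the square in w; the coefficient left for u^2 is 78 - 512 / 7 >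
        0.\<close>
      have "16 * (u\<^sup>2 + (2 * u + w)\<^sup>2) - 2 * (w\<^sup>2 + u\<^sup>2) = 14 * (w + 16 / 7 * u)\<^sup>2 + (78 - 14 * (16 / 7)\<^sup>2) * u\<^sup>2" for u w :: real
        by (simp add: power2_eq_square algebra_simps)
      then have "16 * ((cos \<theta>)\<^sup>2 + (2 * cos \<theta> + sin \<theta>)\<^sup>2) - 2 * ((sin \<theta>)\<^sup>2 + (cos \<theta>)\<^sup>2) =
        14 * (sin \<theta> + 16 / 7 * cos \<theta>)\<^sup>2 + (78 - 14 * (16 / 7)\<^sup>2) * (cos \<theta>)\<^sup>2" .
      also have "\<dots> \<ge> 0" by (intro add_nonneg_nonneg mult_nonneg_nonneg) (auto simp: power2_eq_square)
      finally show ?thesis by simp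
    qed
    then show ?thesis unfolding n by (rule mult_right_mono) simp
  qed
  have L: "L2_circle (\<lambda>x. profile b 0 0 0 \<theta> (of_int m * x + c))"
    using has_weak_derivD(1)[OF snapshot_weak_deriv[of 0 b 1]] convergence_radius(1)[of b] by simp
  have "2 * pi = (\<integral>x. 2 * (cos (of_int m * x + \<phi>))\<^sup>2 \<partial>circ)" using integral_cos_square[OF assms] by simp
  also have "\<dots> \<le> (\<integral>x. (norm (profile b 0 0 0 \<theta> (of_int m * x + c)))\<^sup>2 \<partial>circ)"
  proof (rule integral_mono)
    show "integrable circ (\<lambda>x. 2 * (cos (of_int m * x + \<phi>))\<^sup>2)"
      by (intro integrable_circ_continuous continuous_intros)
    show "integrable circ (\<lambda>x. (norm (profile b 0 0 0 \<theta> (of_int m * x + c)))\<^sup>2)"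
      using L by (simp add: L2_circle_altdef)
  qed (rule low)
  finally show ?thesis by (simp add: L2_norm_power2)
qed

lemma snapshot_asymptotics:
  assumes n: "n \<noteq> 0" and \<delta>: "\<delta>1 = 2 / (of_int n)\<^sup>2" "\<delta>2 = 1 / (of_int n)\<^sup>2"
  obtains a0 C where "0 < a0" "a0 \<le> convergence_radius b" "0 \<le> C"
    "\<And>a \<theta> m c. 0 < a \<Longrightarrow> a \<le> a0 \<Longrightarrow> m = n \<or> m = - n \<Longrightarrow> a \<le> H1_norm (snapshot b a \<theta> m c) \<and>
       H1_norm (snapshot b a \<theta> m c) \<le> C * a \<and> H1_dist (snapshot b a \<theta> m c) (critical_space 1 \<delta>1 \<delta>2 n 1) \<le> C * a\<^sup>2"
    "\<And>a \<theta> \<xi>. 0 < a \<Longrightarrow> a \<le> a0 \<Longrightarrow> norm (profile b a 0 0 \<theta> \<xi> - profile b 0 0 0 \<theta> \<xi>) \<le> 1 / 2"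
proof -
  define R B N where "R = convergence_radius b" and "B = profile_bound b" and "N = \<bar>real_of_int n\<bar>"
  have R: "0 < R" by (simp add: R_def convergence_radius)
  have B: "0 \<le> B" by (simp add: B_def profile_bound_nonneg)
  \<comment> \<open>In this range the leading term has relative error at most 1 / 2, which is small
    enough to keep a lower bound for the norm.\<close>
  define a0 where "a0 = min R (R / (2 * (B + 1)))"
  define K where "K = sqrt (2 * pi) * (1 + N)"
  define C where "C = K * B + K * (B / R)"
  have K: "0 \<le> K" by (simp add: K_def N_def)
  have a0: "0 < a0" "a0 \<le> R" using R B by (auto simp: a0_def)
  have C: "K * B \<le> C" "K * (B / R) \<le> C" "0 \<le> C"
    using K B R by (simp_all add: C_def)
  have half: "B / R * a \<le> 1 / 2" if "a \<le> a0" for a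
  proof -
    have "a \<le> R / (2 * (B + 1))" using that by (simp add: a0_def)
    then have "B / R * a \<le> B / R * (R / (2 * (B + 1)))" using B R by (intro mult_left_mono) auto
    also have "\<dots> = B / (2 * (B + 1))" using R by simp
    also have "\<dots> \<le> 1 / 2" using B by (simp add: field_simps)
    finally show ?thesis .
  qed
  show thesis
  proof (rule that[OF a0[unfolded R_def] C(3)])
    show "norm (profile b a 0 0 \<theta> \<xi> - profile b 0 0 0 \<theta> \<xi>) \<le> 1 / 2" if a: "0 < a" "a \<le> a0" for a \<theta> \<xi>
    proof -
      have "a \<le> convergence_radius b" using a a0 by (simp add: R_def)
      from order_trans[OF profile_tail(2)[OF _ _ this, of 0 0 \<theta> \<xi>] half[OF a(2), unfolded B_def R_def]]
      show ?thesis using a by (simp add: profile_0)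
    qed
  next
    fix a \<theta> c and m :: int assume a: "0 < a" "a \<le> a0" and m: "m = n \<or> m = - n"
    have aR: "0 \<le> a" "a \<le> convergence_radius b" using a a0 by (auto simp: R_def)
    have N: "\<bar>real_of_int m\<bar> = N" using m by (auto simp: N_def)
    define e e' where "e = (\<lambda>x. a *\<^sub>R profile b 0 0 0 \<theta> (of_int m * x + c))"
      and "e' = (\<lambda>x. (a * of_int m) *\<^sub>R profile b 0 0 1 \<theta> (of_int m * x + c))"
    define f f' where "f = snapshot b a \<theta> m c" and "f' = (\<lambda>x. (a * of_int m) *\<^sub>R profile b a 0 1 \<theta> (of_int m * x + c))"
    have wf: "has_weak_deriv f f'" unfolding f_def f'_def snapshot_def by (rule snapshot_weak_deriv[OF aR])
    have we: "has_weak_deriv e e'" unfolding e_def e'_def by (rule snapshot_weak_deriv) (simp_all add: convergence_radius less_imp_le)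
    have wd: "has_weak_deriv (\<lambda>x. f x - e x) (\<lambda>x. f' x - e' x)" by (rule has_weak_deriv_diff[OF wf we])
    have "norm (f x) \<le> a * B" "norm (f' x) \<le> a * N * B" for x
      using profile_tail(1)[OF _ aR, of 0 0] profile_tail(1)[OF _ aR, of 0 1] a
      by (simp_all add: f_def snapshot_def f'_def B_def abs_mult N mult.assoc mult_left_mono N_def)
    then have "L2_norm f \<le> sqrt (2 * pi) * (a * B)" "L2_norm f' \<le> sqrt (2 * pi) * (a * N * B)"
      using L2_norm_le_sup has_weak_derivD[OF wf] by blast+
    from H1_norm_le[OF wf this] have "H1_norm f \<le> (K * B) * a" by (simp add: K_def algebra_simps)
    also have "\<dots> \<le> C * a" using C a by (intro mult_right_mono) auto
    finally have up: "H1_norm f \<le> C * a" .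
    define q where "q = B / R * a"
    have tail: "norm (profile b a 0 l \<theta> \<xi> - profile b 0 0 l \<theta> \<xi>) \<le> q" if "l \<le> 2" for l \<xi>
      using profile_tail(2)[OF _ aR, of 0 l] that by (simp add: profile_0 q_def B_def R_def)
    have q0: "0 \<le> q" using B R a by (simp add: q_def)
    have df: "norm (f x - e x) \<le> a * q" for x
      using tail[of 0 "of_int m * x + c"] a by (simp add: f_def e_def snapshot_def scaleR_diff_right[symmetric] mult_left_mono)
    have df': "norm (f' x - e' x) \<le> a * N * q" for x
      using tail[of 1 "of_int m * x + c"] a
      by (simp add: f'_def e'_def scaleR_diff_right[symmetric] abs_mult N mult_left_mono N_def)
    have l2: "L2_norm (\<lambda>x. f x - e x) \<le> sqrt (2 * pi) * (a * q)" "L2_norm (\<lambda>x. f' x - e' x) \<le> sqrt (2 * pi) * (a * N * q)"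
      using L2_norm_le_sup[OF has_weak_derivD(1)[OF wd]] L2_norm_le_sup[OF has_weak_derivD(2)[OF wd]] df df' by blast+
    from H1_norm_le[OF wd this] have "H1_norm (\<lambda>x. f x - e x) \<le> K * (B / R) * a\<^sup>2"
      by (simp add: K_def q_def power2_eq_square algebra_simps)
    also have "\<dots> \<le> C * a\<^sup>2" using C by (intro mult_right_mono) auto
    finally have "H1_norm (\<lambda>x. f x - e x) \<le> C * a\<^sup>2" .
    moreover have "H1_dist f (critical_space 1 \<delta>1 \<delta>2 n 1) \<le> H1_norm (\<lambda>x. f x - e x)"
      unfolding H1_dist_def
    proof (rule cINF_lower)
      show "bdd_below ((\<lambda>e. H1_norm (\<lambda>x. f x - e x)) ` critical_space 1 \<delta>1 \<delta>2 n 1)"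
        by (rule bdd_belowI[of _ 0]) (auto simp: H1_norm_nonneg)
      show "e \<in> critical_space 1 \<delta>1 \<delta>2 n 1" unfolding e_def by (rule leading_in_critical_space[OF n \<delta> m])
    qed
    ultimately have dist: "H1_dist f (critical_space 1 \<delta>1 \<delta>2 n 1) \<le> C * a\<^sup>2" by linarith
    \<comment> \<open>The aim is a <= ||f||. It follows from 2 pi a^2 <= ||e||^2 <= 2 ||f||^2 + 2
      ||f - e||^2 once 2 ||f - e||^2 <= pi a^2.\<close>
    have "q \<le> 1 / 2" using half[OF a(2)] by (simp add: q_def)
    then have "(a * q)\<^sup>2 \<le> (a * (1 / 2))\<^sup>2" using q0 a by (intro power_mono mult_left_mono) auto
    then have "2 * (L2_norm (\<lambda>x. f x - e x))\<^sup>2 \<le> pi * a\<^sup>2"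
    proof -
      have "(L2_norm (\<lambda>x. f x - e x))\<^sup>2 \<le> 2 * pi * (a * q)\<^sup>2"
        using power_mono[OF l2(1) L2_norm_nonneg, of 2] by (simp add: power_mult_distrib)
      also have "\<dots> \<le> 2 * pi * (a * (1 / 2))\<^sup>2" using \<open>(a * q)\<^sup>2 \<le> (a * (1 / 2))\<^sup>2\<close> by (rule mult_left_mono) simp
      finally show ?thesis by (simp add: power_mult_distrib power_divide)
    qed
    moreover have "2 * pi * a\<^sup>2 \<le> (L2_norm e)\<^sup>2"
    proof -
      have "m \<noteq> 0" using n m by auto
      from mult_left_mono[OF leading_L2_lower[OF this, of b \<theta> c], of "a\<^sup>2"] show ?thesis
        using a by (simp add: e_def L2_norm_scaleR power_mult_distrib mult_ac)
    qed
    moreover have "(L2_norm e)\<^sup>2 \<le> 2 * (L2_norm f)\<^sup>2 + 2 * (L2_norm (\<lambda>x. f x - e x))\<^sup>2"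
    proof -
      have "(L2_norm e)\<^sup>2 = (L2_norm (\<lambda>x. f x + - 1 *\<^sub>R (f x - e x)))\<^sup>2" by simp
      also have "\<dots> \<le> 2 * (L2_norm f)\<^sup>2 + 2 * (L2_norm (\<lambda>x. - 1 *\<^sub>R (f x - e x)))\<^sup>2"
        by (intro L2_norm_add_square_le L2_circle_scaleR has_weak_derivD(1)[OF wf] has_weak_derivD(1)[OF wd])
      finally show ?thesis by (simp only: L2_norm_scaleR) simp
    qed
    ultimately have "pi * a\<^sup>2 \<le> 2 * (L2_norm f)\<^sup>2" by linarith
    moreover have "2 * a\<^sup>2 \<le> pi * a\<^sup>2" using pi_gt3 by (intro mult_right_mono) auto
    ultimately have "a\<^sup>2 \<le> (L2_norm f)\<^sup>2" by linarith
    then have "a \<le> L2_norm f" by (rule power2_le_imp_le) simp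
    also have "\<dots> \<le> H1_norm f" by (rule L2_norm_le_H1_norm)
    finally show "a \<le> H1_norm (snapshot b a \<theta> m c) \<and> H1_norm (snapshot b a \<theta> m c) \<le> C * a \<and>
        H1_dist (snapshot b a \<theta> m c) (critical_space 1 \<delta>1 \<delta>2 n 1) \<le> C * a\<^sup>2"
      using up dist by (simp add: f_def)
  qed
qed

lemma frequency_detuning:
  obtains a0 c where "0 < a0" "a0 \<le> convergence_radius b" "0 < c" "detuning b 0 = 0" "continuous_on {0..a0} (detuning b)"
    "\<And>a. 0 \<le> a \<Longrightarrow> a \<le> a0 \<Longrightarrow> 1 / 2 \<le> frequency b a" "\<And>a. 0 \<le> a \<Longrightarrow> a \<le> a0 \<Longrightarrow> c * a\<^sup>2 \<le> detuning b a"
proof -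
  define R where "R = convergence_radius b"
  define S where "S = suminf (\<lambda>j. \<bar>sig b j\<bar> * R ^ j)"
  define M where "M = suminf (\<lambda>j. \<bar>mu b j\<bar> * R ^ j)"
  define c where "c = mu b 2 / 2"
  have R: "0 < R" "summable (\<lambda>j. \<bar>sig b j\<bar> * R ^ j)" "summable (\<lambda>j. \<bar>mu b j\<bar> * R ^ j)"
    using convergence_radius[of b] by (simp_all add: R_def)
  have S: "0 \<le> S" "0 \<le> M" unfolding S_def M_def using R by (auto intro!: suminf_nonneg)
  have c: "0 < c" using mu_2_pos by (simp add: c_def)
  \<comment> \<open>The three bounds keep a inside the radius of convergence, the frequency above 1
    / 2, and the tail of the detuning from order three on below half of its quadratic term.\<close>
  define a0 where "a0 = min (R / 2) (min (R / (2 * (S + 1))) (c * R ^ 3 / (M + 1)))"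
  have a0: "0 < a0" "a0 < R" "a0 \<le> R / (2 * (S + 1))" "a0 \<le> c * R ^ 3 / (M + 1)"
  proof -
    show "0 < a0" using R S c unfolding a0_def min_less_iff_conj by auto
    have "a0 \<le> R / 2" unfolding a0_def by (rule min.cobounded1)
    then show "a0 < R" using R by linarith
    show "a0 \<le> R / (2 * (S + 1))" unfolding a0_def by (rule min.coboundedI2[OF min.cobounded1])
    show "a0 \<le> c * R ^ 3 / (M + 1)" unfolding a0_def by (rule min.coboundedI2[OF min.cobounded2])
  qed
  have tail: "\<bar>suminf (\<lambda>j. f j * a ^ j) - (\<Sum>j<k. f j * a ^ j)\<bar> \<le> (a / R) ^ k * suminf (\<lambda>j. \<bar>f j\<bar> * R ^ j)"
    if f: "summable (\<lambda>j. \<bar>f j\<bar> * R ^ j)" and a: "0 \<le> a" "a \<le> R" for f :: "nat \<Rightarrow> real" and a k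
  proof -
    have 1: "\<bar>f j * a ^ j\<bar> \<le> 1 * (\<bar>f j\<bar> * a ^ j)" for j using a by (simp add: abs_mult)
    have 2: "0 \<le> \<bar>f j\<bar>" for j by simp
    show ?thesis using tail_bound(2)[OF 1 2 f a R(1), of k] by simp
  qed
  show thesis
  proof (rule that[of a0 c])
    show "0 < a0" "a0 \<le> convergence_radius b" "0 < c" using a0 c by (simp_all add: R_def)
    show "detuning b 0 = 0" by (simp add: detuning_def powser_zero mu_def)
    show "continuous_on {0..a0} (detuning b)"
    proof (intro continuous_at_imp_continuous_on ballI)
      fix a assume "a \<in> {0..a0}"
      then have "norm a < norm R" using a0 by auto
      moreover have "summable (\<lambda>j. mu b j * R ^ j)"
        by (rule summable_rabs_cancel) (use R in \<open>simp add: abs_mult\<close>)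
      ultimately show "isCont (detuning b) a" unfolding detuning_def by (intro isCont_powser)
    qed
    fix a assume a: "0 \<le> a" "a \<le> a0"
    then have aR: "a \<le> R" using a0 by linarith
    have "\<bar>suminf (\<lambda>j. sig b j * a ^ j) - (\<Sum>j<1. sig b j * a ^ j)\<bar> \<le> (a / R) ^ 1 * S"
      unfolding S_def by (rule tail[OF R(2) a(1) aR])
    moreover have "(a / R) * S \<le> 1 / 2"
    proof -
      have "(a / R) * S \<le> ((R / (2 * (S + 1))) / R) * S" using a a0 R S by (intro mult_right_mono divide_right_mono) auto
      also have "\<dots> = S / (2 * (S + 1))" using R by simp
      also have "\<dots> \<le> 1 / 2" using S by (simp add: field_simps)
      finally show ?thesis .
    qed
    moreover have "(\<Sum>j<1. sig b j * a ^ j) = 0" by (simp add: sig_def)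
    ultimately show "1 / 2 \<le> frequency b a" unfolding frequency_def power_one_right abs_le_iff by linarith
    have "\<bar>suminf (\<lambda>j. mu b j * a ^ j) - (\<Sum>j<3. mu b j * a ^ j)\<bar> \<le> (a / R) ^ 3 * M"
      unfolding M_def by (rule tail[OF R(3) a(1) aR])
    moreover have "(\<Sum>j<3. mu b j * a ^ j) = mu b 2 * a\<^sup>2"
      using first_order(5)[of b] by (simp add: numeral_3_eq_3 numeral_2_eq_2 mu_def)
    moreover have "(a / R) ^ 3 * M \<le> c * a\<^sup>2"
    proof -
      have "(a / R) ^ 3 * M = (a * M / R ^ 3) * a\<^sup>2" by (simp add: power3_eq_cube power2_eq_square)
      also have "a * M / R ^ 3 \<le> (c * R ^ 3 / (M + 1)) * M / R ^ 3"
        using a a0 R S by (intro divide_right_mono mult_right_mono) auto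
      also have "\<dots> = c * (M / (M + 1))" using R by simp
      also have "\<dots> \<le> c * 1" using S c by (intro mult_left_mono) auto
      finally show ?thesis by (simp add: mult_right_mono)
    qed
    ultimately show "c * a\<^sup>2 \<le> detuning b a" unfolding detuning_def c_def abs_le_iff by simp
  qed
qed

section \<open>The wave structure\<close>

text \<open>Nonemptiness of the sets matters: the supremum of the empty set in the extended reals is
  minus infinity.\<close>

lemma SUP_tendsto_0:
  assumes "(g \<longlongrightarrow> 0) (at 0 within M)" "\<And>\<mu>. \<mu> \<in> M \<Longrightarrow> P \<mu> \<noteq> {}"
    "\<And>\<mu> v t. \<mu> \<in> M \<Longrightarrow> v \<in> P \<mu> \<Longrightarrow> 0 \<le> F v t \<and> F v t \<le> g \<mu>"
  shows "((\<lambda>\<mu>. SUP v\<in>P \<mu>. SUP t. ereal (F v t)) \<longlongrightarrow> 0) (at (0::real) within M)"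
proof (rule tendsto_sandwich[where f = "\<lambda>_. 0" and h = "\<lambda>\<mu>. ereal (g \<mu>)"])
  have "0 \<le> (SUP v\<in>P \<mu>. SUP t. ereal (F v t))" if \<mu>: "\<mu> \<in> M" for \<mu>
  proof -
    obtain v where v: "v \<in> P \<mu>" using assms(2)[OF \<mu>] by blast
    have "0 \<le> ereal (F v undefined)" using assms(3)[OF \<mu> v] by simp
    also have "\<dots> \<le> (SUP t. ereal (F v t))" by (rule SUP_upper) simp
    also have "\<dots> \<le> (SUP v\<in>P \<mu>. SUP t. ereal (F v t))" by (rule SUP_upper[OF v])
    finally show ?thesis .
  qed
  then show "\<forall>\<^sub>F \<mu> in at 0 within M. 0 \<le> (SUP v\<in>P \<mu>. SUP t. ereal (F v t))"
    by (auto simp: eventually_at_filter)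
  have "(SUP v\<in>P \<mu>. SUP t. ereal (F v t)) \<le> ereal (g \<mu>)" if \<mu>: "\<mu> \<in> M" for \<mu>
    by (intro SUP_least) (use assms(3)[OF \<mu>] in auto)
  then show "\<forall>\<^sub>F \<mu> in at 0 within M. (SUP v\<in>P \<mu>. SUP t. ereal (F v t)) \<le> ereal (g \<mu>)"
    by (auto simp: eventually_at_filter)
  show "((\<lambda>\<mu>. ereal (g \<mu>)) \<longlongrightarrow> 0) (at 0 within M)"
    using tendsto_ereal[OF assms(1)] by (simp add: zero_ereal_def)
qed simp

lemma H1_dist_nonneg: "0 \<le> H1_dist f (critical_space \<alpha> \<delta>1 \<delta>2 n \<omega>)"
proof -
  have "(\<lambda>x. \<Sum>e\<in>({} :: (real \<Rightarrow> real^2) set). 0 *\<^sub>R e x) \<in> critical_space \<alpha> \<delta>1 \<delta>2 n \<omega>"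
    unfolding critical_space_def mem_Collect_eq
    by (intro exI[of _ "{}"] exI[of _ "\<lambda>_::real \<Rightarrow> real^2. 0::real"]) simp
  then show ?thesis unfolding H1_dist_def by (intro cINF_greatest) (auto simp: H1_norm_nonneg)
qed

text \<open>No inverse function is constructed: continuity and the intermediate value theorem supply
  some amplitude for each \<mu>, and c a^2 <= \<mu> forces it to 0 with \<mu>. The relative distance
  to the critical space is then of order a^2 / a.\<close>

lemma amplitude:
  assumes n: "n \<noteq> 0" and \<delta>: "\<delta>1 = 2 / (of_int n)\<^sup>2" "\<delta>2 = 1 / (of_int n)\<^sup>2"
  obtains \<epsilon> amp where "0 < \<epsilon>"
    "\<And>\<mu>. 0 < \<mu> \<Longrightarrow> \<mu> < \<epsilon> \<Longrightarrow> 0 < amp \<mu> \<and> amp \<mu> \<le> convergence_radius b \<and> detuning b (amp \<mu>) = \<mu> \<and> 0 < frequency b (amp \<mu>)"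
    "\<And>\<mu> \<theta> \<xi>. 0 < \<mu> \<Longrightarrow> \<mu> < \<epsilon> \<Longrightarrow> norm (profile b (amp \<mu>) 0 0 \<theta> \<xi> - profile b 0 0 0 \<theta> \<xi>) \<le> 1 / 2"
    "\<And>P. (\<And>\<mu>. 0 < \<mu> \<Longrightarrow> \<mu> < \<epsilon> \<Longrightarrow> P \<mu> \<noteq> {}) \<Longrightarrow>
       (\<And>\<mu> v t. 0 < \<mu> \<Longrightarrow> \<mu> < \<epsilon> \<Longrightarrow> v \<in> P \<mu> \<Longrightarrow> \<exists>\<theta> m c. (m = n \<or> m = - n) \<and> v t = snapshot b (amp \<mu>) \<theta> m c) \<Longrightarrow>
       bifurcates_along (critical_space 1 \<delta>1 \<delta>2 n 1) {0<..<\<epsilon>} P"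
proof -
  obtain a1 C where a1: "0 < a1" "a1 \<le> convergence_radius b" and C: "0 \<le> C"
    and S: "\<And>a \<theta> m c. 0 < a \<Longrightarrow> a \<le> a1 \<Longrightarrow> m = n \<or> m = - n \<Longrightarrow> a \<le> H1_norm (snapshot b a \<theta> m c) \<and>
       H1_norm (snapshot b a \<theta> m c) \<le> C * a \<and> H1_dist (snapshot b a \<theta> m c) (critical_space 1 \<delta>1 \<delta>2 n 1) \<le> C * a\<^sup>2"
    and half: "\<And>a \<theta> \<xi>. 0 < a \<Longrightarrow> a \<le> a1 \<Longrightarrow> norm (profile b a 0 0 \<theta> \<xi> - profile b 0 0 0 \<theta> \<xi>) \<le> 1 / 2"
    by (rule snapshot_asymptotics[OF n \<delta>, of b]) blast
  obtain a2 c where a2: "0 < a2" "a2 \<le> convergence_radius b" and c: "0 < c" and d0: "detuning b 0 = 0"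
    and cont: "continuous_on {0..a2} (detuning b)"
    and fr: "\<And>a. 0 \<le> a \<Longrightarrow> a \<le> a2 \<Longrightarrow> 1 / 2 \<le> frequency b a" and de: "\<And>a. 0 \<le> a \<Longrightarrow> a \<le> a2 \<Longrightarrow> c * a\<^sup>2 \<le> detuning b a"
    by (rule frequency_detuning[of b]) blast
  define a0 where "a0 = min a1 a2"
  have a0: "0 < a0" "a0 \<le> a1" "a0 \<le> a2" using a1 a2 by (simp_all add: a0_def)
  define \<epsilon> where "\<epsilon> = detuning b a0"
  have \<epsilon>: "0 < \<epsilon>"
  proof -
    have "0 < c * a0\<^sup>2" using c a0 by simp
    also have "\<dots> \<le> \<epsilon>" using de[of a0] a0 by (simp add: \<epsilon>_def)
    finally show ?thesis .
  qed
  have "\<exists>a. 0 < a \<and> a \<le> a0 \<and> detuning b a = \<mu>" if \<mu>: "0 < \<mu>" "\<mu> < \<epsilon>" for \<mu>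
  proof -
    have "\<exists>a\<ge>0. a \<le> a0 \<and> detuning b a = \<mu>"
      by (rule IVT') (use \<mu> d0 a0 continuous_on_subset[OF cont, of "{0..a0}"] in \<open>auto simp: \<epsilon>_def\<close>)
    then obtain a where "0 \<le> a" "a \<le> a0" "detuning b a = \<mu>" by blast
    moreover from this have "a \<noteq> 0" using d0 \<mu> by auto
    ultimately show ?thesis by (intro exI[of _ a]) simp
  qed
  then obtain amp where amp: "\<And>\<mu>. 0 < \<mu> \<Longrightarrow> \<mu> < \<epsilon> \<Longrightarrow> 0 < amp \<mu> \<and> amp \<mu> \<le> a0 \<and> detuning b (amp \<mu>) = \<mu>"
    by metis
  have lim: "((\<lambda>\<mu>. C * sqrt (\<mu> / c)) \<longlongrightarrow> 0) (at 0 within {0<..<\<epsilon>})"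
  proof -
    have "((\<lambda>\<mu>. C * sqrt (\<mu> / c)) \<longlongrightarrow> C * sqrt (0 / c)) (at 0 within {0<..<\<epsilon>})" using c by (intro tendsto_intros) auto
    then show ?thesis by simp
  qed
  have small: "C * amp \<mu> \<le> C * sqrt (\<mu> / c)" if \<mu>: "0 < \<mu>" "\<mu> < \<epsilon>" for \<mu>
  proof -
    have "c * (amp \<mu>)\<^sup>2 \<le> \<mu>" using de[of "amp \<mu>"] amp[OF \<mu>] a0 by auto
    then have "(amp \<mu>)\<^sup>2 \<le> \<mu> / c" using c by (simp add: field_simps)
    then have "amp \<mu> \<le> sqrt (\<mu> / c)" by (rule real_le_rsqrt)
    then show ?thesis using C by (rule mult_left_mono)
  qed
  show thesis
  proof (rule that[OF \<epsilon>, of amp])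
    fix \<mu> assume \<mu>: "0 < \<mu>" "\<mu> < \<epsilon>"
    have "1 / 2 \<le> frequency b (amp \<mu>)" using amp[OF \<mu>] a0 by (intro fr) auto
    then show "0 < amp \<mu> \<and> amp \<mu> \<le> convergence_radius b \<and> detuning b (amp \<mu>) = \<mu> \<and> 0 < frequency b (amp \<mu>)"
      using amp[OF \<mu>] a0 a1 by auto
    show "norm (profile b (amp \<mu>) 0 0 \<theta> \<xi> - profile b 0 0 0 \<theta> \<xi>) \<le> 1 / 2" for \<theta> \<xi>
      using amp[OF \<mu>] a0 by (intro half) auto
  next
    fix P assume ne: "\<And>\<mu>. 0 < \<mu> \<Longrightarrow> \<mu> < \<epsilon> \<Longrightarrow> P \<mu> \<noteq> {}"
      and form: "\<And>\<mu> (v::real \<Rightarrow> real \<Rightarrow> real^2) t. 0 < \<mu> \<Longrightarrow> \<mu> < \<epsilon> \<Longrightarrow> v \<in> P \<mu> \<Longrightarrow> \<exists>\<theta> m c. (m = n \<or> m = - n) \<and> v t = snapshot b (amp \<mu>) \<theta> m c"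
    have b: "amp \<mu> \<le> H1_norm (v t) \<and> H1_norm (v t) \<le> C * amp \<mu> \<and> H1_dist (v t) (critical_space 1 \<delta>1 \<delta>2 n 1) \<le> C * (amp \<mu>)\<^sup>2"
      if \<mu>: "0 < \<mu>" "\<mu> < \<epsilon>" "v \<in> P \<mu>" for \<mu> v t
    proof -
      obtain \<theta> m c where "m = n \<or> m = - n" "v t = snapshot b (amp \<mu>) \<theta> m c" using form[OF \<mu>] by blast
      then show ?thesis using S[of "amp \<mu>" m \<theta> c] amp[OF \<mu>(1,2)] a0 by auto
    qed
    show "bifurcates_along (critical_space 1 \<delta>1 \<delta>2 n 1) {0<..<\<epsilon>} P"
      unfolding bifurcates_along_def
    proof (intro conjI; rule SUP_tendsto_0[OF lim])
      fix \<mu> v t assume \<mu>: "\<mu> \<in> {0<..<\<epsilon>}" and v: "v \<in> P \<mu>"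
      have m: "0 < \<mu>" "\<mu> < \<epsilon>" using \<mu> by auto
      note b = b[OF m v, of t]
      show "0 \<le> H1_norm (v t) \<and> H1_norm (v t) \<le> C * sqrt (\<mu> / c)" using b small[OF m] by (auto simp: H1_norm_nonneg)
      have a: "0 < amp \<mu>" using amp[OF m] by simp
      have "H1_dist (v t) (critical_space 1 \<delta>1 \<delta>2 n 1) / H1_norm (v t) \<le> C * (amp \<mu>)\<^sup>2 / amp \<mu>"
        using b a C by (intro frac_le) auto
      also have "\<dots> = C * amp \<mu>" using a by (simp add: power2_eq_square)
      also have "\<dots> \<le> C * sqrt (\<mu> / c)" by (rule small[OF m])
      finally show "0 \<le> H1_dist (v t) (critical_space 1 \<delta>1 \<delta>2 n 1) / H1_norm (v t) \<and>
          H1_dist (v t) (critical_space 1 \<delta>1 \<delta>2 n 1) / H1_norm (v t) \<le> C * sqrt (\<mu> / c)"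
        by (simp add: H1_dist_nonneg H1_norm_nonneg)
    qed (use ne in auto)
  qed
qed

text \<open>Serves to show that a period is minimal: a shorter period would have a multiple at which
  the leading term, four times a cosine, lies far from its value at phase zero.\<close>

lemma cos_multiple_nonpos:
  assumes "0 < \<phi>" "\<phi> < 2 * pi"
  shows "\<exists>j::nat. cos (of_nat j * \<phi>) \<le> 0"
proof (rule ccontr)
  assume "\<nexists>j::nat. cos (of_nat j * \<phi>) \<le> 0"
  then have pos: "0 < cos (of_nat j * \<phi>)" for j :: nat by (meson not_le)
  have "cos \<phi> \<noteq> 1"
  proof
    assume "cos \<phi> = 1"
    then obtain i :: int where i: "\<phi> = of_int i * 2 * pi" using cos_one_2pi_int by blast
    then have "0 < of_int i * (2 * pi)" "of_int i * (2 * pi) < 1 * (2 * pi)" using assms by simp_all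
    then have "(0::real) < of_int i" "of_int i < (1::real)"
      by (simp_all add: zero_less_mult_iff mult_less_cancel_right)
    then have "0 < i" "i < 1" by simp_all
    then show False by linarith
  qed
  then have d: "0 < 1 - cos \<phi>" using cos_le_one[of \<phi>] by linarith
  \<comment> \<open>As long as the cosines stay positive, doubling the angle at least doubles \<open>1 - cos\<close>.\<close>
  have "2 ^ k * (1 - cos \<phi>) \<le> 1 - cos (of_nat (2 ^ k) * \<phi>)" for k
  proof (induction k)
    case (Suc k)
    let ?c = "cos (of_nat (2 ^ k) * \<phi>)"
    have e: "of_nat (2 ^ Suc k) * \<phi> = 2 * (of_nat (2 ^ k) * \<phi>)" by simp
    have "0 \<le> (1 - ?c) * ?c" using pos[of "2 ^ k"] cos_le_one[of "of_nat (2 ^ k) * \<phi>"] by (intro mult_nonneg_nonneg) linarith+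
    moreover have "1 - (2 * ?c\<^sup>2 - 1) = 2 * (1 - ?c) + 2 * ((1 - ?c) * ?c)" by (simp add: power2_eq_square algebra_simps)
    ultimately have "2 * (1 - ?c) \<le> 1 - cos (of_nat (2 ^ Suc k) * \<phi>)" unfolding e cos_double_cos by linarith
    moreover have "2 ^ Suc k * (1 - cos \<phi>) \<le> 2 * (1 - ?c)" using Suc by simp
    ultimately show ?case by linarith
  qed simp
  then have b: "2 ^ k * (1 - cos \<phi>) \<le> 1" for k using pos[of "2 ^ k"] by (smt (verit))
  obtain k :: nat where k: "1 / (1 - cos \<phi>) < real k" using reals_Archimedean2 by blast
  have "real k < 2 ^ k" by (rule of_nat_less_two_power)
  with k have "1 / (1 - cos \<phi>) < 2 ^ k" by linarith
  then have "1 < 2 ^ k * (1 - cos \<phi>)" using d by (simp add: pos_divide_less_eq)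
  with b[of k] show False by linarith
qed

lemma apart_centers:
  fixes p q c d :: real
  assumes "\<bar>p - c\<bar> \<le> 1 / 2" "\<bar>q - d\<bar> \<le> 1 / 2" "1 < c - d"
  shows "p \<noteq> q"
  using assms unfolding abs_le_iff by linarith

lemma rotating_waveI:
  assumes sol: "perturbation_solution \<alpha> \<delta>1 \<delta>2 \<beta> v" and v: "\<And>t x. v t x = G (\<Omega> * t + k * x + d)"
    and G: "\<And>y. G (y + 2 * pi) = G y" "G 0 \<noteq> G pi" and \<Omega>: "0 < \<Omega>" and k: "k \<noteq> 0"
  shows "rotating_wave \<alpha> \<delta>1 \<delta>2 \<beta> v"
  unfolding rotating_wave_def
proof (intro conjI)
  have "time_period v (2 * pi / \<Omega>)" unfolding time_period_def
  proof (intro conjI allI)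
    fix t x
    have "\<Omega> * (t + 2 * pi / \<Omega>) + k * x + d = \<Omega> * t + k * x + d + 2 * pi" using \<Omega> by (simp add: field_simps)
    then show "v (t + 2 * pi / \<Omega>) x = v t x" unfolding v by (simp only: G(1))
  qed (use \<Omega> in simp)
  then show "\<exists>T. time_period v T" by blast
  show "\<not> stationary v"
  proof
    assume "stationary v"
    then have "v t 0 = v 0 0" for t unfolding stationary_def by blast
    from this[of "- d / \<Omega>"] this[of "(pi - d) / \<Omega>"] have "G 0 = G pi" using \<Omega> by (simp add: v)
    then show False using G(2) by simp
  qed
  have "v t x = G (k * (x + \<Omega> / k * t) + d)" for t x using k by (simp add: v algebra_simps)
  moreover have "\<Omega> / k \<noteq> 0" using \<Omega> k by simp
  ultimately show "\<exists>w c. c \<noteq> 0 \<and> (\<forall>t x. v t x = w (x + c * t))"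
    by (intro exI[of _ "\<lambda>y. G (k * y + d)"] exI[of _ "\<Omega> / k"]) simp
qed (rule sol)

lemma hopf_waves:
  assumes n: "n \<noteq> 0" and \<delta>: "\<delta>1 = 2 / (of_int n)\<^sup>2" "\<delta>2 = 1 / (of_int n)\<^sup>2"
  shows "\<exists>M W N U. hopf_wave_structure 1 \<delta>1 \<delta>2 n 1 M W N U"
proof -
  have n0: "real_of_int n \<noteq> 0" using n by simp
  have \<beta>: "beta_crit 1 \<delta>1 \<delta>2 n = 5" by (rule beta_crit_5[OF n \<delta>])
  obtain \<epsilon>1 amp1 where \<epsilon>1: "0 < \<epsilon>1"
    and A1: "\<And>\<mu>. 0 < \<mu> \<Longrightarrow> \<mu> < \<epsilon>1 \<Longrightarrow> 0 < amp1 \<mu> \<and> amp1 \<mu> \<le> convergence_radius True \<and> detuning True (amp1 \<mu>) = \<mu> \<and> 0 < frequency True (amp1 \<mu>)"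
    and H1: "\<And>\<mu> \<theta> \<xi>. 0 < \<mu> \<Longrightarrow> \<mu> < \<epsilon>1 \<Longrightarrow> norm (profile True (amp1 \<mu>) 0 0 \<theta> \<xi> - profile True 0 0 0 \<theta> \<xi>) \<le> 1 / 2"
    and B1: "\<And>P. (\<And>\<mu>. 0 < \<mu> \<Longrightarrow> \<mu> < \<epsilon>1 \<Longrightarrow> P \<mu> \<noteq> {}) \<Longrightarrow>
       (\<And>\<mu> v t. 0 < \<mu> \<Longrightarrow> \<mu> < \<epsilon>1 \<Longrightarrow> v \<in> P \<mu> \<Longrightarrow> \<exists>\<theta> m c. (m = n \<or> m = - n) \<and> v t = snapshot True (amp1 \<mu>) \<theta> m c) \<Longrightarrow>
       bifurcates_along (critical_space 1 \<delta>1 \<delta>2 n 1) {0<..<\<epsilon>1} P"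
    by (rule amplitude[OF n \<delta>, of True]) blast
  obtain \<epsilon>2 amp2 where \<epsilon>2: "0 < \<epsilon>2"
    and A2: "\<And>\<mu>. 0 < \<mu> \<Longrightarrow> \<mu> < \<epsilon>2 \<Longrightarrow> 0 < amp2 \<mu> \<and> amp2 \<mu> \<le> convergence_radius False \<and> detuning False (amp2 \<mu>) = \<mu> \<and> 0 < frequency False (amp2 \<mu>)"
    and H2: "\<And>\<mu> \<theta> \<xi>. 0 < \<mu> \<Longrightarrow> \<mu> < \<epsilon>2 \<Longrightarrow> norm (profile False (amp2 \<mu>) 0 0 \<theta> \<xi> - profile False 0 0 0 \<theta> \<xi>) \<le> 1 / 2"
    and B2: "\<And>P. (\<And>\<mu>. 0 < \<mu> \<Longrightarrow> \<mu> < \<epsilon>2 \<Longrightarrow> P \<mu> \<noteq> {}) \<Longrightarrow>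
       (\<And>\<mu> v t. 0 < \<mu> \<Longrightarrow> \<mu> < \<epsilon>2 \<Longrightarrow> v \<in> P \<mu> \<Longrightarrow> \<exists>\<theta> m c. (m = n \<or> m = - n) \<and> v t = snapshot False (amp2 \<mu>) \<theta> m c) \<Longrightarrow>
       bifurcates_along (critical_space 1 \<delta>1 \<delta>2 n 1) {0<..<\<epsilon>2} P"
    by (rule amplitude[OF n \<delta>, of False]) blast
  let ?W = "\<lambda>\<mu>. wave True n (amp1 \<mu>)" and ?U = "\<lambda>\<mu>. wave False n (amp2 \<mu>)"
  have shiftW: "shift s \<tau> (wave b n a) t = snapshot b a (frequency b a * (t + \<tau>)) n (of_int n * s)" for s \<tau> b a t
    by (simp add: shift_def wave_def snapshot_def fun_eq_iff algebra_simps)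
  have reflW: "shift s \<tau> (reflect (wave b n a)) t = snapshot b a (frequency b a * (t + \<tau>)) (- n) (- of_int n * s)" for s \<tau> b a t
    by (simp add: shift_def reflect_def wave_def snapshot_def fun_eq_iff algebra_simps)
  have sol: "perturbation_solution 1 \<delta>1 \<delta>2 (5 + \<mu>) (shift s \<tau> (wave b n a))"
    "perturbation_solution 1 \<delta>1 \<delta>2 (5 + \<mu>) (shift s \<tau> (reflect (wave b n a)))"
    if a: "0 < a" "a \<le> convergence_radius b" "detuning b a = \<mu>" for b a \<mu> s \<tau>
  proof -
    have cl: "perturbation_solution 1 \<delta>1 \<delta>2 (5 + \<mu>) (\<lambda>t. snapshot b a (frequency b a * t + d) m c)"
      if "m = n \<or> m = - n" for m d c
      using classical_perturbation_solution[OF one_neq_zero classical_snapshot[OF n that _ a(2)]] a \<delta> by simp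
    show "perturbation_solution 1 \<delta>1 \<delta>2 (5 + \<mu>) (shift s \<tau> (wave b n a))"
      "perturbation_solution 1 \<delta>1 \<delta>2 (5 + \<mu>) (shift s \<tau> (reflect (wave b n a)))"
      unfolding shiftW[abs_def] reflW[abs_def] distrib_left by (rule cl; simp)+
  qed
  define G where "G \<mu> y = amp1 \<mu> *\<^sub>R profile True (amp1 \<mu>) 0 0 y 0" for \<mu> y
  have G: "G \<mu> (y + 2 * pi) = G \<mu> y" for \<mu> y using profile_periodic(2)[of True "amp1 \<mu>" 0 0 y 1 0] by (simp add: G_def)
  have snapG: "snapshot True (amp1 \<mu>) \<theta> m c x = G \<mu> (\<theta> + of_int m * x + c)" for \<mu> \<theta> m c x
    unfolding snapshot_def G_def profile_travelling[of "amp1 \<mu>" \<theta> "of_int m * x + c"] by (simp only: add.assoc)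
  \<comment> \<open>The leading first component is 2 at phase 0 and -2 at phase pi, and the error is
    at most 1 / 2 at each.\<close>
  have Gne: "G \<mu> 0 \<noteq> G \<mu> pi" if \<mu>: "0 < \<mu>" "\<mu> < \<epsilon>1" for \<mu>
  proof -
    let ?P = "\<lambda>\<theta>. profile True (amp1 \<mu>) 0 0 \<theta> 0 $ 1"
    have "\<bar>?P \<theta> - 2 * cos \<theta>\<bar> \<le> 1 / 2" for \<theta>
      using order_trans[OF component_le_norm_cart H1[OF \<mu>, of \<theta> 0], of 1] by (simp add: profile_leading)
    from apart_centers[OF this[of 0] this[of pi]] have "?P 0 \<noteq> ?P pi" by simp
    then have "profile True (amp1 \<mu>) 0 0 0 0 \<noteq> profile True (amp1 \<mu>) 0 0 pi 0" by metis
    then show ?thesis using A1[OF \<mu>] by (simp add: G_def)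
  qed
  have rot: "rotating_wave 1 \<delta>1 \<delta>2 (5 + \<mu>) v" if \<mu>: "0 < \<mu>" "\<mu> < \<epsilon>1" and v: "v \<in> rotating_members (?W \<mu>)" for \<mu> v
  proof -
    let ?\<Omega> = "frequency True (amp1 \<mu>)"
    from v consider s where "v = shift s 0 (?W \<mu>)" | s where "v = shift s 0 (reflect (?W \<mu>))"
      by (auto simp: rotating_members_def)
    then show ?thesis
    proof cases
      case 1
      have "perturbation_solution 1 \<delta>1 \<delta>2 (5 + \<mu>) v" unfolding 1
        by (rule sol(1)) (use A1[OF \<mu>] in auto)
      then show ?thesis
        by (rule rotating_waveI[where G = "G \<mu>" and \<Omega> = ?\<Omega> and k = "of_int n" and d = "of_int n * s"])
          (use A1[OF \<mu>] n0 Gne[OF \<mu>] in \<open>auto simp: 1 shiftW snapG G\<close>)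
    next
      case 2
      have "perturbation_solution 1 \<delta>1 \<delta>2 (5 + \<mu>) v" unfolding 2
        by (rule sol(2)) (use A1[OF \<mu>] in auto)
      then show ?thesis
        by (rule rotating_waveI[where G = "G \<mu>" and \<Omega> = ?\<Omega> and k = "- of_int n" and d = "- of_int n * s"])
          (use A1[OF \<mu>] n0 Gne[OF \<mu>] in \<open>auto simp: 2 reflW snapG G\<close>)
    qed
  qed
  \<comment> \<open>The combinations p = \<Omega> t - n x and q = \<Omega> t + n x vary
    independently, so a reflected wave that equals a translate would make \<open>G\<close> constant,
    against \<open>Gne\<close>.\<close>
  have chiral: "reflect (?W \<mu>) \<noteq> shift s \<tau> (?W \<mu>)" if \<mu>: "0 < \<mu>" "\<mu> < \<epsilon>1" for \<mu> s \<tau>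
  proof
    assume eq: "reflect (?W \<mu>) = shift s \<tau> (?W \<mu>)"
    let ?\<Omega> = "frequency True (amp1 \<mu>)"
    have \<Omega>: "0 < ?\<Omega>" using A1[OF \<mu>] by simp
    have e: "G \<mu> (?\<Omega> * t - of_int n * x) = G \<mu> (?\<Omega> * (t + \<tau>) + of_int n * x + of_int n * s)" for t x
      using fun_cong[OF fun_cong[OF eq, of t], of x] unfolding shiftW snapG reflect_def wave_def by simp
    define d where "d = ?\<Omega> * \<tau> + of_int n * s"
    have "G \<mu> p = G \<mu> (q + d)" for p q
    proof -
      have 1: "?\<Omega> * ((p + q) / (2 * ?\<Omega>)) = (p + q) / 2" "of_int n * ((q - p) / (2 * of_int n)) = (q - p) / 2"
        using \<Omega> n0 by simp_all
      have 2: "(p + q) / 2 - (q - p) / 2 = p" "(p + q) / 2 + ?\<Omega> * \<tau> + (q - p) / 2 + of_int n * s = q + d"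
        by (simp_all add: d_def field_simps)
      show ?thesis using e[of "(p + q) / (2 * ?\<Omega>)" "(q - p) / (2 * of_int n)"] by (simp only: distrib_left[of ?\<Omega> "_ / _"] 1 2)
    qed
    then have "G \<mu> 0 = G \<mu> pi" by metis
    then show False using Gne[OF \<mu>] by simp
  qed
  have stand: "standing_wave 1 \<delta>1 \<delta>2 (5 + \<mu>) n v" if \<mu>: "0 < \<mu>" "\<mu> < \<epsilon>2" and v: "v \<in> standing_members (?U \<mu>)" for \<mu> v
  proof -
    define \<Omega> a where "\<Omega> = frequency False (amp2 \<mu>)" and "a = amp2 \<mu>"
    have A: "0 < a" "0 < \<Omega>" using A2[OF \<mu>] by (simp_all add: \<Omega>_def a_def)
    obtain s \<tau> where s: "v = shift s \<tau> (?U \<mu>)" using v by (auto simp: standing_members_def)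
    have vv: "v t x = a *\<^sub>R profile False a 0 0 (\<Omega> * (t + \<tau>)) (of_int n * (x + s))" for t x
      by (simp add: s shiftW snapshot_def \<Omega>_def a_def distrib_left)
    \<comment> \<open>At the reflection axis the leading first component is 4 cos \<theta>. With
      error at most 1 / 2, phases of nonpositive cosine are separated from phase 0.\<close>
    have near: "\<bar>profile False a 0 0 \<theta> 0 $ 1 - 4 * cos \<theta>\<bar> \<le> 1 / 2" for \<theta>
      using order_trans[OF component_le_norm_cart H2[OF \<mu>, of \<theta> 0], of 1] by (simp add: profile_leading a_def)
    have apart: "v t (- s) \<noteq> v (- \<tau>) (- s)" if "cos (\<Omega> * (t + \<tau>)) \<le> 0" for t
    proof -
      have "profile False a 0 0 (\<Omega> * (t + \<tau>)) 0 $ 1 \<noteq> profile False a 0 0 0 0 $ 1"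
        using apart_centers[OF near[of 0] near[of "\<Omega> * (t + \<tau>)"]] that by simp
      then have "profile False a 0 0 (\<Omega> * (t + \<tau>)) 0 \<noteq> profile False a 0 0 0 0" by metis
      then show ?thesis using A by (simp add: vv)
    qed
    show ?thesis unfolding standing_wave_def
    proof (intro conjI)
      show "perturbation_solution 1 \<delta>1 \<delta>2 (5 + \<mu>) v" unfolding s
        by (rule sol(1)) (use A2[OF \<mu>] in auto)
      show "\<not> stationary v"
      proof
        assume "stationary v"
        then have "v (pi / \<Omega> - \<tau>) (- s) = v (- \<tau>) (- s)" unfolding stationary_def by metis
        moreover have "v (pi / \<Omega> - \<tau>) (- s) \<noteq> v (- \<tau>) (- s)" by (rule apart) (use A in simp)
        ultimately show False by simp
      qed
      have "v t (2 * (- s) - x) = v t x" for t x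
      proof -
        have "of_int n * (2 * (- s) - x + s) = - (of_int n * (x + s))" by (simp add: algebra_simps)
        then show ?thesis unfolding vv by (simp only: profile_standing(1))
      qed
      then show "\<exists>x0. \<forall>t x. v t (2 * x0 - x) = v t x" by blast
      define T where "T = 2 * pi / \<Omega>"
      have per: "time_period v T" unfolding time_period_def
      proof (intro conjI allI)
        show "v (t + T) x = v t x" for t x
        proof -
          have "\<Omega> * (t + T + \<tau>) = \<Omega> * (t + \<tau>) + 2 * pi * of_int 1" using A by (simp add: T_def field_simps)
          then show ?thesis unfolding vv by (simp only: profile_periodic(2))
        qed
      qed (use A in \<open>simp add: T_def\<close>)
      have "T \<le> T'" if T': "time_period v T'" for T'
      proof (rule ccontr)
        assume "\<not> T \<le> T'"
        then have "0 < \<Omega> * T'" "\<Omega> * T' < 2 * pi" using T' A by (auto simp: time_period_def T_def field_simps)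
        from cos_multiple_nonpos[OF this] obtain j :: nat where j: "cos (of_nat j * (\<Omega> * T')) \<le> 0" by blast
        have "v (t + of_nat i * T') x = v t x" for i :: nat and t x
        proof (induction i)
          case (Suc i)
          have "v (t + of_nat (Suc i) * T') x = v ((t + of_nat i * T') + T') x" by (simp add: algebra_simps)
          also have "\<dots> = v t x" using T' Suc by (simp add: time_period_def)
          finally show ?case .
        qed simp
        then have "v (of_nat j * T' - \<tau>) (- s) = v (- \<tau>) (- s)" by (metis add.commute uminus_add_conv_diff)
        moreover have "v (of_nat j * T' - \<tau>) (- s) \<noteq> v (- \<tau>) (- s)" by (rule apart) (use j in \<open>simp add: mult_ac\<close>)
        ultimately show False by simp
      qed
      moreover have "v t (x + pi / of_int n) = v (t + T / 2) x" for t x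
      proof -
        have "of_int n * (x + pi / of_int n + s) = of_int n * (x + s) + pi" "\<Omega> * (t + T / 2 + \<tau>) = \<Omega> * (t + \<tau>) + pi"
          using n0 A by (simp_all add: T_def field_simps)
        then show ?thesis unfolding vv by (simp only: profile_standing(2))
      qed
      ultimately show "\<exists>T. minimal_period v T \<and> (\<forall>t x. v t (x + pi / of_int n) = v (t + T / 2) x)"
        using per unfolding minimal_period_def by blast
    qed
  qed
  have "bifurcates_along (critical_space 1 \<delta>1 \<delta>2 n 1) {0<..<\<epsilon>1} (\<lambda>\<mu>. rotating_members (?W \<mu>))"
  proof (rule B1)
    fix \<mu> show "rotating_members (?W \<mu>) \<noteq> {}" by (auto simp: rotating_members_def)
    fix v t assume "v \<in> rotating_members (?W \<mu>)"
    then consider s where "v = shift s 0 (?W \<mu>)" | s where "v = shift s 0 (reflect (?W \<mu>))"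
      by (auto simp: rotating_members_def)
    then show "\<exists>\<theta> m c. (m = n \<or> m = - n) \<and> v t = snapshot True (amp1 \<mu>) \<theta> m c"
    proof cases
      case (1 s)
      show ?thesis unfolding 1 shiftW by (rule exI, rule exI[of _ n], rule exI) simp
    next
      case (2 s)
      show ?thesis unfolding 2 reflW by (rule exI, rule exI[of _ "- n"], rule exI) simp
    qed
  qed
  moreover have "bifurcates_along (critical_space 1 \<delta>1 \<delta>2 n 1) {0<..<\<epsilon>2} (\<lambda>\<mu>. standing_members (?U \<mu>))"
  proof (rule B2)
    fix \<mu> show "standing_members (?U \<mu>) \<noteq> {}" by (auto simp: standing_members_def)
    fix v t assume "v \<in> standing_members (?U \<mu>)"
    then obtain s \<tau> where "v = shift s \<tau> (?U \<mu>)" by (auto simp: standing_members_def)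
    then show "\<exists>\<theta> m c. (m = n \<or> m = - n) \<and> v t = snapshot False (amp2 \<mu>) \<theta> m c"
      by (simp only: shiftW) (rule exI, rule exI[of _ n], rule exI, simp)
  qed
  moreover have "one_sided {0<..<\<epsilon>1}" "one_sided {0<..<\<epsilon>2}" using \<epsilon>1 \<epsilon>2 unfolding one_sided_def by blast+
  ultimately have "hopf_wave_structure 1 \<delta>1 \<delta>2 n 1 {0<..<\<epsilon>1} ?W {0<..<\<epsilon>2} ?U"
    unfolding hopf_wave_structure_def \<beta> using rot chiral stand
    by (intro conjI ballI notI) (auto dest!: greaterThanLessThan_iff[THEN iffD1])
  then show ?thesis by blast
qed

section \<open>Waves of vanishing mean\<close>

lemma fcos_trig:
  fixes P Q :: "'a::euclidean_space"
  assumes "k \<noteq> 0"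
  shows "fcos k (\<lambda>x. cos (real k * x) *\<^sub>R P + sin (real k * x) *\<^sub>R Q) = pi *\<^sub>R P"
    "fsin k (\<lambda>x. cos (real k * x) *\<^sub>R P + sin (real k * x) *\<^sub>R Q) = pi *\<^sub>R Q"
proof -
  let ?b = "\<lambda>j::nat. if j = 0 then 0 else pi *\<^sub>R Q"
  have "(\<lambda>x. cos (real k * x) *\<^sub>R P + sin (real k * x) *\<^sub>R Q) = fterm (\<lambda>_. pi *\<^sub>R P) ?b k"
    using assms by (simp add: fun_eq_iff fterm_def fourier_weight_def scaleR_add_right)
  then show "fcos k (\<lambda>x. cos (real k * x) *\<^sub>R P + sin (real k * x) *\<^sub>R Q) = pi *\<^sub>R P"
    "fsin k (\<lambda>x. cos (real k * x) *\<^sub>R P + sin (real k * x) *\<^sub>R Q) = pi *\<^sub>R Q"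
    using assms by (simp_all add: fcos_fterm[of ?b])
qed

text \<open>At wave number n the choice of \<beta> makes the trace vanish: the rows are (c,
  \<alpha>^2) and (- \<beta>, - c) with c = \<alpha>^2 + \<delta>2 n^2. An eigenvalue \<i> \<omega>
  then forces \<omega>^2 to be the determinant \<alpha>^2 \<beta> - c^2.\<close>

lemma spectral_condition_determinant:
  assumes n: "n \<noteq> 0" and sc: "hopf_spectral_condition \<alpha> \<delta>1 \<delta>2 n \<omega>"
  shows "0 < \<omega>" "\<omega>\<^sup>2 = \<alpha>\<^sup>2 * beta_crit \<alpha> \<delta>1 \<delta>2 n - (\<alpha>\<^sup>2 + \<delta>2 * (of_int n)\<^sup>2)\<^sup>2"
proof -
  let ?A = "brusselator_L \<alpha> \<delta>1 \<delta>2 (beta_crit \<alpha> \<delta>1 \<delta>2 n)" and ?N = "nat \<bar>n\<bar>" and ?\<beta> = "beta_crit \<alpha> \<delta>1 \<delta>2 n"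
  show "0 < \<omega>" using sc by (simp add: hopf_spectral_condition_def)
  obtain V where V: "V \<noteq> 0" "fourier_mode n V \<in> eigenspace ?A (\<i> * of_real \<omega>)"
    using sc unfolding hopf_spectral_condition_def Let_def by blast
  have N: "?N \<noteq> 0" using n by simp
  have NN: "(real ?N)\<^sup>2 = (of_int n)\<^sup>2" by simp
  from eigenspace_coeffs(1)[OF V(2), of ?N]
  have "shifted_symbol \<alpha> \<delta>1 \<delta>2 ?\<beta> (\<i> * of_real \<omega>) ?N (pi *\<^sub>R V) = 0"
    unfolding fourier_mode_trig fcos_trig(1)[OF N] .
  then have "pi *\<^sub>R shifted_symbol \<alpha> \<delta>1 \<delta>2 ?\<beta> (\<i> * of_real \<omega>) ?N V = 0"
    by (simp only: linear_cmul[OF bounded_linear.linear[OF shifted_symbol_linear]])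
  then have s: "shifted_symbol \<alpha> \<delta>1 \<delta>2 ?\<beta> (\<i> * of_real \<omega>) ?N V = 0" by simp
  define c z :: complex where "c = of_real (\<alpha>\<^sup>2 + \<delta>2 * (of_int n)\<^sup>2)" and "z = \<i> * of_real \<omega>"
  have b: "?\<beta> - 1 - \<delta>1 * (of_int n)\<^sup>2 = \<alpha>\<^sup>2 + \<delta>2 * (of_int n)\<^sup>2" by (simp add: beta_crit_def algebra_simps)
  have e1: "(z - c) * V $ 1 = of_real (\<alpha>\<^sup>2) * V $ 2"
  proof -
    have "z * V $ 1 - (of_real \<delta>1 * (- (real ?N)\<^sup>2 *\<^sub>R V $ 1) + of_real (?\<beta> - 1) * V $ 1 + of_real (\<alpha>\<^sup>2) * V $ 2) = 0"
      using arg_cong[OF s, of "\<lambda>v. v $ 1"] by (simp add: shifted_symbol_def linear_part_def z_def)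
    then have "z * V $ 1 - (of_real (?\<beta> - 1 - \<delta>1 * (of_int n)\<^sup>2) * V $ 1 + of_real (\<alpha>\<^sup>2) * V $ 2) = 0"
      unfolding NN by (simp add: scaleR_conv_of_real[where 'a = complex] algebra_simps)
    then show ?thesis unfolding b c_def[symmetric] by (simp add: algebra_simps)
  qed
  have e2: "(z + c) * V $ 2 = - of_real ?\<beta> * V $ 1"
  proof -
    have "z * V $ 2 - (- of_real ?\<beta> * V $ 1 + of_real \<delta>2 * (- (real ?N)\<^sup>2 *\<^sub>R V $ 2) - of_real (\<alpha>\<^sup>2) * V $ 2) = 0"
      using arg_cong[OF s, of "\<lambda>v. v $ 2"] by (simp add: shifted_symbol_def linear_part_def z_def)
    then show ?thesis unfolding NN c_def
      by (simp add: scaleR_conv_of_real[where 'a = complex] algebra_simps eq_neg_iff_add_eq_0)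
  qed
  have "((z - c) * (z + c) + of_real (\<alpha>\<^sup>2 * ?\<beta>)) * V $ 1 = (z + c) * ((z - c) * V $ 1) + of_real (\<alpha>\<^sup>2 * ?\<beta>) * V $ 1"
    by (simp add: algebra_simps)
  also have "\<dots> = of_real (\<alpha>\<^sup>2) * ((z + c) * V $ 2) + of_real (\<alpha>\<^sup>2 * ?\<beta>) * V $ 1" unfolding e1 by (simp add: algebra_simps)
  also have "\<dots> = 0" unfolding e2 by (simp add: algebra_simps)
  finally have d1: "((z - c) * (z + c) + of_real (\<alpha>\<^sup>2 * ?\<beta>)) * V $ 1 = 0" .
  have "((z - c) * (z + c) + of_real (\<alpha>\<^sup>2 * ?\<beta>)) * V $ 2 = (z - c) * ((z + c) * V $ 2) + of_real (\<alpha>\<^sup>2 * ?\<beta>) * V $ 2"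
    by (simp add: algebra_simps)
  also have "\<dots> = - of_real ?\<beta> * ((z - c) * V $ 1) + of_real (\<alpha>\<^sup>2 * ?\<beta>) * V $ 2" unfolding e2 by (simp add: algebra_simps)
  also have "\<dots> = 0" unfolding e1 by (simp add: algebra_simps)
  finally have d2: "((z - c) * (z + c) + of_real (\<alpha>\<^sup>2 * ?\<beta>)) * V $ 2 = 0" .
  have "V $ 1 \<noteq> 0 \<or> V $ 2 \<noteq> 0" using V(1) by (simp add: vec_eq_iff forall_2)
  then have "(z - c) * (z + c) + of_real (\<alpha>\<^sup>2 * ?\<beta>) = 0" using d1 d2 by auto
  moreover have "(z - c) * (z + c) + of_real (\<alpha>\<^sup>2 * ?\<beta>) = of_real (- \<omega>\<^sup>2 - (\<alpha>\<^sup>2 + \<delta>2 * (of_int n)\<^sup>2)\<^sup>2 + \<alpha>\<^sup>2 * ?\<beta>)"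
    unfolding c_def z_def by (simp add: complex_eq_iff power2_eq_square algebra_simps)
  ultimately have "- \<omega>\<^sup>2 - (\<alpha>\<^sup>2 + \<delta>2 * (of_int n)\<^sup>2)\<^sup>2 + \<alpha>\<^sup>2 * ?\<beta> = 0" by (simp only: of_real_eq_0_iff)
  then show "\<omega>\<^sup>2 = \<alpha>\<^sup>2 * ?\<beta> - (\<alpha>\<^sup>2 + \<delta>2 * (of_int n)\<^sup>2)\<^sup>2" by linarith
qed

text \<open>Retains the wave number of the critical space and forgets its eigenvectors.\<close>

lemma critical_space_trig:
  assumes "e \<in> critical_space \<alpha> \<delta>1 \<delta>2 n \<omega>"
  obtains p q where "e = (\<lambda>x. cos (real (nat \<bar>n\<bar>) * x) *\<^sub>R p + sin (real (nat \<bar>n\<bar>) * x) *\<^sub>R q)"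
proof -
  let ?c = "\<lambda>x. cos (real (nat \<bar>n\<bar>) * x)" and ?s = "\<lambda>x. sin (real (nat \<bar>n\<bar>) * x)"
  have part: "\<exists>p q. f = (\<lambda>x. ?c x *\<^sub>R p + ?s x *\<^sub>R q)" if f: "f \<in> critical_parts \<alpha> \<delta>1 \<delta>2 n \<omega>" for f
  proof -
    obtain k V where k: "k = n \<or> k = - n" and
      e: "f = (\<lambda>x. \<chi> j. Re (fourier_mode k V x $ j)) \<or> f = (\<lambda>x. \<chi> j. Im (fourier_mode k V x $ j))"
      using f unfolding critical_parts_def Let_def by blast
    have N: "nat \<bar>k\<bar> = nat \<bar>n\<bar>" using k by auto
    obtain Q where m: "fourier_mode k V = (\<lambda>x. ?c x *\<^sub>R V + ?s x *\<^sub>R Q)"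
      using fourier_mode_trig[of k V] unfolding N by blast
    have "f = (\<lambda>x. ?c x *\<^sub>R (\<chi> j. Re (V $ j)) + ?s x *\<^sub>R (\<chi> j. Re (Q $ j)))
        \<or> f = (\<lambda>x. ?c x *\<^sub>R (\<chi> j. Im (V $ j)) + ?s x *\<^sub>R (\<chi> j. Im (Q $ j)))"
      using e unfolding m by (auto simp: fun_eq_iff vec_eq_iff)
    then show ?thesis by blast
  qed
  obtain G c where G: "finite G" "G \<subseteq> critical_parts \<alpha> \<delta>1 \<delta>2 n \<omega>" and e: "e = (\<lambda>x. \<Sum>f\<in>G. c f *\<^sub>R f x)"
    using assms unfolding critical_space_def by blast
  have "\<forall>f\<in>G. \<exists>p q. f = (\<lambda>x. ?c x *\<^sub>R p + ?s x *\<^sub>R q)" using part G by blast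
  then obtain p q where pq: "\<And>f. f \<in> G \<Longrightarrow> f = (\<lambda>x. ?c x *\<^sub>R p f + ?s x *\<^sub>R q f)" by metis
  have "e = (\<lambda>x. ?c x *\<^sub>R (\<Sum>f\<in>G. c f *\<^sub>R p f) + ?s x *\<^sub>R (\<Sum>f\<in>G. c f *\<^sub>R q f))"
  proof
    fix x
    have "e x = (\<Sum>f\<in>G. c f *\<^sub>R (?c x *\<^sub>R p f + ?s x *\<^sub>R q f))"
      unfolding e by (rule sum.cong[OF refl]) (metis pq)
    then show "e x = ?c x *\<^sub>R (\<Sum>f\<in>G. c f *\<^sub>R p f) + ?s x *\<^sub>R (\<Sum>f\<in>G. c f *\<^sub>R q f)"
      by (simp add: scaleR_add_right sum.distrib scaleR_sum_right mult.commute)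
  qed
  then show thesis by (rule that)
qed

lemma H1_norm_add_le:
  assumes "has_weak_deriv f f'" "has_weak_deriv g g'"
  shows "H1_norm (\<lambda>x. f x + g x) \<le> 2 * H1_norm f + 2 * H1_norm g"
proof -
  have "(H1_norm (\<lambda>x. f x + g x))\<^sup>2 = (L2_norm (\<lambda>x. f x + g x))\<^sup>2 + (L2_norm (\<lambda>x. f' x + g' x))\<^sup>2"
    by (rule H1_norm_eq[OF has_weak_deriv_add[OF assms]])
  also have "\<dots> \<le> (2 * (L2_norm f)\<^sup>2 + 2 * (L2_norm g)\<^sup>2) + (2 * (L2_norm f')\<^sup>2 + 2 * (L2_norm g')\<^sup>2)"
    by (intro add_mono L2_norm_add_square_le has_weak_derivD[OF assms(1)] has_weak_derivD[OF assms(2)])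
  also have "\<dots> = 2 * (H1_norm f)\<^sup>2 + 2 * (H1_norm g)\<^sup>2"
    unfolding H1_norm_eq[OF assms(1)] H1_norm_eq[OF assms(2)] by simp
  also have "\<dots> \<le> (2 * H1_norm f + 2 * H1_norm g)\<^sup>2"
  proof -
    have "0 \<le> H1_norm f * H1_norm g" "0 \<le> (H1_norm f)\<^sup>2" "0 \<le> (H1_norm g)\<^sup>2" by simp_all
    moreover have "(2 * H1_norm f + 2 * H1_norm g)\<^sup>2 = 4 * (H1_norm f)\<^sup>2 + 4 * (H1_norm g)\<^sup>2 + 8 * (H1_norm f * H1_norm g)"
      by (simp add: power2_eq_square algebra_simps)
    ultimately show ?thesis by linarith
  qed
  finally show ?thesis by (rule power2_le_imp_le) simp
qed

text \<open>Replaces an unspecified nearby element of the critical space by the function's own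
  coefficient at wave number N. The part of the error proportional to the H1 norm is absorbed into
  the left side by smallness of \<epsilon>.\<close>

lemma critical_projection:
  fixes f f' :: "real \<Rightarrow> 'a::euclidean_space" and N :: nat
  defines "K \<equiv> sqrt (2 * pi) * (1 + real N)" and "a \<equiv> (1 / pi) *\<^sub>R fcos N f"
  assumes N: "N \<noteq> 0" and f: "has_weak_deriv f f'" and odd: "fsin N f = 0"
    and close: "H1_norm (\<lambda>x. f x - (cos (real N * x) *\<^sub>R p + sin (real N * x) *\<^sub>R q)) \<le> \<epsilon> * H1_norm f"
    and \<epsilon>: "\<epsilon> * (2 + 8 * K) \<le> 1 / 2"
  shows "H1_norm f \<le> 4 * K * norm a" "L2_norm (\<lambda>x. f x - cos (real N * x) *\<^sub>R a) \<le> 8 * \<epsilon> * H1_norm f"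
proof -
  let ?t = "\<lambda>p q x. cos (real N * x) *\<^sub>R p + sin (real N * x) *\<^sub>R (q :: 'a)"
  let ?t' = "\<lambda>p q x. cos (real N * x) *\<^sub>R (real N *\<^sub>R q) + sin (real N * x) *\<^sub>R (- real N *\<^sub>R (p :: 'a))"
  define \<eta> where "\<eta> = \<epsilon> * H1_norm f"
  have K: "0 \<le> K" by (simp add: K_def)
  have \<eta>: "0 \<le> \<eta>" using order_trans[OF H1_norm_nonneg close] by (simp add: \<eta>_def)
  have wt: "has_weak_deriv (?t p q) (?t' p q)" for p q by (rule has_weak_deriv_trig)
  have wd: "has_weak_deriv (\<lambda>x. f x - ?t p q x) (\<lambda>x. f' x - ?t' p q x)" by (rule has_weak_deriv_diff[OF f wt])
  have l2: "L2_norm (\<lambda>x. f x - ?t p q x) \<le> \<eta>"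
    using order_trans[OF L2_norm_le_H1_norm close] by (simp add: \<eta>_def)
  have cs: "fcos N (\<lambda>x. f x - ?t p q x) = pi *\<^sub>R (a - p)" "fsin N (\<lambda>x. f x - ?t p q x) = pi *\<^sub>R (- q)"
    using odd by (simp_all add: fcos_diff[OF has_weak_derivD(1)[OF f] has_weak_derivD(1)[OF wt]] fcos_trig[OF N] a_def scaleR_diff_right)
  have sq: "sqrt (2 * pi) \<le> pi"
    by (rule real_le_lsqrt) (use pi_ge_two in \<open>auto simp: power2_eq_square\<close>)
  \<comment> \<open>Coefficients of the small difference bound a - p, and also q, since f has no
    sine coefficient.\<close>
  have pq: "norm (a - p) \<le> \<eta>" "norm q \<le> \<eta>"
  proof -
    have "sqrt (2 * pi) * L2_norm (\<lambda>x. f x - ?t p q x) \<le> pi * \<eta>" using sq l2 \<eta> by (intro mult_mono) auto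
    from order_trans[OF norm_fcos_le(1)[OF has_weak_derivD(1)[OF wd]] this, of N] order_trans[OF norm_fcos_le(2)[OF has_weak_derivD(1)[OF wd]] this, of N]
    show "norm (a - p) \<le> \<eta>" "norm q \<le> \<eta>" unfolding cs by simp_all
  qed
  have sup: "norm (?t u w x) \<le> norm u + norm w" for u w :: 'a and x
    by (rule order_trans[OF norm_triangle_ineq]) (intro add_mono; simp add: mult_left_le_one_le)
  have "(L2_norm (\<lambda>x. (f x - ?t p q x) + ?t (p - a) q x))\<^sup>2 \<le> 2 * (L2_norm (\<lambda>x. f x - ?t p q x))\<^sup>2 + 2 * (L2_norm (?t (p - a) q))\<^sup>2"
    by (rule L2_norm_add_square_le[OF has_weak_derivD(1)[OF wd] has_weak_derivD(1)[OF wt]])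
  also have "\<dots> \<le> 2 * \<eta>\<^sup>2 + 2 * (sqrt (2 * pi) * (2 * \<eta>))\<^sup>2"
  proof (intro add_mono mult_left_mono power_mono l2 L2_norm_le_sup[OF has_weak_derivD(1)[OF wt]])
    show "norm (?t (p - a) q x) \<le> 2 * \<eta>" for x using sup[of x "p - a" q] pq by (simp add: norm_minus_commute)
  qed auto
  also have "\<dots> \<le> (8 * \<eta>)\<^sup>2"
  proof -
    have "2 * \<eta>\<^sup>2 + 2 * (sqrt (2 * pi) * (2 * \<eta>))\<^sup>2 = (2 + 16 * pi) * \<eta>\<^sup>2" by (simp add: power_mult_distrib algebra_simps)
    also have "\<dots> \<le> 64 * \<eta>\<^sup>2" by (intro mult_right_mono) (use pi_less_4 pi_approx in auto)
    finally show ?thesis by (simp add: power_mult_distrib)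
  qed
  finally have "L2_norm (\<lambda>x. (f x - ?t p q x) + ?t (p - a) q x) \<le> 8 * \<eta>" by (rule power2_le_imp_le) (use \<eta> in simp)
  moreover have "(\<lambda>x. (f x - ?t p q x) + ?t (p - a) q x) = (\<lambda>x. f x - cos (real N * x) *\<^sub>R a)"
    by (simp add: fun_eq_iff scaleR_diff_right)
  ultimately show "L2_norm (\<lambda>x. f x - cos (real N * x) *\<^sub>R a) \<le> 8 * \<epsilon> * H1_norm f" by (simp add: \<eta>_def)
  define s where "s = norm p + norm q"
  have "H1_norm (?t p q) \<le> sqrt (2 * pi) * s + sqrt (2 * pi) * (real N * s)"
  proof (rule H1_norm_le[OF wt]; rule L2_norm_le_sup)
    show "norm (?t p q x) \<le> s" for x using sup[of x p q] by (simp add: s_def)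
    show "norm (?t' p q x) \<le> real N * s" for x using sup[of x "real N *\<^sub>R q" "- real N *\<^sub>R p"] by (simp add: s_def algebra_simps)
  qed (use has_weak_derivD[OF wt] in auto)
  then have e: "H1_norm (?t p q) \<le> K * s" by (simp add: K_def algebra_simps)
  have "s \<le> norm a + 2 * \<eta>" using pq norm_triangle_ineq2[of p a] by (simp add: s_def norm_minus_commute)
  then have "K * s \<le> K * (norm a + 2 * \<eta>)" by (rule mult_left_mono[OF _ K])
  with e have e: "H1_norm (?t p q) \<le> K * norm a + 2 * (K * \<eta>)" by (simp add: distrib_left)
  have "H1_norm f = H1_norm (\<lambda>x. (f x - ?t p q x) + ?t p q x)" by simp
  also have "\<dots> \<le> 2 * H1_norm (\<lambda>x. f x - ?t p q x) + 2 * H1_norm (?t p q)" by (rule H1_norm_add_le[OF wd wt])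
  also have "\<dots> \<le> 2 * \<eta> + 2 * (K * norm a + 2 * (K * \<eta>))" using close e by (simp add: \<eta>_def)
  also have "\<dots> \<le> 2 * (K * norm a) + (2 + 8 * K) * \<eta>" using K \<eta> by (simp add: algebra_simps)
  also have "(2 + 8 * K) * \<eta> = (\<epsilon> * (2 + 8 * K)) * H1_norm f" by (simp add: \<eta>_def)
  also have "\<dots> \<le> 1 / 2 * H1_norm f" by (rule mult_right_mono[OF \<epsilon>]) simp
  finally show "H1_norm f \<le> 4 * K * norm a" by simp
qed

text \<open>(Y, Z) is a perturbed harmonic oscillator along which Y (2 Z + e Y) nearly vanishes. All
  errors are measured relative to the size of (Y, Z), which is why the conclusion is exact vanishing
  and not just smallness.\<close>

lemma planar_rigidity:
  fixes \<omega> e :: real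
  assumes \<omega>: "0 < \<omega>"
  obtains \<epsilon> where "0 < \<epsilon>"
    "\<And>Y Z g h T t. (\<And>t. (Y has_real_derivative Z t + g t) (at t)) \<Longrightarrow> (\<And>t. (Z has_real_derivative h t - \<omega>\<^sup>2 * Y t) (at t)) \<Longrightarrow>
      0 < T \<Longrightarrow> (\<And>t. Y (t + T) = Y t) \<Longrightarrow> (\<And>t. Z (t + T) = Z t) \<Longrightarrow>
      (\<And>t. \<bar>g t\<bar> \<le> \<epsilon> * (\<bar>Y t\<bar> + \<bar>Z t\<bar>)) \<Longrightarrow> (\<And>t. \<bar>h t\<bar> \<le> \<epsilon> * (\<bar>Y t\<bar> + \<bar>Z t\<bar>)) \<Longrightarrow>
      (\<And>t. \<bar>Y t * (2 * Z t + e * Y t)\<bar> \<le> \<epsilon> * ((Y t)\<^sup>2 + (Z t)\<^sup>2)) \<Longrightarrow> Y t = 0 \<and> Z t = 0"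
proof -
  \<comment> \<open>m bounds |Z| / |Y| at the chosen time, and \<epsilon> D collects the errors
    there: 4 (1 + m) from the defect in the critical-point equation, 1 + m^2 from the
    constraint.\<close>
  define m where "m = 2 * \<omega>\<^sup>2 + 1"
  define D where "D = 4 * (1 + m) + 1 + m\<^sup>2"
  have m: "0 < m" by (simp add: m_def add_pos_nonneg add_nonneg_pos)
  have D: "0 < D" using m by (simp add: D_def add_pos_nonneg)
  define \<epsilon> where "\<epsilon> = min (1 / 4) (\<omega>\<^sup>2 / D)"
  have \<epsilon>: "0 < \<epsilon>" "\<epsilon> \<le> 1 / 4" "\<epsilon> * D \<le> \<omega>\<^sup>2"
  proof -
    have "\<epsilon> \<le> \<omega>\<^sup>2 / D" by (simp add: \<epsilon>_def)
    then show "\<epsilon> * D \<le> \<omega>\<^sup>2" using D by (simp add: pos_le_divide_eq)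
    show "\<epsilon> \<le> 1 / 4" unfolding \<epsilon>_def by (rule min.cobounded1)
  qed (use D \<omega> in \<open>simp add: \<epsilon>_def\<close>)
  show thesis
  proof (rule that[OF \<epsilon>(1)])
    fix Y Z g h :: "real \<Rightarrow> real" and T t0 :: real
    assume dY: "\<And>t. (Y has_real_derivative Z t + g t) (at t)" and dZ: "\<And>t. (Z has_real_derivative h t - \<omega>\<^sup>2 * Y t) (at t)"
      and T: "0 < T" and per: "\<And>t. Y (t + T) = Y t" "\<And>t. Z (t + T) = Z t"
      and gh: "\<And>t. \<bar>g t\<bar> \<le> \<epsilon> * (\<bar>Y t\<bar> + \<bar>Z t\<bar>)" "\<And>t. \<bar>h t\<bar> \<le> \<epsilon> * (\<bar>Y t\<bar> + \<bar>Z t\<bar>)"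
      and con: "\<And>t. \<bar>Y t * (2 * Z t + e * Y t)\<bar> \<le> \<epsilon> * ((Y t)\<^sup>2 + (Z t)\<^sup>2)"
    \<comment> \<open>The sign of e, so that 2 \<kappa> \<omega>^2 and e cannot cancel. A critical
      point of Y itself would have Z near 0 and give only that e Y^2 is small, which says nothing
      when e = 0.\<close>
    define \<kappa> :: real where "\<kappa> = (if 0 \<le> e then 1 else - 1)"
    have \<kappa>: "\<kappa> * \<kappa> = 1" "\<bar>\<kappa>\<bar> = 1" "2 * \<omega>\<^sup>2 \<le> \<bar>2 * \<kappa> * \<omega>\<^sup>2 + e\<bar>"
    proof -
      show "2 * \<omega>\<^sup>2 \<le> \<bar>2 * \<kappa> * \<omega>\<^sup>2 + e\<bar>"
      proof (cases "0 \<le> e")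
        case True
        then show ?thesis using abs_ge_self[of "2 * \<omega>\<^sup>2 + e"] by (simp add: \<kappa>_def)
      next
        case False
        then show ?thesis using abs_ge_minus_self[of "- (2 * \<omega>\<^sup>2) + e"] by (simp add: \<kappa>_def)
      qed
    qed (simp_all add: \<kappa>_def)
    define F where "F = (\<lambda>t. Z t + \<kappa> * Y t)"
    have dF: "(F has_real_derivative (h t - \<omega>\<^sup>2 * Y t) + \<kappa> * (Z t + g t)) (at t)" for t
      unfolding F_def by (intro DERIV_add dZ DERIV_cmult dY)
    have "\<exists>z. 0 < z \<and> z < T \<and> (F has_real_derivative 0) (at z)"
    proof (rule Rolle[OF T])
      show "F 0 = F T" using per(1)[of 0] per(2)[of 0] by (simp add: F_def)
      show "continuous_on {0..T} F" using dF by (intro continuous_at_imp_continuous_on ballI DERIV_isCont)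
      show "F differentiable at x" for x using dF real_differentiable_def by blast
    qed
    then obtain z where "(F has_real_derivative 0) (at z)" by blast
    from DERIV_unique[OF this dF] have z: "h z - \<omega>\<^sup>2 * Y z + \<kappa> * (Z z + g z) = 0" by simp
    define R where "R = \<kappa> * Z z - \<omega>\<^sup>2 * Y z"
    have "R = - h z - \<kappa> * g z" using z by (simp add: R_def algebra_simps)
    then have "\<bar>R\<bar> \<le> \<bar>h z\<bar> + \<bar>\<kappa> * g z\<bar>" by linarith
    then have R: "\<bar>R\<bar> \<le> 2 * (\<epsilon> * (\<bar>Y z\<bar> + \<bar>Z z\<bar>))" using gh[of z] \<kappa>(2) by (simp add: abs_mult)
    have Zz: "Z z = \<kappa> * (\<omega>\<^sup>2 * Y z + R)"
    proof -
      have "\<kappa> * (\<omega>\<^sup>2 * Y z + R) = (\<kappa> * \<kappa>) * Z z" by (simp add: R_def algebra_simps)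
      then show ?thesis using \<kappa>(1) by simp
    qed
    have "\<bar>Z z\<bar> = \<bar>\<omega>\<^sup>2 * Y z + R\<bar>" unfolding Zz abs_mult \<kappa>(2) by simp
    also have "\<dots> \<le> \<omega>\<^sup>2 * \<bar>Y z\<bar> + \<bar>R\<bar>" by (rule order_trans[OF abs_triangle_ineq]) (simp add: abs_mult)
    finally have Z1: "\<bar>Z z\<bar> \<le> \<omega>\<^sup>2 * \<bar>Y z\<bar> + \<bar>R\<bar>" .
    have "\<epsilon> * (\<bar>Y z\<bar> + \<bar>Z z\<bar>) \<le> 1 / 4 * (\<bar>Y z\<bar> + \<bar>Z z\<bar>)" by (rule mult_right_mono[OF \<epsilon>(2)]) simp
    with R Z1 have Zm: "\<bar>Z z\<bar> \<le> m * \<bar>Y z\<bar>" by (simp add: m_def algebra_simps)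
    have "\<epsilon> * (\<bar>Y z\<bar> + \<bar>Z z\<bar>) \<le> \<epsilon> * ((1 + m) * \<bar>Y z\<bar>)"
      using Zm \<epsilon>(1) by (intro mult_left_mono) (auto simp: distrib_right)
    with R have R2: "\<bar>R\<bar> \<le> 2 * \<epsilon> * (1 + m) * \<bar>Y z\<bar>" by (simp add: mult.assoc)
    have "Y z * (2 * Z z + e * Y z) = (2 * \<kappa> * \<omega>\<^sup>2 + e) * (Y z)\<^sup>2 + 2 * \<kappa> * (Y z * R)"
      unfolding Zz by (simp add: power2_eq_square algebra_simps)
    then have "\<bar>2 * \<kappa> * \<omega>\<^sup>2 + e\<bar> * (Y z)\<^sup>2 \<le> \<bar>Y z * (2 * Z z + e * Y z)\<bar> + \<bar>2 * \<kappa> * (Y z * R)\<bar>"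
      using abs_triangle_ineq4[of "Y z * (2 * Z z + e * Y z)" "2 * \<kappa> * (Y z * R)"] by (simp add: abs_mult)
    also have "\<bar>2 * \<kappa> * (Y z * R)\<bar> = 2 * (\<bar>Y z\<bar> * \<bar>R\<bar>)" using \<kappa>(2) by (simp add: abs_mult)
    also have "\<bar>Y z\<bar> * \<bar>R\<bar> \<le> \<bar>Y z\<bar> * (2 * \<epsilon> * (1 + m) * \<bar>Y z\<bar>)" by (rule mult_left_mono[OF R2]) simp
    also have "\<bar>Y z\<bar> * (2 * \<epsilon> * (1 + m) * \<bar>Y z\<bar>) = 2 * \<epsilon> * (1 + m) * (Y z)\<^sup>2" by (simp add: power2_eq_square)
    also have "\<bar>Y z * (2 * Z z + e * Y z)\<bar> \<le> \<epsilon> * ((Y z)\<^sup>2 + m\<^sup>2 * (Y z)\<^sup>2)"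
    proof -
      have "(Z z)\<^sup>2 \<le> m\<^sup>2 * (Y z)\<^sup>2" using power_mono[OF Zm, of 2] by (simp add: power_mult_distrib)
      then have "\<epsilon> * ((Y z)\<^sup>2 + (Z z)\<^sup>2) \<le> \<epsilon> * ((Y z)\<^sup>2 + m\<^sup>2 * (Y z)\<^sup>2)" using \<epsilon>(1) by (intro mult_left_mono) auto
      with con[of z] show ?thesis by linarith
    qed
    finally have "\<bar>2 * \<kappa> * \<omega>\<^sup>2 + e\<bar> * (Y z)\<^sup>2 \<le> (\<epsilon> * D) * (Y z)\<^sup>2" by (simp add: D_def algebra_simps)
    also have "\<dots> \<le> \<omega>\<^sup>2 * (Y z)\<^sup>2" by (rule mult_right_mono[OF \<epsilon>(3)]) simp
    finally have "\<bar>2 * \<kappa> * \<omega>\<^sup>2 + e\<bar> * (Y z)\<^sup>2 \<le> \<omega>\<^sup>2 * (Y z)\<^sup>2" .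
    moreover have "(2 * \<omega>\<^sup>2) * (Y z)\<^sup>2 \<le> \<bar>2 * \<kappa> * \<omega>\<^sup>2 + e\<bar> * (Y z)\<^sup>2" by (rule mult_right_mono[OF \<kappa>(3)]) simp
    ultimately have "\<omega>\<^sup>2 * (Y z)\<^sup>2 \<le> 0" by linarith
    then have "Y z = 0" using \<omega> by (simp add: mult_le_0_iff)
    then have z0: "Y z = 0" "Z z = 0" using Zm by simp_all
    \<comment> \<open>Gronwall's argument: S vanishes at z and grows at most exponentially, so it
      vanishes at all later times. Periodicity reaches the earlier ones.\<close>
    define S where "S = (\<lambda>t. (Y t)\<^sup>2 + (Z t)\<^sup>2)"
    define K where "K = 2 + \<omega>\<^sup>2"
    have dS: "(S has_real_derivative 2 * Y t * (Z t + g t) + 2 * Z t * (h t - \<omega>\<^sup>2 * Y t)) (at t)" for t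
      unfolding S_def by (auto intro!: derivative_eq_intros dY dZ)
    have growth: "2 * Y t * (Z t + g t) + 2 * Z t * (h t - \<omega>\<^sup>2 * Y t) \<le> K * S t" for t
    proof -
      define y w r where "y = \<bar>Y t\<bar>" and "w = \<bar>Z t\<bar>" and "r = (\<bar>Y t\<bar> + \<bar>Z t\<bar>) / 4"
      have n: "0 \<le> y" "0 \<le> w" by (simp_all add: y_def w_def)
      have S: "S t = y\<^sup>2 + w\<^sup>2" by (simp add: S_def y_def w_def)
      have b: "\<bar>g t\<bar> \<le> r" "\<bar>h t\<bar> \<le> r"
        using order_trans[OF gh(1) mult_right_mono[OF \<epsilon>(2)], of t] order_trans[OF gh(2) mult_right_mono[OF \<epsilon>(2)], of t] by (simp_all add: r_def)
      have t1: "Y t * g t \<le> y * r" "Z t * h t \<le> w * r"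
        using mult_mono[OF order_refl[of "\<bar>Y t\<bar>"] b(1)] mult_mono[OF order_refl[of "\<bar>Z t\<bar>"] b(2)]
          abs_ge_self[of "Y t * g t"] abs_ge_self[of "Z t * h t"] by (simp_all add: y_def w_def abs_mult)
      have yw: "2 * (y * w) \<le> y\<^sup>2 + w\<^sup>2" using sum_squares_bound[of y w] by (simp add: mult.assoc)
      have t2: "\<bar>Y t * Z t\<bar> = y * w" by (simp add: abs_mult y_def w_def)
      have "2 * ((1 - \<omega>\<^sup>2) * (Y t * Z t)) \<le> (1 + \<omega>\<^sup>2) * (y\<^sup>2 + w\<^sup>2)"
      proof -
        have "(1 - \<omega>\<^sup>2) * (Y t * Z t) \<le> \<bar>1 - \<omega>\<^sup>2\<bar> * \<bar>Y t * Z t\<bar>" by (metis abs_ge_self abs_mult)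
        also have "\<dots> \<le> (1 + \<omega>\<^sup>2) * (y * w)" unfolding t2 using n by (intro mult_right_mono) (auto simp: abs_le_iff)
        finally show ?thesis using mult_left_mono[OF yw, of "1 + \<omega>\<^sup>2"] by (simp add: mult.left_commute)
      qed
      moreover have "2 * (y * r) + 2 * (w * r) \<le> y\<^sup>2 + w\<^sup>2"
      proof -
        have "2 * (y * r) + 2 * (w * r) = (y\<^sup>2 + w\<^sup>2) / 2 + y * w" by (simp add: r_def y_def[symmetric] w_def[symmetric] power2_eq_square field_simps)
        also have "\<dots> \<le> y\<^sup>2 + w\<^sup>2" using yw by (simp add: field_simps)
        finally show ?thesis .
      qed
      moreover have "2 * Y t * (Z t + g t) + 2 * Z t * (h t - \<omega>\<^sup>2 * Y t) = 2 * ((1 - \<omega>\<^sup>2) * (Y t * Z t)) + 2 * (Y t * g t) + 2 * (Z t * h t)"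
        by (simp add: algebra_simps)
      moreover have "K * S t = (1 + \<omega>\<^sup>2) * (y\<^sup>2 + w\<^sup>2) + (y\<^sup>2 + w\<^sup>2)" by (simp add: K_def S algebra_simps)
      ultimately show ?thesis using t1 by linarith
    qed
    have after: "S t = 0" if "z \<le> t" for t
    proof -
      have "S t * exp (- K * t) \<le> S z * exp (- K * z)"
      proof (rule DERIV_nonpos_imp_nonincreasing[OF that])
        fix x
        let ?d = "2 * Y x * (Z x + g x) + 2 * Z x * (h x - \<omega>\<^sup>2 * Y x)"
        have "((\<lambda>t. S t * exp (- K * t)) has_real_derivative (?d - K * S x) * exp (- K * x)) (at x)"
          by (auto intro!: derivative_eq_intros dS simp: algebra_simps)
        moreover have "(?d - K * S x) * exp (- K * x) \<le> 0" using growth[of x] by (intro mult_nonpos_nonneg) auto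
        ultimately show "\<exists>y. ((\<lambda>t. S t * exp (- K * t)) has_real_derivative y) (at x) \<and> y \<le> 0" by blast
      qed
      moreover have "S z = 0" using z0 by (simp add: S_def)
      ultimately have "S t * exp (- K * t) \<le> 0" by simp
      then have "S t \<le> 0" by (simp add: mult_le_0_iff not_le)
      moreover have "0 \<le> S t" by (simp add: S_def)
      ultimately show ?thesis by simp
    qed
    have perS: "S (t + of_nat i * T) = S t" for t and i :: nat
    proof (induction i)
      case (Suc i)
      have "S (t + of_nat (Suc i) * T) = S ((t + of_nat i * T) + T)" by (simp add: algebra_simps)
      also have "\<dots> = S t" using Suc by (simp add: S_def per)
      finally show ?case .
    qed simp
    obtain i :: nat where "(z - t0) / T < of_nat i" using reals_Archimedean2 by blast
    then have "z \<le> t0 + of_nat i * T" using T by (simp add: pos_divide_less_eq)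
    then have "S t0 = 0" using after perS by metis
    then show "Y t0 = 0 \<and> Z t0 = 0" by (simp add: S_def sum_power2_eq_zero_iff)
  qed
qed

section \<open>Time evolution of the Fourier coefficients of a solution\<close>

lemma integral_circ_reflect: "(\<integral>x. f (- x) \<partial>circ) = (\<integral>x. (f x :: 'a::euclidean_space) \<partial>circ)"
proof -
  have "(\<integral>x. f x \<partial>circ) = (\<integral>x. indicator {-pi..pi} x *\<^sub>R f x \<partial>lborel)"
    by (simp add: integral_restrict_space)
  also have "\<dots> = (\<integral>x. indicator {-pi..pi} (- x) *\<^sub>R f (- x) \<partial>lborel)"
    using lborel_integral_real_affine[of "-1" "\<lambda>x. indicator {-pi..pi} x *\<^sub>R f x" 0] by simp
  also have "\<dots> = (\<integral>x. indicator {-pi..pi} x *\<^sub>R f (- x) \<partial>lborel)"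
  proof -
    have "indicator {-pi..pi} (- x) = (indicator {-pi..pi} x :: real)" for x by (auto simp: indicator_def)
    then show ?thesis by simp
  qed
  also have "\<dots> = (\<integral>x. f (- x) \<partial>circ)" by (simp add: integral_restrict_space)
  finally show ?thesis by simp
qed

lemma fsin_even:
  fixes f :: "real \<Rightarrow> 'a::euclidean_space"
  assumes "\<And>x. f (- x) = f x"
  shows "fsin k f = 0"
proof -
  have "fsin k f = (\<integral>x. sin (real k * (- x)) *\<^sub>R f (- x) \<partial>circ)"
    unfolding fsin_def by (rule integral_circ_reflect[symmetric])
  then have "fsin k f = - fsin k f" by (simp add: assms fsin_def)
  then have "2 *\<^sub>R fsin k f = 0" by (simp add: scaleR_2 eq_neg_iff_add_eq_0)
  then show ?thesis by simp
qed

text \<open>Removing the constant state leaves the weak derivatives unchanged as classes, but the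
  chosen representatives are known to agree almost everywhere only.\<close>

lemma perturbation_solution_regular:
  assumes "perturbation_solution \<alpha> \<delta>1 \<delta>2 \<beta> v"
  shows "continuous_on UNIV (v t)" "H2_circle (v t)"
    "AE x in lborel. weak_deriv (weak_deriv (\<lambda>x. uniform_state \<alpha> \<beta> + v t x)) x = weak_deriv (weak_deriv (v t)) x"
proof -
  let ?u = "\<lambda>x. uniform_state \<alpha> \<beta> + v t x"
  have u: "continuous_on UNIV ?u" "H2_circle ?u"
    using assms unfolding perturbation_solution_def brusselator_solution_def by auto
  have "continuous_on UNIV (\<lambda>x. ?u x - uniform_state \<alpha> \<beta>)" by (intro continuous_intros u)
  then show "continuous_on UNIV (v t)" by (simp add: algebra_simps)
  have w: "has_weak_deriv (v t) (weak_deriv ?u)"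
    using has_weak_deriv_diff[OF H2_circleD(1)[OF u(2)] has_weak_deriv_const[of "uniform_state \<alpha> \<beta>"]] by simp
  show "H2_circle (v t)" by (rule H2_circle_AE(1)[OF w H2_circleD(2)[OF u(2)]])
  show "AE x in lborel. weak_deriv (weak_deriv ?u) x = weak_deriv (weak_deriv (v t)) x"
    using H2_circle_AE(2)[OF w H2_circleD(2)[OF u(2)]] by (rule AE_mp) (auto intro: AE_I2)
qed

text \<open>Taking a coefficient is bounded and linear on L2, so differentiability of the curve into
  L2 turns the equation into an ordinary differential equation for each coefficient.\<close>

lemma fcos_time_derivative:
  assumes \<alpha>: "\<alpha> \<noteq> 0" and sol: "perturbation_solution \<alpha> \<delta>1 \<delta>2 \<beta> v"
  shows "((\<lambda>t. fcos k (v t)) has_vector_derivative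
      linear_part \<alpha> \<delta>1 \<delta>2 \<beta> (fcos k (v t)) (- (real k)\<^sup>2 *\<^sub>R fcos k (v t)) + fcos k (\<lambda>x. nonlinear_part \<alpha> \<beta> (v t x))) (at t)"
proof -
  note reg = perturbation_solution_regular[OF sol]
  let ?u = "\<lambda>t x. uniform_state \<alpha> \<beta> + v t x"
  define G where "G = linear_part \<alpha> \<delta>1 \<delta>2 \<beta> (fcos k (v t)) (- (real k)\<^sup>2 *\<^sub>R fcos k (v t)) + fcos k (\<lambda>x. nonlinear_part \<alpha> \<beta> (v t x))"
  define r where "r = (\<lambda>s x. (?u s x - ?u t x) /\<^sub>R (s - t) - brusselator_rhs \<alpha> \<delta>1 \<delta>2 \<beta> (?u t x) (weak_deriv (weak_deriv (?u t)) x))"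
  have lim: "((\<lambda>s. L2_norm (r s)) \<longlongrightarrow> 0) (at t)"
    using sol unfolding perturbation_solution_def brusselator_solution_def r_def by blast
  have Lv: "L2_circle (v s)" for s by (rule has_weak_derivD(1)[OF H2_circleD(1)[OF reg(2)]])
  have Ln: "L2_circle (\<lambda>x. nonlinear_part \<alpha> \<beta> (v t x))"
  proof (rule L2_circle_continuous)
    show "continuous_on UNIV (\<lambda>x. nonlinear_part \<alpha> \<beta> (v t x))" unfolding nonlinear_part_def
      by (intro continuous_intros continuous_on_component reg(1))
    show "periodic_2pi (\<lambda>x. nonlinear_part \<alpha> \<beta> (v t x))"
      using L2_circleD(1)[OF Lv[of t]] by (simp add: periodic_2pi_def)
  qed
  let ?L = "brusselator_L \<alpha> \<delta>1 \<delta>2 \<beta> (v t)"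
  have LL: "L2_circle ?L" by (rule L2_brusselator_L[OF reg(2)])
  have Lq: "L2_circle (\<lambda>x. (v s x - v t x) /\<^sub>R (s - t))" for s by (intro L2_circle_scaleR L2_circle_diff Lv)
  have Lr: "L2_circle (r s)" for s
  proof -
    have "H2_circle (?u t)" using sol unfolding perturbation_solution_def brusselator_solution_def by auto
    then have "L2_circle (weak_deriv (weak_deriv (?u t)))" using has_weak_derivD(2)[OF H2_circleD(2)] by blast
    then have 1: "L2_circle (\<lambda>x. linear_part \<alpha> \<delta>1 \<delta>2 \<beta> 0 (weak_deriv (weak_deriv (?u t)) x))"
      by (rule L2_circle_linear[OF _ bounded_linear_linear_part(2)])
    have 2: "L2_circle (\<lambda>x. linear_part \<alpha> \<delta>1 \<delta>2 \<beta> (v t x) 0)"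
      by (rule L2_circle_linear[OF Lv bounded_linear_linear_part(1)])
    have e: "brusselator_rhs \<alpha> \<delta>1 \<delta>2 \<beta> (?u t x) p = linear_part \<alpha> \<delta>1 \<delta>2 \<beta> (v t x) 0 + linear_part \<alpha> \<delta>1 \<delta>2 \<beta> 0 p + nonlinear_part \<alpha> \<beta> (v t x)" for x p
      unfolding brusselator_rhs_perturbation[OF \<alpha>] linear_part_split[of _ _ _ _ "v t x" p] by simp
    show ?thesis unfolding r_def e using Lq[of s] 1 2 Ln by (simp add: L2_circle_diff L2_circle_add)
  qed
  have ae: "AE x in lborel. r s x = (v s x - v t x) /\<^sub>R (s - t) - (?L x + nonlinear_part \<alpha> \<beta> (v t x))" for s
    using reg(3)[of t]
  proof (rule AE_mp, intro AE_I2 impI)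
    fix x assume w: "weak_deriv (weak_deriv (?u t)) x = weak_deriv (weak_deriv (v t)) x"
    show "r s x = (v s x - v t x) /\<^sub>R (s - t) - (?L x + nonlinear_part \<alpha> \<beta> (v t x))"
      unfolding r_def brusselator_rhs_perturbation[OF \<alpha>] w brusselator_L_def by simp
  qed
  have fr: "fcos k (r s) = (fcos k (v s) - fcos k (v t)) /\<^sub>R (s - t) - G" for s
  proof -
    have "fcos k (r s) = fcos k (\<lambda>x. (v s x - v t x) /\<^sub>R (s - t) - (?L x + nonlinear_part \<alpha> \<beta> (v t x)))"
      by (rule fcos_cong_AE(1)[OF Lr _ ae]) (intro L2_circle_diff[OF Lq] L2_circle_add LL Ln)
    also have "\<dots> = fcos k (\<lambda>x. (v s x - v t x) /\<^sub>R (s - t)) - (fcos k ?L + fcos k (\<lambda>x. nonlinear_part \<alpha> \<beta> (v t x)))"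
      by (simp only: fcos_diff(1)[OF Lq L2_circle_add[OF LL Ln]] fcos_add(1)[OF LL Ln])
    also have "fcos k (\<lambda>x. (v s x - v t x) /\<^sub>R (s - t)) = (fcos k (v s) - fcos k (v t)) /\<^sub>R (s - t)"
      by (simp only: fcos_linear(1)[OF L2_circle_diff[OF Lv Lv] bounded_linear_scaleR_right] fcos_diff(1)[OF Lv Lv])
    finally show ?thesis unfolding G_def coeffs_brusselator_L(1)[OF reg(2)] .
  qed
  have "((\<lambda>s. norm ((fcos k (v s) - fcos k (v t)) - (s - t) *\<^sub>R G) / norm (s - t)) \<longlongrightarrow> 0) (at t)"
  proof (rule Lim_null_comparison)
    have "((\<lambda>s. sqrt (2 * pi) * L2_norm (r s)) \<longlongrightarrow> sqrt (2 * pi) * 0) (at t)" by (intro tendsto_intros lim)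
    then show "((\<lambda>s. sqrt (2 * pi) * L2_norm (r s)) \<longlongrightarrow> 0) (at t)" by simp
    have "norm (norm ((fcos k (v s) - fcos k (v t)) - (s - t) *\<^sub>R G) / norm (s - t)) \<le> sqrt (2 * pi) * L2_norm (r s)" if "s \<noteq> t" for s
    proof -
      have "fcos k (r s) = ((fcos k (v s) - fcos k (v t)) - (s - t) *\<^sub>R G) /\<^sub>R (s - t)"
        using that unfolding fr by (simp add: scaleR_diff_right)
      then have "norm (fcos k (r s)) = norm ((fcos k (v s) - fcos k (v t)) - (s - t) *\<^sub>R G) / norm (s - t)"
        by (simp add: divide_inverse mult.commute)
      then show ?thesis using norm_fcos_le(1)[OF Lr, of k s] by simp
    qed
    then show "\<forall>\<^sub>F s in at t. norm (norm ((fcos k (v s) - fcos k (v t)) - (s - t) *\<^sub>R G) / norm (s - t)) \<le> sqrt (2 * pi) * L2_norm (r s)"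
      by (auto simp: eventually_at_filter)
  qed
  then show ?thesis unfolding G_def[symmetric] has_vector_derivative_def has_derivative_iff_norm
    by (simp add: bounded_linear_scaleR_left)
qed

section \<open>Estimates at a fixed time\<close>

definition quadratic_form :: "real \<Rightarrow> real \<Rightarrow> real^2 \<Rightarrow> real" where
  "quadratic_form \<alpha> \<beta> v = 2 * \<alpha> * (v$1 * v$2) + \<beta> / \<alpha> * (v$1)\<^sup>2"

lemma quadratic_form_lipschitz:
  assumes "\<bar>2 * \<alpha>\<bar> + \<bar>\<beta> / \<alpha>\<bar> \<le> A"
  shows "\<bar>quadratic_form \<alpha> \<beta> v - quadratic_form \<alpha> \<beta> y\<bar> \<le> A * (norm (v - y) * (norm v + norm y))"
proof -
  let ?B = "norm (v - y) * (norm v + norm y)"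
  have c: "\<bar>x $ i\<bar> \<le> norm x" for x :: "real^2" and i by (rule component_le_norm_cart)
  have d: "\<bar>v $ i - y $ i\<bar> \<le> norm (v - y)" for i using c[of "v - y" i] by simp
  have 1: "\<bar>v $ 1 * v $ 2 - y $ 1 * y $ 2\<bar> \<le> ?B"
  proof -
    have "v $ 1 * v $ 2 - y $ 1 * y $ 2 = (v $ 2 - y $ 2) * v $ 1 + (v $ 1 - y $ 1) * y $ 2" by (simp add: algebra_simps)
    also have "\<bar>\<dots>\<bar> \<le> \<bar>v $ 2 - y $ 2\<bar> * \<bar>v $ 1\<bar> + \<bar>v $ 1 - y $ 1\<bar> * \<bar>y $ 2\<bar>"
      by (rule order_trans[OF abs_triangle_ineq]) (simp add: abs_mult)
    also have "\<dots> \<le> norm (v - y) * norm v + norm (v - y) * norm y" by (intro add_mono mult_mono c d) auto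
    finally show ?thesis by (simp add: distrib_left)
  qed
  have 2: "\<bar>(v $ 1)\<^sup>2 - (y $ 1)\<^sup>2\<bar> \<le> ?B"
  proof -
    have "\<bar>(v $ 1)\<^sup>2 - (y $ 1)\<^sup>2\<bar> = \<bar>v $ 1 - y $ 1\<bar> * \<bar>v $ 1 + y $ 1\<bar>"
      by (simp add: abs_mult[symmetric] power2_eq_square algebra_simps)
    also have "\<dots> \<le> ?B"
      using c[of v 1] c[of y 1] by (intro mult_mono d order_trans[OF abs_triangle_ineq] add_mono) auto
    finally show ?thesis .
  qed
  have "quadratic_form \<alpha> \<beta> v - quadratic_form \<alpha> \<beta> y = (2 * \<alpha>) * (v $ 1 * v $ 2 - y $ 1 * y $ 2) + (\<beta> / \<alpha>) * ((v $ 1)\<^sup>2 - (y $ 1)\<^sup>2)"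
    by (simp add: quadratic_form_def algebra_simps)
  also have "\<bar>\<dots>\<bar> \<le> \<bar>2 * \<alpha>\<bar> * \<bar>v $ 1 * v $ 2 - y $ 1 * y $ 2\<bar> + \<bar>\<beta> / \<alpha>\<bar> * \<bar>(v $ 1)\<^sup>2 - (y $ 1)\<^sup>2\<bar>"
    by (rule order_trans[OF abs_triangle_ineq]) (simp only: abs_mult order_refl)
  also have "\<dots> \<le> \<bar>2 * \<alpha>\<bar> * ?B + \<bar>\<beta> / \<alpha>\<bar> * ?B" by (intro add_mono mult_left_mono 1 2) auto
  also have "\<dots> = (\<bar>2 * \<alpha>\<bar> + \<bar>\<beta> / \<alpha>\<bar>) * ?B" by (simp add: distrib_right)
  also have "\<dots> \<le> A * ?B" by (intro mult_right_mono assms) auto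
  finally show ?thesis .
qed

lemma cubic_part_bound: "\<bar>(v $ 1)\<^sup>2 * v $ 2\<bar> \<le> norm v ^ 3" for v :: "real^2"
proof -
  have "\<bar>(v $ 1)\<^sup>2 * v $ 2\<bar> = \<bar>v $ 1\<bar> * \<bar>v $ 1\<bar> * \<bar>v $ 2\<bar>" by (simp add: abs_mult power2_eq_square)
  also have "\<dots> \<le> norm v * norm v * norm v" by (intro mult_mono component_le_norm_cart) auto
  finally show ?thesis by (simp add: power3_eq_cube)
qed

lemma nonlinear_part_bound:
  assumes "\<bar>2 * \<alpha>\<bar> + \<bar>\<beta> / \<alpha>\<bar> \<le> A" "norm v \<le> 1"
  shows "norm (nonlinear_part \<alpha> \<beta> v) \<le> 2 * (A + 1) * (norm v)\<^sup>2"
proof -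
  have e: "nonlinear_part \<alpha> \<beta> v = (quadratic_form \<alpha> \<beta> v + (v$1)\<^sup>2 * v$2) *\<^sub>R vector [1, -1]"
    by (simp add: nonlinear_part_def quadratic_form_def mult.assoc)
  have "\<bar>quadratic_form \<alpha> \<beta> v\<bar> \<le> A * (norm v)\<^sup>2"
    using quadratic_form_lipschitz[OF assms(1), of v 0] by (simp add: quadratic_form_def power2_eq_square)
  moreover have "\<bar>(v $ 1)\<^sup>2 * v $ 2\<bar> \<le> (norm v)\<^sup>2"
  proof -
    have "norm v ^ 3 = (norm v)\<^sup>2 * norm v" by (simp add: power3_eq_cube power2_eq_square)
    also have "\<dots> \<le> (norm v)\<^sup>2 * 1" by (rule mult_left_mono[OF assms(2)]) simp
    finally show ?thesis using cubic_part_bound[of v] by simp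
  qed
  ultimately have b: "\<bar>quadratic_form \<alpha> \<beta> v + (v$1)\<^sup>2 * v$2\<bar> \<le> (A + 1) * (norm v)\<^sup>2"
    using abs_triangle_ineq[of "quadratic_form \<alpha> \<beta> v" "(v$1)\<^sup>2 * v$2"] by (simp add: distrib_right)
  have n: "norm (vector [1, -1] :: real^2) \<le> 2" using norm_vec2_le[of "vector [1, -1]"] by simp
  have "norm (nonlinear_part \<alpha> \<beta> v) \<le> ((A + 1) * (norm v)\<^sup>2) * 2"
    unfolding e norm_scaleR by (intro mult_mono b n) (use order_trans[OF abs_ge_zero b] in auto)
  then show ?thesis by (simp only: mult_ac)
qed

text \<open>
  The vanishing mean enters in the second estimate: the integral of the nonlinearity over the circle
  vanishes, which constrains the critical Fourier coefficient \<open>b\<close> quadratically.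
\<close>

lemma slice_estimates:
  fixes f :: "real \<Rightarrow> real^2" and N :: nat
  defines "K \<equiv> sqrt (2 * pi) * (1 + real N)" and "S \<equiv> 8 * sqrt (2 * pi)" and "b \<equiv> fcos N f"
  assumes N: "N \<noteq> 0" and \<alpha>: "0 < \<alpha>" and A: "\<bar>2 * \<alpha>\<bar> + \<bar>\<beta> / \<alpha>\<bar> \<le> A"
    and f: "has_weak_deriv f f'" "continuous_on UNIV f" and even: "\<And>x. f (- x) = f x"
    and small: "H1_norm f \<le> \<epsilon>" "\<epsilon> * S \<le> 1" "\<epsilon> * (2 + 8 * K) \<le> 1 / 2"
    and close: "H1_norm (\<lambda>x. f x - (cos (real N * x) *\<^sub>R p + sin (real N * x) *\<^sub>R q)) \<le> \<epsilon> * H1_norm f"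
    and mean: "fcos 0 (\<lambda>x. nonlinear_part \<alpha> \<beta> (f x)) = 0"
  shows "norm (fcos N (\<lambda>x. nonlinear_part \<alpha> \<beta> (f x))) \<le> (16 * (A + 1) * S\<^sup>2 * K) * \<epsilon> * norm b"
    "\<bar>quadratic_form \<alpha> \<beta> b\<bar> \<le> (32 * pi * (S * K)\<^sup>2 * S + 32 * sqrt (2 * pi) * K * A * (4 * S * K + 1)) * \<epsilon> * (norm b)\<^sup>2"
    "b = 0 \<Longrightarrow> f x = 0"
proof -
  define a where "a = (1 / pi) *\<^sub>R b"
  define \<rho> where "\<rho> = H1_norm f"
  have b: "b = pi *\<^sub>R a" by (simp add: a_def)
  have na: "norm b = pi * norm a" by (simp add: b)
  have K: "0 \<le> K" and S: "0 \<le> S" by (simp_all add: K_def S_def)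
  have A0: "0 \<le> A" using A abs_ge_zero[of "2 * \<alpha>"] abs_ge_zero[of "\<beta> / \<alpha>"] by linarith
  have \<rho>: "0 \<le> \<rho>" by (simp add: \<rho>_def)
  have \<epsilon>: "0 \<le> \<epsilon>" using small(1) H1_norm_nonneg order_trans by blast
  have odd: "fsin N f = 0" by (rule fsin_even) (rule even)
  note cp = critical_projection[OF N f(1) odd close small(3)[unfolded K_def]]
  \<comment> \<open>The whole function is controlled by its critical coefficient, so that all later
    errors are relative to \<open>norm b\<close>.\<close>
  have r: "\<rho> \<le> 4 * K * norm a" using cp(1) by (simp add: \<rho>_def K_def a_def b_def)
  have w: "L2_norm (\<lambda>x. f x - cos (real N * x) *\<^sub>R a) \<le> 8 * \<epsilon> * \<rho>" using cp(2) by (simp add: \<rho>_def a_def b_def)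
  have sup: "norm (f x) \<le> S * \<rho>" for x using Sobolev[OF f] by (simp add: S_def \<rho>_def)
  show "f x = 0" if "b = 0"
  proof -
    have "\<rho> \<le> 0" using r that by (simp add: a_def)
    then show ?thesis using sup[of x] \<rho> by simp
  qed
  have sup1: "norm (f x) \<le> S * \<epsilon>" for x
    by (rule order_trans[OF sup mult_left_mono[OF small(1)[folded \<rho>_def] S]])
  have sup2: "norm (f x) \<le> (4 * S * K) * norm a" for x
    using order_trans[OF sup mult_left_mono[OF r S]] by (simp add: mult_ac)
  have one: "norm (f x) \<le> 1" for x using sup1[of x] small(2) by (simp add: mult.commute)
  have sq: "(norm (f x))\<^sup>2 \<le> (S * \<epsilon>) * ((4 * S * K) * norm a)" for x
    unfolding power2_eq_square by (intro mult_mono sup1 sup2) (use S \<epsilon> in auto)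
  have per: "periodic_2pi f" by (rule L2_circleD(1)[OF has_weak_derivD(1)[OF f(1)]])
  have Ln: "L2_circle (\<lambda>x. nonlinear_part \<alpha> \<beta> (f x))"
    by (rule L2_circle_continuous) (use per f(2) \<alpha> in \<open>auto simp: periodic_2pi_def nonlinear_part_def intro!: continuous_intros continuous_on_component\<close>)
  have "L2_norm (\<lambda>x. nonlinear_part \<alpha> \<beta> (f x)) \<le> sqrt (2 * pi) * (2 * (A + 1) * ((S * \<epsilon>) * ((4 * S * K) * norm a)))"
  proof (rule L2_norm_le_sup[OF Ln])
    fix x
    have "norm (nonlinear_part \<alpha> \<beta> (f x)) \<le> 2 * (A + 1) * (norm (f x))\<^sup>2" by (rule nonlinear_part_bound[OF A one])
    also have "\<dots> \<le> 2 * (A + 1) * ((S * \<epsilon>) * ((4 * S * K) * norm a))" by (rule mult_left_mono[OF sq]) (use A0 in simp)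
    finally show "norm (nonlinear_part \<alpha> \<beta> (f x)) \<le> 2 * (A + 1) * ((S * \<epsilon>) * ((4 * S * K) * norm a))" .
  qed
  from order_trans[OF norm_fcos_le(1)[OF Ln] mult_left_mono[OF this, of "sqrt (2 * pi)"], of N]
  have "norm (fcos N (\<lambda>x. nonlinear_part \<alpha> \<beta> (f x))) \<le> (sqrt (2 * pi) * sqrt (2 * pi)) * (2 * (A + 1) * ((S * \<epsilon>) * ((4 * S * K) * norm a)))"
    by (simp only: mult.assoc) simp
  also have "\<dots> = (16 * (A + 1) * S\<^sup>2 * K) * \<epsilon> * norm b" by (simp add: na power2_eq_square)
  finally show "norm (fcos N (\<lambda>x. nonlinear_part \<alpha> \<beta> (f x))) \<le> (16 * (A + 1) * S\<^sup>2 * K) * \<epsilon> * norm b" .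

  let ?y = "\<lambda>x. cos (real N * x) *\<^sub>R a" and ?Q = "quadratic_form \<alpha> \<beta>"
  have cf: "continuous_on UNIV (\<lambda>x. f x $ i)" for i by (rule continuous_on_component[OF f(2)])
  have iQ: "integrable circ (\<lambda>x. ?Q (f x))" "integrable circ (\<lambda>x. (f x $ 1)\<^sup>2 * f x $ 2)" "integrable circ (\<lambda>x. ?Q (?y x))"
    unfolding quadratic_form_def by (intro integrable_circ_continuous continuous_intros cf)+
  have split: "nonlinear_part \<alpha> \<beta> v $ 1 = ?Q v + (v $ 1)\<^sup>2 * v $ 2" for v
    by (simp add: nonlinear_part_def quadratic_form_def mult.assoc)
  \<comment> \<open>The vanishing mean splits into a quadratic and a cubic integral that cancel. The
    cubic one is smaller by a factor \<epsilon>, so the quadratic one nearly vanishes.\<close>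
  have "0 = fcos 0 (\<lambda>x. nonlinear_part \<alpha> \<beta> (f x) $ 1)"
    using fcos_linear(1)[OF Ln bounded_linear_vec_nth, of 0 1] mean by simp
  also have "\<dots> = (\<integral>x. ?Q (f x) \<partial>circ) + (\<integral>x. (f x $ 1)\<^sup>2 * f x $ 2 \<partial>circ)"
    unfolding split fcos_def by (simp add: iQ)
  finally have Qf: "(\<integral>x. ?Q (f x) \<partial>circ) = - (\<integral>x. (f x $ 1)\<^sup>2 * f x $ 2 \<partial>circ)" by simp
  have cube: "\<bar>\<integral>x. (f x $ 1)\<^sup>2 * f x $ 2 \<partial>circ\<bar> \<le> 2 * pi * ((S * \<epsilon>) * ((4 * S * K) * norm a)\<^sup>2)"
  proof -
    have "norm (f x) ^ 3 \<le> (S * \<epsilon>) * ((4 * S * K) * norm a)\<^sup>2" for x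
    proof -
      have "norm (f x) ^ 3 = norm (f x) * (norm (f x))\<^sup>2" by (simp add: power3_eq_cube power2_eq_square)
      also have "\<dots> \<le> (S * \<epsilon>) * ((4 * S * K) * norm a)\<^sup>2" by (intro mult_mono sup1 power_mono sup2) (use S \<epsilon> in auto)
      finally show ?thesis .
    qed
    then have p: "\<bar>(f x $ 1)\<^sup>2 * f x $ 2\<bar> \<le> (S * \<epsilon>) * ((4 * S * K) * norm a)\<^sup>2" for x
      using cubic_part_bound order_trans by blast
    have "\<bar>\<integral>x. (f x $ 1)\<^sup>2 * f x $ 2 \<partial>circ\<bar> \<le> (\<integral>x. \<bar>(f x $ 1)\<^sup>2 * f x $ 2\<bar> \<partial>circ)"
      using integral_norm_bound[of circ "\<lambda>x. (f x $ 1)\<^sup>2 * f x $ 2"] by simp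
    also have "\<dots> \<le> (\<integral>x. (S * \<epsilon>) * ((4 * S * K) * norm a)\<^sup>2 \<partial>circ)"
      by (intro integral_mono integrable_abs iQ p integrable_circ_continuous continuous_intros)
    also have "\<dots> = 2 * pi * ((S * \<epsilon>) * ((4 * S * K) * norm a)\<^sup>2)"
      using measure_circ by (simp add: space_restrict_space)
    finally show ?thesis .
  qed
  have diff: "\<bar>(\<integral>x. ?Q (f x) \<partial>circ) - (\<integral>x. ?Q (?y x) \<partial>circ)\<bar> \<le> A * ((4 * S * K + 1) * norm a) * (sqrt (2 * pi) * (8 * \<epsilon> * (4 * K * norm a)))"
  proof -
    let ?w = "\<lambda>x. f x - ?y x"
    have cw: "continuous_on UNIV ?w" by (intro continuous_intros f(2))
    have Lw: "L2_circle ?w"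
      by (intro L2_circle_diff has_weak_derivD(1)[OF f(1)] L2_circle_linear[OF L2_cos_sin(1) bounded_linear_scaleR_left])
    have L1: "L2_circle (\<lambda>x. 1 :: real)" by (rule L2_circle_continuous) (auto simp: periodic_2pi_def)
    have pt: "\<bar>?Q (f x) - ?Q (?y x)\<bar> \<le> A * ((4 * S * K + 1) * norm a) * norm (?w x)" for x
    proof -
      have "norm (?y x) \<le> norm a" by (simp add: mult_left_le_one_le)
      then have s: "norm (f x) + norm (?y x) \<le> (4 * S * K + 1) * norm a" using sup2[of x] by (simp add: distrib_right)
      have "\<bar>?Q (f x) - ?Q (?y x)\<bar> \<le> A * (norm (?w x) * (norm (f x) + norm (?y x)))" by (rule quadratic_form_lipschitz[OF A])
      also have "\<dots> \<le> A * (norm (?w x) * ((4 * S * K + 1) * norm a))" by (intro mult_left_mono s A0) simp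
      finally show ?thesis by (simp add: mult_ac)
    qed
    have iw: "integrable circ (\<lambda>x. norm (?w x))" by (intro integrable_circ_continuous continuous_intros cw)
    have "\<bar>(\<integral>x. ?Q (f x) \<partial>circ) - (\<integral>x. ?Q (?y x) \<partial>circ)\<bar> = \<bar>\<integral>x. ?Q (f x) - ?Q (?y x) \<partial>circ\<bar>"
      by (simp add: iQ)
    also have "\<dots> \<le> (\<integral>x. \<bar>?Q (f x) - ?Q (?y x)\<bar> \<partial>circ)"
      using integral_norm_bound[of circ "\<lambda>x. ?Q (f x) - ?Q (?y x)"] by simp
    also have "\<dots> \<le> (\<integral>x. A * ((4 * S * K + 1) * norm a) * norm (?w x) \<partial>circ)"
      by (intro integral_mono integrable_abs Bochner_Integration.integrable_diff iQ pt integrable_mult_right iw)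
    also have "\<dots> = A * ((4 * S * K + 1) * norm a) * (\<integral>x. norm (1 :: real) * norm (?w x) \<partial>circ)" by simp
    also have "\<dots> \<le> A * ((4 * S * K + 1) * norm a) * (sqrt (2 * pi) * (8 * \<epsilon> * (4 * K * norm a)))"
    proof (rule mult_left_mono)
      have "(\<integral>x. norm (1 :: real) * norm (?w x) \<partial>circ) \<le> L2_norm (\<lambda>x. 1 :: real) * L2_norm ?w" by (rule L2_norm_mult_le[OF L1 Lw])
      also have "\<dots> \<le> (sqrt (2 * pi) * 1) * (8 * \<epsilon> * (4 * K * norm a))"
      proof (intro mult_mono L2_norm_le_sup[OF L1])
        have "8 * \<epsilon> * \<rho> \<le> 8 * \<epsilon> * (4 * K * norm a)" by (rule mult_left_mono[OF r]) (use \<epsilon> in simp)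
        then show "L2_norm ?w \<le> 8 * \<epsilon> * (4 * K * norm a)" using w by linarith
      qed auto
      finally show "(\<integral>x. norm (1 :: real) * norm (?w x) \<partial>circ) \<le> sqrt (2 * pi) * (8 * \<epsilon> * (4 * K * norm a))" by simp
    qed (use A0 S K in simp)
    finally show ?thesis .
  qed
  have "?Q (?y x) = (cos (real N * x) * cos (real N * x)) * ?Q a" for x
    by (simp add: quadratic_form_def power2_eq_square algebra_simps)
  then have Qy: "(\<integral>x. ?Q (?y x) \<partial>circ) = pi * ?Q a"
    using integral_trig_orthogonal(1)[of N N] N by simp
  have Qb: "?Q b = pi\<^sup>2 * ?Q a" by (simp add: b quadratic_form_def power2_eq_square algebra_simps)
  have "\<bar>pi * ?Q a\<bar> \<le> \<bar>\<integral>x. (f x $ 1)\<^sup>2 * f x $ 2 \<partial>circ\<bar> + \<bar>(\<integral>x. ?Q (f x) \<partial>circ) - (\<integral>x. ?Q (?y x) \<partial>circ)\<bar>"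
    unfolding Qf Qy by linarith
  also have "\<dots> \<le> 2 * pi * ((S * \<epsilon>) * ((4 * S * K) * norm a)\<^sup>2) + A * ((4 * S * K + 1) * norm a) * (sqrt (2 * pi) * (8 * \<epsilon> * (4 * K * norm a)))"
    by (rule add_mono[OF cube diff])
  also have "\<dots> = (32 * pi * (S * K)\<^sup>2 * S + 32 * sqrt (2 * pi) * K * A * (4 * S * K + 1)) * \<epsilon> * (norm a)\<^sup>2"
    by (simp add: power2_eq_square algebra_simps)
  finally have fin: "\<bar>pi * ?Q a\<bar> \<le> (32 * pi * (S * K)\<^sup>2 * S + 32 * sqrt (2 * pi) * K * A * (4 * S * K + 1)) * \<epsilon> * (norm a)\<^sup>2" (is "_ \<le> ?C * \<epsilon> * _") .
  have C: "0 \<le> ?C * \<epsilon> * (norm a)\<^sup>2" by (rule order_trans[OF abs_ge_zero fin])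
  have "\<bar>?Q b\<bar> = pi * \<bar>pi * ?Q a\<bar>" unfolding Qb by (simp add: abs_mult power2_eq_square)
  also have "\<dots> \<le> pi * (?C * \<epsilon> * (norm a)\<^sup>2)" by (rule mult_left_mono[OF fin]) simp
  also have "\<dots> \<le> pi\<^sup>2 * (?C * \<epsilon> * (norm a)\<^sup>2)"
    by (rule mult_right_mono[OF _ C]) (use pi_ge_two in \<open>simp add: power2_eq_square\<close>)
  also have "\<dots> = ?C * \<epsilon> * (norm b)\<^sup>2" by (simp add: na power_mult_distrib mult_ac)
  finally show "\<bar>?Q b\<bar> \<le> ?C * \<epsilon> * (norm b)\<^sup>2" .
qed

text \<open>Feeds the estimates at each time into \<open>planar_rigidity\<close>. Every error is
  proportional to \<epsilon>, which is therefore fixed in terms of the threshold \<epsilon>0 of the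
  planar system.\<close>

lemma mean_zero_standing_trivial:
  assumes \<alpha>: "0 < \<alpha>" and \<delta>: "0 < \<delta>2" and n: "n \<noteq> 0" and sc: "hopf_spectral_condition \<alpha> \<delta>1 \<delta>2 n \<omega>"
  obtains \<epsilon> where "0 < \<epsilon>"
    "\<And>\<mu> v T t x. \<bar>\<mu>\<bar> \<le> \<epsilon> \<Longrightarrow> perturbation_solution \<alpha> \<delta>1 \<delta>2 (beta_crit \<alpha> \<delta>1 \<delta>2 n + \<mu>) v \<Longrightarrow>
      (\<And>t x. v t (- x) = v t x) \<Longrightarrow> time_period v T \<Longrightarrow> mean_zero v \<Longrightarrow>
      (\<And>t. H1_norm (v t) \<le> \<epsilon>) \<Longrightarrow>
      (\<And>t. \<exists>p q. H1_norm (\<lambda>x. v t x - (cos (real (nat \<bar>n\<bar>) * x) *\<^sub>R p + sin (real (nat \<bar>n\<bar>) * x) *\<^sub>R q)) \<le> \<epsilon> * H1_norm (v t)) \<Longrightarrow>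
      v t x = 0"
proof -
  define N where "N = nat \<bar>n\<bar>"
  define K S \<beta>0 where "K = sqrt (2 * pi) * (1 + real N)" and "S = 8 * sqrt (2 * pi)" and "\<beta>0 = beta_crit \<alpha> \<delta>1 \<delta>2 n"
  define A where "A = \<bar>2 * \<alpha>\<bar> + (\<bar>\<beta>0\<bar> + 1) / \<alpha>"
  define c where "c = \<alpha>\<^sup>2 + \<delta>2 * (of_int n)\<^sup>2"
  define C1 where "C1 = 16 * (A + 1) * S\<^sup>2 * K"
  define C2 where "C2 = 32 * pi * (S * K)\<^sup>2 * S + 32 * sqrt (2 * pi) * K * A * (4 * S * K + 1)"
  define L where "L = 1 + (1 + c) / \<alpha>\<^sup>2"
  have N: "N \<noteq> 0" using n by (simp add: N_def)
  have N2: "(real N)\<^sup>2 = (of_int n)\<^sup>2" by (simp add: N_def)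
  have pos: "0 \<le> A" "0 \<le> K" "0 \<le> S" "0 \<le> c" "0 \<le> C1" "0 \<le> C2" "0 \<le> L"
    using \<alpha> \<delta> by (auto simp: A_def K_def S_def c_def C1_def C2_def L_def intro!: add_nonneg_nonneg mult_nonneg_nonneg divide_nonneg_nonneg)
  note det = spectral_condition_determinant[OF n sc]
  obtain \<epsilon>0 where \<epsilon>0: "0 < \<epsilon>0" and rigid: "\<And>Y Z g h T t. (\<And>t. (Y has_real_derivative Z t + g t) (at t)) \<Longrightarrow>
      (\<And>t. (Z has_real_derivative h t - \<omega>\<^sup>2 * Y t) (at t)) \<Longrightarrow>
      0 < T \<Longrightarrow> (\<And>t. Y (t + T) = Y t) \<Longrightarrow> (\<And>t. Z (t + T) = Z t) \<Longrightarrow>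
      (\<And>t. \<bar>g t\<bar> \<le> \<epsilon>0 * (\<bar>Y t\<bar> + \<bar>Z t\<bar>)) \<Longrightarrow> (\<And>t. \<bar>h t\<bar> \<le> \<epsilon>0 * (\<bar>Y t\<bar> + \<bar>Z t\<bar>)) \<Longrightarrow>
      (\<And>t. \<bar>Y t * (2 * Z t + (\<beta>0 - 2 * c) * Y t)\<bar> \<le> \<epsilon>0 * ((Y t)\<^sup>2 + (Z t)\<^sup>2)) \<Longrightarrow> Y t = 0 \<and> Z t = 0"
    by (rule planar_rigidity[OF det(1), of "\<beta>0 - 2 * c"]) blast
  define G where "G = (1 + C1) * L"
  \<comment> \<open>Q dominates each factor that has to become small after multiplication by
    \<epsilon> = 1 / Q; the summand 1 ensures \<epsilon> <= 1.\<close>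
  define Q where "Q = 1 + 2 * (2 + 8 * K) + S + (1 + c + \<alpha>\<^sup>2) * G / \<epsilon>0 + 2 * ((\<alpha> * C2 + 1) * L\<^sup>2) / \<epsilon>0"
  define \<epsilon> where "\<epsilon> = 1 / Q"
  have G: "0 \<le> G" using pos by (simp add: G_def)
  have q: "0 \<le> 2 * (2 + 8 * K)" "0 \<le> (1 + c + \<alpha>\<^sup>2) * G / \<epsilon>0" "0 \<le> 2 * ((\<alpha> * C2 + 1) * L\<^sup>2) / \<epsilon>0"
    using pos G \<alpha> \<epsilon>0 by simp_all
  then have Q: "1 \<le> Q" using pos by (simp add: Q_def)
  have \<epsilon>: "0 < \<epsilon>" "\<epsilon> \<le> 1" using Q by (simp_all add: \<epsilon>_def)
  have sm: "\<epsilon> * y \<le> 1" if "y \<le> Q" for y using that Q by (simp add: \<epsilon>_def)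
  have "\<epsilon> * S \<le> 1" "\<epsilon> * (2 * (2 + 8 * K)) \<le> 1" "\<epsilon> * ((1 + c + \<alpha>\<^sup>2) * G / \<epsilon>0) \<le> 1" "\<epsilon> * (2 * ((\<alpha> * C2 + 1) * L\<^sup>2) / \<epsilon>0) \<le> 1"
    by (rule sm, unfold Q_def, use q pos in linarith)+
  moreover have "\<epsilon> * (2 * (2 + 8 * K)) = 2 * (\<epsilon> * (2 + 8 * K))" by simp
  ultimately have e: "\<epsilon> * S \<le> 1" "\<epsilon> * (2 + 8 * K) \<le> 1 / 2" "\<epsilon> * ((1 + c + \<alpha>\<^sup>2) * G) \<le> \<epsilon>0" "\<epsilon> * (2 * ((\<alpha> * C2 + 1) * L\<^sup>2)) \<le> \<epsilon>0"
    using \<epsilon>0 by (simp_all only: times_divide_eq_right pos_divide_le_eq mult_1)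
  show thesis
  proof (rule that[OF \<epsilon>(1)])
    fix \<mu> v T t0 x0
    assume \<mu>: "\<bar>\<mu>\<bar> \<le> \<epsilon>" and sol: "perturbation_solution \<alpha> \<delta>1 \<delta>2 (beta_crit \<alpha> \<delta>1 \<delta>2 n + \<mu>) v"
      and even: "\<And>t x. v t (- x) = v t x" and T: "time_period v T" and mz: "mean_zero v"
      and small: "\<And>t. H1_norm (v t) \<le> \<epsilon>"
      and close: "\<And>t. \<exists>p q. H1_norm (\<lambda>x. v t x - (cos (real (nat \<bar>n\<bar>) * x) *\<^sub>R p + sin (real (nat \<bar>n\<bar>) * x) *\<^sub>R q)) \<le> \<epsilon> * H1_norm (v t)"
    define \<beta> where "\<beta> = \<beta>0 + \<mu>"
    have sol: "perturbation_solution \<alpha> \<delta>1 \<delta>2 \<beta> v" using sol by (simp add: \<beta>_def \<beta>0_def)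
    have \<alpha>0: "\<alpha> \<noteq> 0" using \<alpha> by simp
    note reg = perturbation_solution_regular[OF sol]
    note dt = fcos_time_derivative[OF \<alpha>0 sol]
    define b where "b = (\<lambda>t. fcos N (v t))"
    define g where "g = (\<lambda>t. fcos N (\<lambda>x. nonlinear_part \<alpha> \<beta> (v t x)))"
    have f0: "fcos 0 (v t) = 0" for t using mz by (simp add: mean_zero_def LBINT_circ fcos_def)
    \<comment> \<open>The coefficient of order 0 is identically zero, so its evolution equation
      loses the linear part and states that the nonlinearity has mean zero.\<close>
    have mean: "fcos 0 (\<lambda>x. nonlinear_part \<alpha> \<beta> (v t x)) = 0" for t
    proof -
      have "((\<lambda>t. 0 :: real^2) has_vector_derivative fcos 0 (\<lambda>x. nonlinear_part \<alpha> \<beta> (v t x))) (at t)"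
      proof -
        have "linear_part \<alpha> \<delta>1 \<delta>2 \<beta> (0 :: real^2) 0 = 0" by (simp add: linear_part_def vec_eq_iff forall_2)
        then show ?thesis using dt[of 0 t] by (simp add: f0)
      qed
      from vector_derivative_unique_at[OF this has_vector_derivative_const] show ?thesis .
    qed
    have A: "\<bar>2 * \<alpha>\<bar> + \<bar>\<beta> / \<alpha>\<bar> \<le> A"
    proof -
      have "\<bar>\<beta>\<bar> \<le> \<bar>\<beta>0\<bar> + 1" using \<mu> \<epsilon>(2) by (simp add: \<beta>_def)
      then have "\<bar>\<beta> / \<alpha>\<bar> \<le> (\<bar>\<beta>0\<bar> + 1) / \<alpha>" using \<alpha> by (simp add: abs_divide divide_right_mono)
      then show ?thesis by (simp add: A_def)
    qed
    have est: "norm (g t) \<le> C1 * \<epsilon> * norm (b t)" "\<bar>quadratic_form \<alpha> \<beta> (b t)\<bar> \<le> C2 * \<epsilon> * (norm (b t))\<^sup>2" "b t = 0 \<Longrightarrow> v t x = 0" for t x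
    proof -
      obtain p q where pq: "H1_norm (\<lambda>x. v t x - (cos (real N * x) *\<^sub>R p + sin (real N * x) *\<^sub>R q)) \<le> \<epsilon> * H1_norm (v t)"
        using close[of t] unfolding N_def by blast
      note se = slice_estimates[OF N \<alpha> A H2_circleD(1)[OF reg(2)] reg(1) even small e(1,2)[unfolded S_def K_def] pq mean]
      show "norm (g t) \<le> C1 * \<epsilon> * norm (b t)" using se(1) by (simp only: g_def b_def C1_def S_def K_def)
      show "\<bar>quadratic_form \<alpha> \<beta> (b t)\<bar> \<le> C2 * \<epsilon> * (norm (b t))\<^sup>2" using se(2) by (simp only: b_def C2_def S_def K_def)
      show "v t x = 0" if "b t = 0" using se(3) that by (simp only: b_def)
    qed
    have db: "(b has_vector_derivative linear_part \<alpha> \<delta>1 \<delta>2 \<beta> (b t) (- (real N)\<^sup>2 *\<^sub>R b t) + g t) (at t)" for t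
      using dt[of N t] by (simp add: b_def g_def)
    have comp: "((\<lambda>t. b t $ i) has_real_derivative (linear_part \<alpha> \<delta>1 \<delta>2 \<beta> (b t) (- (real N)\<^sup>2 *\<^sub>R b t) + g t) $ i) (at t)" for i t
      using bounded_linear.has_vector_derivative[OF bounded_linear_vec_nth db]
      by (simp add: has_real_derivative_iff_has_vector_derivative)
    \<comment> \<open>Z is the first row of the critical block applied to b, so Y' = Z up to errors.
      As the trace is zero, Z' then brings in - \<omega>^2 Y, with \<omega>^2 the determinant; the
      detuning \<mu> is moved into the errors g1 and g2.\<close>
    define Y Z where "Y = (\<lambda>t. b t $ 1)" and "Z = (\<lambda>t. c * b t $ 1 + \<alpha>\<^sup>2 * b t $ 2)"
    define g1 g2 where "g1 = (\<lambda>t. \<mu> * b t $ 1 + g t $ 1)" and "g2 = (\<lambda>t. - \<mu> * b t $ 1 + g t $ 2)"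
    define h where "h = (\<lambda>t. c * g1 t + \<alpha>\<^sup>2 * g2 t)"
    have c1: "\<beta>0 - 1 - \<delta>1 * (of_int n)\<^sup>2 = c" by (simp add: \<beta>0_def beta_crit_def c_def algebra_simps)
    have l1: "(linear_part \<alpha> \<delta>1 \<delta>2 \<beta> (b t) (- (real N)\<^sup>2 *\<^sub>R b t) + g t) $ 1 = Z t + g1 t" for t
      unfolding Z_def g1_def N2 c1[symmetric] \<beta>_def by (simp add: linear_part_def algebra_simps)
    have l2: "(linear_part \<alpha> \<delta>1 \<delta>2 \<beta> (b t) (- (real N)\<^sup>2 *\<^sub>R b t) + g t) $ 2 = - \<beta>0 * b t $ 1 - c * b t $ 2 + g2 t" for t
      unfolding g2_def N2 c_def \<beta>_def by (simp add: linear_part_def algebra_simps)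
    have dY: "(Y has_real_derivative Z t + g1 t) (at t)" for t using comp[of 1 t] unfolding l1 Y_def .
    have dZ: "(Z has_real_derivative h t - \<omega>\<^sup>2 * Y t) (at t)" for t
    proof -
      have "(Z has_real_derivative c * (Z t + g1 t) + \<alpha>\<^sup>2 * (- \<beta>0 * b t $ 1 - c * b t $ 2 + g2 t)) (at t)"
        unfolding Z_def[abs_def] using comp[of 1 t] comp[of 2 t] unfolding l1 l2 Z_def
        by (intro DERIV_add DERIV_cmult)
      moreover have "c * (Z t + g1 t) + \<alpha>\<^sup>2 * (- \<beta>0 * b t $ 1 - c * b t $ 2 + g2 t) = h t - (\<alpha>\<^sup>2 * \<beta>0 - c\<^sup>2) * Y t"
        by (simp add: Z_def Y_def h_def power2_eq_square algebra_simps)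
      moreover have "\<alpha>\<^sup>2 * \<beta>0 - c\<^sup>2 = \<omega>\<^sup>2" using det(2) by (simp add: \<beta>0_def c_def)
      ultimately show ?thesis by simp
    qed
    have bL: "norm (b t) \<le> L * (\<bar>Y t\<bar> + \<bar>Z t\<bar>)" for t
    proof -
      have "b t $ 2 = (Z t - c * Y t) / \<alpha>\<^sup>2" using \<alpha> by (simp add: Z_def Y_def)
      then have "\<bar>b t $ 2\<bar> = \<bar>Z t - c * Y t\<bar> / \<alpha>\<^sup>2" by simp
      also have "\<dots> \<le> (1 + c) * (\<bar>Y t\<bar> + \<bar>Z t\<bar>) / \<alpha>\<^sup>2"
      proof (rule divide_right_mono)
        have "\<bar>Z t - c * Y t\<bar> \<le> \<bar>Z t\<bar> + c * \<bar>Y t\<bar>" using abs_triangle_ineq4[of "Z t" "c * Y t"] pos by (simp add: abs_mult)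
        also have "\<dots> \<le> (1 + c) * (\<bar>Y t\<bar> + \<bar>Z t\<bar>)" using pos by (simp add: algebra_simps)
        finally show "\<bar>Z t - c * Y t\<bar> \<le> (1 + c) * (\<bar>Y t\<bar> + \<bar>Z t\<bar>)" .
      qed simp
      finally have b2: "\<bar>b t $ 2\<bar> \<le> (1 + c) / \<alpha>\<^sup>2 * (\<bar>Y t\<bar> + \<bar>Z t\<bar>)" by simp
      have "\<bar>b t $ 1\<bar> \<le> \<bar>Y t\<bar> + \<bar>Z t\<bar>" by (simp add: Y_def)
      from order_trans[OF norm_vec2_le add_mono[OF this b2]] show ?thesis
        unfolding L_def by (simp only: distrib_right mult_1)
    qed
    have g12: "\<bar>g1 t\<bar> \<le> \<epsilon> * (G * (\<bar>Y t\<bar> + \<bar>Z t\<bar>))" "\<bar>g2 t\<bar> \<le> \<epsilon> * (G * (\<bar>Y t\<bar> + \<bar>Z t\<bar>))" for t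
    proof -
      have m: "\<bar>\<mu> * b t $ 1\<bar> \<le> \<epsilon> * norm (b t)"
        unfolding abs_mult by (intro mult_mono \<mu> component_le_norm_cart) (use \<epsilon> in auto)
      have "\<epsilon> * norm (b t) + C1 * \<epsilon> * norm (b t) = \<epsilon> * ((1 + C1) * norm (b t))" by (simp add: algebra_simps)
      also have "\<dots> \<le> \<epsilon> * ((1 + C1) * (L * (\<bar>Y t\<bar> + \<bar>Z t\<bar>)))" using \<epsilon> pos by (intro mult_left_mono bL) auto
      finally have tot: "\<epsilon> * norm (b t) + C1 * \<epsilon> * norm (b t) \<le> \<epsilon> * (G * (\<bar>Y t\<bar> + \<bar>Z t\<bar>))" by (simp add: G_def mult.assoc)
      have gc: "\<bar>g t $ i\<bar> \<le> C1 * \<epsilon> * norm (b t)" for i using component_le_norm_cart[of "g t" i] est(1)[of t] by linarith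
      show "\<bar>g1 t\<bar> \<le> \<epsilon> * (G * (\<bar>Y t\<bar> + \<bar>Z t\<bar>))" "\<bar>g2 t\<bar> \<le> \<epsilon> * (G * (\<bar>Y t\<bar> + \<bar>Z t\<bar>))"
        using m gc[of 1] gc[of 2] tot unfolding g1_def g2_def by linarith+
    qed
    have "Y t = 0 \<and> Z t = 0" for t
    proof (rule rigid[OF dY dZ])
      show "0 < T" using T by (simp add: time_period_def)
      have "v (t + T) = v t" for t using T by (simp add: time_period_def fun_eq_iff)
      then show "Y (t + T) = Y t" "Z (t + T) = Z t" for t by (simp_all add: Y_def Z_def b_def)
      fix t
      define s where "s = \<bar>Y t\<bar> + \<bar>Z t\<bar>"
      have s: "0 \<le> s" by (simp add: s_def)
      have x1: "\<epsilon> * (G * s) \<le> \<epsilon>0 * s"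
      proof -
        have "0 \<le> (c + \<alpha>\<^sup>2) * G" using pos G by simp
        then have "\<epsilon> * (0 + G) \<le> \<epsilon> * ((c + \<alpha>\<^sup>2) * G + G)" using \<epsilon> by (intro mult_left_mono) auto
        then have "\<epsilon> * G \<le> \<epsilon>0" using e(3) by (simp add: algebra_simps)
        from mult_right_mono[OF this s] show ?thesis by (simp add: mult.assoc)
      qed
      show "\<bar>g1 t\<bar> \<le> \<epsilon>0 * (\<bar>Y t\<bar> + \<bar>Z t\<bar>)" using g12(1)[of t] x1 by (simp add: s_def)
      have "\<bar>h t\<bar> \<le> c * \<bar>g1 t\<bar> + \<alpha>\<^sup>2 * \<bar>g2 t\<bar>"
        unfolding h_def by (rule order_trans[OF abs_triangle_ineq]) (use pos in \<open>simp add: abs_mult\<close>)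
      also have "\<dots> \<le> c * (\<epsilon> * (G * s)) + \<alpha>\<^sup>2 * (\<epsilon> * (G * s))"
        using g12[of t] pos by (intro add_mono mult_left_mono) (auto simp: s_def)
      also have "\<dots> \<le> (\<epsilon> * ((1 + c + \<alpha>\<^sup>2) * G)) * s"
      proof -
        have "0 \<le> \<epsilon> * (G * s)" using \<epsilon> G s by simp
        then show ?thesis by (simp add: algebra_simps)
      qed
      also have "\<dots> \<le> \<epsilon>0 * s" by (rule mult_right_mono[OF e(3) s])
      finally show "\<bar>h t\<bar> \<le> \<epsilon>0 * (\<bar>Y t\<bar> + \<bar>Z t\<bar>)" by (simp add: s_def)
      \<comment> \<open>Substituting \<alpha>^2 b2 = Z - c Y turns \<alpha> times the quadratic form
        into the planar constraint; the term with \<mu> stems from \<beta> = \<beta>0 +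
        \<mu>.\<close>
      have "Y t * (2 * Z t + (\<beta>0 - 2 * c) * Y t) = \<alpha> * quadratic_form \<alpha> \<beta> (b t) - \<mu> * (b t $ 1)\<^sup>2"
        using \<alpha> by (simp add: quadratic_form_def Y_def Z_def \<beta>_def power2_eq_square field_simps)
      then have "\<bar>Y t * (2 * Z t + (\<beta>0 - 2 * c) * Y t)\<bar> \<le> \<alpha> * \<bar>quadratic_form \<alpha> \<beta> (b t)\<bar> + \<bar>\<mu>\<bar> * (b t $ 1)\<^sup>2"
        using abs_triangle_ineq4[of "\<alpha> * quadratic_form \<alpha> \<beta> (b t)" "\<mu> * (b t $ 1)\<^sup>2"] \<alpha> by (simp add: abs_mult)
      also have "\<dots> \<le> \<alpha> * (C2 * \<epsilon> * (norm (b t))\<^sup>2) + \<epsilon> * (norm (b t))\<^sup>2"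
      proof (intro add_mono mult_left_mono est mult_mono \<mu>)
        show "(b t $ 1)\<^sup>2 \<le> (norm (b t))\<^sup>2" using power_mono[OF component_le_norm_cart[of "b t" 1], of 2] by simp
      qed (use \<alpha> \<epsilon> in auto)
      also have "\<dots> = \<epsilon> * (\<alpha> * C2 + 1) * (norm (b t))\<^sup>2" by (simp add: algebra_simps)
      also have "\<dots> \<le> \<epsilon> * (\<alpha> * C2 + 1) * (L * s)\<^sup>2"
        using \<epsilon> \<alpha> pos by (intro mult_left_mono power_mono bL[folded s_def]) (auto simp: s_def bL)
      also have "\<dots> = \<epsilon> * ((\<alpha> * C2 + 1) * L\<^sup>2) * s\<^sup>2" by (simp add: power_mult_distrib)
      also have "\<dots> \<le> \<epsilon> * ((\<alpha> * C2 + 1) * L\<^sup>2) * (2 * ((Y t)\<^sup>2 + (Z t)\<^sup>2))"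
      proof (rule mult_left_mono)
        show "s\<^sup>2 \<le> 2 * ((Y t)\<^sup>2 + (Z t)\<^sup>2)"
          using sum_squares_bound[of "\<bar>Y t\<bar>" "\<bar>Z t\<bar>"] by (simp add: s_def power2_sum)
      qed (use \<epsilon> \<alpha> pos in simp)
      also have "\<dots> = (\<epsilon> * (2 * ((\<alpha> * C2 + 1) * L\<^sup>2))) * ((Y t)\<^sup>2 + (Z t)\<^sup>2)" by simp
      also have "\<dots> \<le> \<epsilon>0 * ((Y t)\<^sup>2 + (Z t)\<^sup>2)" by (rule mult_right_mono[OF e(4)]) simp
      finally show "\<bar>Y t * (2 * Z t + (\<beta>0 - 2 * c) * Y t)\<bar> \<le> \<epsilon>0 * ((Y t)\<^sup>2 + (Z t)\<^sup>2)" .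
    qed
    then have "Y t0 = 0" "Z t0 = 0" by auto
    then have "b t0 = 0" using bL[of t0] by simp
    then show "v t0 x0 = 0" by (rule est(3))
  qed
qed

lemma one_sided_small:
  assumes "one_sided M" "0 < d"
  obtains \<mu> where "\<mu> \<in> M" "\<mu> \<noteq> 0" "\<bar>\<mu>\<bar> < d"
proof -
  obtain \<epsilon> where \<epsilon>: "0 < \<epsilon>" "M = {0<..<\<epsilon>} \<or> M = {-\<epsilon><..<0}" using assms(1) unfolding one_sided_def by blast
  have m: "0 < min \<epsilon> d / 2" "min \<epsilon> d / 2 < \<epsilon>" "min \<epsilon> d / 2 < d" using \<epsilon>(1) assms(2) by (auto simp: min_def)
  from \<epsilon>(2) show thesis
  proof
    assume M: "M = {0<..<\<epsilon>}"
    show thesis by (rule that[of "min \<epsilon> d / 2"]) (use m M in auto)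
  next
    assume M: "M = {-\<epsilon><..<0}"
    show thesis by (rule that[of "- (min \<epsilon> d / 2)"]) (use m M in auto)
  qed
qed

text \<open>Translating a standing wave so that its reflection axis becomes 0 stays inside the torus
  and makes it even. For small \<mu> the triviality result then applies and contradicts that the
  wave is not stationary.\<close>

lemma no_mean_zero_structure:
  assumes pos: "0 < \<alpha>" "0 < \<delta>2" and n: "n \<noteq> 0" and sc: "hopf_spectral_condition \<alpha> \<delta>1 \<delta>2 n \<omega>"
    and ws: "hopf_wave_structure \<alpha> \<delta>1 \<delta>2 n \<omega> M W N U"
    and mz: "\<And>\<mu> v. \<mu> \<in> N \<Longrightarrow> v \<in> standing_members (U \<mu>) \<Longrightarrow> mean_zero v"
  shows False
proof -
  let ?E = "critical_space \<alpha> \<delta>1 \<delta>2 n \<omega>" and ?P = "\<lambda>\<mu>. standing_members (U \<mu>)"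
  obtain \<epsilon> where \<epsilon>: "0 < \<epsilon>" and trivial: "\<And>\<mu> v T t x. \<bar>\<mu>\<bar> \<le> \<epsilon> \<Longrightarrow> perturbation_solution \<alpha> \<delta>1 \<delta>2 (beta_crit \<alpha> \<delta>1 \<delta>2 n + \<mu>) v \<Longrightarrow>
      (\<And>t x. v t (- x) = v t x) \<Longrightarrow> time_period v T \<Longrightarrow> mean_zero v \<Longrightarrow> (\<And>t. H1_norm (v t) \<le> \<epsilon>) \<Longrightarrow>
      (\<And>t. \<exists>p q. H1_norm (\<lambda>x. v t x - (cos (real (nat \<bar>n\<bar>) * x) *\<^sub>R p + sin (real (nat \<bar>n\<bar>) * x) *\<^sub>R q)) \<le> \<epsilon> * H1_norm (v t)) \<Longrightarrow>
      v t x = 0"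
    by (rule mean_zero_standing_trivial[OF pos n sc]) blast
  from ws have os: "one_sided N" and bif: "bifurcates_along ?E N ?P"
    and st: "\<And>\<mu> v. \<mu> \<in> N \<Longrightarrow> v \<in> ?P \<mu> \<Longrightarrow> standing_wave \<alpha> \<delta>1 \<delta>2 (beta_crit \<alpha> \<delta>1 \<delta>2 n + \<mu>) n v"
    unfolding hopf_wave_structure_def by auto
  have "\<forall>\<^sub>F \<mu> in at 0 within N. (SUP v\<in>?P \<mu>. SUP t. ereal (H1_norm (v t))) < ereal \<epsilon>"
    "\<forall>\<^sub>F \<mu> in at 0 within N. (SUP v\<in>?P \<mu>. SUP t. ereal (H1_dist (v t) ?E / H1_norm (v t))) < ereal \<epsilon>"
    using bif \<epsilon> unfolding bifurcates_along_def by (auto intro: order_tendstoD(2))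
  then have "\<forall>\<^sub>F \<mu> in at 0 within N. (SUP v\<in>?P \<mu>. SUP t. ereal (H1_norm (v t))) < ereal \<epsilon> \<and>
      (SUP v\<in>?P \<mu>. SUP t. ereal (H1_dist (v t) ?E / H1_norm (v t))) < ereal \<epsilon>" by (rule eventually_conj)
  then obtain d where d: "0 < d" and near: "\<And>\<mu>. \<mu> \<in> N \<Longrightarrow> \<mu> \<noteq> 0 \<Longrightarrow> dist \<mu> 0 < d \<Longrightarrow>
      (SUP v\<in>?P \<mu>. SUP t. ereal (H1_norm (v t))) < ereal \<epsilon> \<and>
      (SUP v\<in>?P \<mu>. SUP t. ereal (H1_dist (v t) ?E / H1_norm (v t))) < ereal \<epsilon>"
    unfolding eventually_at by blast
  obtain \<mu> where \<mu>: "\<mu> \<in> N" "\<mu> \<noteq> 0" "\<bar>\<mu>\<bar> < min d \<epsilon>"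
    by (rule one_sided_small[OF os, of "min d \<epsilon>"]) (use d \<epsilon> in auto)
  have sup: "(SUP v\<in>?P \<mu>. SUP t. ereal (H1_norm (v t))) < ereal \<epsilon>"
    "(SUP v\<in>?P \<mu>. SUP t. ereal (H1_dist (v t) ?E / H1_norm (v t))) < ereal \<epsilon>"
    using near[OF \<mu>(1,2)] \<mu>(3) by auto
  have bd: "F v t < \<epsilon>" if "(SUP v\<in>?P \<mu>. SUP t. ereal (F v t)) < ereal \<epsilon>" "v \<in> ?P \<mu>" for F v and t :: real
  proof -
    have "ereal (F v t) \<le> (SUP t. ereal (F v t))" by (rule SUP_upper) simp
    also have "\<dots> \<le> (SUP v\<in>?P \<mu>. SUP t. ereal (F v t))" by (rule SUP_upper[OF that(2)])
    also note that(1)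
    finally show ?thesis by simp
  qed
  have "U \<mu> \<in> ?P \<mu>" unfolding standing_members_def mem_Collect_eq
    by (rule exI[of _ 0], rule exI[of _ 0]) (simp add: shift_def)
  from st[OF \<mu>(1) this] obtain x0 where x0: "\<And>t x. U \<mu> t (2 * x0 - x) = U \<mu> t x"
    unfolding standing_wave_def by blast
  define v where "v = shift x0 0 (U \<mu>)"
  have vP: "v \<in> ?P \<mu>" unfolding standing_members_def v_def by blast
  have even: "v t (- x) = v t x" for t x using x0[of t "x + x0"] by (simp add: v_def shift_def)
  from st[OF \<mu>(1) vP] obtain T where sol: "perturbation_solution \<alpha> \<delta>1 \<delta>2 (beta_crit \<alpha> \<delta>1 \<delta>2 n + \<mu>) v"
    and ns: "\<not> stationary v" and T: "time_period v T"
    unfolding standing_wave_def minimal_period_def by blast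
  have small: "H1_norm (v t) \<le> \<epsilon>" for t using bd[OF sup(1) vP, of t] by simp
  have close: "\<exists>p q. H1_norm (\<lambda>x. v t x - (cos (real (nat \<bar>n\<bar>) * x) *\<^sub>R p + sin (real (nat \<bar>n\<bar>) * x) *\<^sub>R q)) \<le> \<epsilon> * H1_norm (v t)" for t
  \<comment> \<open>For norm 0 the quotient is 0 by the convention on division and carries no
    information; the zero function then serves as approximation.\<close>
  proof (cases "H1_norm (v t) = 0")
    case True
    then show ?thesis by (intro exI[of _ 0]) simp
  next
    case False
    then have p: "0 < H1_norm (v t)" using H1_norm_nonneg[of "v t"] by linarith
    have "H1_dist (v t) ?E / H1_norm (v t) < \<epsilon>" by (rule bd[OF sup(2) vP])
    then have "H1_dist (v t) ?E < \<epsilon> * H1_norm (v t)" using p by (simp add: pos_divide_less_eq)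
    moreover have "?E \<noteq> {}" unfolding critical_space_def by blast
    ultimately obtain e where e: "e \<in> ?E" "H1_norm (\<lambda>x. v t x - e x) < \<epsilon> * H1_norm (v t)"
      unfolding H1_dist_def using cInf_lessD[of "(\<lambda>e. H1_norm (\<lambda>x. v t x - e x)) ` ?E"] by blast
    from critical_space_trig[OF e(1)] obtain p q where
      "e = (\<lambda>x. cos (real (nat \<bar>n\<bar>) * x) *\<^sub>R p + sin (real (nat \<bar>n\<bar>) * x) *\<^sub>R q)" .
    then show ?thesis using e(2) by (intro exI[of _ p] exI[of _ q]) simp
  qed
  have "v t x = 0" for t x
    by (rule trivial[OF _ sol even T mz[OF \<mu>(1) vP] small close]) (use \<mu>(3) in simp)
  then have "stationary v" by (simp add: stationary_def)
  then show False using ns by contradiction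
qed

theorem theorem1p1:
  shows "(\<exists>\<alpha> \<delta>1 \<delta>2 \<omega>. 0 < \<alpha> \<and> 0 < \<delta>1 \<and> 0 < \<delta>2 \<and>
            hopf_spectral_condition \<alpha> \<delta>1 \<delta>2 1 \<omega> \<and>
            (\<exists>M W N U. hopf_wave_structure \<alpha> \<delta>1 \<delta>2 1 \<omega> M W N U))
       \<and> (\<forall>n::int. n \<noteq> 0 \<longrightarrow>
            (\<exists>\<alpha> \<delta>1 \<delta>2 \<omega>. 0 < \<alpha> \<and> 0 < \<delta>1 \<and> 0 < \<delta>2 \<and>
              hopf_spectral_condition \<alpha> \<delta>1 \<delta>2 n \<omega> \<and>
              (\<exists>M W N U. hopf_wave_structure \<alpha> \<delta>1 \<delta>2 n \<omega> M W N U)))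
       \<and> (\<forall>\<alpha> \<delta>1 \<delta>2 \<omega>. \<forall>n::int. 0 < \<alpha> \<longrightarrow> 0 < \<delta>1 \<longrightarrow> 0 < \<delta>2 \<longrightarrow> n \<noteq> 0 \<longrightarrow>
            hopf_spectral_condition \<alpha> \<delta>1 \<delta>2 n \<omega> \<longrightarrow>
            \<not> (\<exists>M W N U. hopf_wave_structure \<alpha> \<delta>1 \<delta>2 n \<omega> M W N U \<and>
                 (\<forall>\<mu>\<in>M. \<forall>v\<in>rotating_members (W \<mu>). mean_zero v) \<and>
                 (\<forall>\<mu>\<in>N. \<forall>v\<in>standing_members (U \<mu>). mean_zero v)))"
proof -
  have exist: "\<exists>\<alpha> \<delta>1 \<delta>2 \<omega>. 0 < \<alpha> \<and> 0 < \<delta>1 \<and> 0 < \<delta>2 \<and> hopf_spectral_condition \<alpha> \<delta>1 \<delta>2 n \<omega> \<and>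
      (\<exists>M W N U. hopf_wave_structure \<alpha> \<delta>1 \<delta>2 n \<omega> M W N U)" if n: "n \<noteq> 0" for n :: int
  proof -
    let ?d1 = "2 / (real_of_int n)\<^sup>2" and ?d2 = "1 / (real_of_int n)\<^sup>2"
    have "(0::real) < 1" "0 < ?d1" "0 < ?d2" using n by simp_all
    moreover have "hopf_spectral_condition 1 ?d1 ?d2 n 1" by (rule spectral_condition[OF n refl refl])
    moreover have "\<exists>M W N U. hopf_wave_structure 1 ?d1 ?d2 n 1 M W N U" by (rule hopf_waves[OF n refl refl])
    ultimately show ?thesis by blast
  qed
  have nonexist: "\<not> (\<exists>M W N U. hopf_wave_structure \<alpha> \<delta>1 \<delta>2 n \<omega> M W N U \<and>
       (\<forall>\<mu>\<in>M. \<forall>v\<in>rotating_members (W \<mu>). mean_zero v) \<and> (\<forall>\<mu>\<in>N. \<forall>v\<in>standing_members (U \<mu>). mean_zero v))"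
    if "0 < \<alpha>" "0 < \<delta>2" "n \<noteq> 0" "hopf_spectral_condition \<alpha> \<delta>1 \<delta>2 n \<omega>" for \<alpha> \<delta>1 \<delta>2 \<omega> n
    using no_mean_zero_structure[OF that] by blast
  show ?thesis
  proof (intro conjI allI impI)
    show "\<exists>\<alpha> \<delta>1 \<delta>2 \<omega>. 0 < \<alpha> \<and> 0 < \<delta>1 \<and> 0 < \<delta>2 \<and> hopf_spectral_condition \<alpha> \<delta>1 \<delta>2 1 \<omega> \<and>
      (\<exists>M W N U. hopf_wave_structure \<alpha> \<delta>1 \<delta>2 1 \<omega> M W N U)" by (rule exist) simp
  qed (rule exist nonexist; assumption)+
qed

end
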